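(* Let $\Omega\subset\mathbb{R}^2$ be a piecewise regular bounded Lipschitz domain, $\gamma>1$, $T\in(0,\infty)$. Let $\varrho_B,b_B\in C_c(\mathbb{R}^2)$ with $\varrho_B,b_B>0$ on $\overline{\Omega}$, $\mathbf{u}_B\in C_c^1(\mathbb{R}^2;\mathbb{R}^2)$, and let $\varrho_0,b_0,\mathbf{u}_0$ satisfy $$\int_\Omega\Big(\tfrac12\varrho_0|\mathbf{u}_0|^2+\tfrac{1}{\gamma-1}\varrho_0^\gamma+\tfrac12 b_0^2\Big)\,dx<\infty,$$ and, for some constants $0<C_*<C^*<\infty$, $C_*\varrho_0\le b_0\le C^*\varrho_0$ a.e. in $\Omega$ and $C_*\varrho_B\le b_B\le C^*\varrho_B$ on $\overline{\Omega}$. Let $(\varrho,\mathbf{u},b)$ be a weak solution on $(0,T)\times\Omega$, in the sense defined in the context, of $$\partial_t\varrho+\mathrm{div}(\varrho\mathbf{u})=0,\quad \partial_t(\varrho\mathbf{u})+\mathrm{div}(\varrho\mathbf{u}\otimes\mathbf{u})+\nabla\big(\varrho^\gamma+\tfrac12b^2\big)=\mathrm{div}\,\mathbb{S}(\nabla\mathbf{u}),\quad \partial_t b+\mathrm{div}(b\mathbf{u})=0$$ with initial conditions $\varrho|_{t=0}=\varrho_0$, $b|_{t=0}=b_0$, $\varrho\mathbf{u}|_{t=0}=\varrho_0\mathbf{u}_0$ and boundary conditions $\mathbf{u}|_{\partial\Omega}=\mathbf{u}_B$, $\varrho|_{\Gamma^{\rm in}}=\varrho_B$, $b|_{\Gamma^{\rm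 in}}=b_B$. Assume that $(\tilde\varrho,\tilde{\mathbf{u}},\tilde b)$ is a strong solution of the same system of equations in $(0,T)\times\Omega$ such that $$(\tilde\varrho,\tilde{\mathbf{u}},\tilde b)|_{t=0}=(\varrho_0,\mathbf{u}_0,b_0),\qquad \tilde{\mathbf{u}}|_{\partial\Omega}=\mathbf{u}_B,\quad\tilde\varrho|_{\Gamma^{\rm in}}=\varrho_B,\quad\tilde b|_{\Gamma^{\rm in}}=b_B,$$ $$0<\underline{c}\le\tilde\varrho,\tilde b\le\overline{c}<\infty\ \text{ for some constants }\underline c,\overline c,$$ $$\tilde\varrho,\tilde b\in C^1([0,T]\times\overline\Omega),\qquad\tilde{\mathbf{u}}\in C^2([0,T]\times\overline\Omega;\mathbb{R}^2).$$ Then $\varrho=\tilde\varrho$, $\mathbf{u}=\tilde{\mathbf{u}}$, $b=\tilde b$ a.e. in $(0,T)\times\Omega$.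
   Context: A piecewise regular domain is one whose boundary is piecewise $C^2$. $\mathbf{n}$ is the unit outward normal to $\partial\Omega$; $\Gamma^{\rm in}=\{x\in\partial\Omega:\mathbf{u}_B\cdot\mathbf{n}<0\}$, $\Gamma^{\rm out}=\{x\in\partial\Omega:\mathbf{u}_B\cdot\mathbf{n}>0\}$. $\mathbb{S}(\nabla\mathbf{u})=\mu(\nabla\mathbf{u}+\nabla^t\mathbf{u})+\lambda\,\mathrm{div}\,\mathbf{u}\,\mathbb{I}$ with constants $\mu>0$, $2\mu+\lambda>0$; $p(\varrho)=\varrho^\gamma$. Notation: $[f]_{t=0}^{t=\tau}=f(\tau)-f(0)$, where values at $t=0$ are those given by the initial conditions; $\mathbf{a}\cdot\nabla\mathbf{w}\cdot\mathbf{c}=\sum_{i,j}a^j\partial_jw^i c^i$; $\mathbf{u}\otimes\mathbf{u}:\nabla\boldsymbol\phi=\sum_{i,j}u^iu^j\partial_j\phi^i$. $f\in C_{\rm weak}([0,T];L^p(\Omega))$ means $f\in L^\infty(0,T;L^p(\Omega))$ and $t\mapsto\int_\Omega f(t)\phi\,dx$ is continuous on $[0,T]$ for every $\phi\in L^{p'}(\Omega)$, $\frac1p+\frac1{p'}=1$. Definition (weak solution). Let $T\in(0,\infty)$. A triple $(\varrho,\mathbf{u},b)$ (with boundary values of $\varrho,b$ on $\Gamma^{\rm out}$ being part of the solution) is a weak solution on $(0,T)\times\Omega$ with the given initial and boundary data if: (i) $\varrho,b\ge0$ a.e. in $(0,T)\times\Omega$; $\varrho\in C_{\rm weak}([0,T];L^\gamma(\Omega))\cap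 L^\gamma(0,T;L^\gamma(\partial\Omega;|\mathbf{u}_B\cdot\mathbf{n}|dS))$; $b\in C_{\rm weak}([0,T];L^2(\Omega))\cap L^2(0,T;L^2(\partial\Omega;|\mathbf{u}_B\cdot\mathbf{n}|dS))$; $\mathbf{u}-\mathbf{u}_B\in L^2(0,T;W^{1,2}_0(\Omega;\mathbb{R}^2))$; $\varrho\mathbf{u}\in C_{\rm weak}([0,T];L^{2\gamma/(\gamma+1)}(\Omega))$; $\varrho|\mathbf{u}-\mathbf{u}_B|^2\in L^\infty(0,T;L^1(\Omega))$. (ii) For any $\tau\in[0,T]$ and $\phi\in C^1([0,T]\times\overline\Omega)$, $$\int_0^\tau\!\!\int_\Omega(\varrho\partial_t\phi+\varrho\mathbf{u}\cdot\nabla\phi)\,dxdt-\int_0^\tau\!\!\int_{\Gamma^{\rm in}}\varrho_B\mathbf{u}_B\cdot\mathbf{n}\,\phi\,dSdt=\int_0^\tau\!\!\int_{\Gamma^{\rm out}}\varrho\,\mathbf{u}_B\cdot\mathbf{n}\,\phi\,dSdt+\Big[\int_\Omega\varrho\phi\,dx\Big]_{t=0}^{t=\tau}.$$ (iii) For any $\tau\in[0,T]$ and $\boldsymbol\phi\in C^1_c([0,T]\times\Omega;\mathbb{R}^2)$, $$\int_0^\tau\!\!\int_\Omega\Big(\varrho\mathbf{u}\cdot\partial_t\boldsymbol\phi+\varrho\mathbf{u}\otimes\mathbf{u}:\nabla\boldsymbol\phi+\big(p(\varrho)+\tfrac12b^2\big)\mathrm{div}\,\boldsymbol\phi-\mathbb{S}(\nabla\mathbf{u}):\nabla\boldsymbol\phi\Big)dxdt=\Big[\int_\Omega\varrho\mathbf{u}\cdot\boldsymbol\phi\,dx\Big]_{t=0}^{t=\tau}.$$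 (iv) For any $\tau\in[0,T]$ and $\phi\in C^1([0,T]\times\overline\Omega)$, $$\int_0^\tau\!\!\int_\Omega(b\partial_t\phi+b\mathbf{u}\cdot\nabla\phi)\,dxdt-\int_0^\tau\!\!\int_{\Gamma^{\rm in}}b_B\mathbf{u}_B\cdot\mathbf{n}\,\phi\,dSdt=\int_0^\tau\!\!\int_{\Gamma^{\rm out}}b\,\mathbf{u}_B\cdot\mathbf{n}\,\phi\,dSdt+\Big[\int_\Omega b\phi\,dx\Big]_{t=0}^{t=\tau}.$$ (v) For a.e. $\tau\in(0,T)$, $$\int_\Omega\Big(\tfrac12\varrho|\mathbf{u}-\mathbf{u}_B|^2+\tfrac{1}{\gamma-1}\varrho^\gamma+\tfrac12b^2\Big)(\tau)\,dx+\int_0^\tau\!\!\int_\Omega\mathbb{S}(\nabla\mathbf{u}):\nabla\mathbf{u}\,dxdt+\int_0^\tau\!\!\int_{\Gamma^{\rm out}}\Big(\tfrac1{\gamma-1}\varrho^\gamma+\tfrac12b^2\Big)\mathbf{u}_B\cdot\mathbf{n}\,dSdt$$ $$\le\int_\Omega\Big(\tfrac12\varrho_0|\mathbf{u}_0-\mathbf{u}_B|^2+\tfrac1{\gamma-1}\varrho_0^\gamma+\tfrac12b_0^2\Big)dx-\int_0^\tau\!\!\int_{\Gamma^{\rm in}}\Big(\tfrac1{\gamma-1}\varrho_B^\gamma+\tfrac12b_B^2\Big)\mathbf{u}_B\cdot\mathbf{n}\,dSdt$$ $$+\int_0^\tau\!\!\int_\Omega\Big[-\big(\varrho^\gamma+\tfrac12b^2\big)\mathrm{div}\,\mathbf{u}_B-\varrho\mathbf{u}\cdot\nabla\mathbf{u}_B\cdot(\mathbf{u}-\mathbf{u}_B)+\mathbb{S}(\nabla\mathbf{u}):\nabla\mathbf{u}_B\Big]dxdt.$$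 *)

theory Defs
  imports "HOL-Analysis.Analysis"
begin

type_synonym plane = "real ^ 2"
type_synonym spacetime = "real \<times> plane"

section \<open>Function spaces\<close>

text \<open>
  The space \<open>C^k\<close> on the closure of an open set \<open>U\<close>: the function is differentiable inside \<open>U\<close> and all its
  partial derivatives of order at most \<open>k\<close> extend continuously to the closure of \<open>U\<close>. The family
  \<open>g\<close> holds the extended partial derivatives along the standard basis. Values of \<open>f\<close> off the
  closure are irrelevant. For \<open>U = UNIV\<close> this is the usual \<open>C^k\<close>.
\<close>

primrec Ck_closure ::
    "nat \<Rightarrow> 'a::euclidean_space set \<Rightarrow> ('a \<Rightarrow> 'b::real_normed_vector) \<Rightarrow> bool" where
  "Ck_closure 0 U f \<longleftrightarrow> continuous_on (closure U) f"
| "Ck_closure (Suc k) U f \<longleftrightarrow> continuous_on (closure U) f \<and>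
     (\<exists>g. (\<forall>x\<in>U. (f has_derivative (\<lambda>h. \<Sum>i\<in>Basis. (h \<bullet> i) *\<^sub>R g i x)) (at x)) \<and>
          (\<forall>i\<in>Basis. Ck_closure k U (g i)))"

definition compactly_supported :: "('a::topological_space \<Rightarrow> 'b::zero) \<Rightarrow> bool" where
  "compactly_supported f \<longleftrightarrow> compact (closure {x. f x \<noteq> 0})"

definition test_function :: "plane set \<Rightarrow> (plane \<Rightarrow> 'b::real_normed_vector) \<Rightarrow> bool" where
  "test_function \<Omega> \<phi> \<longleftrightarrow> (\<forall>k. Ck_closure k UNIV \<phi>) \<and> compactly_supported \<phi> \<and>
     closure {x. \<phi> x \<noteq> 0} \<subseteq> \<Omega>"

definition Lp :: "real \<Rightarrow> plane set \<Rightarrow> (plane \<Rightarrow> 'b::euclidean_space) \<Rightarrow> bool" where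
  "Lp p \<Omega> f \<longleftrightarrow> set_borel_measurable lebesgue \<Omega> f \<and>
     set_integrable lebesgue \<Omega> (\<lambda>x. norm (f x) powr p)"

definition Linf_Lp ::
    "real \<Rightarrow> real \<Rightarrow> plane set \<Rightarrow> (spacetime \<Rightarrow> 'b::euclidean_space) \<Rightarrow> bool" where
  "Linf_Lp T p \<Omega> f \<longleftrightarrow> set_borel_measurable lebesgue ({0<..<T} \<times> \<Omega>) f \<and>
     (\<exists>C. AE t in lebesgue. t \<in> {0<..<T} \<longrightarrow> Lp p \<Omega> (\<lambda>x. f (t, x)) \<and>
        (LINT x:\<Omega>|lebesgue. norm (f (t, x)) powr p) \<le> C)"

text \<open>Weak continuity in time, for \<open>1 < p < \<infinity>\<close>; the dual exponent is \<open>p / (p - 1)\<close>.\<close>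

definition C_weak ::
    "real \<Rightarrow> real \<Rightarrow> plane set \<Rightarrow> (spacetime \<Rightarrow> 'b::euclidean_space) \<Rightarrow> bool" where
  "C_weak T p \<Omega> f \<longleftrightarrow> Linf_Lp T p \<Omega> f \<and> (\<forall>t\<in>{0..T}. Lp p \<Omega> (\<lambda>x. f (t, x))) \<and>
     (\<forall>\<phi>. Lp (p / (p - 1)) \<Omega> \<phi> \<longrightarrow>
        continuous_on {0..T} (\<lambda>t. LINT x:\<Omega>|lebesgue. f (t, x) \<bullet> \<phi> x))"

text \<open>Gradients of planar vector fields are matrices with \<open>(i, j)\<close> entry \<open>\<partial>\<^sub>j v\<^sup>i\<close>, as for
  the library's \<open>jacobian\<close>.\<close>

definition weak_gradient :: "plane set \<Rightarrow> (plane \<Rightarrow> real ^ 2) \<Rightarrow> (plane \<Rightarrow> real ^ 2 ^ 2) \<Rightarrow> bool" where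
  "weak_gradient \<Omega> v G \<longleftrightarrow>
     (\<forall>\<phi> :: plane \<Rightarrow> real. test_function \<Omega> \<phi> \<longrightarrow> (\<forall>i j.
        (LINT x:\<Omega>|lebesgue. v x $ i * frechet_derivative \<phi> (at x) (axis j 1)) =
        - (LINT x:\<Omega>|lebesgue. G x $ i $ j * \<phi> x)))"

definition W12 :: "plane set \<Rightarrow> (plane \<Rightarrow> real ^ 2) \<Rightarrow> (plane \<Rightarrow> real ^ 2 ^ 2) \<Rightarrow> bool" where
  "W12 \<Omega> v G \<longleftrightarrow> Lp 2 \<Omega> v \<and> Lp 2 \<Omega> G \<and> weak_gradient \<Omega> v G"

definition W12_zero :: "plane set \<Rightarrow> (plane \<Rightarrow> real ^ 2) \<Rightarrow> (plane \<Rightarrow> real ^ 2 ^ 2) \<Rightarrow> bool" where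
  "W12_zero \<Omega> v G \<longleftrightarrow> W12 \<Omega> v G \<and>
     (\<exists>\<phi> :: nat \<Rightarrow> plane \<Rightarrow> real ^ 2. (\<forall>n. test_function \<Omega> (\<phi> n)) \<and>
        (\<lambda>n. LINT x:\<Omega>|lebesgue.
           (norm (v x - \<phi> n x))\<^sup>2 + (norm (G x - jacobian (\<phi> n) (at x)))\<^sup>2) \<longlonglongrightarrow> 0)"

definition L2_W12_zero ::
    "real \<Rightarrow> plane set \<Rightarrow> (spacetime \<Rightarrow> real ^ 2) \<Rightarrow> (spacetime \<Rightarrow> real ^ 2 ^ 2) \<Rightarrow> bool" where
  "L2_W12_zero T \<Omega> v G \<longleftrightarrow>
     set_borel_measurable lebesgue ({0<..<T} \<times> \<Omega>) v \<and>
     set_borel_measurable lebesgue ({0<..<T} \<times> \<Omega>) G \<and>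
     (AE t in lebesgue. t \<in> {0<..<T} \<longrightarrow> W12_zero \<Omega> (\<lambda>x. v (t, x)) (\<lambda>x. G (t, x))) \<and>
     set_integrable lebesgue ({0<..<T} \<times> \<Omega>) (\<lambda>z. (norm (v z))\<^sup>2 + (norm (G z))\<^sup>2)"


section \<open>The domain and its boundary\<close>

text \<open>Near each boundary point, after an isometric change of coordinates, the domain is the set
  above the graph of a Lipschitz function.\<close>

definition lipschitz_boundary :: "plane set \<Rightarrow> bool" where
  "lipschitz_boundary \<Omega> \<longleftrightarrow>
     (\<forall>x0\<in>frontier \<Omega>. \<exists>r>0. \<exists>Q :: plane \<Rightarrow> plane. \<exists>\<psi> :: real \<Rightarrow> real. \<exists>L.
        orthogonal_transformation Q \<and> L-lipschitz_on UNIV \<psi> \<and>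
        \<Omega> \<inter> ball x0 r = {x \<in> ball x0 r. Q x $ 2 > \<psi> (Q x $ 1)})"

text \<open>Finitely many regular injective \<open>C^2\<close> arcs (\<open>C^2\<close> up to their endpoints) that cover the
  boundary and meet only at endpoints.\<close>

definition boundary_arcs :: "plane set \<Rightarrow> (real \<Rightarrow> plane) list \<Rightarrow> bool" where
  "boundary_arcs \<Omega> gs \<longleftrightarrow>
     (\<forall>g\<in>set gs. arc g \<and> Ck_closure 2 {0<..<1} g \<and>
        (\<forall>t\<in>{0..1}. vector_derivative g (at t within {0..1}) \<noteq> 0)) \<and>
     (\<forall>k<length gs. \<forall>l<length gs. k \<noteq> l \<longrightarrow>
        (gs ! k) ` {0<..<1} \<inter> path_image (gs ! l) = {}) \<and>
     frontier \<Omega> = (\<Union>g\<in>set gs. path_image g)"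

definition piecewise_regular_lipschitz_domain :: "plane set \<Rightarrow> bool" where
  "piecewise_regular_lipschitz_domain \<Omega> \<longleftrightarrow>
     open \<Omega> \<and> connected \<Omega> \<and> \<Omega> \<noteq> {} \<and> bounded \<Omega> \<and> lipschitz_boundary \<Omega> \<and> (\<exists>gs. boundary_arcs \<Omega> gs)"

definition arclength_measure :: "(real \<Rightarrow> plane) list \<Rightarrow> plane measure" where
  "arclength_measure gs =
     distr (density (count_space {..<length gs} \<Otimes>\<^sub>M restrict_space lborel {0..1})
              (\<lambda>(k, t). ennreal (norm (vector_derivative (gs ! k) (at t within {0..1})))))
           borel (\<lambda>(k, t). (gs ! k) t)"

text \<open>The surface element \<open>dS\<close>. Arc length does not depend on the parametrisation, so the choice
  of arcs is immaterial.\<close>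

definition surface_measure :: "plane set \<Rightarrow> plane measure" where
  "surface_measure \<Omega> = arclength_measure (SOME gs. boundary_arcs \<Omega> gs)"

text \<open>\<open>\<nu>\<close> is the outer unit normal if, up to cones of arbitrarily small opening around the tangent
  line, the points near \<open>x\<close> on the side of \<open>-\<nu>\<close> are in \<open>\<Omega>\<close> and those on the side of \<open>\<nu>\<close> are not.
  There is at most one such vector. It exists except possibly at the finitely many endpoints of
  boundary arcs, which are null for \<open>dS\<close>; there the normal is set to zero, so that corners
  belong neither to the inflow nor to the outflow part.\<close>

definition is_outer_normal :: "plane set \<Rightarrow> plane \<Rightarrow> plane \<Rightarrow> bool" where
  "is_outer_normal \<Omega> x \<nu> \<longleftrightarrow> norm \<nu> = 1 \<and>
     (\<forall>\<epsilon>>0. \<exists>\<delta>>0. \<forall>y. norm (y - x) < \<delta> \<longrightarrow>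
        ((y - x) \<bullet> \<nu> < - \<epsilon> * norm (y - x) \<longrightarrow> y \<in> \<Omega>) \<and>
        ((y - x) \<bullet> \<nu> > \<epsilon> * norm (y - x) \<longrightarrow> y \<notin> \<Omega>))"

definition outer_normal :: "plane set \<Rightarrow> plane \<Rightarrow> plane" where
  "outer_normal \<Omega> x = (if \<exists>\<nu>. is_outer_normal \<Omega> x \<nu> then THE \<nu>. is_outer_normal \<Omega> x \<nu> else 0)"

definition inflow :: "plane set \<Rightarrow> (plane \<Rightarrow> plane) \<Rightarrow> plane set" where
  "inflow \<Omega> uB = {x \<in> frontier \<Omega>. uB x \<bullet> outer_normal \<Omega> x < 0}"

definition outflow :: "plane set \<Rightarrow> (plane \<Rightarrow> plane) \<Rightarrow> plane set" where
  "outflow \<Omega> uB = {x \<in> frontier \<Omega>. uB x \<bullet> outer_normal \<Omega> x > 0}"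

definition boundary_Lp ::
    "real \<Rightarrow> real \<Rightarrow> plane set \<Rightarrow> (plane \<Rightarrow> plane) \<Rightarrow> (spacetime \<Rightarrow> real) \<Rightarrow> bool" where
  "boundary_Lp T p \<Omega> uB f \<longleftrightarrow>
     set_borel_measurable (lborel \<Otimes>\<^sub>M surface_measure \<Omega>) ({0<..<T} \<times> frontier \<Omega>) f \<and>
     set_integrable (lborel \<Otimes>\<^sub>M surface_measure \<Omega>) ({0<..<T} \<times> frontier \<Omega>)
       (\<lambda>(t, x). \<bar>f (t, x)\<bar> powr p * \<bar>uB x \<bullet> outer_normal \<Omega> x\<bar>)"

definition bulk_integral :: "real \<Rightarrow> plane set \<Rightarrow> (spacetime \<Rightarrow> real) \<Rightarrow> real" where
  "bulk_integral \<tau> \<Omega> F = (LINT z:{0<..<\<tau>} \<times> \<Omega>|lebesgue. F z)"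

definition boundary_integral :: "real \<Rightarrow> plane set \<Rightarrow> plane set \<Rightarrow> (spacetime \<Rightarrow> real) \<Rightarrow> real" where
  "boundary_integral \<tau> \<Omega> \<Gamma> F = (LINT z:{0<..<\<tau>} \<times> \<Gamma>|(lborel \<Otimes>\<^sub>M surface_measure \<Omega>). F z)"


section \<open>Differential operators\<close>

definition ddt :: "(spacetime \<Rightarrow> 'b::real_normed_vector) \<Rightarrow> spacetime \<Rightarrow> 'b" where
  "ddt f z = frechet_derivative f (at z) (1, 0)"

definition ddx :: "2 \<Rightarrow> (spacetime \<Rightarrow> 'b::real_normed_vector) \<Rightarrow> spacetime \<Rightarrow> 'b" where
  "ddx j f z = frechet_derivative f (at z) (0, axis j 1)"

definition space_grad :: "(spacetime \<Rightarrow> real) \<Rightarrow> spacetime \<Rightarrow> real ^ 2" where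
  "space_grad f z = (\<chi> j. ddx j f z)"

definition space_jacobian :: "(spacetime \<Rightarrow> real ^ 2) \<Rightarrow> spacetime \<Rightarrow> real ^ 2 ^ 2" where
  "space_jacobian v z = (\<chi> i j. ddx j (\<lambda>w. v w $ i) z)"

definition space_div :: "(spacetime \<Rightarrow> real ^ 2) \<Rightarrow> spacetime \<Rightarrow> real" where
  "space_div v z = (\<Sum>j\<in>UNIV. ddx j (\<lambda>w. v w $ j) z)"

definition space_matrix_div :: "(spacetime \<Rightarrow> real ^ 2 ^ 2) \<Rightarrow> spacetime \<Rightarrow> real ^ 2" where
  "space_matrix_div M z = (\<chi> i. \<Sum>j\<in>UNIV. ddx j (\<lambda>w. M w $ i $ j) z)"

definition tensor :: "real ^ 2 \<Rightarrow> real ^ 2 \<Rightarrow> real ^ 2 ^ 2" where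
  "tensor v w = (\<chi> i j. v $ i * w $ j)"

definition stress :: "real \<Rightarrow> real \<Rightarrow> real ^ 2 ^ 2 \<Rightarrow> real ^ 2 ^ 2" where
  "stress mu lam D = mu *\<^sub>R (D + transpose D) + (lam * trace D) *\<^sub>R mat 1"


section \<open>Weak solutions\<close>

text \<open>
  Here and below \<open>rho\<close> and \<open>b\<close> are functions on space-time whose restrictions to \<open>\<Omega>\<close> (an open
  set) are the densities in the domain and whose restrictions to \<open>frontier \<Omega>\<close> are their boundary
  values. They are the weakly continuous representatives in time. The product \<open>:\<close> of
  matrices is the inner product of \<open>real ^ 2 ^ 2\<close>, and \<open>a \<cdot> \<nabla>w \<cdot> c\<close> is \<open>(\<nabla>w *v a) \<bullet> c\<close>.
  The library's \<open>powr\<close> satisfies \<open>x powr a = \<bar>x\<bar> powr a\<close>, so no sign of the boundary values is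
  needed for the boundary terms of the energy inequality to make sense.
\<close>

definition weak_transport ::
    "plane set \<Rightarrow> real \<Rightarrow> (plane \<Rightarrow> plane) \<Rightarrow> (spacetime \<Rightarrow> plane) \<Rightarrow>
     (plane \<Rightarrow> real) \<Rightarrow> (plane \<Rightarrow> real) \<Rightarrow> (spacetime \<Rightarrow> real) \<Rightarrow> bool" where
  "weak_transport \<Omega> T uB u fB f0 f \<longleftrightarrow>
     (\<forall>\<tau>\<in>{0..T}. \<forall>\<phi> :: spacetime \<Rightarrow> real. Ck_closure 1 ({0<..<T} \<times> \<Omega>) \<phi> \<longrightarrow>
        bulk_integral \<tau> \<Omega> (\<lambda>z. f z * ddt \<phi> z + f z * (u z \<bullet> space_grad \<phi> z))
        - boundary_integral \<tau> \<Omega> (inflow \<Omega> uB)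
            (\<lambda>(t, x). fB x * (uB x \<bullet> outer_normal \<Omega> x) * \<phi> (t, x))
        = boundary_integral \<tau> \<Omega> (outflow \<Omega> uB)
            (\<lambda>(t, x). f (t, x) * (uB x \<bullet> outer_normal \<Omega> x) * \<phi> (t, x))
          + ((LINT x:\<Omega>|lebesgue. f (\<tau>, x) * \<phi> (\<tau>, x)) - (LINT x:\<Omega>|lebesgue. f0 x * \<phi> (0, x))))"

text \<open>\<open>Du\<close> is the spatial weak gradient of \<open>u\<close>, and \<open>m\<close> the weakly continuous representative of
  the momentum \<open>rho u\<close>.\<close>

definition weak_momentum ::
    "plane set \<Rightarrow> real \<Rightarrow> real \<Rightarrow> real \<Rightarrow> real \<Rightarrow> (plane \<Rightarrow> real) \<Rightarrow> (plane \<Rightarrow> plane) \<Rightarrow>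
     (spacetime \<Rightarrow> real) \<Rightarrow> (spacetime \<Rightarrow> plane) \<Rightarrow> (spacetime \<Rightarrow> real ^ 2 ^ 2) \<Rightarrow>
     (spacetime \<Rightarrow> real) \<Rightarrow> (spacetime \<Rightarrow> plane) \<Rightarrow> bool" where
  "weak_momentum \<Omega> T \<gamma> mu lam rho0 u0 rho u Du b m \<longleftrightarrow>
     (\<forall>\<tau>\<in>{0..T}. \<forall>\<phi> :: spacetime \<Rightarrow> real ^ 2.
        Ck_closure 1 ({0<..<T} \<times> \<Omega>) \<phi> \<and>
        (\<exists>K. compact K \<and> K \<subseteq> \<Omega> \<and> (\<forall>t\<in>{0..T}. \<forall>x\<in>closure \<Omega> - K. \<phi> (t, x) = 0)) \<longrightarrow>
        bulk_integral \<tau> \<Omega> (\<lambda>z.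
            rho z *\<^sub>R u z \<bullet> ddt \<phi> z
            + (rho z *\<^sub>R tensor (u z) (u z)) \<bullet> space_jacobian \<phi> z
            + (rho z powr \<gamma> + (b z)\<^sup>2 / 2) * space_div \<phi> z
            - stress mu lam (Du z) \<bullet> space_jacobian \<phi> z)
        = (LINT x:\<Omega>|lebesgue. m (\<tau>, x) \<bullet> \<phi> (\<tau>, x))
          - (LINT x:\<Omega>|lebesgue. rho0 x *\<^sub>R u0 x \<bullet> \<phi> (0, x)))"

definition energy_inequality ::
    "plane set \<Rightarrow> real \<Rightarrow> real \<Rightarrow> real \<Rightarrow> real \<Rightarrow>
     (plane \<Rightarrow> real) \<Rightarrow> (plane \<Rightarrow> plane) \<Rightarrow> (plane \<Rightarrow> real) \<Rightarrow>
     (plane \<Rightarrow> real) \<Rightarrow> (plane \<Rightarrow> plane) \<Rightarrow> (plane \<Rightarrow> real) \<Rightarrow>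
     (spacetime \<Rightarrow> real) \<Rightarrow> (spacetime \<Rightarrow> plane) \<Rightarrow> (spacetime \<Rightarrow> real ^ 2 ^ 2) \<Rightarrow>
     (spacetime \<Rightarrow> real) \<Rightarrow> bool" where
  "energy_inequality \<Omega> T \<gamma> mu lam rhoB uB bB rho0 u0 b0 rho u Du b \<longleftrightarrow>
     (AE \<tau> in lebesgue. \<tau> \<in> {0<..<T} \<longrightarrow>
        (LINT x:\<Omega>|lebesgue. rho (\<tau>, x) * (norm (u (\<tau>, x) - uB x))\<^sup>2 / 2
             + rho (\<tau>, x) powr \<gamma> / (\<gamma> - 1) + (b (\<tau>, x))\<^sup>2 / 2)
        + bulk_integral \<tau> \<Omega> (\<lambda>z. stress mu lam (Du z) \<bullet> Du z)
        + boundary_integral \<tau> \<Omega> (outflow \<Omega> uB)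
            (\<lambda>(t, x). (rho (t, x) powr \<gamma> / (\<gamma> - 1) + (b (t, x))\<^sup>2 / 2)
               * (uB x \<bullet> outer_normal \<Omega> x))
        \<le> (LINT x:\<Omega>|lebesgue. rho0 x * (norm (u0 x - uB x))\<^sup>2 / 2
             + rho0 x powr \<gamma> / (\<gamma> - 1) + (b0 x)\<^sup>2 / 2)
          - boundary_integral \<tau> \<Omega> (inflow \<Omega> uB)
              (\<lambda>(t, x). (rhoB x powr \<gamma> / (\<gamma> - 1) + (bB x)\<^sup>2 / 2)
                 * (uB x \<bullet> outer_normal \<Omega> x))
          + bulk_integral \<tau> \<Omega> (\<lambda>(t, x).
              - (rho (t, x) powr \<gamma> + (b (t, x))\<^sup>2 / 2) * trace (jacobian uB (at x))
              - rho (t, x) * ((jacobian uB (at x) *v u (t, x)) \<bullet> (u (t, x) - uB x))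
              + stress mu lam (Du (t, x)) \<bullet> jacobian uB (at x)))"

definition weak_solution ::
    "plane set \<Rightarrow> real \<Rightarrow> real \<Rightarrow> real \<Rightarrow> real \<Rightarrow>
     (plane \<Rightarrow> real) \<Rightarrow> (plane \<Rightarrow> plane) \<Rightarrow> (plane \<Rightarrow> real) \<Rightarrow>
     (plane \<Rightarrow> real) \<Rightarrow> (plane \<Rightarrow> plane) \<Rightarrow> (plane \<Rightarrow> real) \<Rightarrow>
     (spacetime \<Rightarrow> real) \<Rightarrow> (spacetime \<Rightarrow> plane) \<Rightarrow> (spacetime \<Rightarrow> real) \<Rightarrow> bool" where
  "weak_solution \<Omega> T \<gamma> mu lam rhoB uB bB rho0 u0 b0 rho u b \<longleftrightarrow>
     (AE z in lebesgue. z \<in> {0<..<T} \<times> \<Omega> \<longrightarrow> rho z \<ge> 0 \<and> b z \<ge> 0) \<and>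
     C_weak T \<gamma> \<Omega> rho \<and> boundary_Lp T \<gamma> \<Omega> uB rho \<and>
     C_weak T 2 \<Omega> b \<and> boundary_Lp T 2 \<Omega> uB b \<and>
     Linf_Lp T 1 \<Omega> (\<lambda>(t, x). rho (t, x) * (norm (u (t, x) - uB x))\<^sup>2) \<and>
     weak_transport \<Omega> T uB u rhoB rho0 rho \<and>
     weak_transport \<Omega> T uB u bB b0 b \<and>
     (\<exists>Du m.
        L2_W12_zero T \<Omega> (\<lambda>(t, x). u (t, x) - uB x) (\<lambda>(t, x). Du (t, x) - jacobian uB (at x)) \<and>
        C_weak T (2 * \<gamma> / (\<gamma> + 1)) \<Omega> m \<and>
        (AE z in lebesgue. z \<in> {0<..<T} \<times> \<Omega> \<longrightarrow> m z = rho z *\<^sub>R u z) \<and>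
        weak_momentum \<Omega> T \<gamma> mu lam rho0 u0 rho u Du b m \<and>
        energy_inequality \<Omega> T \<gamma> mu lam rhoB uB bB rho0 u0 b0 rho u Du b)"


section \<open>Strong solutions\<close>

definition solves_system_classically ::
    "plane set \<Rightarrow> real \<Rightarrow> real \<Rightarrow> real \<Rightarrow> real \<Rightarrow>
     (spacetime \<Rightarrow> real) \<Rightarrow> (spacetime \<Rightarrow> plane) \<Rightarrow> (spacetime \<Rightarrow> real) \<Rightarrow> bool" where
  "solves_system_classically \<Omega> T \<gamma> mu lam r U B \<longleftrightarrow>
     (\<forall>z \<in> {0<..<T} \<times> \<Omega>.
        ddt r z + space_div (\<lambda>w. r w *\<^sub>R U w) z = 0 \<and>
        ddt (\<lambda>w. r w *\<^sub>R U w) z + space_matrix_div (\<lambda>w. r w *\<^sub>R tensor (U w) (U w)) z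
          + space_grad (\<lambda>w. r w powr \<gamma> + (B w)\<^sup>2 / 2) z
          = space_matrix_div (\<lambda>w. stress mu lam (space_jacobian U w)) z \<and>
        ddt B z + space_div (\<lambda>w. B w *\<^sub>R U w) z = 0)"

definition strong_solution ::
    "plane set \<Rightarrow> real \<Rightarrow> real \<Rightarrow> real \<Rightarrow> real \<Rightarrow>
     (plane \<Rightarrow> real) \<Rightarrow> (plane \<Rightarrow> plane) \<Rightarrow> (plane \<Rightarrow> real) \<Rightarrow>
     (plane \<Rightarrow> real) \<Rightarrow> (plane \<Rightarrow> plane) \<Rightarrow> (plane \<Rightarrow> real) \<Rightarrow>
     (spacetime \<Rightarrow> real) \<Rightarrow> (spacetime \<Rightarrow> plane) \<Rightarrow> (spacetime \<Rightarrow> real) \<Rightarrow> bool" where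
  "strong_solution \<Omega> T \<gamma> mu lam rhoB uB bB rho0 u0 b0 r U B \<longleftrightarrow>
     Ck_closure 1 ({0<..<T} \<times> \<Omega>) r \<and>
     Ck_closure 1 ({0<..<T} \<times> \<Omega>) B \<and>
     Ck_closure 2 ({0<..<T} \<times> \<Omega>) U \<and>
     (\<exists>c1 c2. 0 < c1 \<and> (\<forall>z \<in> {0..T} \<times> closure \<Omega>. c1 \<le> r z \<and> r z \<le> c2 \<and> c1 \<le> B z \<and> B z \<le> c2)) \<and>
     solves_system_classically \<Omega> T \<gamma> mu lam r U B \<and>
     (AE x in lebesgue. x \<in> \<Omega> \<longrightarrow> r (0, x) = rho0 x \<and> U (0, x) = u0 x \<and> B (0, x) = b0 x) \<and>
     (\<forall>t\<in>{0..T}. (\<forall>x\<in>frontier \<Omega>. U (t, x) = uB x) \<and>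
        (\<forall>x\<in>inflow \<Omega> uB. r (t, x) = rhoB x \<and> B (t, x) = bB x))"

end

theory Submission
  imports Defs
begin

text \<open>
The proof is the relative energy method. Put \<open>w = u - U\<close> and let \<open>e\<close> be the sum of \<open>rho |w|^2 / 2\<close>, the Bregman
distance of \<open>s^\<gamma> / (\<gamma> - 1)\<close> between \<open>rho\<close> and \<open>r\<close>, and \<open>(b - B)^2 / 2\<close>. Expanding the squares expresses \<open>e\<close> by
quantities that the weak formulation controls (\<open>energy_decomposition\<close>): the energy, the momentum against \<open>U - uB\<close>,
\<open>rho\<close> against \<open>(|U|^2 - |uB|^2) / 2 - \<gamma> / (\<gamma> - 1) r^(\<gamma> - 1)\<close>, \<open>b\<close> against \<open>B\<close>, and the strong pressure
\<open>r^\<gamma> + B^2 / 2\<close>. The inflow terms cancel, and since \<open>U = uB\<close> on the boundary the outflow terms are the flux of a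
nonnegative relative energy. Hence \<open>\<integral> e(\<tau>) \<le> \<integral>\<integral> X\<close>, where the strong equations turn the integrand \<open>X\<close> into
\<open>R - S(Dw) : Dw - (w \<cdot> div S(DU) + S(DU) : Dw)\<close> (\<open>relative_energy_rate_identity\<close>). The bracket integrates to zero
because \<open>w\<close> vanishes on the boundary. The remainder satisfies \<open>R \<le> C e + \<delta> |w|^2\<close> (\<open>remainder_bound\<close>), and the
dissipation absorbs \<open>\<delta> |w|^2\<close> by Poincare's inequality; if only \<open>2 mu + lam > 0\<close>, it is coercive after subtracting
a multiple of \<open>det Dw\<close>, whose integral vanishes. Gronwall's lemma gives \<open>e = 0\<close>.

Two tools have to be built. The fluxes need the divergence theorem on a Lipschitz domain with piecewise \<open>C^2\<close>
boundary (\<open>divergence_theorem_component\<close>): almost every line parallel to an axis crosses the boundary finitely often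
and transversally (Sard), the fundamental theorem of calculus turns the integral over its part inside the domain
into a signed sum over the crossings, and the area formula turns the integral of these sums into arc length.
Secondly, \<open>U - uB\<close> vanishes on the boundary without having compact support. Cutting off its small values gives
admissible functions; their gradients converge almost everywhere, because a \<open>C^1\<close> function has zero
gradient at almost every point of its zero set (\<open>negligible_transversal_zeros\<close>). This serves for the momentum
equation (\<open>weak_momentum_vanishing_test\<close>) and for \<open>w \<in> W^{1,2}_0\<close> at almost every time.
\<close>

abbreviation cyl :: "real \<Rightarrow> 'a set \<Rightarrow> (real \<times> 'a) set" where "cyl T \<Omega> \<equiv> {0<..<T} \<times> \<Omega>"

section \<open>The outer normal along a boundary arc\<close>

text \<open>Points moved from \<open>x\<close> in a direction that has positive inner product with one normal and negative
 inner product with the other would have to lie both inside and outside.\<close>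

lemma outer_normal_unique:
 assumes "is_outer_normal Om x \<nu>" "is_outer_normal Om x \<nu>'"
 shows "\<nu> = \<nu>'"
proof (rule ccontr)
 assume ne: "\<nu> ~= \<nu>'"
 define d where "d = \<nu>' - \<nu>"
 have n1: "\<nu> \<bullet> \<nu> = 1" "\<nu>' \<bullet> \<nu>' = 1" using assms by (auto simp: is_outer_normal_def dot_square_norm)
 have d0: "d ~= 0" using ne by (simp add: d_def)
 have dd: "d \<bullet> d > 0" using d0 by simp
 have neg: "d \<bullet> \<nu> = - (d \<bullet> d) / 2" and pos: "d \<bullet> \<nu>' = (d \<bullet> d) / 2" using n1 by (auto simp: d_def algebra_simps inner_commute)
 define \<epsilon> where "\<epsilon> = norm d / 4"
 have e0: "\<epsilon> > 0" using d0 by (simp add: \<epsilon>_def)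
 have en: "\<epsilon> * norm d < d \<bullet> d / 2" using dd by (simp add: \<epsilon>_def dot_square_norm power2_eq_square)
 obtain \<delta> where \<delta>: "\<delta> > 0" "!!y. norm (y - x) < \<delta> ==> (y - x) \<bullet> \<nu> < - \<epsilon> * norm (y - x) ==> y \<in> Om"
  using assms(1) e0 unfolding is_outer_normal_def by blast
 obtain \<delta>' where \<delta>': "\<delta>' > 0" "!!y. norm (y - x) < \<delta>' ==> (y - x) \<bullet> \<nu>' > \<epsilon> * norm (y - x) ==> y ~: Om"
  using assms(2) e0 unfolding is_outer_normal_def by blast
 define s where "s = min \<delta> \<delta>' / (2 * norm d)"
 have s0: "s > 0" using \<delta>(1) \<delta>'(1) d0 by (simp add: s_def)
 have sn: "norm (s *\<^sub>R d) < \<delta>" "norm (s *\<^sub>R d) < \<delta>'" using \<delta>(1) \<delta>'(1) d0 s0 by (auto simp: s_def)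
 have "x + s *\<^sub>R d \<in> Om"
 proof (rule \<delta>(2))
  have "s * (d \<bullet> \<nu>) < s * (- (\<epsilon> * norm d))" using s0 en neg by (intro mult_strict_left_mono) auto
  thus "(x + s *\<^sub>R d - x) \<bullet> \<nu> < - \<epsilon> * norm (x + s *\<^sub>R d - x)" using s0 by (simp add: mult.left_commute)
 qed (use sn in simp)
 moreover have "x + s *\<^sub>R d ~: Om"
 proof (rule \<delta>'(2))
  have "s * (\<epsilon> * norm d) < s * (d \<bullet> \<nu>')" using s0 en pos by (intro mult_strict_left_mono) auto
  thus "\<epsilon> * norm (x + s *\<^sub>R d - x) < (x + s *\<^sub>R d - x) \<bullet> \<nu>'" using s0 by (simp add: mult.left_commute)
 qed (use sn in simp)
 ultimately show False by simp
qed

lemma outer_normal_eq: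
 assumes "is_outer_normal Om x \<nu>"
 shows "outer_normal Om x = \<nu>"
proof -
 have "(THE \<nu>. is_outer_normal Om x \<nu>) = \<nu>" using assms outer_normal_unique by (intro the_equality) auto
 thus ?thesis using assms unfolding outer_normal_def by auto
qed

lemma frontier_on_graph:
 fixes Om :: "plane set" and Q :: "plane => plane" and \<psi> :: "real => real"
 assumes "open Om" and \<psi>: "continuous_on UNIV \<psi>" and Q: "orthogonal_transformation Q"
  and loc: "Om \<inter> ball x0 r = {x \<in> ball x0 r. Q x $ 2 > \<psi> (Q x $ 1)}"
  and y: "y \<in> frontier Om" "y \<in> ball x0 r"
 shows "Q y $ 2 = \<psi> (Q y $ 1)"
proof (rule ccontr)
 assume ne: "Q y $ 2 ~= \<psi> (Q y $ 1)"
 have contQ: "continuous_on UNIV Q" using orthogonal_transformation_linear[OF Q] by (intro linear_continuous_on) (simp add: linear_conv_bounded_linear)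
 have "y ~: Om" using y assms(1) by (simp add: frontier_def interior_open)
 hence "\<not> Q y $ 2 > \<psi> (Q y $ 1)" using loc y by blast
 with ne have lt: "Q y $ 2 < \<psi> (Q y $ 1)" by simp
 define V where "V = ball x0 r \<inter> {x. Q x $ 2 < \<psi> (Q x $ 1)}"
 have "open V" unfolding V_def by (intro open_Int open_ball open_Collect_less continuous_intros contQ
    continuous_on_compose2[OF \<psi>]) auto
 moreover have "V \<inter> Om = {}"
 proof -
  have "z ~: Om" if "z \<in> ball x0 r" "Q z $ 2 < \<psi> (Q z $ 1)" for z
  proof
   assume "z \<in> Om"
   hence "z \<in> {x \<in> ball x0 r. Q x $ 2 > \<psi> (Q x $ 1)}" using loc that(1) by blast
   thus False using that(2) by simp
  qed
  thus ?thesis by (auto simp: V_def)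
 qed
 moreover have "y \<in> V" using lt y by (simp add: V_def)
 ultimately have "y ~: closure Om" by (meson disjoint_iff open_Int_closure_eq_empty)
 thus False using y(1) by (simp add: frontier_def)
qed

text \<open>A differentiable curve in the graph whose first coordinate has nonzero derivative forces the graph function to
 be differentiable at that point: by the intermediate value theorem the first coordinate reaches every nearby
 abscissa, at a time comparable with the distance.\<close>

lemma graph_derivative_along_curve:
 fixes p q \<psi> :: "real => real"
 assumes p: "(p has_real_derivative a) (at t)" and q: "(q has_real_derivative b) (at t)"
  and a: "a ~= 0" and near: "\<forall>\<^sub>F s in at t. q s = \<psi> (p s)" and qt: "q t = \<psi> (p t)"
  and contp: "\<forall>\<^sub>F h in at_right 0. continuous_on {t - h..t + h} p"
  and \<epsilon>: "\<epsilon> > 0"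
 shows "\<exists>\<delta>>0. \<forall>w. \<bar>w\<bar> < \<delta> --> \<bar>\<psi> (p t + w) - \<psi> (p t) - (b / a) * w\<bar> <= \<epsilon> * \<bar>w\<bar>"
proof -
 define m where "m = b / a"
 define \<kappa> where "\<kappa> = min (\<bar>a\<bar> / 2) (\<epsilon> * \<bar>a\<bar> / (2 * (1 + \<bar>m\<bar>)))"
 have \<kappa>: "\<kappa> > 0" using a \<epsilon> by (auto simp: \<kappa>_def intro!: divide_pos_pos mult_pos_pos)
 have P: "\<exists>d>0. \<forall>s. \<bar>s - t\<bar> < d --> \<bar>p s - p t - a * (s - t)\<bar> <= \<kappa> * \<bar>s - t\<bar>"
  using p \<kappa> unfolding has_field_derivative_def has_derivative_at_alt real_norm_def by blast
 then obtain d1 where d1: "d1 > 0" "!!s. \<bar>s - t\<bar> < d1 ==> \<bar>p s - p t - a * (s - t)\<bar> <= \<kappa> * \<bar>s - t\<bar>" by blast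
 have "\<exists>d>0. \<forall>s. \<bar>s - t\<bar> < d --> \<bar>q s - q t - b * (s - t)\<bar> <= \<kappa> * \<bar>s - t\<bar>"
  using q \<kappa> unfolding has_field_derivative_def has_derivative_at_alt real_norm_def by blast
 then obtain d2 where d2: "d2 > 0" "!!s. \<bar>s - t\<bar> < d2 ==> \<bar>q s - q t - b * (s - t)\<bar> <= \<kappa> * \<bar>s - t\<bar>" by blast
 obtain d3 where d3: "d3 > 0" "!!s. \<bar>s - t\<bar> < d3 ==> q s = \<psi> (p s)"
  using near qt unfolding eventually_at dist_real_def by (metis UNIV_I)
 obtain d4 where d4: "d4 > 0" "!!h. 0 < h ==> h < d4 ==> continuous_on {t - h..t + h} p"
  using contp unfolding eventually_at_right_field by (metis)
 define d where "d = Min {d1, d2, d3, d4}"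
 have d: "d > 0" "d <= d1" "d <= d2" "d <= d3" "d <= d4" using d1(1) d2(1) d3(1) d4(1) by (auto simp: d_def)
 define \<delta> where "\<delta> = d * \<bar>a\<bar> / 2"
 show ?thesis
 proof (intro exI[of _ \<delta>] conjI allI impI)
  show "\<delta> > 0" using d a by (simp add: \<delta>_def)
  fix w assume w: "\<bar>w\<bar> < \<delta>"
  show "\<bar>\<psi> (p t + w) - \<psi> (p t) - (b / a) * w\<bar> <= \<epsilon> * \<bar>w\<bar>"
  proof (cases "w = 0")
   case False
   define h where "h = 2 * \<bar>w\<bar> / \<bar>a\<bar>"
   have h: "0 < h" "h < d" using False a w by (auto simp: h_def \<delta>_def field_simps)
   have hw: "\<bar>a\<bar> * h / 2 = \<bar>w\<bar>" using a by (simp add: h_def)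
   have "\<kappa> <= \<bar>a\<bar>/2" unfolding \<kappa>_def by (rule min.cobounded1)
   hence k2: "\<kappa> * h <= \<bar>w\<bar>" using hw h mult_right_mono[of \<kappa> "\<bar>a\<bar>/2" h] by simp
   have r: "\<bar>p (t + h) - p t - a * h\<bar> <= \<bar>w\<bar>" and l: "\<bar>p (t - h) - p t + a * h\<bar> <= \<bar>w\<bar>"
    using d1(2)[of "t + h"] d1(2)[of "t - h"] h d k2 by auto
   have ah: "\<bar>a * h\<bar> = 2 * \<bar>w\<bar>" using hw h by (simp add: abs_mult)
   have cont: "continuous_on {t - h..t + h} p" using d4(2)[of h] h d by simp
   have "\<exists>s. t - h <= s & s <= t + h & p s = p t + w"
   proof (cases "a > 0")
    case True
    hence "a * h > 0" using h by simp
    hence "p (t - h) <= p t + w" "p t + w <= p (t + h)" using r l ah by (auto simp: abs_if split: if_splits)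
    thus ?thesis using IVT'[of p "t - h" "p t + w" "t + h"] cont h by auto
   next
    case False
    hence "a * h < 0" using h a by (simp add: mult_neg_pos)
    hence "p (t + h) <= p t + w" "p t + w <= p (t - h)" using r l ah by (auto simp: abs_if split: if_splits)
    thus ?thesis using IVT2'[of p "t + h" "p t + w" "t - h"] cont h by auto
   qed
   then obtain s where s: "\<bar>s - t\<bar> <= h" "p s = p t + w" by (smt (verit))
   have sd: "\<bar>s - t\<bar> < d" using s h by linarith
   have e1: "\<bar>p s - p t - a * (s - t)\<bar> <= \<kappa> * h" and e2: "\<bar>q s - q t - b * (s - t)\<bar> <= \<kappa> * h"
   proof -
    have "\<kappa> * \<bar>s - t\<bar> <= \<kappa> * h" using s \<kappa> by (intro mult_left_mono) auto
    moreover have "\<bar>s - t\<bar> < d1" "\<bar>s - t\<bar> < d2" using sd d by linarith+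
    ultimately show "\<bar>p s - p t - a * (s - t)\<bar> <= \<kappa> * h" "\<bar>q s - q t - b * (s - t)\<bar> <= \<kappa> * h"
     using d1(2)[of s] d2(2)[of s] by linarith+
   qed
   have "\<psi> (p t + w) - \<psi> (p t) - m * w = (q s - q t - b * (s - t)) - m * (p s - p t - a * (s - t))"
    using d3(2)[of s] sd d s qt a by (simp add: m_def field_simps)
   also have "\<bar>...\<bar> <= \<kappa> * h + \<bar>m\<bar> * (\<kappa> * h)"
   proof -
    have "\<bar>m * (p s - p t - a * (s - t))\<bar> <= \<bar>m\<bar> * (\<kappa> * h)" unfolding abs_mult using e1 by (intro mult_left_mono) auto
    thus ?thesis using e2 by linarith
   qed
   also have "... = (1 + \<bar>m\<bar>) * \<kappa> * h" by (simp add: algebra_simps)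
   also have "... <= (\<epsilon> * \<bar>a\<bar> / 2) * h"
   proof -
    have "(1 + \<bar>m\<bar>) * \<kappa> <= (1 + \<bar>m\<bar>) * (\<epsilon> * \<bar>a\<bar> / (2 * (1 + \<bar>m\<bar>)))"
     by (intro mult_left_mono) (auto simp: \<kappa>_def)
    also have "... = \<epsilon> * \<bar>a\<bar> / 2"
    proof -
     have "1 + \<bar>m\<bar> ~= 0" by linarith
     thus ?thesis by (simp add: nonzero_divide_eq_eq eq_divide_eq)
    qed
    finally show ?thesis using h by (simp add: mult_right_mono)
   qed
   also have "... = \<epsilon> * \<bar>w\<bar>" using hw by (simp add: field_simps)
   finally show ?thesis by (simp add: m_def)
  qed simp
 qed
qed

text \<open>The rotated velocity of the arc is normal to the tangent line of the graph, and the domain lies above the graph,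
 hence on one side of this line up to small cones.\<close>

lemma outer_normal_exists_on_arc:
 fixes Om :: "plane set" and g :: "real => plane"
 assumes lip: "lipschitz_boundary Om" and op: "open Om"
  and g: "path g" "path_image g <= frontier Om" and t: "0 < t" "t < 1"
  and d: "(g has_vector_derivative d) (at t)" "d ~= 0"
 shows "\<exists>\<nu>. is_outer_normal Om (g t) \<nu> & \<nu> \<bullet> d = 0"
proof -
 have gfr: "g s \<in> frontier Om" if "s \<in> {0..1}" for s using g(2) that by (auto simp: path_image_def)
 obtain r L and Q :: "plane => plane" and \<psi> :: "real => real" where r: "r > 0" and Q: "orthogonal_transformation Q" and L: "L-lipschitz_on UNIV \<psi>"
  and loc: "Om \<inter> ball (g t) r = {x \<in> ball (g t) r. Q x $ 2 > \<psi> (Q x $ 1)}"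
 proof -
  have "g t \<in> frontier Om" using gfr[of t] t by simp
  thus ?thesis using lip that unfolding lipschitz_boundary_def by blast
 qed
 have lin: "linear Q" using Q by (rule orthogonal_transformation_linear)
 hence bl: "bounded_linear Q" by (simp add: linear_conv_bounded_linear)
 have cont\<psi>: "continuous_on UNIV \<psi>" using L lipschitz_on_continuous_on by blast
 define p q where "p = (%s. Q (g s) $ 1)" and "q = (%s. Q (g s) $ 2)"
 define a b where "a = Q d $ 1" and "b = Q d $ 2"
 have Qg: "((%s. Q (g s)) has_vector_derivative Q d) (at t)" using bounded_linear.has_vector_derivative[OF bl d(1)] .
 have comp: "((%s. Q (g s) $ i) has_real_derivative Q d $ i) (at t)" for i using bounded_linear.has_vector_derivative[OF bounded_linear_vec_nth Qg, of i]
  by (simp add: has_real_derivative_iff_has_vector_derivative)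
 have p: "(p has_real_derivative a) (at t)" and q: "(q has_real_derivative b) (at t)" using comp by (simp_all add: p_def q_def a_def b_def)
 have contg: "continuous_on {0..1} g" using g(1) by (simp add: path_def)
 have "isCont g t" using d(1) has_vector_derivative_continuous by blast
 hence ev_ball: "\<forall>\<^sub>F s in at t. g s \<in> ball (g t) r" using r by (auto simp: isCont_def tendsto_iff dist_commute)
 have ev01: "\<forall>\<^sub>F s in at t. s \<in> {0..1}" using eventually_at_in_open'[of "{0<..<1::real}" t] t by (auto elim: eventually_mono)
 have near: "\<forall>\<^sub>F s in at t. q s = \<psi> (p s)"
  using ev_ball ev01 by eventually_elim (use frontier_on_graph[OF op cont\<psi> Q loc] gfr in \<open>auto simp: p_def q_def\<close>)
 have qt: "q t = \<psi> (p t)" using frontier_on_graph[OF op cont\<psi> Q loc, of "g t"] gfr[of t] t r by (auto simp: p_def q_def)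
 have "\<bar>b\<bar> <= L * \<bar>a\<bar>"
 proof (rule tendsto_le[of "at t"])
  show "((%s. \<bar>(q s - q t) / (s - t)\<bar>) \<longlongrightarrow> \<bar>b\<bar>) (at t)"
   using q by (intro tendsto_rabs) (simp add: has_field_derivative_iff)
  show "((%s. L * \<bar>(p s - p t) / (s - t)\<bar>) \<longlongrightarrow> L * \<bar>a\<bar>) (at t)"
   using p by (intro tendsto_intros) (simp add: has_field_derivative_iff)
  show "\<forall>\<^sub>F s in at t. \<bar>(q s - q t) / (s - t)\<bar> <= L * \<bar>(p s - p t) / (s - t)\<bar>" using near
  proof eventually_elim
   case (elim s)
   have "\<bar>q s - q t\<bar> <= L * \<bar>p s - p t\<bar>" using lipschitz_onD[OF L, of "p s" "p t"] elim qt by (simp add: dist_real_def)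
   thus ?case by (simp add: divide_right_mono)
  qed
 qed simp
 moreover have "a ~= 0 \<or> b ~= 0"
 proof (rule ccontr)
  assume "\<not> ?thesis"
  hence "Q d = 0" by (simp add: a_def b_def vec_eq_iff forall_2)
  thus False using d(2) Q by (metis orthogonal_transformation_norm norm_eq_zero)
 qed
 ultimately have a0: "a ~= 0" by auto
 have contp: "\<forall>\<^sub>F h in at_right 0. continuous_on {t - h..t + h} p"
 proof -
  have "\<forall>\<^sub>F h in at_right 0. (h::real) < min t (1 - t)" using t unfolding eventually_at_right_field by (intro exI[of _ "min t (1 - t)"]) auto
  thus ?thesis
  proof eventually_elim
   case (elim h)
   have "continuous_on {t - h..t + h} g" using contg by (rule continuous_on_subset) (use elim in auto)
   thus ?case unfolding p_def by (intro continuous_intros continuous_on_compose2[OF linear_continuous_on[OF bl, of UNIV]]) auto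
  qed
 qed
 define m where "m = b / a"
 define k where "k = sqrt (1 + m^2)"
 have k1: "k >= 1" and kk: "k * k = 1 + m^2" unfolding k_def by auto
 obtain \<nu>0 where \<nu>0: "Q \<nu>0 = vector [m, -1]" using orthogonal_transformation_surj[OF Q] by (metis surj_def)
 define \<nu> where "\<nu> = (1 / k) *\<^sub>R \<nu>0"
 have inner\<nu>: "y \<bullet> \<nu> = (m * Q y $ 1 - Q y $ 2) / k" for y
 proof -
  have "y \<bullet> \<nu>0 = Q y \<bullet> Q \<nu>0" using Q by (simp add: orthogonal_transformation_def)
  also have "... = m * Q y $ 1 - Q y $ 2" by (simp add: \<nu>0 inner_vec_def sum_2)
  finally show ?thesis by (simp add: \<nu>_def)
 qed
 have "\<nu> \<bullet> \<nu> = 1"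
 proof -
  have "Q \<nu> = (1/k) *\<^sub>R vector [m, -1]" using \<nu>0 lin by (simp add: \<nu>_def linear_cmul)
  hence "\<nu> \<bullet> \<nu> = (m * m + 1) / (k * k)" using inner\<nu>[of \<nu>] k1 by (simp add: field_simps)
  moreover have "k * k ~= 0" using k1 by auto
  ultimately show ?thesis using kk by (simp add: power2_eq_square add.commute)
 qed
 hence norm1: "norm \<nu> = 1" by (simp add: norm_eq_1)
 have "is_outer_normal Om (g t) \<nu>" unfolding is_outer_normal_def
 proof (intro conjI allI impI norm1)
  fix \<epsilon> :: real assume \<epsilon>: "\<epsilon> > 0"
  obtain \<delta> where \<delta>: "\<delta> > 0" "!!w. \<bar>w\<bar> < \<delta> ==> \<bar>\<psi> (p t + w) - \<psi> (p t) - m * w\<bar> <= \<epsilon> * \<bar>w\<bar>"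
   using graph_derivative_along_curve[OF p q a0 near qt contp \<epsilon>] unfolding m_def by blast
  show "\<exists>\<delta>>0. \<forall>y. norm (y - g t) < \<delta> -->
      ((y - g t) \<bullet> \<nu> < - \<epsilon> * norm (y - g t) --> y \<in> Om) &
      (\<epsilon> * norm (y - g t) < (y - g t) \<bullet> \<nu> --> y ~: Om)"
  proof (intro exI[of _ "min \<delta> r"] conjI allI impI)
   show "min \<delta> r > 0" using \<delta> r by simp
   fix y assume y: "norm (y - g t) < min \<delta> r"
   define w where "w = Q (y - g t)"
   have nw: "norm w = norm (y - g t)" unfolding w_def using Q by (rule orthogonal_transformation_norm)
   have w12: "\<bar>w $ 1\<bar> <= norm w" using component_le_norm_cart by auto
   have Qy: "Q y $ 1 = p t + w $ 1" "Q y $ 2 = q t + w $ 2" by (simp_all add: w_def p_def q_def linear_diff[OF lin])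
   have yb: "y \<in> ball (g t) r" using y by (simp add: dist_norm norm_minus_commute)
   have iff: "y \<in> Om \<longleftrightarrow> q t + w $ 2 > \<psi> (p t + w $ 1)"
   proof -
    have "y \<in> Om \<longleftrightarrow> y \<in> Om \<inter> ball (g t) r" using yb by simp
    also have "... \<longleftrightarrow> q t + w $ 2 > \<psi> (p t + w $ 1)" unfolding loc using yb Qy by simp
    finally show ?thesis .
   qed
   have err: "\<bar>\<psi> (p t + w $ 1) - q t - m * w $ 1\<bar> <= \<epsilon> * norm w"
   proof -
    have "\<bar>w $ 1\<bar> < \<delta>" using w12 y nw by linarith
    hence "\<bar>\<psi> (p t + w $ 1) - \<psi> (p t) - m * w $ 1\<bar> <= \<epsilon> * \<bar>w $ 1\<bar>" by (rule \<delta>(2))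
    also have "... <= \<epsilon> * norm w" using w12 \<epsilon> by (intro mult_left_mono) auto
    finally show ?thesis by (simp add: qt)
   qed
   have kn: "\<epsilon> * norm w <= k * (\<epsilon> * norm w)" using mult_right_mono[OF k1, of "\<epsilon> * norm w"] \<epsilon> by simp
   {
    assume "(y - g t) \<bullet> \<nu> < - \<epsilon> * norm (y - g t)"
    hence "m * w $ 1 - w $ 2 < - (k * (\<epsilon> * norm w))"
     using k1 unfolding inner\<nu> w_def[symmetric] nw[symmetric] by (simp add: pos_divide_less_eq mult_ac)
    thus "y \<in> Om" using iff err kn by (simp add: abs_le_iff)
   next
    assume "(y - g t) \<bullet> \<nu> > \<epsilon> * norm (y - g t)"
    hence "m * w $ 1 - w $ 2 > k * (\<epsilon> * norm w)" using k1 unfolding inner\<nu> w_def[symmetric] nw[symmetric] by (simp add: pos_less_divide_eq mult_ac)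
    thus "y ~: Om" using iff err kn by (simp add: abs_le_iff)
   }
  qed
 qed
 moreover have "\<nu> \<bullet> d = 0" using inner\<nu>[of d] a0 by (simp add: inner_commute m_def a_def b_def)
 ultimately show ?thesis by blast
qed

section \<open>The area formula in one dimension\<close>

text \<open>Sard's lemma on the line.\<close>

lemma negligible_critical_values:
 fixes f :: "real => real"
 assumes "!!x. x \<in> N ==> (f has_real_derivative 0) (at x)"
 shows "negligible (f ` N)"
proof -
 define F :: "real ^ 1 => real ^ 1" where "F = (%x. vec (f (x $ 1)))"
 have "negligible (F ` {x. x $ 1 \<in> N})"
 proof (rule baby_Sard)
  fix x :: "real ^ 1" assume x: "x \<in> {x. x $ 1 \<in> N}"
  have "(f has_derivative (%h. 0)) (at (x $ 1))" using assms[of "x $ 1"] x by (simp add: has_field_derivative_def lambda_zero)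
  hence "((%y. f (y $ 1)) has_derivative (%h. 0)) (at x)"
   using has_derivative_compose[of "%y. y $ 1" "%h. h $ 1" x UNIV f "%h. 0"]
    bounded_linear_imp_has_derivative[OF bounded_linear_vec_nth] by auto
  hence "(F has_derivative (%h. vec 0)) (at x)" unfolding F_def has_derivative_componentwise_within[of "%x. vec (f (x $ 1))"]
   by (auto simp: Basis_vec_def inner_axis)
  thus "(F has_derivative (%h. 0)) (at x within {x. x $ 1 \<in> N})" by (simp add: vec_eq_iff has_derivative_at_withinI flip: zero_vec_def)
 next
  show "rank (matrix (%h::real^1. 0 :: real^1)) < CARD(1)" for x
  proof -
   have "matrix (%h::real^1. 0 :: real^1) = 0" by (simp add: matrix_def vec_eq_iff)
   thus ?thesis by (simp add: rank_eq_0)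
  qed
 qed simp
 moreover have "f ` N = (%x. x $ 1) ` (F ` {x. x $ 1 \<in> N})"
 proof -
  have "f n \<in> (%x. x $ 1) ` (F ` {x. x $ 1 \<in> N})" if "n \<in> N" for n using that by (auto simp: F_def image_iff intro!: exI[of _ "vec n"])
  thus ?thesis by (auto simp: F_def)
 qed
 moreover have "(%x::real^1. x $ 1) differentiable_on S" for S by (simp add: linear_imp_differentiable_on bounded_linear_vec_nth bounded_linear.linear)
 ultimately show ?thesis using negligible_differentiable_image_negligible[of "F ` {x. x $ 1 \<in> N}" "%x. x $ 1"] by simp
qed

lemma inj_on_interval_if_derivative_nonzero:
 fixes f :: "real => real"
 assumes "!!x. x \<in> {p<..<q} ==> (f has_real_derivative f' x) (at x) & f' x ~= 0"
 shows "inj_on f {p<..<q}"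
proof (rule linorder_inj_onI)
 fix x y assume xy: "x < y" "x \<in> {p<..<q}" "y \<in> {p<..<q}"
 show "f x ~= f y"
 proof
  assume eq: "f x = f y"
  have sub: "z \<in> {p<..<q}" if "x <= z" "z <= y" for z using xy that by auto
  have "\<exists>z. x < z & z < y & (f has_real_derivative 0) (at z)"
  proof (rule Rolle[OF xy(1) eq])
   show "continuous_on {x..y} f" using assms sub by (intro continuous_at_imp_continuous_on) (force intro: DERIV_isCont)
   show "f differentiable at z" if "x < z" "z < y" for z using assms[of z] sub[of z] that by (auto simp: real_differentiable_def)
  qed
  thus False using assms sub DERIV_unique by (metis less_imp_le)
 qed
qed auto

text \<open>Intervals with rational endpoints on which the function is injective cover the set; making them disjoint gives
 countably many Borel pieces.\<close>

lemma open_set_split_into_injectivity_pieces: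
 fixes f :: "real => real"
 assumes "open A" and d: "!!x. x \<in> A ==> (f has_real_derivative f' x) (at x) & f' x ~= 0"
 obtains D :: "nat => real set" where "!!n. D n \<in> sets borel" "disjoint_family D" "(\<Union>n. D n) = A"
  "!!n. inj_on f (D n)"
proof -
 define I where "I = {pq. pq \<in> \<rat> \<times> \<rat> & {fst pq<..<snd pq} <= A}"
 have cI: "countable I" unfolding I_def by (rule countable_subset[of _ "\<rat> \<times> \<rat>"]) (auto intro: countable_SIGMA countable_rat)
 have neI: "I ~= {}" unfolding I_def by (auto intro!: exI[of _ 0])
 define C where "C n = {fst (from_nat_into I n)<..<snd (from_nat_into I n)}" for n
 have CI: "from_nat_into I n \<in> I" for n using neI by (rule from_nat_into)
 hence CA: "C n <= A" for n by (auto simp: I_def C_def)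
 have UC: "(\<Union>n. C n) = A"
 proof (intro antisym subsetI)
  fix x assume "x \<in> A"
  then obtain e where e: "e > 0" "ball x e <= A" using assms(1) open_contains_ball by blast
  obtain p where p: "p \<in> \<rat>" "x - e < p" "p < x" using Rats_dense_in_real[of "x - e" x] e by auto
  obtain q where q: "q \<in> \<rat>" "x < q" "q < x + e" using Rats_dense_in_real[of x "x + e"] e by auto
  have "{p<..<q} <= ball x e" using p q by (auto simp: dist_real_def)
  hence "(p, q) \<in> I" using p q e by (auto simp: I_def)
  then obtain n where "from_nat_into I n = (p, q)" using cI by (metis from_nat_into_to_nat_on)
  hence "x \<in> C n" using p q by (simp add: C_def)
  thus "x \<in> (\<Union>n. C n)" by blast
 qed (use CA in blast)
 show ?thesis
 proof (rule that[of "disjointed C"])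
  show "disjointed C n \<in> sets borel" for n
  proof -
   have "range (disjointed C) <= sets borel" by (rule sets.range_disjointed_sets) (auto simp: C_def)
   thus ?thesis by blast
  qed
  show "disjoint_family (disjointed C)" by (rule disjoint_family_disjointed)
  show "(\<Union>n. disjointed C n) = A" by (simp add: UN_disjointed_eq UC)
  show "inj_on f (disjointed C n)" for n
  proof (rule inj_on_subset[OF _ disjointed_subset])
   show "inj_on f (C n)" unfolding C_def by (rule inj_on_interval_if_derivative_nonzero[of _ _ f f'])
      (use d CA[of n] in \<open>auto simp: C_def\<close>)
  qed
 qed
qed

lemma measurable_completion_AE_cong:
 fixes f g :: "'a => 'b::topological_space"
 assumes f: "f \<in> borel_measurable (completion M)" and ae: "AE x in completion M. f x = g x"
 shows "g \<in> borel_measurable (completion M)"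
proof (rule measurableI)
 fix A :: "'b set" assume A: "A \<in> sets borel"
 show "g -` A \<inter> space (completion M) \<in> sets (completion M)"
 proof (rule completion.in_sets_AE)
  show "f -` A \<inter> space (completion M) \<in> sets (completion M)" using f A by (rule measurable_sets)
  show "AE x in completion M. (x \<in> f -` A \<inter> space (completion M)) = (x \<in> g -` A \<inter> space (completion M))" using ae by eventually_elim auto
 qed auto
qed auto

text \<open>On each injectivity piece this is the substitution rule; summing over the countably many pieces collects all
 preimages of a value.\<close>

lemma area_formula:
 fixes f f' h :: "real => real"
 assumes d: "!!t. t \<in> {0<..<1} ==> (f has_real_derivative f' t) (at t)"
  and contf': "continuous_on {0<..<1} f'"
  and int: "set_integrable lebesgue {0<..<1} (\<lambda>t. \<bar>f' t\<bar> * h t)"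
  and fin: "AE y in lebesgue. finite {t \<in> {0<..<1}. f t = y} & (\<forall>t\<in>{0<..<1}. f t = y --> f' t ~= 0)"
 shows "integrable lebesgue (\<lambda>y. \<Sum>t\<in>{t \<in> {0<..<1}. f t = y}. h t)"
  and "(LINT y|lebesgue. (\<Sum>t\<in>{t \<in> {0<..<1}. f t = y}. h t)) = (LINT t:{0<..<1}|lebesgue. \<bar>f' t\<bar> * h t)"
proof -
 define A where "A = {t \<in> {0<..<1}. f' t ~= 0}"
 have "open A"
 proof -
  have "open ({0<..<1} \<inter> f' -` (- {0}))" by (rule continuous_open_preimage[OF contf']) auto
  moreover have "{0<..<1} \<inter> f' -` (- {0}) = A" by (auto simp: A_def)
  ultimately show ?thesis by simp
 qed
 have dA: "(f has_real_derivative f' x) (at x) & f' x ~= 0" if "x \<in> A" for x using that d by (auto simp: A_def)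
 obtain D :: "nat => real set" where D: "!!n. D n \<in> sets borel" "disjoint_family D" "(\<Union>n. D n) = A"
  "!!n. inj_on f (D n)" using open_set_split_into_injectivity_pieces[OF \<open>open A\<close> dA] by blast
 have DA: "D n <= A" for n using D(3) by blast
 have D01: "D n <= {0<..<1}" for n using DA[of n] by (auto simp: A_def)
 have Dleb: "D n \<in> sets lebesgue" for n using D(1) by simp
 define k where "k n y = h (inv_into (D n) f y)" for n y
 have kf: "k n (f x) = h x" if "x \<in> D n" for n x using D(4) that by (simp add: k_def)
 have intD: "(%t. \<bar>f' t\<bar> * h t) absolutely_integrable_on D n" for n by (rule set_integrable_subset[OF int]) (use Dleb D01 in auto)
 have cov: "(%y. \<phi> (k n y)) absolutely_integrable_on f ` D n &
   integral (f ` D n) (%y. \<phi> (k n y)) = integral (D n) (%t. \<bar>f' t\<bar> * \<phi> (h t))"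
  if "(%t. \<bar>f' t\<bar> * \<phi> (h t)) absolutely_integrable_on D n" for n and \<phi> :: "real => real"
 proof -
  have iff: "(%x. \<bar>f' x\<bar> * \<phi> (k n (f x))) absolutely_integrable_on D n &
      integral (D n) (%x. \<bar>f' x\<bar> * \<phi> (k n (f x))) = integral (D n) (%t. \<bar>f' t\<bar> * \<phi> (h t))
    \<longleftrightarrow> (%y. \<phi> (k n y)) absolutely_integrable_on f ` D n &
      integral (f ` D n) (%y. \<phi> (k n y)) = integral (D n) (%t. \<bar>f' t\<bar> * \<phi> (h t))"
  proof (rule has_absolute_integral_change_of_variables_1'[where f = "%y. \<phi> (k n y)" and g = f and g' = f' and S = "D n", OF Dleb _ D(4)])
   show "(f has_real_derivative f' x) (at x within D n)" if "x \<in> D n" for x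
   proof (rule has_field_derivative_at_within, rule d)
    show "x \<in> {0<..<1}" using that D01[of n] by blast
   qed
  qed
  have 1: "(%x. \<bar>f' x\<bar> * \<phi> (k n (f x))) absolutely_integrable_on D n"
  proof -
   have "set_integrable lebesgue (D n) (%x. \<bar>f' x\<bar> * \<phi> (k n (f x))) = set_integrable lebesgue (D n) (%t. \<bar>f' t\<bar> * \<phi> (h t))"
    by (rule set_integrable_cong) (simp_all add: kf)
   thus ?thesis using that by simp
  qed
  have 2: "integral (D n) (%x. \<bar>f' x\<bar> * \<phi> (k n (f x))) = integral (D n) (%t. \<bar>f' t\<bar> * \<phi> (h t))"
   by (rule integral_cong) (simp add: kf)
  show ?thesis by (rule iffD1[OF iff, OF conjI[OF 1 2]])
 qed
 define K where "K n y = indicator (f ` D n) y * k n y" for n y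
 have Kint: "integrable lebesgue (K n)"
  and KL: "(LINT y|lebesgue. K n y) = (LINT t:D n|lebesgue. \<bar>f' t\<bar> * h t)" for n
 proof -
  note c = cov[where \<phi> = "%x. x" and n = n, OF intD]
  show "integrable lebesgue (K n)" using c by (simp add: set_integrable_def K_def[abs_def])
  have "(LINT y|lebesgue. K n y) = (LINT y:f ` D n|lebesgue. k n y)" by (simp add: set_lebesgue_integral_def K_def[abs_def])
  also have "... = integral (f ` D n) (k n)" by (rule set_lebesgue_integral_eq_integral) (use c in simp)
  also have "... = integral (D n) (%t. \<bar>f' t\<bar> * h t)" using c by simp
  also have "... = (LINT t:D n|lebesgue. \<bar>f' t\<bar> * h t)" by (rule set_lebesgue_integral_eq_integral(2)[symmetric]) (rule intD)
  finally show "(LINT y|lebesgue. K n y) = (LINT t:D n|lebesgue. \<bar>f' t\<bar> * h t)" .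
 qed
 have intabs: "set_integrable lebesgue {0<..<1} (%t. \<bar>f' t\<bar> * \<bar>h t\<bar>)" using set_integrable_abs[OF int] by (simp add: abs_mult)
 have intDabs: "(%t. \<bar>f' t\<bar> * \<bar>h t\<bar>) absolutely_integrable_on D n" for n by (rule set_integrable_subset[OF intabs]) (use Dleb D01 in auto)
 have Kn: "(LINT y|lebesgue. norm (K n y)) = (LINT t:D n|lebesgue. \<bar>f' t\<bar> * \<bar>h t\<bar>)" for n
 proof -
  note c = cov[where \<phi> = abs and n = n, OF intDabs]
  have "(LINT y|lebesgue. norm (K n y)) = (LINT y:f ` D n|lebesgue. \<bar>k n y\<bar>)" by (simp add: set_lebesgue_integral_def K_def[abs_def] abs_mult)
  also have "... = integral (f ` D n) (%y. \<bar>k n y\<bar>)" by (rule set_lebesgue_integral_eq_integral) (use c in simp)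
  also have "... = integral (D n) (%t. \<bar>f' t\<bar> * \<bar>h t\<bar>)" using c by simp
  also have "... = (LINT t:D n|lebesgue. \<bar>f' t\<bar> * \<bar>h t\<bar>)" by (rule set_lebesgue_integral_eq_integral(2)[symmetric]) (rule intDabs)
  finally show ?thesis .
 qed
 have summ: "summable (%n. LINT y|lebesgue. norm (K n y))" unfolding Kn
 proof (rule bounded_imp_summable)
  fix n
  show "(LINT t:D n|lebesgue. \<bar>f' t\<bar> * \<bar>h t\<bar>) >= 0" unfolding set_lebesgue_integral_def by (simp add: integral_nonneg_AE)
  have "(\<Sum>i\<le>n. LINT t:D i|lebesgue. \<bar>f' t\<bar> * \<bar>h t\<bar>) = (LINT t:(\<Union>i\<in>{..n}. D i)|lebesgue. \<bar>f' t\<bar> * \<bar>h t\<bar>)"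
   by (rule set_integral_finite_Union[symmetric])
     (use Dleb intDabs D(2) in \<open>auto simp: disjoint_family_on_def\<close>)
  also have "... <= (LINT t:{0<..<1}|lebesgue. \<bar>f' t\<bar> * \<bar>h t\<bar>)" unfolding set_lebesgue_integral_def
  proof (rule integral_mono)
   show "integrable lebesgue (%t. indicat_real (\<Union>i\<in>{..n}. D i) t *\<^sub>R (\<bar>f' t\<bar> * \<bar>h t\<bar>))"
    using set_integrable_subset[OF intabs, of "\<Union>i\<in>{..n}. D i"] D01 Dleb unfolding set_integrable_def by blast
   show "integrable lebesgue (%t. indicat_real {0<..<1} t *\<^sub>R (\<bar>f' t\<bar> * \<bar>h t\<bar>))" using intabs unfolding set_integrable_def .
   show "indicat_real (\<Union>i\<in>{..n}. D i) t *\<^sub>R (\<bar>f' t\<bar> * \<bar>h t\<bar>) <= indicat_real {0<..<1} t *\<^sub>R (\<bar>f' t\<bar> * \<bar>h t\<bar>)" for t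
   proof (intro scaleR_right_mono)
    have "(\<Union>i\<in>{..n}. D i) <= {0<..<1}" using D01 by blast
    thus "indicat_real (\<Union>i\<in>{..n}. D i) t <= indicat_real {0<..<1} t" by (auto simp: indicator_def)
   qed simp
  qed
  finally show "(\<Sum>i\<le>n. LINT t:D i|lebesgue. \<bar>f' t\<bar> * \<bar>h t\<bar>) <= (LINT t:{0<..<1}|lebesgue. \<bar>f' t\<bar> * \<bar>h t\<bar>)" .
 qed
 \<comment> \<open>At a regular value only finitely many pieces contribute, one for each preimage.\<close>
 have sumK: "(%n. K n y) sums (\<Sum>t\<in>{t \<in> {0<..<1}. f t = y}. h t) & summable (%n. norm (K n y))"
  if y: "finite {t \<in> {0<..<1}. f t = y}" "\<forall>t\<in>{0<..<1}. f t = y --> f' t ~= 0" for y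
 proof -
  define F where "F = {t \<in> {0<..<1}. f t = y}"
  have FA: "F <= A" using y(2) by (auto simp: F_def A_def)
  have "\<exists>n. t \<in> D n" if "t \<in> F" for t using that FA D(3) by blast
  then obtain N where N: "!!t. t \<in> F ==> t \<in> D (N t)" by metis
  have uniq: "n = N t" if "t \<in> F" "t \<in> D n" for t n
  proof (rule ccontr)
   assume "n ~= N t"
   hence "D n \<inter> D (N t) = {}" using D(2) by (simp add: disjoint_family_on_def)
   thus False using that N[of t] by blast
  qed
  have K_eq: "K n y = (\<Sum>t\<in>{t \<in> F. N t = n}. h t)" for n
  proof (cases "y \<in> f ` D n")
   case True
   then obtain t where t: "t \<in> D n" "f t = y" by auto
   hence tF: "t \<in> F" using D01[of n] unfolding F_def by blast
   have "{t \<in> F. N t = n} = {t}"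
   proof -
    have "t' = t" if "t' \<in> F" "N t' = n" for t'
    proof (rule inj_onD[OF D(4)[of n]])
     show "f t' = f t" using that t by (simp add: F_def)
     show "t' \<in> D n" using N[OF that(1)] that(2) by simp
    qed (rule t)
    moreover have "N t = n" using uniq[OF tF t(1)] by simp
    ultimately show ?thesis using tF by blast
   qed
   moreover have "K n y = h t" using True kf[OF t(1)] t(2) by (simp add: K_def)
   ultimately show ?thesis by (simp only: sum.insert sum.empty finite.emptyI empty_iff) simp
  next
   case False
   have "{t \<in> F. N t = n} = {}"
   proof -
    have "N t ~= n" if "t \<in> F" for t using False N[OF that] that by (auto simp: F_def)
    thus ?thesis by blast
   qed
   moreover have "K n y = 0" using False by (simp add: K_def)
   ultimately show ?thesis by (simp only: sum.empty)
  qed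
  have fF: "finite F" using y(1) by (simp add: F_def)
  have z: "K n y = 0" if "n ~: N ` F" for n
  proof -
   have "{t \<in> F. N t = n} = {}" using that by auto
   thus ?thesis unfolding K_eq[of n] by (simp only: sum.empty)
  qed
  have "(\<Sum>n\<in>N ` F. K n y) = (\<Sum>n\<in>N ` F. \<Sum>t\<in>{t \<in> F. N t = n}. h t)" by (simp add: K_eq)
  also have "... = (\<Sum>t\<in>F. h t)" using fF by (rule sum.image_gen[symmetric])
  finally have "(\<Sum>n\<in>N ` F. K n y) = (\<Sum>t\<in>{t \<in> {0<..<1}. f t = y}. h t)" by (simp add: F_def)
  moreover have "(%n. K n y) sums (\<Sum>n\<in>N ` F. K n y)" by (rule sums_finite) (use fF z in auto)
  moreover have "summable (%n. norm (K n y))" by (rule summable_finite[of "N ` F"]) (use fF z in auto)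
  ultimately show ?thesis by simp
 qed
 have AEsum: "AE y in lebesgue. summable (%n. norm (K n y))" using fin
 proof eventually_elim
  case (elim y)
  show ?case using sumK[OF conjunct1[OF elim] conjunct2[OF elim]] by (rule conjunct2)
 qed
 note S = integrable_suminf[OF Kint AEsum summ] integral_suminf[OF Kint AEsum summ]
 have AEeq: "AE y in lebesgue. (\<Sum>n. K n y) = (\<Sum>t\<in>{t \<in> {0<..<1}. f t = y}. h t)" using fin
 proof eventually_elim
  case (elim y)
  show ?case using sumK[OF conjunct1[OF elim] conjunct2[OF elim], THEN conjunct1] by (rule sums_unique[symmetric])
 qed
 have meas: "(%y. \<Sum>t\<in>{t \<in> {0<..<1}. f t = y}. h t) \<in> borel_measurable lebesgue"
 proof -
  have "(%y. \<Sum>n. K n y) \<in> borel_measurable lebesgue" using S(1) by simp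
  thus ?thesis
  proof (rule measurable_completion_AE_cong)
   show "AE y in lebesgue. (\<Sum>n. K n y) = (\<Sum>t\<in>{t \<in> {0<..<1}. f t = y}. h t)" by (rule AEeq)
  qed
 qed
 show "integrable lebesgue (%y. \<Sum>t\<in>{t \<in> {0<..<1}. f t = y}. h t)" using integrable_cong_AE_imp[OF S(1) meas] AEeq by (simp add: eq_commute)
 have "(LINT y|lebesgue. (\<Sum>t\<in>{t \<in> {0<..<1}. f t = y}. h t)) = (LINT y|lebesgue. (\<Sum>n. K n y))"
  by (rule integral_cong_AE) (use meas S(1) AEeq in \<open>auto simp: eq_commute\<close>)
 also have "... = (\<Sum>n. LINT t:D n|lebesgue. \<bar>f' t\<bar> * h t)" by (simp add: S(2) KL)
 also have "... = (LINT t:(\<Union>n. D n)|lebesgue. \<bar>f' t\<bar> * h t)"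
 proof (rule lebesgue_integral_countable_add[symmetric])
  show "set_integrable lebesgue (\<Union>n. D n) (%t. \<bar>f' t\<bar> * h t)" by (rule set_integrable_subset[OF int]) (use Dleb D01 in auto)
 qed (use Dleb D(2) in \<open>auto simp: disjoint_family_on_def\<close>)
 also have "... = (LINT t:{0<..<1}|lebesgue. \<bar>f' t\<bar> * h t)" unfolding set_lebesgue_integral_def D(3)
  by (rule Bochner_Integration.integral_cong) (auto simp: A_def indicator_def)
 finally show "(LINT y|lebesgue. (\<Sum>t\<in>{t \<in> {0<..<1}. f t = y}. h t)) = (LINT t:{0<..<1}|lebesgue. \<bar>f' t\<bar> * h t)" .
qed

section \<open>The divergence theorem\<close>

definition crosses_out :: "real set => real => bool" where
 "crosses_out W s \<longleftrightarrow> (\<exists>e>0. {s - e<..<s} <= W & {s<..<s + e} \<inter> W = {})"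

definition crosses_in :: "real set => real => bool" where
 "crosses_in W s \<longleftrightarrow> (\<exists>e>0. {s - e<..<s} \<inter> W = {} & {s<..<s + e} <= W)"

lemma connected_avoiding_frontier:
 assumes "connected C" "C \<inter> frontier W = {}"
 shows "C <= W \<or> C \<inter> W = {}" using connected_Int_frontier[OF assms(1), of W] assms(2) by blast

text \<open>The fundamental theorem of calculus on every component interval of the slice \<open>W\<close>. The points of the
 finite set \<open>S\<close> cut the line into intervals that lie either in \<open>W\<close> or in its
 complement, and each crossing contributes the boundary value with the sign that tells on which side
 \<open>W\<close> lies.\<close>

lemma integral_derivative_over_slice:
 fixes W :: "real set" and f f' \<sigma> :: "real => real"
 assumes "finite S" and "open W" "bounded W" "W \<inter> S = {}" "frontier W <= S"
  and "!!s. s \<in> S ==> (\<sigma> s = 1 & crosses_out W s) \<or> (\<sigma> s = -1 & crosses_in W s)"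
  and "continuous_on (closure W) f"
  and "!!x. x \<in> W ==> (f has_real_derivative f' x) (at x)"
  and "set_integrable lborel W f'"
 shows "(LINT x:W|lborel. f' x) = (\<Sum>s\<in>S. \<sigma> s * f s)" using assms
proof (induction S arbitrary: W rule: finite_psubset_induct)
 case (psubset S W)
 note openW = psubset.prems(1) and bW = psubset.prems(2) and WS = psubset.prems(3)
  and fr = psubset.prems(4) and sides = psubset.prems(5) and cont = psubset.prems(6)
  and der = psubset.prems(7) and int = psubset.prems(8)
 show ?case
 proof (cases "S = {}")
  case True
  hence "frontier W = {}" using fr by simp
  hence "W = {} \<or> W = UNIV" using frontier_eq_empty by blast
  hence "W = {}" using bW by auto
  thus ?thesis using True by (simp add: set_lebesgue_integral_def)
 next
  case False
  define s where "s = Max S"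
  have sS: "s \<in> S" and smax: "!!x. x \<in> S ==> x <= s" using psubset.hyps False by (auto simp: s_def)
  have right: "{s<..} \<inter> W = {}"
  proof -
   have "{s<..} \<inter> frontier W = {}" using fr smax by force
   hence "{s<..} <= W \<or> {s<..} \<inter> W = {}" by (intro connected_avoiding_frontier) auto
   moreover have "\<not> {s<..} <= W"
   proof
    assume "{s<..} <= W"
    hence "bounded {s<..}" using bW bounded_subset by blast
    then obtain M where "!!x. s < x ==> \<bar>x\<bar> <= M" by (auto simp: bounded_real)
    moreover have "s < \<bar>M\<bar> + \<bar>s\<bar> + 1" by arith
    ultimately have "\<bar>\<bar>M\<bar> + \<bar>s\<bar> + 1\<bar> <= M" by blast
    thus False by arith
   qed
   ultimately show ?thesis by blast
  qed
  have not_in: "\<not> crosses_in W s"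
  proof
   assume "crosses_in W s"
   then obtain e where e: "e > 0" "{s<..<s + e} <= W" by (auto simp: crosses_in_def)
   hence "s + e / 2 \<in> W" by auto
   moreover have "s + e / 2 \<in> {s<..}" using e by simp
   ultimately show False using right by blast
  qed
  with sides[OF sS] have \<sigma>s: "\<sigma> s = 1" and out: "crosses_out W s" by auto
  obtain e where e: "e > 0" "{s - e<..<s} <= W" using out by (auto simp: crosses_out_def)
  define S1 where "S1 = S - {s}"
  have ne1: "S1 ~= {}"
  proof
   assume "S1 = {}"
   hence "{..<s} \<inter> frontier W = {}" using fr by (auto simp: S1_def)
   hence "{..<s} <= W \<or> {..<s} \<inter> W = {}" by (intro connected_avoiding_frontier) auto
   moreover have "s - e / 2 \<in> {..<s} \<inter> W" using e by auto
   ultimately have "{..<s} <= W" by blast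
   hence "bounded {..<s}" using bW bounded_subset by blast
   then obtain M where "!!x. x < s ==> \<bar>x\<bar> <= M" by (auto simp: bounded_real)
   moreover have "- \<bar>M\<bar> - \<bar>s\<bar> - 1 < s" by arith
   ultimately have "\<bar>- \<bar>M\<bar> - \<bar>s\<bar> - 1\<bar> <= M" by blast
   thus False by arith
  qed
  have fin1: "finite S1" using psubset.hyps by (simp add: S1_def)
  define a where "a = Max S1"
  have aS: "a \<in> S1" and amax: "!!x. x \<in> S1 ==> x <= a" using fin1 ne1 by (auto simp: a_def)
  have as: "a < s" using aS smax[of a] by (auto simp: S1_def)
  have aS': "a \<in> S" using aS by (simp add: S1_def)
  have mid: "{a<..<s} <= W"
  proof -
   have "{a<..<s} \<inter> frontier W = {}" using fr amax by (force simp: S1_def)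
   hence "{a<..<s} <= W \<or> {a<..<s} \<inter> W = {}" by (intro connected_avoiding_frontier) auto
   moreover have "max (s - e / 2) ((a + s) / 2) \<in> {a<..<s} \<inter> {s - e<..<s}" using e as by (auto simp: less_max_iff_disj)
   hence "{a<..<s} \<inter> W ~= {}" using e by blast
   ultimately show ?thesis by blast
  qed
  have not_out: "\<not> crosses_out W a"
  proof
   assume "crosses_out W a"
   then obtain d where d: "d > 0" "{a<..<a + d} \<inter> W = {}" by (auto simp: crosses_out_def)
   have "min (a + d / 2) ((a + s) / 2) \<in> {a<..<a + d} \<inter> {a<..<s}" using d as by (auto simp: min_less_iff_disj)
   hence "min (a + d / 2) ((a + s) / 2) \<in> {a<..<a + d} \<inter> W" using mid by blast
   thus False using d by blast
  qed
  with sides[OF aS'] have \<sigma>a: "\<sigma> a = -1" and ain: "crosses_in W a" by auto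
  obtain d where d: "d > 0" "{a - d<..<a} \<inter> W = {}" using ain by (auto simp: crosses_in_def)
  define V where "V = W \<inter> {..<a}"
  define S2 where "S2 = S - {a, s}"
  have aW: "a ~: W" and sW: "s ~: W" using WS aS' sS by auto
  have WV: "W = V \<union> {a<..<s}"
  proof -
   have "x < a \<or> (a < x & x < s)" if "x \<in> W" for x
   proof -
    have "\<not> s < x" using right that by blast
    thus ?thesis using aW sW that by (metis linorder_neqE_linordered_idom)
   qed
   thus ?thesis using mid unfolding V_def by (intro set_eqI iffI) auto
  qed
  have disj: "V \<inter> {a<..<s} = {}" by (auto simp: V_def)
  have openV: "open V" using openW by (auto simp: V_def)
  have VW: "V <= W" by (auto simp: V_def)
  have "frontier V <= S2"
  proof
   fix x assume x: "x \<in> frontier V"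
   have xcl: "x \<in> closure V" and xV: "x ~: V" using x openV by (auto simp: frontier_def interior_open)
   have "closure V <= {..a}" by (rule closure_minimal) (auto simp: V_def)
   hence xa: "x <= a" using xcl by auto
   have "x ~= a"
   proof
    assume "x = a"
    then obtain y where "y \<in> V" "dist y a < d" using xcl d by (auto simp: closure_approachable)
    hence "y \<in> {a - d<..<a} \<inter> W" by (auto simp: V_def dist_real_def)
    thus False using d by blast
   qed
   moreover have "x \<in> closure W" using xcl VW closure_mono by blast
   moreover have "x ~: W" using xV xa \<open>x ~= a\<close> by (auto simp: V_def)
   ultimately show "x \<in> S2" using fr openW xa as by (auto simp: S2_def frontier_def interior_open)
  qed
  moreover have "(\<sigma> x = 1 & crosses_out V x) \<or> (\<sigma> x = -1 & crosses_in V x)" if xS: "x \<in> S2" for x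
  proof -
   have xa: "x < a" using amax[of x] xS by (auto simp: S2_def S1_def)
   consider "\<sigma> x = 1" "crosses_out W x" | "\<sigma> x = -1" "crosses_in W x" using sides[of x] xS by (auto simp: S2_def)
   thus ?thesis
   proof cases
    case 1
    then obtain k where k: "k > 0" "{x - k<..<x} <= W" "{x<..<x + k} \<inter> W = {}" by (auto simp: crosses_out_def)
    hence "crosses_out V x" unfolding crosses_out_def using xa VW by (intro exI[of _ k]) (auto simp: V_def)
    thus ?thesis using 1 by simp
   next
    case 2
    then obtain k where k: "k > 0" "{x - k<..<x} \<inter> W = {}" "{x<..<x + k} <= W" by (auto simp: crosses_in_def)
    have "{x - min k (a - x)<..<x} <= {x - k<..<x}" "{x<..<x + min k (a - x)} <= {x<..<x + k} \<inter> {..<a}" by auto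
    hence "crosses_in V x" unfolding crosses_in_def using xa VW k by (intro exI[of _ "min k (a - x)"]) (simp, unfold V_def, blast)
    thus ?thesis using 2 by simp
   qed
  qed
  moreover have "bounded V" using bW VW bounded_subset by blast
  moreover have "V \<inter> S2 = {}" using WS VW by (auto simp: S2_def)
  moreover have "continuous_on (closure V) f" using cont closure_mono[OF VW] by (rule continuous_on_subset)
  moreover have intV: "set_integrable lborel V f'" using openV by (intro set_integrable_subset[OF int _ VW]) simp
  moreover have "S2 \<subset> S" using sS by (auto simp: S2_def)
  ultimately have IH: "(LINT x:V|lborel. f' x) = (\<Sum>s\<in>S2. \<sigma> s * f s)" using psubset.IH[of S2 V] openV der VW by blast
  have intM: "set_integrable lborel {a<..<s} f'" by (rule set_integrable_subset[OF int _ mid]) simp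
  have "(f' has_integral (f s - f a)) {a..s}"
  proof (rule fundamental_theorem_of_calculus_interior)
   have "{a..s} <= closure W"
   proof -
    have "{a..s} = closure {a<..<s}" using as by simp
    thus ?thesis using closure_mono[OF mid] by simp
   qed
   thus "continuous_on {a..s} f" using cont by (rule continuous_on_subset[rotated])
   show "(f has_vector_derivative f' x) (at x)" if "x \<in> {a<..<s}" for x using der[of x] mid that by (auto simp: has_real_derivative_iff_has_vector_derivative)
  qed (use as in simp)
  hence "integral {a<..<s} f' = f s - f a" by (simp add: has_integral_Icc_iff_Ioo integral_unique)
  hence I2: "(LINT x:{a<..<s}|lborel. f' x) = f s - f a" using set_borel_integral_eq_integral(2)[OF intM] by simp
  have "(LINT x:W|lborel. f' x) = (LINT x:V|lborel. f' x) + (LINT x:{a<..<s}|lborel. f' x)" unfolding WV by (rule set_integral_Un[OF disj intV intM])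
  also have "... = (\<Sum>s\<in>S2. \<sigma> s * f s) + (\<sigma> a * f a + \<sigma> s * f s)" using IH I2 \<sigma>a \<sigma>s by simp
  also have "... = (\<Sum>s\<in>S. \<sigma> s * f s)"
  proof -
   have "S = S2 \<union> {a, s}" "S2 \<inter> {a, s} = {}" using aS' sS by (auto simp: S2_def)
   thus ?thesis using psubset.hyps as sum.union_disjoint[of S2 "{a, s}" "%s. \<sigma> s * f s"] by (auto simp: S2_def)
  qed
  finally show ?thesis .
 qed
qed

section \<open>Fubini for Lebesgue measurable functions\<close>

lemma AE_lebesgue_pair:
 fixes P :: "'a::euclidean_space \<times> 'b::euclidean_space => bool"
 assumes "AE z in lebesgue. P z"
 shows "AE t in lebesgue. AE x in lebesgue. P (t, x)"
proof -
 have "AE z in lborel \<Otimes>\<^sub>M lborel. P z" using assms by (simp only: AE_completion_iff lborel_prod)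
 hence "AE t in lborel. AE x in lborel. P (t, x)" by (rule lborel_pair.AE_pair)
 thus ?thesis by (simp add: AE_completion_iff)
qed

text \<open>A slice of a Lebesgue measurable set need not be measurable. Almost every slice of a Lebesgue measurable
 function agrees almost everywhere with the slice of a Borel version, for which Fubini's theorem holds without
 exceptions.\<close>

lemma lebesgue_borel_version:
 fixes f :: "'a::euclidean_space \<times> 'b::euclidean_space => real"
 assumes "f \<in> borel_measurable lebesgue"
 obtains g where "g \<in> borel_measurable (lborel \<Otimes>\<^sub>M lborel)" "AE z in lebesgue. f z = g z"
  "AE t in lebesgue. AE x in lebesgue. f (t, x) = g (t, x)"
proof -
 obtain g where g: "g \<in> borel_measurable lborel" "AE z in lborel. f z = g z" using completion_ex_borel_measurable_real[OF assms] by blast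
 show ?thesis
 proof (rule that[of g])
  show "g \<in> borel_measurable (lborel \<Otimes>\<^sub>M lborel)" using g(1) by (simp add: lborel_prod)
  show "AE z in lebesgue. f z = g z" using g(2) by (rule AE_completion)
  thus "AE t in lebesgue. AE x in lebesgue. f (t, x) = g (t, x)" by (rule AE_lebesgue_pair)
 qed
qed

lemma lebesgue_Fubini:
 fixes f :: "'a::euclidean_space \<times> 'b::euclidean_space => real"
 assumes f: "integrable lebesgue f"
 shows "AE t in lebesgue. integrable lebesgue (\<lambda>x. f (t, x))"
  and "integrable lebesgue (\<lambda>t. LINT x|lebesgue. f (t, x))"
  and "(LINT t|lebesgue. LINT x|lebesgue. f (t, x)) = (LINT z|lebesgue. f z)"
proof -
 obtain g where g: "g \<in> borel_measurable (lborel \<Otimes>\<^sub>M lborel)" "AE z in lebesgue. f z = g z"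
  and sl: "AE t in lebesgue. AE x in lebesgue. f (t, x) = g (t, x)" using lebesgue_borel_version[of f] f by auto
 have g': "g \<in> borel_measurable lborel" using g(1) by (simp add: lborel_prod)
 hence gl: "g \<in> borel_measurable lebesgue" by (rule measurable_completion)
 have "integrable lebesgue g" using integrable_cong_AE_imp[OF f gl] g(2) by (simp add: eq_commute)
 hence gi: "integrable (lborel \<Otimes>\<^sub>M lborel) g" using g' by (simp add: integrable_completion lborel_prod)
 have gs: "(%x. g (t, x)) \<in> borel_measurable lborel" for t using g(1) by measurable
 have slice: "integrable lebesgue (%x. f (t, x)) & (LINT x|lebesgue. f (t, x)) = (LINT x|lborel. g (t, x))"
  if ae: "AE x in lebesgue. f (t, x) = g (t, x)" and i: "integrable lborel (%x. g (t, x))" for t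
 proof -
  have m: "(%x. f (t, x)) \<in> borel_measurable lebesgue" by (rule measurable_completion_AE_cong[of "%x. g (t, x)"])
     (use gs ae in \<open>auto intro: measurable_completion simp: eq_commute\<close>)
  have il: "integrable lebesgue (%x. g (t, x))" using i gs by (simp add: integrable_completion)
  have "integrable lebesgue (%x. f (t, x))" using integrable_cong_AE_imp[OF il m] ae by (simp add: eq_commute)
  moreover have "(LINT x|lebesgue. f (t, x)) = (LINT x|lebesgue. g (t, x))" by (rule integral_cong_AE) (use m il ae in auto)
  ultimately show ?thesis using gs by (simp add: integral_completion)
 qed
 have "AE t in lborel. integrable lborel (%x. g (t, x))" by (rule lborel_pair.AE_integrable_fst'[OF gi])
 hence "AE t in lebesgue. integrable lborel (%x. g (t, x))" by (rule AE_completion)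
 with sl have both: "AE t in lebesgue. integrable lebesgue (%x. f (t, x)) &
   (LINT x|lebesgue. f (t, x)) = (LINT x|lborel. g (t, x))" by eventually_elim (use slice in blast)
 thus "AE t in lebesgue. integrable lebesgue (%x. f (t, x))" by eventually_elim simp
 have G: "integrable lborel (%t. LINT x|lborel. g (t, x))" by (rule lborel_pair.integrable_fst'[OF gi])
 hence Gl: "integrable lebesgue (%t. LINT x|lborel. g (t, x))" by (simp add: integrable_completion)
 have eq: "AE t in lebesgue. (LINT x|lborel. g (t, x)) = (LINT x|lebesgue. f (t, x))" using both by eventually_elim simp
 have m: "(%t. LINT x|lebesgue. f (t, x)) \<in> borel_measurable lebesgue" by (rule measurable_completion_AE_cong[OF _ eq]) (use Gl in simp)
 show "integrable lebesgue (%t. LINT x|lebesgue. f (t, x))" by (rule integrable_cong_AE_imp[OF Gl m eq])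
 have "(LINT t|lebesgue. LINT x|lebesgue. f (t, x)) = (LINT t|lebesgue. LINT x|lborel. g (t, x))"
  by (rule integral_cong_AE) (use m Gl eq in \<open>auto simp: eq_commute\<close>)
 also have "... = (LINT t|lborel. LINT x|lborel. g (t, x))" using G by (simp add: integral_completion)
 also have "... = (LINT z|lborel. g z)" using lborel_pair.integral_fst'[OF gi] by (simp add: lborel_prod)
 also have "... = (LINT z|lebesgue. g z)" using g' by (simp add: integral_completion)
 also have "... = (LINT z|lebesgue. f z)" by (rule integral_cong_AE) (use f gl g(2) in \<open>auto simp: eq_commute\<close>)
 finally show "(LINT t|lebesgue. LINT x|lebesgue. f (t, x)) = (LINT z|lebesgue. f z)" .
qed

lemma set_lebesgue_Fubini:
 fixes f :: "'a::euclidean_space \<times> 'b::euclidean_space => real"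
 assumes f: "set_integrable lebesgue (A \<times> X) f"
 shows "AE t in lebesgue. t \<in> A --> set_integrable lebesgue X (\<lambda>x. f (t, x))"
  and "set_integrable lebesgue A (\<lambda>t. LINT x:X|lebesgue. f (t, x))"
  and "(LINT t:A|lebesgue. LINT x:X|lebesgue. f (t, x)) = (LINT z:A \<times> X|lebesgue. f z)"
proof -
 have eq: "indicator (A \<times> X) (t, x) *\<^sub>R f (t, x) = indicator A t *\<^sub>R (indicator X x *\<^sub>R f (t, x))" for t x by (simp add: indicator_def)
 have eq2: "(LINT x|lebesgue. indicator A t *\<^sub>R (indicator X x *\<^sub>R f (t, x))) =
   indicator A t *\<^sub>R (LINT x|lebesgue. indicator X x *\<^sub>R f (t, x))" for t by simp
 note F = lebesgue_Fubini[OF f[unfolded set_integrable_def], unfolded eq eq2]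
 show "AE t in lebesgue. t \<in> A --> set_integrable lebesgue X (%x. f (t, x))" using F(1) by eventually_elim (auto simp: set_integrable_def)
 show "set_integrable lebesgue A (%t. LINT x:X|lebesgue. f (t, x))" using F(2) by (simp add: set_integrable_def set_lebesgue_integral_def)
 show "(LINT t:A|lebesgue. LINT x:X|lebesgue. f (t, x)) = (LINT z:A \<times> X|lebesgue. f z)" using F(3) by (simp add: set_lebesgue_integral_def)
qed

text \<open>Tonelli: this is how the classes \<open>L^\<infinity>(0, T; L^p)\<close> give integrability in space-time.\<close>

lemma set_integrable_Times_if_slices_bounded:
 fixes f :: "real \<times> 'b::euclidean_space => real"
 assumes m: "set_borel_measurable lebesgue ({0<..<T} \<times> X) f"
  and ae: "AE t in lebesgue. t \<in> {0<..<T} --> set_integrable lebesgue X (\<lambda>x. f (t, x)) &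
    (LINT x:X|lebesgue. \<bar>f (t, x)\<bar>) <= C"
 shows "set_integrable lebesgue ({0<..<T} \<times> X) f"
proof -
 define F where "F = (%z. indicator ({0<..<T} \<times> X) z *\<^sub>R f z)"
 have Fm: "F \<in> borel_measurable lebesgue" using m by (simp add: F_def set_borel_measurable_def)
 obtain g where g: "g \<in> borel_measurable (lborel \<Otimes>\<^sub>M lborel)" "AE z in lebesgue. F z = g z"
  and sl: "AE t in lebesgue. AE x in lebesgue. F (t, x) = g (t, x)" using lebesgue_borel_version[OF Fm] by blast
 have g': "g \<in> borel_measurable lborel" using g(1) by (simp add: lborel_prod)
 hence gl: "g \<in> borel_measurable lebesgue" by (rule measurable_completion)
 have slb: "(\<integral>\<^sup>+x. ennreal (norm (g (t, x))) \<partial>lborel) <= ennreal \<bar>C\<bar> * indicator {0<..<T} t"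
  if a: "AE x in lebesgue. F (t, x) = g (t, x)"
   and b: "t \<in> {0<..<T} --> set_integrable lebesgue X (%x. f (t, x)) & (LINT x:X|lebesgue. \<bar>f (t, x)\<bar>) <= C" for t
 proof -
  have gs: "(%x. g (t, x)) \<in> borel_measurable lborel" using g(1) by measurable
  have "(\<integral>\<^sup>+x. ennreal (norm (g (t, x))) \<partial>lborel) = (\<integral>\<^sup>+x. ennreal (norm (g (t, x))) \<partial>lebesgue)"
   using gs by (subst nn_integral_completion) auto
  also have "... = (\<integral>\<^sup>+x. ennreal (norm (F (t, x))) \<partial>lebesgue)"
   by (rule nn_integral_cong_AE) (use a in \<open>eventually_elim, simp\<close>)
  also have "... <= ennreal \<bar>C\<bar> * indicator {0<..<T} t"
  proof (cases "t \<in> {0<..<T}")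
   case True
   hence i: "integrable lebesgue (%x. indicator X x *\<^sub>R f (t, x))" and le: "(LINT x:X|lebesgue. \<bar>f (t, x)\<bar>) <= C"
    using b by (auto simp: set_integrable_def)
   have "(\<integral>\<^sup>+x. ennreal (norm (F (t, x))) \<partial>lebesgue) = (\<integral>\<^sup>+x. ennreal (norm (indicator X x *\<^sub>R f (t, x))) \<partial>lebesgue)"
    using True by (intro nn_integral_cong) (simp add: F_def indicator_def)
   also have "... = ennreal (LINT x|lebesgue. norm (indicator X x *\<^sub>R f (t, x)))" using i by (intro nn_integral_eq_integral) auto
   also have "(LINT x|lebesgue. norm (indicator X x *\<^sub>R f (t, x))) = (LINT x:X|lebesgue. \<bar>f (t, x)\<bar>)" by (simp add: set_lebesgue_integral_def abs_mult)
   finally show ?thesis using True le by (simp add: ennreal_leI)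
  next
   case False
   hence "F (t, x) = 0" for x by (auto simp: F_def indicator_def)
   thus ?thesis by simp
  qed
  finally show ?thesis .
 qed
 have "AE t in lebesgue. (\<integral>\<^sup>+x. ennreal (norm (g (t, x))) \<partial>lborel) <= ennreal \<bar>C\<bar> * indicator {0<..<T} t"
  using sl ae by eventually_elim (use slb in blast)
 hence "AE t in lborel. (\<integral>\<^sup>+x. ennreal (norm (g (t, x))) \<partial>lborel) <= ennreal \<bar>C\<bar> * indicator {0<..<T} t"
  by (simp add: AE_completion_iff)
 hence "(\<integral>\<^sup>+t. \<integral>\<^sup>+x. ennreal (norm (g (t, x))) \<partial>lborel \<partial>lborel) <= (\<integral>\<^sup>+t. ennreal \<bar>C\<bar> * indicator {0<..<T} t \<partial>lborel)"
  by (rule nn_integral_mono_AE)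
 also have "... < \<infinity>"
 proof -
  have "emeasure lborel {0<..<T} < top" using emeasure_bounded_finite[of "{0<..<T}"] by auto
  thus ?thesis by (simp add: nn_integral_cmult_indicator ennreal_mult_less_top)
 qed
 also have "(\<integral>\<^sup>+t. \<integral>\<^sup>+x. ennreal (norm (g (t, x))) \<partial>lborel \<partial>lborel) = (\<integral>\<^sup>+z. ennreal (norm (g z)) \<partial>(lborel \<Otimes>\<^sub>M lborel))"
  by (rule lborel.nn_integral_fst) (use g(1) in measurable)
 finally have "integrable lborel g" using g' by (intro integrableI_bounded) (auto simp: lborel_prod)
 hence "integrable lebesgue g" using g' by (simp add: integrable_completion)
 hence "integrable lebesgue F" using integrable_cong_AE_imp[of lebesgue g F] Fm g(2) by (simp add: eq_commute)
 thus ?thesis by (simp add: set_integrable_def F_def)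
qed

section \<open>The relative pressure potential\<close>

lemma powr_slope_bound:
 fixes \<alpha> :: real
 assumes "\<alpha> > 0"
 shows "\<exists>c>0. (\<forall>x. 0 < x & x <= 1 --> 1 - x powr \<alpha> >= c * (1 - x)) &
   (\<forall>x. 1 <= x & x <= 2 --> x powr \<alpha> - 1 >= c * (x - 1)) & (\<forall>x\<ge>2. x powr \<alpha> - 1 >= c)"
proof -
 define c where "c = min 1 (\<alpha> / 2)"
 have c: "c > 0" "c <= 1" "c <= \<alpha> / 2" using assms by (auto simp: c_def)
 have bern: "x powr \<alpha> <= 1 + \<alpha> * (x - 1)" if "0 < x" "\<alpha> <= 1" for x
  using Youngs_inequality_0[of \<alpha> "1 - \<alpha>" x 1] that assms by (simp add: algebra_simps)
 have low: "1 - x powr \<alpha> >= c * (1 - x)" if x: "0 < x" "x <= 1" for x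
 proof (cases "\<alpha> <= 1")
  case True
  have "c * (1 - x) <= \<alpha> * (1 - x)" using c assms x by (intro mult_right_mono) auto
  thus ?thesis using bern[OF x(1) True] by (simp add: algebra_simps)
 next
  case False
  have "x powr \<alpha> <= x powr 1" using x False by (intro powr_mono') auto
  moreover have "c * (1 - x) <= 1 * (1 - x)" using c x by (intro mult_right_mono) auto
  ultimately show ?thesis using x by simp
 qed
 have high: "x powr \<alpha> - 1 >= c * (x - 1)" if x: "1 <= x" "x <= 2" for x
 proof (cases "\<alpha> <= 1")
  case True
  have "(1 / x) powr \<alpha> <= 1 + \<alpha> * (1 / x - 1)" using bern[of "1 / x"] x True by simp
  hence "x powr \<alpha> * (1 / x) powr \<alpha> <= x powr \<alpha> * (1 + \<alpha> * (1 / x - 1))" by (intro mult_left_mono) auto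
  moreover have "x powr \<alpha> * (1 / x) powr \<alpha> = 1" using x by (simp add: powr_mult[symmetric])
  ultimately have "1 + x powr \<alpha> * (\<alpha> * ((x - 1) / x)) <= x powr \<alpha>" using x by (simp add: field_simps)
  moreover have "1 * (\<alpha> * ((x - 1) / x)) <= x powr \<alpha> * (\<alpha> * ((x - 1) / x))"
   using x assms by (intro mult_right_mono) (auto simp: ge_one_powr_ge_zero)
  moreover have "c * (x - 1) <= \<alpha> * ((x - 1) / x)"
  proof -
   have "c * (x - 1) <= (\<alpha> / 2) * (x - 1)" using c x by (intro mult_right_mono) auto
   also have "... <= (\<alpha> / x) * (x - 1)" using x assms by (intro mult_right_mono divide_left_mono) auto
   finally show ?thesis by simp
  qed
  ultimately show ?thesis by linarith
 next
  case False
  have "x powr 1 <= x powr \<alpha>" using x False by (intro powr_mono) auto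
  moreover have "c * (x - 1) <= 1 * (x - 1)" using c x by (intro mult_right_mono) auto
  ultimately show ?thesis using x by simp
 qed
 have "x powr \<alpha> - 1 >= c" if "x >= 2" for x using high[of 2] powr_mono2[of \<alpha> 2 x] that assms by simp
 thus ?thesis using c low high by blast
qed

text \<open>The function and its first derivative vanish at 1, and by the slope bound the derivative grows at least linearly
 up to 2 and stays bounded below afterwards.\<close>

lemma powr_bregman_lower_bound:
 fixes \<gamma> :: real
 assumes "\<gamma> > 1"
 shows "\<exists>c>0. \<forall>x\<ge>0. (x <= 2 --> c * (x - 1)^2 <= x powr \<gamma> - \<gamma> * x + (\<gamma> - 1)) &
   (2 <= x --> c * x <= x powr \<gamma> - \<gamma> * x + (\<gamma> - 1))"
proof -
 obtain c where c: "c > 0"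
  and c1: "!!x. 0 < x ==> x <= 1 ==> 1 - x powr (\<gamma> - 1) >= c * (1 - x)"
  and c2: "!!x. 1 <= x ==> x <= 2 ==> x powr (\<gamma> - 1) - 1 >= c * (x - 1)"
  and c3: "!!x. 2 <= x ==> x powr (\<gamma> - 1) - 1 >= c" using powr_slope_bound[of "\<gamma> - 1"] assms by auto
 define k where "k x = x powr \<gamma> - \<gamma> * x + (\<gamma> - 1)" for x
 have dk: "(k has_real_derivative \<gamma> * (x powr (\<gamma> - 1) - 1)) (at x)" if "x > 0" for x
  unfolding k_def using that by (auto intro!: derivative_eq_intros simp: algebra_simps)
 have ck: "continuous_on {a..b} k" if "0 <= a" for a b unfolding k_def using that assms by (auto intro!: continuous_intros continuous_on_powr')
 define g where "g x = k x - (c * \<gamma> / 2) * (x - 1)^2" for x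
 have dg: "(g has_real_derivative \<gamma> * (x powr (\<gamma> - 1) - 1) - c * \<gamma> * (x - 1)) (at x)" if "x > 0" for x
  unfolding g_def using that by (auto intro!: derivative_eq_intros dk simp: field_simps)
 have cg: "continuous_on {a..b} g" if "0 <= a" for a b unfolding g_def using that by (intro continuous_intros ck)
 have g1: "g 1 = 0" by (simp add: g_def k_def)
 have g0: "g x >= 0" if x: "0 <= x" "x <= 2" for x
 proof (cases "x <= 1")
  case True
  have "g x >= g 1"
  proof (rule DERIV_nonpos_imp_decreasing_open[of x 1 g, OF True])
   fix y assume y: "x < y" "y < 1"
   have "\<gamma> * (y powr (\<gamma> - 1) - 1) - c * \<gamma> * (y - 1) = - (\<gamma> * ((1 - y powr (\<gamma> - 1)) - c * (1 - y)))" by (simp add: algebra_simps)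
   also have "... <= 0" using c1[of y] y x assms by simp
   finally show "\<exists>z. (g has_real_derivative z) (at y) & z <= 0" using dg[of y] y x by fastforce
  qed (rule cg[OF x(1)])
  thus ?thesis using g1 by simp
 next
  case False
  have "g 1 <= g x"
  proof (rule DERIV_nonneg_imp_increasing_open[of 1 x g])
   fix y assume y: "1 < y" "y < x"
   have "\<gamma> * (y powr (\<gamma> - 1) - 1) - c * \<gamma> * (y - 1) = \<gamma> * ((y powr (\<gamma> - 1) - 1) - c * (y - 1))" by (simp add: algebra_simps)
   also have "... >= 0" using c2[of y] y x assms by simp
   finally show "\<exists>z. (g has_real_derivative z) (at y) & 0 <= z" using dg[of y] y by fastforce
  qed (use False cg in auto)
  thus ?thesis using g1 by simp
 qed
 have large: "k x >= c * \<gamma> / 4 * x" if x: "2 <= x" for x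
 proof -
  have "k 2 - c * \<gamma> * 2 <= k x - c * \<gamma> * x"
  proof (rule DERIV_nonneg_imp_increasing_open[of 2 x "%x. k x - c * \<gamma> * x", OF x])
   fix y assume y: "2 < y" "y < x"
   have "((%x. k x - c * \<gamma> * x) has_real_derivative \<gamma> * (y powr (\<gamma> - 1) - 1) - c * \<gamma>) (at y)"
    using y by (auto intro!: derivative_eq_intros dk)
   moreover have "\<gamma> * (y powr (\<gamma> - 1) - 1) - c * \<gamma> = \<gamma> * ((y powr (\<gamma> - 1) - 1) - c)" by (simp add: algebra_simps)
   moreover have "... >= 0" using c3[of y] y assms by simp
   ultimately show "\<exists>z. ((%x. k x - c * \<gamma> * x) has_real_derivative z) (at y) & 0 <= z" by metis
  qed (intro continuous_intros ck, simp)
  moreover have "k 2 >= c * \<gamma> / 2" using g0[of 2] by (simp add: g_def)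
  moreover have "c * \<gamma> * x >= c * \<gamma> * 2" using x c assms by simp
  moreover have "c * \<gamma> / 4 * x = (c * \<gamma> * x) / 4" by simp
  ultimately show ?thesis by linarith
 qed
 show ?thesis
 proof (intro exI[of _ "c * \<gamma> / 4"] conjI allI impI)
  show "c * \<gamma> / 4 > 0" using c assms by simp
  fix x :: real assume x: "0 <= x"
  { assume "x <= 2"
   hence "c * \<gamma> / 2 * (x - 1)^2 <= k x" using g0[of x] x by (simp add: g_def)
   moreover have "c * \<gamma> / 4 * (x - 1)^2 <= c * \<gamma> / 2 * (x - 1)^2" using c assms by (intro mult_right_mono) auto
   ultimately show "c * \<gamma> / 4 * (x - 1)^2 <= x powr \<gamma> - \<gamma> * x + (\<gamma> - 1)" unfolding k_def by linarith }
  { assume "2 <= x" thus "c * \<gamma> / 4 * x <= x powr \<gamma> - \<gamma> * x + (\<gamma> - 1)" using large by (simp add: k_def) }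
 qed
qed

text \<open>The Bregman distance of \<open>s^\<gamma> / (\<gamma> - 1)\<close> at \<open>r\<close>.\<close>

definition rel_potential :: "real => real => real => real" where
 "rel_potential \<gamma> s r = (s powr \<gamma> - \<gamma> * r powr (\<gamma> - 1) * s + (\<gamma> - 1) * r powr \<gamma>) / (\<gamma> - 1)"

text \<open>Homogeneity reduces the potential to the function of the single variable \<open>s / r\<close>.\<close>

lemma rel_potential_scaling:
 assumes "r > 0" "s >= 0" "\<gamma> ~= 1"
 shows "(\<gamma> - 1) * rel_potential \<gamma> s r
  = r powr \<gamma> * ((s / r) powr \<gamma> - \<gamma> * (s / r) + (\<gamma> - 1))"
proof -
 have "r powr \<gamma> * (s / r) powr \<gamma> = s powr \<gamma>" using assms by (simp add: powr_divide)
 moreover have "r powr \<gamma> * (\<gamma> * (s / r)) = \<gamma> * r powr (\<gamma> - 1) * s" using assms by (simp add: powr_diff)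
 moreover have "(\<gamma> - 1) * rel_potential \<gamma> s r = s powr \<gamma> - \<gamma> * r powr (\<gamma> - 1) * s + (\<gamma> - 1) * r powr \<gamma>"
  using assms(3) by (simp add: rel_potential_def)
 moreover have "r powr \<gamma> * ((s / r) powr \<gamma> - \<gamma> * (s / r) + (\<gamma> - 1))
   = r powr \<gamma> * (s / r) powr \<gamma> - r powr \<gamma> * (\<gamma> * (s / r)) + (\<gamma> - 1) * r powr \<gamma>" by (simp add: algebra_simps)
 ultimately show ?thesis by simp
qed

lemma rel_potential_controls:
 assumes "\<gamma> > 1" "0 < c1"
 shows "\<exists>c>0. \<forall>s\<ge>0. \<forall>r\<ge>c1. (s <= 2 * r --> c * (s / r - 1)^2 <= rel_potential \<gamma> s r) &
   (2 * r <= s --> c * (s / r) <= rel_potential \<gamma> s r)"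
proof -
 obtain c where c: "c > 0" and lo: "!!x. 0 <= x ==> x <= 2 ==> c * (x - 1)^2 <= x powr \<gamma> - \<gamma> * x + (\<gamma> - 1)"
  and hi: "!!x. 2 <= x ==> c * x <= x powr \<gamma> - \<gamma> * x + (\<gamma> - 1)"
  proof -
  from powr_bregman_lower_bound[OF assms(1)] obtain c where "c > 0"
   and c: "!!x. x >= 0 ==> (x <= 2 --> c * (x - 1)^2 <= x powr \<gamma> - \<gamma> * x + (\<gamma> - 1)) &
   (2 <= x --> c * x <= x powr \<gamma> - \<gamma> * x + (\<gamma> - 1))" by blast
  show ?thesis by (rule that[of c]) (use c \<open>c > 0\<close> in auto)
 qed
 define d where "d = c1 powr \<gamma> * c / (\<gamma> - 1)"
 have d: "d > 0" using assms c by (simp add: d_def)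
 have key: "d * q <= rel_potential \<gamma> s r"
  if "0 <= q" "c * q <= (s / r) powr \<gamma> - \<gamma> * (s / r) + (\<gamma> - 1)" "s >= 0" "r >= c1" for q s r
 proof -
  have "c1 powr \<gamma> * (c * q) <= r powr \<gamma> * ((s / r) powr \<gamma> - \<gamma> * (s / r) + (\<gamma> - 1))"
   using that assms c by (intro mult_mono powr_mono2) auto
  also have "... = (\<gamma> - 1) * rel_potential \<gamma> s r" using rel_potential_scaling[of r s \<gamma>] that assms by simp
  finally show ?thesis using assms by (simp add: d_def field_simps)
 qed
 show ?thesis
 proof (intro exI[of _ d] conjI d allI impI)
  fix s r :: real assume sr: "0 <= s" "c1 <= r"
  { assume "s <= 2 * r" thus "d * (s / r - 1)^2 <= rel_potential \<gamma> s r" using sr assms by (intro key lo) (auto simp: field_simps) }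
  { assume "2 * r <= s" thus "d * (s / r) <= rel_potential \<gamma> s r" using sr assms by (intro key hi) (auto simp: field_simps) }
 qed
qed

lemma rel_potential_nonneg:
 assumes "\<gamma> > 1" "r > 0" "s >= 0"
 shows "rel_potential \<gamma> s r >= 0"
  and "rel_potential \<gamma> s r = 0 ==> s = r"
proof -
 obtain c where c: "c > 0" "s <= 2 * r --> c * (s / r - 1)^2 <= rel_potential \<gamma> s r"
   "2 * r <= s --> c * (s / r) <= rel_potential \<gamma> s r" using rel_potential_controls[OF assms(1,2)] assms by blast
 show "rel_potential \<gamma> s r >= 0"
 proof (cases "s <= 2 * r")
  case True
  have "0 <= c * (s / r - 1)^2" using c by simp
  thus ?thesis using c True by linarith
 next
  case False
  have "0 <= c * (s / r)" using c assms by simp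
  thus ?thesis using c False by linarith
 qed
 show "s = r" if z: "rel_potential \<gamma> s r = 0"
 proof (cases "s <= 2 * r")
  case True
  hence "c * (s / r - 1)^2 <= 0" using c z by simp
  hence "(s / r - 1)^2 <= 0" using c by (simp add: mult_le_0_iff)
  thus ?thesis using assms by simp
 next
  case False
  hence "c * (s / r) <= 0" "s > 0" using c z assms by auto
  moreover have "c * (s / r) > 0" using c assms \<open>s > 0\<close> by simp
  ultimately show ?thesis by simp
 qed
qed

text \<open>For \<open>s \<le> 2 r\<close> Young's inequality and the quadratic lower bound apply. For \<open>s > 2
 r\<close> the bound \<open>|s / r - 1| w \<le> (s / r) (1 + w^2)\<close> suffices: the potential grows at least
 like \<open>s / r\<close>, and \<open>s w^2\<close> is part of the right-hand side.\<close>

lemma relative_velocity_term_bound: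
 assumes "\<gamma> > 1" "0 < c1" "\<delta> > 0" "K >= 0"
 shows "\<exists>C\<ge>0. \<forall>s\<ge>0. \<forall>r\<ge>c1. \<forall>w\<ge>0.
   \<bar>s / r - 1\<bar> * K * w <= C * (rel_potential \<gamma> s r + s * w^2) + \<delta> * w^2"
proof -
 obtain c where c: "c > 0"
  and lo: "!!s r. s >= 0 ==> r >= c1 ==> s <= 2 * r ==> c * (s / r - 1)^2 <= rel_potential \<gamma> s r"
  and hi: "!!s r. s >= 0 ==> r >= c1 ==> 2 * r <= s ==> c * (s / r) <= rel_potential \<gamma> s r"
  using rel_potential_controls[OF assms(1,2)] by blast
 define C where "C = K^2 / (4 * \<delta> * c) + K / c + K / c1"
 have C: "C >= 0" "K^2 / (4 * \<delta> * c) <= C" "K / c <= C" "K / c1 <= C" using assms c by (simp_all add: C_def)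
 have "\<bar>s / r - 1\<bar> * K * w <= C * (rel_potential \<gamma> s r + s * w^2) + \<delta> * w^2"
  if h: "s >= 0" "r >= c1" "w >= 0" for s r w
 proof -
  let ?H = "rel_potential \<gamma> s r"
  have H0: "?H >= 0" using rel_potential_nonneg(1)[of \<gamma> r s] h assms by simp
  have sw: "s * w^2 >= 0" using h by simp
  show ?thesis
  proof (cases "s <= 2 * r")
   case True
   let ?x = "\<bar>s / r - 1\<bar>"
   have "0 <= (?x * K / (2 * sqrt \<delta>) - sqrt \<delta> * w)^2" by simp
   also have "... = ?x^2 * K^2 / (4 * \<delta>) - ?x * K * w + \<delta> * w^2"
    using assms by (simp add: power2_diff power_mult_distrib power_divide)
   finally have "?x * K * w <= K^2 / (4 * \<delta> * c) * (c * ?x^2) + \<delta> * w^2" using c by (simp add: field_simps)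
   also have "K^2 / (4 * \<delta> * c) * (c * ?x^2) <= C * ?H" using lo[OF h(1,2) True] C c by (intro mult_mono) auto
   finally have "?x * K * w <= C * ?H + \<delta> * w^2" by simp
   moreover have "C * (s * w^2) >= 0" using C(1) sw by simp
   moreover have "C * (?H + s * w^2) = C * ?H + C * (s * w^2)" by (rule distrib_left)
   ultimately show ?thesis by linarith
  next
   case False
   have r: "r > 0" using h assms by simp
   have x: "\<bar>s / r - 1\<bar> <= s / r" using False r by (simp add: field_simps)
   have w1: "w <= 1 + w^2" using sum_squares_bound[of w 1] zero_le_power2[of w] by (simp, linarith)
   have "\<bar>s / r - 1\<bar> * K * w <= s / r * K * (1 + w^2)" using x w1 assms h r by (intro mult_mono) auto
   also have "... = K / c * (c * (s / r)) + K / r * (s * w^2)" using c r by (simp add: field_simps)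
   also have "... <= C * ?H + C * (s * w^2)"
   proof (intro add_mono mult_mono)
    show "c * (s / r) <= ?H" using hi[OF h(1,2)] False by simp
    have "K / r <= K / c1" using assms h by (intro divide_left_mono) auto
    thus "K / r <= C" using C by simp
   qed (use C c h r sw in auto)
   finally have "\<bar>s / r - 1\<bar> * K * w <= C * ?H + C * (s * w^2)" .
   moreover have "\<delta> * w^2 >= 0" using assms by simp
   moreover have "C * (?H + s * w^2) = C * ?H + C * (s * w^2)" by (rule distrib_left)
   ultimately show ?thesis by linarith
  qed
 qed
 thus ?thesis using C(1) by blast
qed

section \<open>Gronwall's lemma\<close>

text \<open>Integrating once removes the exceptional null set: the running integral \<open>y\<close> of \<open>E\<close>
 satisfies \<open>y \<le> C Y\<close> at all times, where \<open>Y\<close> is its primitive, so that \<open>exp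
 (- C t) Y\<close> is nonincreasing.\<close>

lemma integral_Gronwall_zero:
 fixes E :: "real => real"
 assumes C: "C >= 0" and T: "T > 0"
  and int: "set_integrable lebesgue {0<..<T} E"
  and nonneg: "AE t in lebesgue. t \<in> {0<..<T} --> E t >= 0"
  and ineq: "AE t in lebesgue. t \<in> {0<..<T} --> E t <= C * (LINT s:{0<..<t}|lebesgue. E s)"
 shows "(LINT t:{0<..<T}|lebesgue. E t) = 0"
proof -
 have intE: "E absolutely_integrable_on {0<..<t}" if "t <= T" for t by (rule set_integrable_subset[OF int]) (use that in auto)
 define y where "y t = integral {0..t} E" for t
 have yL: "(LINT s:{0<..<t}|lebesgue. E s) = y t" if "t <= T" for t using set_lebesgue_integral_eq_integral(2)[OF intE[OF that]] integral_open_interval[of 0 t E]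
  by (simp add: y_def)
 have Ei: "E integrable_on {0..T}" using set_lebesgue_integral_eq_integral(1)[OF int] integrable_on_open_interval[of E 0 T] by simp
 have conty: "continuous_on {0..T} y" unfolding y_def by (rule indefinite_integral_continuous_1[OF Ei])
 define Y where "Y t = integral {0..t} y" for t
 have yi: "y integrable_on {0..t}" if "t <= T" for t using conty that by (intro integrable_continuous_interval continuous_on_subset[OF conty]) auto
 have dY: "(Y has_real_derivative y t) (at t)" if "0 < t" "t < T" for t
 proof -
  have "(Y has_real_derivative y t) (at t within {0..T})" unfolding Y_def using integral_has_real_derivative[OF conty] that by simp
  moreover have "at t within {0..T} = at t" using that by (intro at_within_interior) simp
  ultimately show ?thesis by simp
 qed
 have contY: "continuous_on {0..T} Y" unfolding Y_def by (rule indefinite_integral_continuous_1) (use yi in simp)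
 have y_nonneg: "y t >= 0" if "t <= T" for t
 proof -
  have "(LINT s:{0<..<t}|lebesgue. E s) >= 0" unfolding set_lebesgue_integral_def
   by (rule integral_nonneg_AE) (use nonneg in eventually_elim, use that in \<open>auto simp: indicator_def\<close>)
  thus ?thesis using yL[OF that] by simp
 qed
 have yY: "y t <= C * Y t" if t: "t <= T" for t
 proof -
  have yabs: "set_integrable lebesgue {0<..<t} y"
  proof (rule set_integrable_subset[of _ "{0..t}"])
   show "set_integrable lebesgue {0..t} y" by (rule absolutely_integrable_continuous_real) (use conty t continuous_on_subset in fastforce)
  qed auto
  have "(LINT s:{0<..<t}|lebesgue. E s) <= (LINT s:{0<..<t}|lebesgue. C * y s)" unfolding set_lebesgue_integral_def
  proof (rule integral_mono_AE)
   show "AE s in lebesgue. indicat_real {0<..<t} s *\<^sub>R E s <= indicat_real {0<..<t} s *\<^sub>R (C * y s)"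
    using ineq by eventually_elim (use t yL in \<open>auto simp: indicator_def\<close>)
  qed (use intE[OF t] set_integrable_mult_right[OF yabs, of C] in \<open>auto simp: set_integrable_def\<close>)
  also have "... = C * (LINT s:{0<..<t}|lebesgue. y s)" by simp
  also have "(LINT s:{0<..<t}|lebesgue. y s) = Y t" using set_lebesgue_integral_eq_integral(2)[OF yabs] integral_open_interval[of 0 t y] by (simp add: Y_def)
  finally show ?thesis using yL[OF t] by simp
 qed
 define Z where "Z t = exp (- C * t) * Y t" for t
 have "Z T <= Z 0"
 proof (rule DERIV_nonpos_imp_decreasing_open[of 0 T Z])
  fix t assume t: "0 < t" "t < T"
  have "(Z has_real_derivative exp (- C * t) * (y t - C * Y t)) (at t)" unfolding Z_def by (auto intro!: derivative_eq_intros dY t simp: algebra_simps)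
  moreover have "exp (- C * t) * (y t - C * Y t) <= 0" using yY[of t] t by (simp add: mult_le_0_iff)
  ultimately show "\<exists>z. (Z has_real_derivative z) (at t) & z <= 0" by blast
 qed (use T in \<open>auto simp: Z_def intro!: continuous_intros contY\<close>)
 hence "Y T <= 0" by (simp add: Z_def Y_def mult_le_0_iff)
 hence "C * Y T <= 0" using C by (simp add: mult_nonneg_nonpos)
 hence "y T = 0" using yY[of T] y_nonneg[of T] by simp
 thus ?thesis using yL[of T] by simp
qed

section \<open>Lines crossing boundary arcs\<close>

lemma arc_velocity:
 assumes "boundary_arcs Om gs" "g \<in> set gs"
 obtains d where "continuous_on {0..1} d"
  "!!t. t \<in> {0<..<1} ==> (g has_vector_derivative d t) (at t)"
  "!!t. t \<in> {0<..<1} ==> d t ~= 0"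
  "!!t. t \<in> {0<..<1} ==> vector_derivative g (at t within {0..1}) = d t"
proof -
 have C2: "Ck_closure 2 {0<..<1} g" and nz: "!!t. t \<in> {0..1} ==> vector_derivative g (at t within {0..1}) ~= 0"
  using assms unfolding boundary_arcs_def by auto
 from C2 obtain G where G: "\<forall>x\<in>{0<..<1}. (g has_derivative (%h. \<Sum>i\<in>Basis. (h \<bullet> i) *\<^sub>R G i x)) (at x)"
  and Gc: "\<forall>i\<in>Basis. Ck_closure 1 {0<..<1} (G i)" by (auto simp: numeral_2_eq_2)
 have d: "(g has_vector_derivative G 1 t) (at t)" if "t \<in> {0<..<1}" for t using bspec[OF G that] by (simp add: has_vector_derivative_def)
 have vd: "vector_derivative g (at t within {0..1}) = G 1 t" if t: "t \<in> {0<..<1}" for t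
 proof -
  have "at t within {0..1} = at t" using t by (intro at_within_interior) simp
  thus ?thesis using vector_derivative_at[OF d[OF t]] by simp
 qed
 show ?thesis
 proof (rule that[of "G 1"])
  show "continuous_on {0..1} (G 1)" using Gc by (simp add: closure_greaterThanLessThan)
  show "G 1 t ~= 0" if "t \<in> {0<..<1}" for t using vd[OF that] nz[of t] that by auto
 qed (use d vd in auto)
qed

definition perp :: "2 => 2" where "perp i = (if i = 1 then 2 else 1)"

lemma perp_neq [simp]: "perp i ~= i" "i ~= perp i" using exhaust_2[of i] by (auto simp: perp_def)

lemma plane_eqI: "(a::plane) $ i = b $ i ==> a $ perp i = b $ perp i ==> a = b"
 using exhaust_2[of i] by (auto simp: vec_eq_iff forall_2 perp_def)

definition rot :: "plane => plane" where "rot v = vector [v $ 2, - (v $ 1)]"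

lemma rot_simps [simp]: "rot v $ 1 = v $ 2" "rot v $ 2 = - v $ 1" by (simp_all add: rot_def)

lemma norm_rot [simp]: "norm (rot v) = norm v" by (simp add: norm_eq_sqrt_inner inner_vec_def sum_2 add.commute)

lemma rot_eq: "rot v = (v $ 2) *\<^sub>R axis 1 1 - (v $ 1) *\<^sub>R axis 2 1" by (simp add: vec_eq_iff forall_2 axis_def)

lemma continuous_on_rot [continuous_intros]: "continuous_on S f ==> continuous_on S (\<lambda>x. rot (f x))" unfolding rot_eq by (intro continuous_intros)

lemma unit_normal_cases:
 fixes \<nu> d :: plane
 assumes "norm \<nu> = 1" "\<nu> \<bullet> d = 0" "d ~= 0"
 shows "\<nu> = (1 / norm d) *\<^sub>R rot d \<or> \<nu> = - ((1 / norm d) *\<^sub>R rot d)"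
proof -
 define c where "c = \<nu> \<bullet> rot d"
 have eq: "(norm d)^2 *\<^sub>R \<nu> = c *\<^sub>R rot d"
 proof -
  have o: "\<nu> $ 1 * d $ 1 = - (\<nu> $ 2 * d $ 2)" using assms(2) by (simp add: inner_vec_def sum_2)
  have n: "(norm d)^2 = d $ 1 * d $ 1 + d $ 2 * d $ 2" by (simp add: power2_norm_eq_inner inner_vec_def sum_2)
  have "(norm d)^2 * \<nu> $ 1 = c * d $ 2"
  proof -
   have "(norm d)^2 * \<nu> $ 1 = d $ 1 * (\<nu> $ 1 * d $ 1) + d $ 2 * d $ 2 * \<nu> $ 1" by (simp add: n algebra_simps)
   also have "... = c * d $ 2" unfolding o by (simp add: c_def inner_vec_def sum_2 algebra_simps)
   finally show ?thesis .
  qed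
  moreover have "(norm d)^2 * \<nu> $ 2 = - c * d $ 1"
  proof -
   have "(norm d)^2 * \<nu> $ 2 = d $ 1 * d $ 1 * \<nu> $ 2 + d $ 2 * (\<nu> $ 2 * d $ 2)" by (simp add: n algebra_simps)
   also have "\<nu> $ 2 * d $ 2 = - (\<nu> $ 1 * d $ 1)" using o by simp
   finally show ?thesis by (simp add: c_def inner_vec_def sum_2 algebra_simps)
  qed
  ultimately show ?thesis by (simp add: vec_eq_iff forall_2)
 qed
 have "norm ((norm d)^2 *\<^sub>R \<nu>) = norm (c *\<^sub>R rot d)" using eq by simp
 hence "\<bar>c\<bar> = norm d" using assms by (simp add: power2_eq_square)
 hence "c = norm d \<or> c = - norm d" by linarith
 moreover have "\<nu> = (c / (norm d)^2) *\<^sub>R rot d"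
 proof -
  have "\<nu> = (1 / (norm d)^2) *\<^sub>R ((norm d)^2 *\<^sub>R \<nu>)" using assms(3) by simp
  thus ?thesis unfolding eq by simp
 qed
 ultimately show ?thesis using assms(3) by (auto simp: power2_eq_square)
qed

lemma abs_normal_component:
 fixes \<nu> d :: plane
 assumes "norm \<nu> = 1" "\<nu> \<bullet> d = 0" "d ~= 0"
 shows "\<bar>\<nu> $ i\<bar> * norm d = \<bar>d $ perp i\<bar>"
proof -
 have "\<bar>\<nu> $ i\<bar> = \<bar>d $ perp i\<bar> / norm d" using unit_normal_cases[OF assms] exhaust_2[of i] by (auto simp: perp_def)
 thus ?thesis using assms(3) by simp
qed

lemma normal_on_boundary_arc:
 assumes lip: "lipschitz_boundary Om" and op: "open Om" and arcs: "boundary_arcs Om gs" "g \<in> set gs"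
  and t: "t \<in> {0<..<1}" and d: "(g has_vector_derivative d) (at t)" "d ~= 0"
 shows "is_outer_normal Om (g t) (outer_normal Om (g t))" "outer_normal Om (g t) \<bullet> d = 0"
  "norm (outer_normal Om (g t)) = 1"
proof -
 have "path g" "path_image g <= frontier Om" using arcs unfolding boundary_arcs_def by (auto simp: arc_imp_path)
 then obtain \<nu> where \<nu>: "is_outer_normal Om (g t) \<nu>" "\<nu> \<bullet> d = 0" using outer_normal_exists_on_arc[OF lip op _ _ _ _ d] t by auto
 have e: "outer_normal Om (g t) = \<nu>" by (rule outer_normal_eq[OF \<nu>(1)])
 show "is_outer_normal Om (g t) (outer_normal Om (g t))" "outer_normal Om (g t) \<bullet> d = 0"
  "norm (outer_normal Om (g t)) = 1" unfolding e using \<nu> by (auto simp: is_outer_normal_def)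
qed

lemma outer_normal_sides:
 assumes "is_outer_normal Om x \<nu>" "v \<bullet> \<nu> > 0"
 shows "\<exists>\<delta>>0. \<forall>h. 0 < h & h < \<delta> --> x - h *\<^sub>R v \<in> Om & x + h *\<^sub>R v ~: Om"
proof -
 define \<epsilon> where "\<epsilon> = (v \<bullet> \<nu>) / (2 * norm v)"
 have v: "v ~= 0" using assms(2) by auto
 have e: "\<epsilon> > 0" "\<epsilon> * norm v < v \<bullet> \<nu>" using assms(2) v by (auto simp: \<epsilon>_def)
 obtain \<delta> where \<delta>: "\<delta> > 0" "!!y. norm (y - x) < \<delta> ==>
    ((y - x) \<bullet> \<nu> < - \<epsilon> * norm (y - x) --> y \<in> Om) & ((y - x) \<bullet> \<nu> > \<epsilon> * norm (y - x) --> y ~: Om)"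
  using assms(1) e(1) unfolding is_outer_normal_def by blast
 show ?thesis
 proof (intro exI[of _ "\<delta> / norm v"] conjI allI impI)
  show "\<delta> / norm v > 0" using \<delta>(1) v by simp
  fix h assume h: "0 < h & h < \<delta> / norm v"
  hence hn: "h * norm v < \<delta>" using v by (simp add: pos_less_divide_eq)
  have he: "h * (\<epsilon> * norm v) < h * (v \<bullet> \<nu>)" using e(2) h by simp
  show "x - h *\<^sub>R v \<in> Om" using \<delta>(2)[of "x - h *\<^sub>R v"] h hn he by (simp add: mult.left_commute)
  show "x + h *\<^sub>R v ~: Om" using \<delta>(2)[of "x + h *\<^sub>R v"] h hn he by (simp add: mult.left_commute)
 qed
qed

text \<open>Along an arc the normal is plus or minus the rotated velocity. Which of the two occurs is decided by membership
 in the open domain of points moved a short way along it, a measurable condition.\<close>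

lemma measurable_outer_normal_on_arc:
 assumes lip: "lipschitz_boundary Om" and op: "open Om" and arcs: "boundary_arcs Om gs" "g \<in> set gs"
 shows "(\<lambda>t. indicator {0<..<1} t *\<^sub>R outer_normal Om (g t)) \<in> borel_measurable borel"
proof -
 obtain d where d: "continuous_on {0..1} d" "!!t. t \<in> {0<..<1} ==> (g has_vector_derivative d t) (at t)"
  "!!t. t \<in> {0<..<1} ==> d t ~= 0"
  "!!t. t \<in> {0<..<1} ==> vector_derivative g (at t within {0..1}) = d t" by (rule arc_velocity[OF arcs]) (rule that)
 have contg: "continuous_on {0..1} g" using arcs unfolding boundary_arcs_def arc_def path_def by blast
 define \<tau> where "\<tau> t = (1 / norm (d t)) *\<^sub>R rot (d t)" for t
 have cont\<tau>: "continuous_on {0<..<1} \<tau>" unfolding \<tau>_def by (intro continuous_intros continuous_on_subset[OF d(1)]) (use d(3) in auto)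
 have contg': "continuous_on {0<..<1} g" by (rule continuous_on_subset[OF contg]) auto
 have n\<tau>: "\<tau> t \<bullet> \<tau> t = 1" if "t \<in> {0<..<1}" for t using d(3)[OF that] by (simp add: \<tau>_def dot_square_norm power2_eq_square)
 define A where "A = {t \<in> {0<..<1}. \<exists>N. \<forall>n\<ge>N. g t - (1 / real (Suc n)) *\<^sub>R \<tau> t \<in> Om}"
 define D where "D n = {0<..<1} \<inter> (%t. g t - (1 / real (Suc n)) *\<^sub>R \<tau> t) -` Om" for n
 have "open (D n)" for n unfolding D_def by (rule continuous_open_preimage[OF _ _ op]) (auto intro!: continuous_intros contg' cont\<tau>)
 hence [measurable]: "D n \<in> sets borel" for n by simp
 have "A = {t \<in> space borel. t \<in> {0<..<1} & (\<exists>N. \<forall>n. N <= n --> t \<in> D n)}" by (auto simp: A_def D_def)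
 also have "... \<in> sets borel" by measurable
 finally have A: "A \<in> sets borel" .
 have small: "\<exists>N. \<forall>n\<ge>N. 1 / real (Suc n) < \<delta>" if \<delta>: "\<delta> > 0" for \<delta>
 proof -
  obtain N where N: "1 / real (Suc N) < \<delta>" using nat_approx_posE[OF \<delta>] by blast
  have "1 / real (Suc n) <= 1 / real (Suc N)" if "n >= N" for n using that by (simp add: frac_le)
  thus ?thesis using N by (intro exI[of _ N]) fastforce
 qed
 have val: "outer_normal Om (g t) = (if t \<in> A then \<tau> t else - \<tau> t)" if t: "t \<in> {0<..<1}" for t
 proof -
  note n = normal_on_boundary_arc[OF lip op arcs t d(2)[OF t] d(3)[OF t]]
  have "outer_normal Om (g t) = \<tau> t \<or> outer_normal Om (g t) = - \<tau> t" using unit_normal_cases[OF n(3,2) d(3)[OF t]] by (simp add: \<tau>_def)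
  moreover have "t \<in> A" if e: "outer_normal Om (g t) = \<tau> t"
  proof -
   obtain \<delta> where \<delta>: "\<delta> > 0" "!!h. 0 < h & h < \<delta> ==> g t - h *\<^sub>R \<tau> t \<in> Om"
    using outer_normal_sides[OF n(1), of "\<tau> t"] n\<tau>[OF t] e by auto
   obtain N where "\<forall>n\<ge>N. 1 / real (Suc n) < \<delta>" using small[OF \<delta>(1)] by blast
   thus ?thesis using \<delta>(2) t unfolding A_def by (auto intro!: exI[of _ N])
  qed
  moreover have "t ~: A" if e: "outer_normal Om (g t) = - \<tau> t"
  proof
   assume "t \<in> A"
   then obtain N where N: "\<forall>n\<ge>N. g t - (1 / real (Suc n)) *\<^sub>R \<tau> t \<in> Om" by (auto simp: A_def)
   obtain \<delta> where \<delta>: "\<delta> > 0" "!!h. 0 < h & h < \<delta> ==> g t + h *\<^sub>R (- \<tau> t) ~: Om"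
    using outer_normal_sides[OF n(1), of "- \<tau> t"] n\<tau>[OF t] e by auto
   obtain N' where N': "\<forall>n\<ge>N'. 1 / real (Suc n) < \<delta>" using small[OF \<delta>(1)] by blast
   have "g t + (1 / real (Suc (max N N'))) *\<^sub>R (- \<tau> t) ~: Om" using N' by (intro \<delta>(2)) auto
   moreover have "g t - (1 / real (Suc (max N N'))) *\<^sub>R \<tau> t \<in> Om" using N by (meson max.cobounded1)
   ultimately show False by simp
  qed
  ultimately show ?thesis by auto
 qed
 have \<tau>m: "(%t. indicator {0<..<1} t *\<^sub>R \<tau> t) \<in> borel_measurable borel"
  by (rule borel_measurable_continuous_on_indicator[OF _ cont\<tau>]) auto
 have eq: "(%t. indicator {0<..<1} t *\<^sub>R outer_normal Om (g t))
   = (%t. (if t \<in> A then indicator {0<..<1} t *\<^sub>R \<tau> t else - (indicator {0<..<1} t *\<^sub>R \<tau> t)))"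
  using val by (auto simp: fun_eq_iff indicator_def)
 show ?thesis unfolding eq using A \<tau>m by (intro measurable_If_set borel_measurable_uminus) auto
qed

text \<open>The line with \<open>perp i\<close>-coordinate \<open>y\<close>, parametrized by the other coordinate.\<close>

definition grid :: "2 => real => real => plane" where
 "grid i y s = s *\<^sub>R axis i 1 + y *\<^sub>R axis (perp i) 1"

lemma grid_simps [simp]: "grid i y s $ i = s" "grid i y s $ perp i = y" by (simp_all add: grid_def axis_def)

lemma grid_of_coords: "grid i (x $ perp i) (x $ i) = x" by (rule plane_eqI[of _ i]) simp_all

lemma continuous_on_grid [continuous_intros]:
 "continuous_on S f ==> continuous_on S g ==> continuous_on S (\<lambda>x. grid i (f x) (g x))"
 unfolding grid_def by (intro continuous_intros)

lemma lborel_plane_eq: "lborel = distr (lborel \<Otimes>\<^sub>M lborel) borel (\<lambda>(y, s). grid i y s)"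
proof (rule lborel_eqI)
 have cm: "(%(y, s). grid i y s) \<in> borel_measurable (lborel \<Otimes>\<^sub>M lborel)" unfolding lborel_prod case_prod_beta
  by (simp add: borel_measurable_continuous_onI continuous_intros)
 fix l u :: plane
 assume le: "!!b. b \<in> Basis ==> l \<bullet> b <= u \<bullet> b"
 have lei: "l $ k <= u $ k" for k using le[of "axis k 1"] by (simp add: inner_axis axis_in_Basis_iff)
 have memb: "grid i y s \<in> box l u \<longleftrightarrow> l $ perp i < y & y < u $ perp i & l $ i < s & s < u $ i" for y s
 proof -
  have "x \<in> box l u \<longleftrightarrow> l $ perp i < x $ perp i & x $ perp i < u $ perp i & l $ i < x $ i & x $ i < u $ i" for x
   using exhaust_2[of i] by (auto simp: mem_box_cart forall_2 perp_def)
  thus ?thesis by simp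
 qed
 have "(%(y, s). grid i y s) -` box l u \<inter> space (lborel \<Otimes>\<^sub>M lborel) = {l $ perp i<..<u $ perp i} \<times> {l $ i<..<u $ i}"
  by (auto simp: memb space_pair_measure)
 hence "emeasure (distr (lborel \<Otimes>\<^sub>M lborel) borel (%(y, s). grid i y s)) (box l u)
   = ennreal (u $ perp i - l $ perp i) * ennreal (u $ i - l $ i)" using cm lei by (simp add: emeasure_distr lborel.emeasure_pair_measure_Times)
 also have "... = ennreal ((u - l) $ perp i * (u - l) $ i)" using lei by (simp add: ennreal_mult)
 also have "(u - l) $ perp i * (u - l) $ i = (\<Prod>b\<in>Basis. (u - l) \<bullet> b)"
 proof -
  have B: "(Basis :: plane set) = {axis 1 1, axis 2 1}" by (auto simp: Basis_vec_def UNIV_2)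
  show ?thesis unfolding B using exhaust_2[of i] by (auto simp: perp_def axis_eq_axis inner_axis)
 qed
 finally show "emeasure (distr (lborel \<Otimes>\<^sub>M lborel) borel (%(y, s). grid i y s)) (box l u) = (\<Prod>b\<in>Basis. (u - l) \<bullet> b)" .
qed simp

lemma measurable_grid: "(\<lambda>(y, s). grid i y s) \<in> borel_measurable (lborel \<Otimes>\<^sub>M lborel)"
 unfolding lborel_prod case_prod_beta by (simp add: borel_measurable_continuous_onI continuous_intros)

lemma plane_Fubini:
 fixes f :: "plane => real"
 assumes "integrable lborel f"
 shows "integrable lborel (\<lambda>y. LINT s|lborel. f (grid i y s))"
  "(LINT y|lborel. (LINT s|lborel. f (grid i y s))) = (LINT x|lborel. f x)"
proof -
 have "integrable (distr (lborel \<Otimes>\<^sub>M lborel) borel (%(y, s). grid i y s)) f" using assms lborel_plane_eq[of i] by simp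
 hence i: "integrable (lborel \<Otimes>\<^sub>M lborel) (%z. f (case z of (y, s) => grid i y s))" by (rule integrable_distr[OF measurable_grid])
 show "integrable lborel (%y. LINT s|lborel. f (grid i y s))" using lborel_pair.integrable_fst'[OF i] by simp
 have "(LINT x|lborel. f x) = (LINT x|distr (lborel \<Otimes>\<^sub>M lborel) borel (%(y, s). grid i y s). f x)" using lborel_plane_eq[of i] by simp
 also have "... = (LINT z|(lborel \<Otimes>\<^sub>M lborel). f (case z of (y, s) => grid i y s))"
  by (rule integral_distr[OF measurable_grid]) (use assms in simp)
 also have "... = (LINT y|lborel. (LINT s|lborel. f (grid i y s)))" using lborel_pair.integral_fst'[OF i] by simp
 finally show "(LINT y|lborel. (LINT s|lborel. f (grid i y s))) = (LINT x|lborel. f x)" by simp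
qed

lemma finite_regular_level_set:
 fixes f :: "real => real"
 assumes cont: "continuous_on {0..1} f" and d: "!!t. t \<in> {0<..<1} ==> (f has_real_derivative f' t) (at t)"
  and reg: "!!t. t \<in> {0<..<1} ==> f t = y ==> f' t ~= 0" and ends: "f 0 ~= y" "f 1 ~= y"
 shows "finite {t \<in> {0<..<1}. f t = y}"
proof (rule ccontr)
 assume inf: "\<not> finite {t \<in> {0<..<1}. f t = y}"
 let ?P = "{t \<in> {0..1}. f t = y}"
 have "infinite ?P" by (rule infinite_super[OF _ inf]) auto
 moreover have "compact {0..1::real}" by simp
 ultimately obtain t where t: "t \<in> {0..1}" "t islimpt ?P"
 proof -
  have "?P <= {0..1}" by auto
  with \<open>compact {0..1::real}\<close> \<open>infinite ?P\<close> have "\<exists>x\<in>{0..1}. x islimpt ?P" by (rule Heine_Borel_imp_Bolzano_Weierstrass)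
  thus ?thesis using that by blast
 qed
 have "closed ?P" by (rule continuous_closed_preimage_constant[OF cont]) simp
 hence "t \<in> ?P" using t(2) closed_limpt[of ?P] by iprover
 hence ft: "f t = y" by simp
 have t01: "t \<in> {0<..<1}" using t(1) ft ends by (auto simp: less_le)
 have "((%s. (f s - f t) / (s - t)) \<longlongrightarrow> f' t) (at t)" using d[OF t01] by (simp add: has_field_derivative_iff)
 hence "\<forall>\<^sub>F s in at t. (f s - f t) / (s - t) ~= 0" using reg[OF t01 ft] by (rule tendsto_imp_eventually_ne)
 hence "\<forall>\<^sub>F s in at t. s ~: ?P"
 proof eventually_elim
  case (elim s)
  hence "f s ~= f t" by auto
  thus ?case unfolding ft by simp
 qed
 with t(2) show False unfolding islimpt_iff_eventually by (rule notE)
qed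

text \<open>A line that avoids the endpoints of the arcs and is nowhere tangent to them meets the boundary in finitely many
 points, at which the sign of the normal component says whether the line leaves or enters the domain.\<close>

lemma flux_through_regular_line:
 fixes Om :: "plane set" and F :: "plane => real"
 assumes op: "open Om" and bd: "bounded Om" and lip: "lipschitz_boundary Om" and arcs: "boundary_arcs Om gs"
  and contF: "continuous_on (closure Om) F"
  and dF: "!!x. x \<in> Om ==> (F has_derivative F' x) (at x)"
  and contF': "continuous_on Om (\<lambda>x. F' x (axis i 1))"
  and bdF': "!!x. x \<in> Om ==> \<bar>F' x (axis i 1)\<bar> <= M"
  and v: "!!k. k < length gs ==> \<forall>t\<in>{0<..<1}. (gs ! k has_vector_derivative v k t) (at t) & v k t ~= 0"
  and ends: "!!k. k < length gs ==> (gs ! k) 0 $ perp i ~= y & (gs ! k) 1 $ perp i ~= y"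
  and reg: "!!k. k < length gs ==> \<forall>t\<in>{0<..<1}. (gs ! k) t $ perp i = y --> v k t $ perp i ~= 0"
 shows "(LINT s|lborel. indicator Om (grid i y s) * F' (grid i y s) (axis i 1)) =
  (\<Sum>k<length gs. \<Sum>t\<in>{t \<in> {0<..<1}. (gs ! k) t $ perp i = y}.
    F ((gs ! k) t) * sgn (outer_normal Om ((gs ! k) t) $ i))"
proof -
 define P where "P k = {t \<in> {0<..<1}. (gs ! k) t $ perp i = y}" for k
 define W where "W = {s. grid i y s \<in> Om}"
 define S where "S = {s. grid i y s \<in> frontier Om}"
 have arc: "arc (gs ! k)" and fr: "path_image (gs ! k) <= frontier Om" if "k < length gs" for k
  using arcs that unfolding boundary_arcs_def by (auto simp: arc_imp_path)
 have contg: "continuous_on {0..1} (gs ! k)" if "k < length gs" for k using arc[OF that] by (simp add: arc_def path_def)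
 have contgrid: "continuous_on UNIV (grid i y)" by (intro continuous_intros)
 have comp: "((%t. (gs ! k) t $ perp i) has_real_derivative v k t $ perp i) (at t)"
  if "k < length gs" "t \<in> {0<..<1}" for k t using bounded_linear.has_vector_derivative[OF bounded_linear_vec_nth, of "gs ! k" "v k t" "at t" "perp i"]
   bspec[OF v[OF that(1)] that(2)] by (simp add: has_real_derivative_iff_has_vector_derivative)
 have finP: "finite (P k)" if "k < length gs" for k unfolding P_def
 proof (rule finite_regular_level_set)
  show "continuous_on {0..1} (%t. (gs ! k) t $ perp i)" by (intro continuous_intros contg that)
  show "((%t. (gs ! k) t $ perp i) has_real_derivative v k t $ perp i) (at t)" if "t \<in> {0<..<1}" for t
   by (rule comp) (use \<open>k < length gs\<close> that in auto)
  show "v k t $ perp i ~= 0" if "t \<in> {0<..<1}" "(gs ! k) t $ perp i = y" for t using reg[OF \<open>k < length gs\<close>] that by blast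
 qed (use ends[OF that] in auto)
 define \<Phi> where "\<Phi> = (%(k, t). (gs ! k) t $ i)"
 have gridP: "grid i y ((gs ! k) t $ i) = (gs ! k) t" if "t \<in> P k" for k t using that grid_of_coords[of i "(gs ! k) t"] by (simp add: P_def)
 have bij: "bij_betw \<Phi> (SIGMA k:{..<length gs}. P k) S"
 proof (rule bij_betwI')
  fix a b assume a: "a \<in> (SIGMA k:{..<length gs}. P k)" and b: "b \<in> (SIGMA k:{..<length gs}. P k)"
  obtain k t where [simp]: "a = (k, t)" by fastforce
  obtain l s where [simp]: "b = (l, s)" by fastforce
  have kt: "k < length gs" "t \<in> P k" and ls: "l < length gs" "s \<in> P l" using a b by auto
  show "(\<Phi> a = \<Phi> b) = (a = b)"
  proof
   assume "\<Phi> a = \<Phi> b"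
   hence "(gs ! k) t $ i = (gs ! l) s $ i" by (simp add: \<Phi>_def)
   hence "grid i y ((gs ! k) t $ i) = grid i y ((gs ! l) s $ i)" by (rule arg_cong)
   hence eq: "(gs ! k) t = (gs ! l) s" unfolding gridP[OF kt(2)] gridP[OF ls(2)] .
   have t01: "t \<in> {0<..<1}" and s01: "s \<in> {0<..<1}" using kt ls by (simp_all add: P_def)
   have "k = l"
   proof (rule ccontr)
    assume "k ~= l"
    hence "(gs ! k) ` {0<..<1} \<inter> path_image (gs ! l) = {}" using arcs kt ls unfolding boundary_arcs_def by blast
    moreover have "(gs ! k) t \<in> (gs ! k) ` {0<..<1}" using t01 by (rule imageI)
    moreover have "(gs ! k) t \<in> path_image (gs ! l)" unfolding eq path_image_def using s01 by (intro imageI) auto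
    ultimately show False by (metis IntI empty_iff)
   qed
   moreover have "t = s"
   proof (rule inj_onD)
    show "inj_on (gs ! k) {0..1}" using arc[OF kt(1)] by (simp add: arc_def)
    show "(gs ! k) t = (gs ! k) s" using eq \<open>k = l\<close> by simp
   qed (use t01 s01 in auto)
   ultimately show "a = b" by simp
  qed simp
 next
  fix a assume a: "a \<in> (SIGMA k:{..<length gs}. P k)"
  obtain k t where [simp]: "a = (k, t)" by fastforce
  have kt: "k < length gs" "t \<in> P k" using a by auto
  have "(gs ! k) t \<in> path_image (gs ! k)" using kt unfolding path_image_def P_def by (intro imageI) auto
  hence "(gs ! k) t \<in> frontier Om" using fr[OF kt(1)] by (rule subsetD[rotated])
  thus "\<Phi> a \<in> S" using gridP[OF kt(2)] by (simp add: S_def \<Phi>_def)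
 next
  fix s assume "s \<in> S"
  hence "grid i y s \<in> frontier Om" by (simp add: S_def)
  then obtain g where "g \<in> set gs" "grid i y s \<in> path_image g" using arcs unfolding boundary_arcs_def by auto
  then obtain k t where k: "k < length gs" and t: "t \<in> {0..1}" "grid i y s = (gs ! k) t" by (auto simp: in_set_conv_nth path_image_def)
  have y: "(gs ! k) t $ perp i = y" using t(2) by (metis grid_simps(2))
  have "t ~= 0" "t ~= 1" using y ends[OF k] by auto
  hence "t \<in> P k" using t y by (auto simp: P_def)
  moreover have "s = (gs ! k) t $ i" using t(2) by (metis grid_simps(1))
  ultimately show "\<exists>a\<in>SIGMA k:{..<length gs}. P k. s = \<Phi> a" using k by (intro bexI[of _ "(k, t)"]) (auto simp: \<Phi>_def)
 qed
 have finS: "finite S"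
 proof -
  have "finite (SIGMA k:{..<length gs}. P k)" by (rule finite_SigmaI) (simp, rule finP, simp)
  thus ?thesis using bij_betw_finite[OF bij] by iprover
 qed
 have openW: "open W" using open_vimage[OF op contgrid] by (simp add: W_def vimage_def)
 have bW: "bounded W"
 proof -
  obtain R where R: "!!x. x \<in> Om ==> norm x <= R" using bd by (auto simp: bounded_iff)
  have "\<bar>s\<bar> <= R" if "s \<in> W" for s using R[of "grid i y s"] that component_le_norm_cart[of "grid i y s" i] by (simp add: W_def)
  thus ?thesis by (auto simp: bounded_real)
 qed
 have clW: "s \<in> closure W ==> grid i y s \<in> closure Om" for s
 proof -
  assume s: "s \<in> closure W"
  have "closed {s. grid i y s \<in> closure Om}" using closed_vimage[OF closed_closure contgrid] by (simp add: vimage_def)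
  hence "closure W <= {s. grid i y s \<in> closure Om}" by (rule closure_minimal[rotated]) (auto simp: W_def intro: subsetD[OF closure_subset])
  thus "grid i y s \<in> closure Om" using s by auto
 qed
 have frW: "frontier W <= S" using clW openW op by (auto simp: frontier_def S_def W_def interior_open)
 have WS: "W \<inter> S = {}" using op by (auto simp: W_def S_def frontier_def interior_open)
 define \<sigma> where "\<sigma> s = sgn (outer_normal Om (grid i y s) $ i)" for s
 have sides: "(\<sigma> s = 1 & crosses_out W s) \<or> (\<sigma> s = -1 & crosses_in W s)" if s: "s \<in> S" for s
 proof -
  obtain k t where k: "k < length gs" and t: "t \<in> P k" and skt: "s = (gs ! k) t $ i" using bij s unfolding bij_betw_def \<Phi>_def by auto
  have x: "grid i y s = (gs ! k) t" unfolding skt by (rule gridP[OF t])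
  have t01: "t \<in> {0<..<1}" and ty: "(gs ! k) t $ perp i = y" using t by (auto simp: P_def)
  define \<nu> where "\<nu> = outer_normal Om ((gs ! k) t)"
  have gk: "gs ! k \<in> set gs" using k by simp
  note vt = bspec[OF v[OF k] t01]
  note n = normal_on_boundary_arc[OF lip op arcs gk t01 conjunct1[OF vt] conjunct2[OF vt], folded \<nu>_def]
  have "v k t $ perp i ~= 0" using reg[OF k] t01 ty by blast
  hence "\<nu> $ i ~= 0" using abs_normal_component[OF n(3,2) conjunct2[OF vt], of i] by auto
  have move: "grid i y s + h *\<^sub>R axis i 1 = grid i y (s + h)" for h by (rule plane_eqI[of _ i]) (simp_all add: axis_def)
  have move': "grid i y s - h *\<^sub>R axis i 1 = grid i y (s - h)" for h by (rule plane_eqI[of _ i]) (simp_all add: axis_def)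
  show ?thesis
  proof (cases "\<nu> $ i > 0")
   case True
   hence "axis i 1 \<bullet> \<nu> > 0" by (simp add: inner_axis')
   from outer_normal_sides[OF n(1) this] obtain \<delta> where \<delta>: "\<delta> > 0"
    "!!h. 0 < h & h < \<delta> ==> grid i y (s - h) \<in> Om & grid i y (s + h) ~: Om"
    unfolding x[symmetric] move move' by blast
   have "crosses_out W s" unfolding crosses_out_def
   proof (intro exI[of _ \<delta>] conjI \<delta>(1))
    show "{s - \<delta><..<s} <= W" using \<delta>(2)[of "s - z" for z] by (auto simp: W_def)
    show "{s<..<s + \<delta>} \<inter> W = {}" using \<delta>(2)[of "z - s" for z] by (auto simp: W_def)
   qed
   thus ?thesis using True by (simp add: \<sigma>_def x \<nu>_def)
  next
   case False
   hence neg: "\<nu> $ i < 0" using \<open>\<nu> $ i ~= 0\<close> by simp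
   hence "(- axis i 1) \<bullet> \<nu> > 0" by (simp add: inner_axis')
   from outer_normal_sides[OF n(1) this] obtain \<delta> where \<delta>: "\<delta> > 0"
    "!!h. 0 < h & h < \<delta> ==> grid i y (s + h) \<in> Om & grid i y (s - h) ~: Om"
    unfolding x[symmetric] scaleR_minus_right diff_minus_eq_add add_uminus_conv_diff move move' by blast
   have "crosses_in W s" unfolding crosses_in_def
   proof (intro exI[of _ \<delta>] conjI \<delta>(1))
    show "{s - \<delta><..<s} \<inter> W = {}" using \<delta>(2)[of "s - z" for z] by (auto simp: W_def)
    show "{s<..<s + \<delta>} <= W" using \<delta>(2)[of "z - s" for z] by (auto simp: W_def)
   qed
   thus ?thesis using neg by (simp add: \<sigma>_def x \<nu>_def)
  qed
 qed
 define f f' where "f s = F (grid i y s)" and "f' s = F' (grid i y s) (axis i 1)" for s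
 have contf: "continuous_on (closure W) f" unfolding f_def by (rule continuous_on_compose2[OF contF continuous_on_subset[OF contgrid]]) (use clW in auto)
 have derf: "(f has_real_derivative f' s) (at s)" if "s \<in> W" for s
 proof -
  have g: "(grid i y has_derivative (%h. h *\<^sub>R axis i 1)) (at s)" unfolding grid_def by (auto intro!: derivative_eq_intros)
  have D: "(F has_derivative F' (grid i y s)) (at (grid i y s))" using dF that by (simp add: W_def)
  have "(f has_derivative (%h. F' (grid i y s) (h *\<^sub>R axis i 1))) (at s)" unfolding f_def by (rule has_derivative_compose[OF g D])
  moreover have "F' (grid i y s) (h *\<^sub>R axis i 1) = h * f' s" for h using linear_cmul[OF has_derivative_linear[OF D]] by (simp add: f'_def)
  ultimately show ?thesis by (simp add: has_field_derivative_def mult.commute[of _ "f' s"])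
 qed
 have contf': "continuous_on W f'" unfolding f'_def by (rule continuous_on_compose2[OF contF' continuous_on_subset[OF contgrid]]) (auto simp: W_def)
 have intf': "set_integrable lborel W f'" unfolding set_integrable_def
 proof (rule integrableI_bounded_set)
  show "W \<in> sets lborel" using openW by simp
  show "emeasure lborel W < \<infinity>" using emeasure_bounded_finite[OF bW] by simp
  show "(%s. indicat_real W s *\<^sub>R f' s) \<in> borel_measurable lborel" using borel_measurable_continuous_on_indicator[OF _ contf'] openW by simp
  show "AE s in lborel. s \<in> W --> norm (indicat_real W s *\<^sub>R f' s) <= \<bar>M\<bar>"
   using bdF' by (intro AE_I2) (fastforce simp: W_def f'_def indicator_def)
  show "AE s in lborel. s ~: W --> indicat_real W s *\<^sub>R f' s = 0" by simp
 qed
 have "(LINT s|lborel. indicator Om (grid i y s) * F' (grid i y s) (axis i 1)) = (LINT s:W|lborel. f' s)"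
  unfolding set_lebesgue_integral_def by (intro Bochner_Integration.integral_cong) (auto simp: W_def f'_def indicator_def)
 also have "... = (\<Sum>s\<in>S. \<sigma> s * f s)" by (rule integral_derivative_over_slice[OF finS openW bW WS frW sides contf derf intf'])
 also have "... = (\<Sum>a\<in>(SIGMA k:{..<length gs}. P k). \<sigma> (\<Phi> a) * f (\<Phi> a))" by (rule sum.reindex_bij_betw[OF bij, symmetric])
 also have "... = (\<Sum>k<length gs. \<Sum>t\<in>P k. \<sigma> (\<Phi> (k, t)) * f (\<Phi> (k, t)))"
  by (subst sum.Sigma) (use finP in \<open>auto intro!: sum.cong\<close>)
 also have "... = (\<Sum>k<length gs. \<Sum>t\<in>P k. F ((gs ! k) t) * sgn (outer_normal Om ((gs ! k) t) $ i))"
  by (intro sum.cong refl) (simp add: \<Phi>_def \<sigma>_def f_def gridP)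
 finally show ?thesis by (simp add: P_def)
qed

text \<open>Almost every line is regular. Integrating the line identity over all lines and applying the area formula to the
 transversal coordinate of each arc produces the factor \<open>|v $ perp i| = |n $ i| norm v\<close>.\<close>

lemma flux_through_boundary_arcs:
 fixes Om :: "plane set" and F :: "plane => real"
 assumes op: "open Om" and bd: "bounded Om" and lip: "lipschitz_boundary Om" and arcs: "boundary_arcs Om gs"
  and contF: "continuous_on (closure Om) F"
  and dF: "!!x. x \<in> Om ==> (F has_derivative F' x) (at x)"
  and contF': "continuous_on Om (\<lambda>x. F' x (axis i 1))"
  and bdF': "!!x. x \<in> Om ==> \<bar>F' x (axis i 1)\<bar> <= M"
  and v: "!!k. k < length gs ==> \<forall>t\<in>{0<..<1}. (gs ! k has_vector_derivative v k t) (at t) & v k t ~= 0"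
  and contv: "!!k. k < length gs ==> continuous_on {0..1} (v k)"
 shows "(LINT x:Om|lborel. F' x (axis i 1)) =
  (\<Sum>k<length gs. LINT t:{0<..<1}|lebesgue. F ((gs ! k) t) * outer_normal Om ((gs ! k) t) $ i * norm (v k t))"
  and "!!k. k < length gs ==>
   set_integrable lebesgue {0<..<1} (\<lambda>t. F ((gs ! k) t) * outer_normal Om ((gs ! k) t) $ i * norm (v k t))"
proof -
 define h where "h k t = F ((gs ! k) t) * sgn (outer_normal Om ((gs ! k) t) $ i)" for k t
 have gk: "gs ! k \<in> set gs" if "k < length gs" for k using that by simp
 have fr: "(gs ! k) t \<in> frontier Om" if "k < length gs" "t \<in> {0..1}" for k t
 proof -
  have "(gs ! k) t \<in> path_image (gs ! k)" using that(2) unfolding path_image_def by (rule imageI)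
  thus ?thesis using arcs gk[OF that(1)] unfolding boundary_arcs_def by blast
 qed
 have contg: "continuous_on {0..1} (gs ! k)" if "k < length gs" for k using arcs gk[OF that] unfolding boundary_arcs_def by (simp add: arc_def path_def)
 have contFg: "continuous_on {0..1} (%t. F ((gs ! k) t))" if "k < length gs" for k by (rule continuous_on_compose2[OF contF contg[OF that]])
    (use fr[OF that] in \<open>auto simp: frontier_def\<close>)
 have hv: "\<bar>v k t $ perp i\<bar> * h k t = F ((gs ! k) t) * outer_normal Om ((gs ! k) t) $ i * norm (v k t)"
  if k: "k < length gs" and t: "t \<in> {0<..<1}" for k t
 proof -
  note vt = bspec[OF v[OF k] t]
  note n = normal_on_boundary_arc[OF lip op arcs gk[OF k] t conjunct1[OF vt] conjunct2[OF vt]]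
  have "\<bar>v k t $ perp i\<bar> = \<bar>outer_normal Om ((gs ! k) t) $ i\<bar> * norm (v k t)"
   using abs_normal_component[OF n(3,2) conjunct2[OF vt], of i] by simp
  thus ?thesis unfolding h_def by (simp add: abs_sgn[of "outer_normal Om ((gs ! k) t) $ i"] sgn_if)
 qed
 have intN: "set_integrable lebesgue {0<..<1} (%t. F ((gs ! k) t) * outer_normal Om ((gs ! k) t) $ i * norm (v k t))"
  if k: "k < length gs" for k
 proof -
  have "compact ((%t. F ((gs ! k) t) * norm (v k t)) ` {0..1})" by (intro compact_continuous_image continuous_intros contFg contv k) simp
  then obtain B where B: "!!t. t \<in> {0..1} ==> \<bar>F ((gs ! k) t) * norm (v k t)\<bar> <= B"
   proof -
   from \<open>compact _\<close> have "bounded ((%t. F ((gs ! k) t) * norm (v k t)) ` {0..1})" by (rule compact_imp_bounded)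
   then obtain a where "\<forall>x\<in>(%t. F ((gs ! k) t) * norm (v k t)) ` {0..1}. \<bar>x\<bar> <= a" unfolding bounded_real by iprover
   thus ?thesis using that[of a] by simp
  qed
  let ?a = "%t. indicator {0<..<1} t *\<^sub>R (F ((gs ! k) t) * norm (v k t))"
  let ?n = "%t. (indicator {0<..<1} t *\<^sub>R outer_normal Om ((gs ! k) t)) $ i"
  have m1: "?a \<in> borel_measurable borel" by (rule borel_measurable_continuous_on_indicator)
     (auto intro!: continuous_intros continuous_on_subset[OF contFg[OF k]] continuous_on_subset[OF contv[OF k]])
  have m2: "?n \<in> borel_measurable borel"
  proof (rule measurable_compose[OF measurable_outer_normal_on_arc[OF lip op arcs gk[OF k]]])
   show "(%x::plane. x $ i) \<in> borel_measurable borel" by (intro borel_measurable_continuous_onI continuous_intros)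
  qed
  have eq: "(%t. indicator {0<..<1} t *\<^sub>R (F ((gs ! k) t) * outer_normal Om ((gs ! k) t) $ i * norm (v k t))) = (%t. ?a t * ?n t)"
   by (auto simp: fun_eq_iff indicator_def)
  have m: "(%t. ?a t * ?n t) \<in> borel_measurable lebesgue" by (rule measurable_completion) (use m1 m2 in simp)
  show ?thesis unfolding set_integrable_def eq
  proof (rule integrableI_bounded_set[OF _ m])
   show "{0<..<1::real} \<in> sets lebesgue" by simp
   show "emeasure lebesgue {0<..<1::real} < \<infinity>" by simp
   show "AE t in lebesgue. t \<in> {0<..<1} --> norm (?a t * ?n t) <= \<bar>B\<bar> * 1"
   proof (intro AE_I2 impI)
    fix t :: real assume t: "t \<in> {0<..<1}"
    note vt = bspec[OF v[OF k] t]
    note n = normal_on_boundary_arc[OF lip op arcs gk[OF k] t conjunct1[OF vt] conjunct2[OF vt]]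
    have "\<bar>outer_normal Om ((gs ! k) t) $ i\<bar> <= 1" using component_le_norm_cart n(3) by metis
    moreover have "\<bar>F ((gs ! k) t) * norm (v k t)\<bar> <= \<bar>B\<bar>" using B[of t] t by simp
    ultimately show "norm (?a t * ?n t) <= \<bar>B\<bar> * 1" using t unfolding real_norm_def abs_mult[of "?a t"] by (intro mult_mono) auto
   qed
   show "AE t in lebesgue. t ~: {0<..<1} --> ?a t * ?n t = 0" by simp
  qed
 qed
 thus "!!k. k < length gs ==>
   set_integrable lebesgue {0<..<1} (%t. F ((gs ! k) t) * outer_normal Om ((gs ! k) t) $ i * norm (v k t))" .
 have comp: "((%t. (gs ! k) t $ perp i) has_real_derivative v k t $ perp i) (at t)"
  if "k < length gs" "t \<in> {0<..<1}" for k t using bounded_linear.has_vector_derivative[OF bounded_linear_vec_nth, of "gs ! k" "v k t" "at t" "perp i"]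
   bspec[OF v[OF that(1)] that(2)] by (simp add: has_real_derivative_iff_has_vector_derivative)
 \<comment> \<open>The lines that hit an endpoint of an arc or are tangent to an arc form a null set (Sard).\<close>
 define Z where "Z = (\<Union>k<length gs. {(gs ! k) 0 $ perp i, (gs ! k) 1 $ perp i} \<union>
   (%t. (gs ! k) t $ perp i) ` {t \<in> {0<..<1}. v k t $ perp i = 0})"
 have "negligible Z" unfolding Z_def
 proof (rule negligible_Union)
  show "finite ((%k. {(gs ! k) 0 $ perp i, (gs ! k) 1 $ perp i} \<union>
   (%t. (gs ! k) t $ perp i) ` {t \<in> {0<..<1}. v k t $ perp i = 0}) ` {..<length gs})" by simp
  have "negligible ((%t. (gs ! k) t $ perp i) ` {t \<in> {0<..<1}. v k t $ perp i = 0})" if "k < length gs" for k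
  proof (rule negligible_critical_values)
   fix t assume "t \<in> {t \<in> {0<..<1}. v k t $ perp i = 0}"
   thus "((%t. (gs ! k) t $ perp i) has_real_derivative 0) (at t)" using comp[OF that, of t] by auto
  qed
  note cv = this
  show "negligible X" if "X \<in> (%k. {(gs ! k) 0 $ perp i, (gs ! k) 1 $ perp i} \<union>
   (%t. (gs ! k) t $ perp i) ` {t \<in> {0<..<1}. v k t $ perp i = 0}) ` {..<length gs}" for X
  proof -
   obtain k where "k < length gs" and X: "X = {(gs ! k) 0 $ perp i, (gs ! k) 1 $ perp i} \<union>
     (%t. (gs ! k) t $ perp i) ` {t \<in> {0<..<1}. v k t $ perp i = 0}" using \<open>X \<in> _\<close> by auto
   show ?thesis unfolding X by (rule negligible_Un[OF negligible_finite cv]) (simp, fact)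
  qed
 qed
 hence AEZ: "AE y in lebesgue. y ~: Z" by (simp add: negligible_iff_null_sets AE_not_in)
 have good: "(\<forall>k<length gs. (gs ! k) 0 $ perp i ~= y & (gs ! k) 1 $ perp i ~= y &
   (\<forall>t\<in>{0<..<1}. (gs ! k) t $ perp i = y --> v k t $ perp i ~= 0))" if "y ~: Z" for y
 proof (intro allI impI conjI ballI)
  fix k assume k: "k < length gs"
  have nz: "y ~: {(gs ! k) 0 $ perp i, (gs ! k) 1 $ perp i} \<union>
     (%t. (gs ! k) t $ perp i) ` {t \<in> {0<..<1}. v k t $ perp i = 0}" using that k unfolding Z_def by blast
  thus "(gs ! k) 0 $ perp i ~= y" "(gs ! k) 1 $ perp i ~= y" by auto
  fix t assume t: "t \<in> {0<..<1}" "(gs ! k) t $ perp i = y"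
  show "v k t $ perp i ~= 0"
  proof
   assume "v k t $ perp i = 0"
   hence "y \<in> (%t. (gs ! k) t $ perp i) ` {t \<in> {0<..<1}. v k t $ perp i = 0}" using t by (intro image_eqI[of _ _ t]) auto
   thus False using nz by blast
  qed
 qed
 let ?inner = "%y. LINT s|lborel. indicator Om (grid i y s) * F' (grid i y s) (axis i 1)"
 have slice: "AE y in lebesgue. ?inner y = (\<Sum>k<length gs. \<Sum>t\<in>{t \<in> {0<..<1}. (gs ! k) t $ perp i = y}. h k t)" using AEZ
 proof eventually_elim
  case (elim y)
  show ?case unfolding h_def by (rule flux_through_regular_line[OF op bd lip arcs contF dF contF' bdF' v])
     (use good[OF elim] in simp_all)
 qed
 have area: "integrable lebesgue (%y. \<Sum>t\<in>{t \<in> {0<..<1}. (gs ! k) t $ perp i = y}. h k t)"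
   "(LINT y|lebesgue. (\<Sum>t\<in>{t \<in> {0<..<1}. (gs ! k) t $ perp i = y}. h k t))
    = (LINT t:{0<..<1}|lebesgue. \<bar>v k t $ perp i\<bar> * h k t)" if k: "k < length gs" for k
 proof -
  have c: "continuous_on {0<..<1} (%t. v k t $ perp i)" by (intro continuous_intros continuous_on_subset[OF contv[OF k]]) auto
  have int: "set_integrable lebesgue {0<..<1} (%t. \<bar>v k t $ perp i\<bar> * h k t)"
  proof -
   have "set_integrable lebesgue {0<..<1} (%t. \<bar>v k t $ perp i\<bar> * h k t) =
     set_integrable lebesgue {0<..<1} (%t. F ((gs ! k) t) * outer_normal Om ((gs ! k) t) $ i * norm (v k t))"
    by (rule set_integrable_cong) (use hv[OF k] in auto)
   thus ?thesis using intN[OF k] by simp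
  qed
  have ae: "AE y in lebesgue. finite {t \<in> {0<..<1}. (gs ! k) t $ perp i = y} &
    (\<forall>t\<in>{0<..<1}. (gs ! k) t $ perp i = y --> v k t $ perp i ~= 0)" using AEZ
  proof eventually_elim
   case (elim y)
   note g = good[OF elim, rule_format, OF k]
   have "finite {t \<in> {0<..<1}. (gs ! k) t $ perp i = y}"
   proof (rule finite_regular_level_set)
    show "continuous_on {0..1} (%t. (gs ! k) t $ perp i)" by (intro continuous_intros contg k)
    show "((%t. (gs ! k) t $ perp i) has_real_derivative v k t $ perp i) (at t)" if "t \<in> {0<..<1}" for t by (rule comp[OF k that])
   qed (use g in auto)
   thus ?case using g by blast
  qed
  show "integrable lebesgue (%y. \<Sum>t\<in>{t \<in> {0<..<1}. (gs ! k) t $ perp i = y}. h k t)" by (rule area_formula(1)[OF comp[OF k] c int ae])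
  show "(LINT y|lebesgue. (\<Sum>t\<in>{t \<in> {0<..<1}. (gs ! k) t $ perp i = y}. h k t))
    = (LINT t:{0<..<1}|lebesgue. \<bar>v k t $ perp i\<bar> * h k t)" by (rule area_formula(2)[OF comp[OF k] c int ae])
 qed
 have intOm: "integrable lborel (%x. indicator Om x * F' x (axis i 1))"
 proof (rule integrableI_bounded_set)
  show "Om \<in> sets lborel" using op by simp
  show "emeasure lborel Om < \<infinity>" using emeasure_bounded_finite[OF bd] by simp
  show "(%x. indicator Om x * F' x (axis i 1)) \<in> borel_measurable lborel" using borel_measurable_continuous_on_indicator[OF _ contF'] op by simp
  show "AE x in lborel. x \<in> Om --> norm (indicator Om x * F' x (axis i 1)) <= \<bar>M\<bar>"
   using bdF' by (intro AE_I2) (fastforce simp: indicator_def)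
  show "AE x in lborel. x ~: Om --> indicator Om x * F' x (axis i 1) = 0" by simp
 qed
 note fub = plane_Fubini[OF intOm, of i]
 have "(LINT x:Om|lborel. F' x (axis i 1)) = (LINT y|lborel. ?inner y)" using fub(2) by (simp add: set_lebesgue_integral_def)
 also have "... = (LINT y|lebesgue. ?inner y)" by (rule integral_completion[symmetric]) (use fub(1) in simp)
 also have "... = (LINT y|lebesgue. (\<Sum>k<length gs. \<Sum>t\<in>{t \<in> {0<..<1}. (gs ! k) t $ perp i = y}. h k t))"
 proof (rule integral_cong_AE[OF _ _ slice])
  show "?inner \<in> borel_measurable lebesgue" by (rule measurable_completion) (use fub(1) in simp)
  show "(%y. \<Sum>k<length gs. \<Sum>t\<in>{t \<in> {0<..<1}. (gs ! k) t $ perp i = y}. h k t) \<in> borel_measurable lebesgue"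
   by (intro borel_measurable_sum borel_measurable_integrable area(1)) simp
 qed
 also have "... = (\<Sum>k<length gs. LINT y|lebesgue. (\<Sum>t\<in>{t \<in> {0<..<1}. (gs ! k) t $ perp i = y}. h k t))"
  by (rule Bochner_Integration.integral_sum) (use area(1) in simp)
 also have "... = (\<Sum>k<length gs. LINT t:{0<..<1}|lebesgue. F ((gs ! k) t) * outer_normal Om ((gs ! k) t) $ i * norm (v k t))"
 proof (rule sum.cong[OF refl])
  fix k assume "k \<in> {..<length gs}"
  hence k: "k < length gs" by simp
  show "(LINT y|lebesgue. (\<Sum>t\<in>{t \<in> {0<..<1}. (gs ! k) t $ perp i = y}. h k t))
   = (LINT t:{0<..<1}|lebesgue. F ((gs ! k) t) * outer_normal Om ((gs ! k) t) $ i * norm (v k t))"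
   unfolding area(2)[OF k] by (rule set_lebesgue_integral_cong) (use hv[OF k] in auto)
 qed
 finally show "(LINT x:Om|lborel. F' x (axis i 1)) =
  (\<Sum>k<length gs. LINT t:{0<..<1}|lebesgue. F ((gs ! k) t) * outer_normal Om ((gs ! k) t) $ i * norm (v k t))" .
qed

lemma measurable_outer_normal_frontier:
 assumes lip: "lipschitz_boundary Om" and op: "open Om" and arcs: "boundary_arcs Om gs"
 shows "(\<lambda>x. indicator (frontier Om) x *\<^sub>R outer_normal Om x) \<in> borel_measurable borel"
proof -
 have arc: "arc (gs ! k)" if "k < length gs" for k using arcs that unfolding boundary_arcs_def by simp
 have "\<exists>h. continuous_on (path_image (gs ! k)) h & (\<forall>t\<in>{0..1}. h ((gs ! k) t) = t)" if "k < length gs" for k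
 proof -
  have a: "arc (gs ! k)" by (rule arc[OF that])
  obtain h where "homeomorphism {0..1} (path_image (gs ! k)) (gs ! k) h" by (rule homeomorphism_arc[OF a])
  thus ?thesis unfolding homeomorphism_def by blast
 qed
 then obtain h where hc: "!!k. k < length gs ==> continuous_on (path_image (gs ! k)) (h k)"
  and hg: "!!k t. k < length gs ==> t \<in> {0..1} ==> h k ((gs ! k) t) = t" by metis
 define N where "N k t = indicator {0<..<1} t *\<^sub>R outer_normal Om ((gs ! k) t)" for k t
 have Nm: "N k \<in> borel_measurable borel" if "k < length gs" for k
  unfolding N_def[abs_def] by (rule measurable_outer_normal_on_arc[OF lip op arcs]) (use that in simp)
 define G where "G x = (\<Sum>k<length gs. indicator (path_image (gs ! k)) x *\<^sub>R N k (h k x))" for x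
 have Gm: "G \<in> borel_measurable borel" unfolding G_def[abs_def]
 proof (intro borel_measurable_sum)
  fix k assume "k \<in> {..<length gs}"
  hence k: "k < length gs" by simp
  have cl: "path_image (gs ! k) \<in> sets borel" using closed_path_image[OF arc_imp_path[OF arc[OF k]]] by simp
  have "h k \<in> borel_measurable (restrict_space borel (path_image (gs ! k)))" by (rule borel_measurable_continuous_on_restrict[OF hc[OF k]])
  hence "(%x. N k (h k x)) \<in> borel_measurable (restrict_space borel (path_image (gs ! k)))" by (rule measurable_compose[OF _ Nm[OF k]])
  thus "(%x. indicator (path_image (gs ! k)) x *\<^sub>R N k (h k x)) \<in> borel_measurable borel"
   using cl by (simp add: borel_measurable_restrict_space_iff)
 qed
 define X where "X = (\<Union>k<length gs. {(gs ! k) 0, (gs ! k) 1})"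
 have eq: "G x = indicator (frontier Om) x *\<^sub>R outer_normal Om x" if x: "x ~: X" for x
 proof (cases "x \<in> frontier Om")
  case False
  hence "x ~: path_image (gs ! k)" if "k < length gs" for k using arcs nth_mem[OF that] unfolding boundary_arcs_def by blast
  hence "G x = 0" unfolding G_def by (intro sum.neutral) simp
  thus ?thesis using False by simp
 next
  case True
  then obtain g where "g \<in> set gs" "x \<in> path_image g" using arcs unfolding boundary_arcs_def by auto
  then obtain k t where k: "k < length gs" and t: "t \<in> {0..1}" "x = (gs ! k) t" by (auto simp: in_set_conv_nth path_image_def)
  have "t ~= 0" "t ~= 1" using x t k by (auto simp: X_def)
  hence t01: "t \<in> {0<..<1}" using t by auto
  have xk: "x \<in> (gs ! k) ` {0<..<1}" using t01 t by blast
  have other: "x ~: path_image (gs ! l)" if "l < length gs" "l ~= k" for l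
  proof -
   have "(gs ! k) ` {0<..<1} \<inter> path_image (gs ! l) = {}" using arcs k that unfolding boundary_arcs_def by metis
   thus ?thesis using xk by blast
  qed
  have "G x = (\<Sum>l<length gs. if l = k then N k (h k x) else 0)" unfolding G_def
  proof (rule sum.cong[OF refl])
   fix l assume l: "l \<in> {..<length gs}"
   have "x \<in> path_image (gs ! k)" unfolding path_image_def using t by blast
   thus "indicator (path_image (gs ! l)) x *\<^sub>R N l (h l x) = (if l = k then N k (h k x) else 0)" using other[of l] l by auto
  qed
  also have "... = N k (h k x)" using k by simp
  also have "... = outer_normal Om x" using hg[OF k t(1)] t(2) t01 by (simp add: N_def)
  finally show ?thesis using True by simp
 qed
 show ?thesis
 proof (rule measurable_discrete_difference[OF Gm, of X])
  show "countable X" unfolding X_def by (intro countable_finite finite_UN_I) auto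
 qed (use eq in auto)
qed

locale boundary_parametrization =
 fixes Om :: "plane set" and gs :: "(real => plane) list" and v :: "nat => real => plane"
 assumes arcs: "boundary_arcs Om gs"
  and contv: "!!k. k < length gs ==> continuous_on {0..1} (v k)"
  and velocity: "!!k. k < length gs ==> \<forall>t\<in>{0<..<1}. (gs ! k has_vector_derivative v k t) (at t) & v k t ~= 0"
  and vd_eq: "!!k t. k < length gs ==> t \<in> {0<..<1} ==> vector_derivative (gs ! k) (at t within {0..1}) = v k t"

begin

definition unit_interval :: "real measure" where "unit_interval = restrict_space lborel {0..1}"

definition parameter_measure :: "(nat \<times> real) measure" where
 "parameter_measure = count_space {..<length gs} \<Otimes>\<^sub>M unit_interval"

definition speed :: "nat => real => real" where
 "speed k t = norm (vector_derivative (gs ! k) (at t within {0..1}))"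

lemma space_interval [simp]: "space unit_interval = {0..1}" by (simp add: unit_interval_def space_restrict_space)

lemma continuous_arc: "k < length gs ==> continuous_on {0..1} (gs ! k)" using arcs unfolding boundary_arcs_def by (simp add: arc_def path_def)

lemma borel_measurable_interval:
 assumes "continuous_on {0..1::real} f"
 shows "f \<in> borel_measurable unit_interval" using borel_measurable_continuous_on_restrict[OF assms]
 by (simp add: unit_interval_def cong: measurable_cong_sets sets_restrict_space_cong)

lemma speed_measurable: "k < length gs ==> speed k \<in> borel_measurable unit_interval"
proof -
 assume k: "k < length gs"
 have "(%t. norm (v k t)) \<in> borel_measurable unit_interval" by (intro borel_measurable_interval continuous_intros contv k)
 thus "speed k \<in> borel_measurable unit_interval"
 proof (rule measurable_discrete_difference[where X = "{0, 1}"])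
  show "{t} \<in> sets unit_interval" if "t \<in> {0, 1}" for t using that by (auto simp: unit_interval_def sets_restrict_space_iff)
 qed (use vd_eq[OF k] in \<open>auto simp: speed_def\<close>)
qed

lemma speed_bounded: "\<exists>C. \<forall>k<length gs. \<forall>t\<in>{0..1}. speed k t <= C"
proof -
 have "\<exists>C. \<forall>t\<in>{0..1}. speed k t <= C" if k: "k < length gs" for k
 proof -
  have "compact ((%t. norm (v k t)) ` {0..1})" by (intro compact_continuous_image continuous_intros contv k) simp
  hence "bounded ((%t. norm (v k t)) ` {0..1})" by (rule compact_imp_bounded)
  then obtain a where a: "\<forall>t\<in>{0..1}. norm (v k t) <= a" unfolding bounded_real by auto
  have "speed k t <= max a (max (speed k 0) (speed k 1))" if t: "t \<in> {0..1}" for t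
  proof (cases "t \<in> {0<..<1}")
   case True
   hence "speed k t = norm (v k t)" using vd_eq[OF k] by (simp add: speed_def)
   thus ?thesis using a t by (simp add: le_max_iff_disj)
  next
   case False
   hence "t = 0 \<or> t = 1" using t by auto
   thus ?thesis by auto
  qed
  thus ?thesis by blast
 qed
 then obtain C where C: "!!k. k < length gs ==> \<forall>t\<in>{0..1}. speed k t <= C k" by metis
 have "\<forall>t\<in>{0..1}. speed k t <= (\<Sum>l<length gs. \<bar>C l\<bar>)" if k: "k < length gs" for k
 proof
  fix t :: real assume "t \<in> {0..1}"
  hence "speed k t <= \<bar>C k\<bar>" using C[OF k] by force
  also have "... <= (\<Sum>l<length gs. \<bar>C l\<bar>)" using k by (intro member_le_sum) auto
  finally show "speed k t <= (\<Sum>l<length gs. \<bar>C l\<bar>)" .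
 qed
 thus ?thesis by blast
qed

lemma measurable_on_parameters:
 assumes "!!k. k < length gs ==> f k \<in> measurable unit_interval N"
 shows "(\<lambda>(k, t). f k t) \<in> measurable parameter_measure N" unfolding parameter_measure_def by (rule measurable_pair_measure_countable1) (use assms in auto)

lemma arclength_measure_eq:
 "arclength_measure gs = distr (density parameter_measure (\<lambda>(k, t). ennreal (speed k t))) borel (\<lambda>(k, t). (gs ! k) t)"
 by (simp add: arclength_measure_def parameter_measure_def speed_def unit_interval_def)

lemma measurable_arc_map: "(\<lambda>(k, t). (gs ! k) t) \<in> borel_measurable (density parameter_measure (\<lambda>(k, t). ennreal (speed k t)))"
proof -
 have "(%(k, t). (gs ! k) t) \<in> borel_measurable parameter_measure" by (rule measurable_on_parameters) (rule borel_measurable_interval[OF continuous_arc])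
 thus ?thesis by simp
qed

lemma measurable_speed: "(\<lambda>(k, t). speed k t) \<in> borel_measurable parameter_measure" by (rule measurable_on_parameters) (rule speed_measurable)

lemma emeasure_parameters_finite: "emeasure parameter_measure (space parameter_measure) < \<infinity>"
proof -
 interpret I: sigma_finite_measure unit_interval unfolding unit_interval_def by (intro sigma_finite_measure_restrict_space sigma_finite_lborel) auto
 have "emeasure unit_interval {0..1} = 1" by (simp add: unit_interval_def emeasure_restrict_space)
 moreover have "emeasure parameter_measure ({..<length gs} \<times> {0..1})
   = emeasure (count_space {..<length gs}) {..<length gs} * emeasure unit_interval {0..1}" unfolding parameter_measure_def using sets.top[of unit_interval]
  by (intro I.emeasure_pair_measure_Times) auto
 ultimately show ?thesis by (simp add: parameter_measure_def space_pair_measure ennreal_of_nat_eq_real_of_nat)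
qed

lemma finite_arclength_measure: "finite_measure (arclength_measure gs)"
proof
 obtain C where C: "\<forall>k<length gs. \<forall>t\<in>{0..1}. speed k t <= C" using speed_bounded by blast
 have "emeasure (arclength_measure gs) (space (arclength_measure gs))
   = (\<integral>\<^sup>+z. (case z of (k, t) => ennreal (speed k t)) * indicator (space parameter_measure) z \<partial>parameter_measure)"
 proof -
  have sm: "(%(k, t). ennreal (speed k t)) \<in> borel_measurable parameter_measure"
   using measurable_compose[OF measurable_speed measurable_ennreal] by (simp add: case_prod_beta')
  show ?thesis unfolding arclength_measure_eq using emeasure_density[OF sm sets.top] by (simp add: emeasure_distr[OF measurable_arc_map])
 qed
 also have "... <= (\<integral>\<^sup>+z. ennreal C \<partial>parameter_measure)"
  by (intro nn_integral_mono) (use C in \<open>auto simp: parameter_measure_def space_pair_measure indicator_def intro!: ennreal_leI\<close>)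
 also have "... < \<infinity>" using emeasure_parameters_finite by (simp add: ennreal_mult_less_top)
 finally show "emeasure (arclength_measure gs) (space (arclength_measure gs)) ~= \<infinity>" by simp
qed

text \<open>The arclength measure is the image of a measure with density, and the endpoints of the arcs, where the velocity
 may differ, are null.\<close>

lemma integral_arclength_measure:
 fixes f :: "plane => real"
 assumes f: "f \<in> borel_measurable borel"
  and int: "!!k. k < length gs ==> set_integrable lebesgue {0<..<1} (\<lambda>t. f ((gs ! k) t) * norm (v k t))"
 shows "(LINT x|arclength_measure gs. f x) = (\<Sum>k<length gs. LINT t:{0<..<1}|lebesgue. f ((gs ! k) t) * norm (v k t))"
proof -
 define \<phi> where "\<phi> k t = speed k t * f ((gs ! k) t)" for k t
 interpret I: sigma_finite_measure unit_interval unfolding unit_interval_def by (intro sigma_finite_measure_restrict_space sigma_finite_lborel) auto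
 interpret C: sigma_finite_measure "count_space {..<length gs}" by (rule sigma_finite_measure_count_space_finite) simp
 interpret P: pair_sigma_finite "count_space {..<length gs}" unit_interval ..
 have \<phi>m: "\<phi> k \<in> borel_measurable unit_interval" if "k < length gs" for k unfolding \<phi>_def[abs_def]
  using speed_measurable[OF that] measurable_compose[OF borel_measurable_interval[OF continuous_arc[OF that]] f] by simp
 have ext: "(%t. indicator {0..1} t *\<^sub>R \<phi> k t) \<in> borel_measurable lborel" if "k < length gs" for k
  using \<phi>m[OF that] by (simp add: unit_interval_def borel_measurable_restrict_space_iff)
 have AE: "AE t in lebesgue. indicator {0..1} t *\<^sub>R \<phi> k t = indicator {0<..<1} t *\<^sub>R (f ((gs ! k) t) * norm (v k t))"
  if k: "k < length gs" for k
 proof -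
  have "AE t in lborel. t ~= 0 & t ~= (1::real)" by (intro AE_conjI AE_lborel_singleton)
  hence "AE t in lebesgue. t ~= 0 & t ~= (1::real)" by (rule AE_completion)
  thus ?thesis
  proof eventually_elim
   case (elim t)
   thus ?case using vd_eq[OF k, of t] by (cases "t \<in> {0<..<1}") (auto simp: \<phi>_def speed_def indicator_def)
  qed
 qed
 have 1: "integrable lebesgue (%t. indicator {0..1} t *\<^sub>R \<phi> k t)" if k: "k < length gs" for k
 proof (rule integrable_cong_AE_imp[OF int[OF k, unfolded set_integrable_def]])
  show "(%t. indicator {0..1} t *\<^sub>R \<phi> k t) \<in> borel_measurable lebesgue" by (rule measurable_completion[OF ext[OF k]])
  show "AE t in lebesgue. indicator {0<..<1} t *\<^sub>R (f ((gs ! k) t) * norm (v k t)) = indicator {0..1} t *\<^sub>R \<phi> k t"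
   using AE[OF k] by eventually_elim simp
 qed
 have \<phi>i: "integrable unit_interval (\<phi> k)" if k: "k < length gs" for k
  using 1[OF k] ext[OF k] by (simp add: unit_interval_def integrable_restrict_space integrable_completion set_integrable_def)
 have \<phi>L: "(LINT t|unit_interval. \<phi> k t) = (LINT t:{0<..<1}|lebesgue. f ((gs ! k) t) * norm (v k t))"
  if k: "k < length gs" for k
 proof -
  have "(LINT t|unit_interval. \<phi> k t) = (LINT t|lborel. indicator {0..1} t *\<^sub>R \<phi> k t)"
   unfolding unit_interval_def by (subst integral_restrict_space) (auto simp: set_lebesgue_integral_def)
  also have "... = (LINT t|lebesgue. indicator {0..1} t *\<^sub>R \<phi> k t)" by (rule integral_completion[OF ext[OF k], symmetric])
  also have "... = (LINT t|lebesgue. indicator {0<..<1} t *\<^sub>R (f ((gs ! k) t) * norm (v k t)))"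
   by (rule integral_cong_AE[OF borel_measurable_integrable[OF 1[OF k]] borel_measurable_integrable[OF int[OF k, unfolded set_integrable_def]] AE[OF k]])
  finally show ?thesis by (simp add: set_lebesgue_integral_def)
 qed
 have \<phi>P: "integrable (count_space {..<length gs} \<Otimes>\<^sub>M unit_interval) (%(k, t). \<phi> k t)"
 proof (rule P.Fubini_integrable)
  show "(%(k, t). \<phi> k t) \<in> borel_measurable (count_space {..<length gs} \<Otimes>\<^sub>M unit_interval)"
   using measurable_on_parameters[of \<phi> borel] \<phi>m by (simp add: parameter_measure_def)
  show "integrable (count_space {..<length gs}) (%k. LINT t|unit_interval. norm (case (k, t) of (k, t) => \<phi> k t))"
   by (intro integrable_count_space) simp
  show "AE k in count_space {..<length gs}. integrable unit_interval (%t. case (k, t) of (k, t) => \<phi> k t)" using \<phi>i by (intro AE_I2) simp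
 qed
 have "(LINT x|arclength_measure gs. f x) = (LINT z|density parameter_measure (%(k, t). ennreal (speed k t)). f (case z of (k, t) => (gs ! k) t))"
  unfolding arclength_measure_eq by (rule integral_distr[OF measurable_arc_map f])
 also have "... = (LINT z|density parameter_measure (%z. ennreal (case z of (k, t) => speed k t)). f (case z of (k, t) => (gs ! k) t))"
 proof -
  have "(%(k, t). ennreal (speed k t)) = (%z. ennreal (case z of (k, t) => speed k t))" by auto
  thus ?thesis by (simp only:)
 qed
 also have "... = (LINT z|parameter_measure. (case z of (k, t) => speed k t) *\<^sub>R f (case z of (k, t) => (gs ! k) t))"
 proof (rule integral_density)
  show "(%z. f (case z of (k, t) => (gs ! k) t)) \<in> borel_measurable parameter_measure" using measurable_compose[OF measurable_arc_map f] by simp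
 qed (use measurable_speed in \<open>auto simp: speed_def\<close>)
 also have "... = (LINT z|(count_space {..<length gs} \<Otimes>\<^sub>M unit_interval). (case z of (k, t) => \<phi> k t))"
  by (simp add: parameter_measure_def \<phi>_def case_prod_beta)
 also have "... = (LINT k|count_space {..<length gs}. LINT t|unit_interval. \<phi> k t)" using P.integral_fst'[OF \<phi>P] by simp
 also have "... = (\<Sum>k<length gs. LINT t|unit_interval. \<phi> k t)" by (rule lebesgue_integral_count_space_finite) simp
 also have "... = (\<Sum>k<length gs. LINT t:{0<..<1}|lebesgue. f ((gs ! k) t) * norm (v k t))" by (rule sum.cong[OF refl]) (rule \<phi>L, simp)
 finally show ?thesis .
qed

end

lemma boundary_parametrization_exists:
 assumes "boundary_arcs Om gs"
 shows "\<exists>v. boundary_parametrization Om gs v"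
proof -
 have "\<exists>d. continuous_on {0..1} d & (\<forall>t\<in>{0<..<1}. (gs ! k has_vector_derivative d t) (at t) & d t ~= 0) &
   (\<forall>t\<in>{0<..<1}. vector_derivative (gs ! k) (at t within {0..1}) = d t)" if k: "k < length gs" for k
 proof -
  obtain d where "continuous_on {0..1} d"
   "!!t. t \<in> {0<..<1} ==> (gs ! k has_vector_derivative d t) (at t)"
   "!!t. t \<in> {0<..<1} ==> d t ~= 0"
   "!!t. t \<in> {0<..<1} ==> vector_derivative (gs ! k) (at t within {0..1}) = d t" by (rule arc_velocity[OF assms nth_mem[OF k]]) (rule that)
  thus ?thesis by (intro exI[of _ d]) simp
 qed
 then obtain v where v: "!!k. k < length gs ==> continuous_on {0..1} (v k) &
   (\<forall>t\<in>{0<..<1}. (gs ! k has_vector_derivative v k t) (at t) & v k t ~= 0) &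
   (\<forall>t\<in>{0<..<1}. vector_derivative (gs ! k) (at t within {0..1}) = v k t)" by metis
 have "boundary_parametrization Om gs v" by unfold_locales (use v assms in auto)
 thus ?thesis by blast
qed

lemma surface_measure_parametrized:
 assumes "piecewise_regular_lipschitz_domain Om"
 obtains gs v where "boundary_parametrization Om gs v" "surface_measure Om = arclength_measure gs"
proof -
 have "boundary_arcs Om (SOME gs. boundary_arcs Om gs)" using assms unfolding piecewise_regular_lipschitz_domain_def by (metis someI_ex)
 thus ?thesis using boundary_parametrization_exists that unfolding surface_measure_def by blast
qed

lemma finite_surface_measure:
 "piecewise_regular_lipschitz_domain Om ==> finite_measure (surface_measure Om)"
 by (metis boundary_parametrization.finite_arclength_measure surface_measure_parametrized)

lemma sets_surface_measure [simp, measurable_cong]: "sets (surface_measure Om) = sets borel" by (simp add: surface_measure_def arclength_measure_def)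

lemma space_surface_measure [simp]: "space (surface_measure Om) = UNIV" by (simp add: surface_measure_def arclength_measure_def)

lemma measurable_outer_normal:
 assumes "piecewise_regular_lipschitz_domain Om"
 shows "(\<lambda>x. indicator (frontier Om) x *\<^sub>R outer_normal Om x) \<in> borel_measurable borel"
 using assms measurable_outer_normal_frontier unfolding piecewise_regular_lipschitz_domain_def by blast

lemma norm_outer_normal_le_1: "norm (outer_normal Om x) <= 1"
proof (cases "\<exists>\<nu>. is_outer_normal Om x \<nu>")
 case True
 then obtain \<nu> where \<nu>: "is_outer_normal Om x \<nu>" by blast
 show ?thesis unfolding outer_normal_eq[OF \<nu>] using \<nu> by (simp add: is_outer_normal_def)
qed (simp add: outer_normal_def)

text \<open>The divergence theorem for \<open>F\<close> times a coordinate vector.\<close>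

theorem divergence_theorem_component:
 fixes F :: "plane => real"
 assumes dom: "piecewise_regular_lipschitz_domain Om"
  and contF: "continuous_on (closure Om) F"
  and dF: "!!x. x \<in> Om ==> (F has_derivative F' x) (at x)"
  and contF': "continuous_on Om (\<lambda>x. F' x (axis i 1))"
  and bdF': "!!x. x \<in> Om ==> \<bar>F' x (axis i 1)\<bar> <= M"
 shows "(LINT x:Om|lborel. F' x (axis i 1)) = (LINT x:frontier Om|surface_measure Om. F x * outer_normal Om x $ i)"
proof -
 have op: "open Om" and bd: "bounded Om" and lip: "lipschitz_boundary Om" using dom by (auto simp: piecewise_regular_lipschitz_domain_def)
 obtain gs v where bp: "boundary_parametrization Om gs v" and sm: "surface_measure Om = arclength_measure gs" by (rule surface_measure_parametrized[OF dom])
 interpret boundary_parametrization Om gs v by (rule bp)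
 note flux = flux_through_boundary_arcs[OF op bd lip arcs contF dF contF' bdF' velocity contv]
 define f where "f x = (indicator (frontier Om) x *\<^sub>R F x) * (indicator (frontier Om) x *\<^sub>R outer_normal Om x) $ i" for x
 have fg: "f ((gs ! k) t) = F ((gs ! k) t) * outer_normal Om ((gs ! k) t) $ i" if "k < length gs" "t \<in> {0<..<1}" for k t
 proof -
  have "(gs ! k) t \<in> path_image (gs ! k)" using that(2) unfolding path_image_def by (intro imageI) auto
  hence "(gs ! k) t \<in> frontier Om" using arcs nth_mem[OF that(1)] unfolding boundary_arcs_def by blast
  thus ?thesis by (simp add: f_def)
 qed
 have fm: "f \<in> borel_measurable borel"
 proof -
  have "continuous_on (frontier Om) F" by (rule continuous_on_subset[OF contF]) (simp add: frontier_def)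
  hence "(%x. indicator (frontier Om) x *\<^sub>R F x) \<in> borel_measurable borel" by (rule borel_measurable_continuous_on_indicator[rotated]) simp
  moreover have "(%x. (indicator (frontier Om) x *\<^sub>R outer_normal Om x) $ i) \<in> borel_measurable borel"
  proof (rule measurable_compose[OF measurable_outer_normal[OF dom]])
   show "(%x::plane. x $ i) \<in> borel_measurable borel" by (intro borel_measurable_continuous_onI continuous_intros)
  qed
  ultimately show ?thesis unfolding f_def[abs_def] by (rule borel_measurable_times)
 qed
 have fi: "set_integrable lebesgue {0<..<1} (%t. f ((gs ! k) t) * norm (v k t))" if k: "k < length gs" for k
 proof -
  have "set_integrable lebesgue {0<..<1} (%t. f ((gs ! k) t) * norm (v k t)) =
   set_integrable lebesgue {0<..<1} (%t. F ((gs ! k) t) * outer_normal Om ((gs ! k) t) $ i * norm (v k t))"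
   by (rule set_integrable_cong) (use fg[OF k] in auto)
  moreover have "set_integrable lebesgue {0<..<1} (%t. F ((gs ! k) t) * outer_normal Om ((gs ! k) t) $ i * norm (v k t))"
   by (rule flux(2)) (assumption | rule k)+
  ultimately show ?thesis by simp
 qed
 have "(LINT x:frontier Om|surface_measure Om. F x * outer_normal Om x $ i) = (LINT x|arclength_measure gs. f x)"
  unfolding sm set_lebesgue_integral_def f_def by (rule Bochner_Integration.integral_cong[OF refl]) (simp add: indicator_def)
 also have "... = (\<Sum>k<length gs. LINT t:{0<..<1}|lebesgue. f ((gs ! k) t) * norm (v k t))" by (rule integral_arclength_measure[OF fm fi])
 also have "... = (\<Sum>k<length gs. LINT t:{0<..<1}|lebesgue. F ((gs ! k) t) * outer_normal Om ((gs ! k) t) $ i * norm (v k t))"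
 proof (rule sum.cong[OF refl])
  fix k assume "k \<in> {..<length gs}"
  hence k: "k < length gs" by simp
  show "(LINT t:{0<..<1}|lebesgue. f ((gs ! k) t) * norm (v k t)) =
    (LINT t:{0<..<1}|lebesgue. F ((gs ! k) t) * outer_normal Om ((gs ! k) t) $ i * norm (v k t))" by (rule set_lebesgue_integral_cong) (use fg[OF k] in auto)
 qed
 also have "... = (LINT x:Om|lborel. F' x (axis i 1))" by (rule flux(1)[symmetric]) assumption+
 finally show ?thesis by (rule sym)
qed

section \<open>Functions that are C^1 up to the boundary\<close>

text \<open>The derivative is carried along as data. On the boundary only its values at basis vectors matter, as the
 continuous extensions of the partial derivatives.\<close>

definition C1_closure ::
  "'a::euclidean_space set => ('a => 'b::real_normed_vector) => ('a => 'a => 'b) => bool" where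
 "C1_closure S f D \<longleftrightarrow> continuous_on (closure S) f & (\<forall>z\<in>S. (f has_derivative D z) (at z)) &
   (\<forall>e\<in>Basis. continuous_on (closure S) (\<lambda>z. D z e))"

lemma C1D:
 assumes "C1_closure S f D"
 shows "continuous_on (closure S) f" "!!z. z \<in> S ==> (f has_derivative D z) (at z)"
  "!!e. e \<in> Basis ==> continuous_on (closure S) (\<lambda>z. D z e)" using assms by (auto simp: C1_closure_def)

lemma C1_closure_imp_Ck_closure:
 assumes "C1_closure S f D"
 shows "Ck_closure 1 S f"
proof -
 have "(f has_derivative (%h. \<Sum>i\<in>Basis. (h \<bullet> i) *\<^sub>R D x i)) (at x)" if "x \<in> S" for x
 proof -
  have d: "(f has_derivative D x) (at x)" by (rule C1D(2)[OF assms that])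
  hence lin: "linear (D x)" by (rule has_derivative_linear)
  have "D x h = (\<Sum>i\<in>Basis. (h \<bullet> i) *\<^sub>R D x i)" for h
  proof -
   have "D x h = D x (\<Sum>i\<in>Basis. (h \<bullet> i) *\<^sub>R i)" by (simp add: euclidean_representation)
   also have "... = (\<Sum>i\<in>Basis. (h \<bullet> i) *\<^sub>R D x i)" by (simp add: linear_sum[OF lin] linear_cmul[OF lin])
   finally show ?thesis .
  qed
  hence "D x = (%h. \<Sum>i\<in>Basis. (h \<bullet> i) *\<^sub>R D x i)" by (rule ext)
  thus ?thesis using d by simp
 qed
 thus ?thesis using assms unfolding C1_closure_def by (auto intro!: exI[of _ "%i x. D x i"])
qed

lemma Ck_closure_Suc_derivative:
 assumes "Ck_closure (Suc k) S f"
 obtains D where "C1_closure S f D" "!!e. e \<in> Basis ==> Ck_closure k S (\<lambda>z. D z e)" "!!z. linear (D z)"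
proof -
 obtain g where c: "continuous_on (closure S) f"
  and g: "\<forall>x\<in>S. (f has_derivative (%h. \<Sum>i\<in>Basis. (h \<bullet> i) *\<^sub>R g i x)) (at x)"
  and gk: "\<forall>i\<in>Basis. Ck_closure k S (g i)" using assms by auto
 define D where "D z h = (\<Sum>i\<in>Basis. (h \<bullet> i) *\<^sub>R g i z)" for z h
 have De: "D z e = g e z" if "e \<in> Basis" for z e
 proof -
  have "D z e = (\<Sum>i\<in>Basis. if i = e then g i z else 0)" unfolding D_def by (rule sum.cong) (use that in \<open>auto simp: inner_Basis\<close>)
  thus ?thesis using that by simp
 qed
 show ?thesis
 proof (rule that[of D])
  show k: "Ck_closure k S (%z. D z e)" if "e \<in> Basis" for e using gk that by (simp add: De)
  have "continuous_on (closure S) (%z. D z e)" if "e \<in> Basis" for e using k[OF that] by (cases k) auto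
  thus "C1_closure S f D" using c g by (auto simp: C1_closure_def D_def[abs_def])
  show "linear (D z)" for z unfolding D_def by (rule linearI) (simp_all add: inner_add_left scaleR_add_left sum.distrib scaleR_sum_right)
 qed
qed

lemma C1_closure_const: "C1_closure S (\<lambda>z. c) (\<lambda>z h. 0)" by (auto simp: C1_closure_def)

lemma C1_closure_diff:
 assumes "C1_closure S f D" "C1_closure S g E"
 shows "C1_closure S (\<lambda>z. f z - g z) (\<lambda>z h. D z h - E z h)" using assms unfolding C1_closure_def by (auto intro!: continuous_intros has_derivative_diff)

lemma C1_closure_add:
 assumes "C1_closure S f D" "C1_closure S g E"
 shows "C1_closure S (\<lambda>z. f z + g z) (\<lambda>z h. D z h + E z h)" using assms unfolding C1_closure_def by (auto intro!: continuous_intros has_derivative_add)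

lemma C1_closure_mult:
 fixes f g :: "'a::euclidean_space => real"
 assumes "C1_closure S f D" "C1_closure S g E"
 shows "C1_closure S (\<lambda>z. f z * g z) (\<lambda>z h. f z * E z h + D z h * g z)"
 using assms unfolding C1_closure_def by (auto intro!: continuous_intros has_derivative_mult)

lemma C1_closure_nth:
 fixes f :: "'a::euclidean_space => 'b::euclidean_space ^ 'n"
 assumes "C1_closure S f D"
 shows "C1_closure S (\<lambda>z. f z $ i) (\<lambda>z h. D z h $ i)" using assms unfolding C1_closure_def
 by (auto intro!: continuous_intros bounded_linear.has_derivative[OF bounded_linear_vec_nth])

lemma C1_closure_compose:
 fixes f :: "'a::euclidean_space => real" and \<theta> :: "real => real"
 assumes f: "C1_closure S f D" and \<theta>: "!!s. s \<in> A ==> (\<theta> has_real_derivative \<theta>' s) (at s)"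
  and c: "continuous_on A \<theta>'" and fA: "!!z. z \<in> closure S ==> f z \<in> A"
 shows "C1_closure S (\<lambda>z. \<theta> (f z)) (\<lambda>z h. \<theta>' (f z) * D z h)" unfolding C1_closure_def
proof (intro conjI ballI)
 have cf: "continuous_on (closure S) f" by (rule C1D(1)[OF f])
 have "continuous_on A \<theta>" using \<theta> by (intro continuous_at_imp_continuous_on ballI DERIV_isCont) auto
 thus "continuous_on (closure S) (%z. \<theta> (f z))" by (rule continuous_on_compose2[OF _ cf]) (use fA in auto)
 have c': "continuous_on (closure S) (%z. \<theta>' (f z))" by (rule continuous_on_compose2[OF c cf]) (use fA in auto)
 show "continuous_on (closure S) (%z. \<theta>' (f z) * D z e)" if "e \<in> Basis" for e by (intro continuous_intros c' C1D(3)[OF f that])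
 show "((%z. \<theta> (f z)) has_derivative (%h. \<theta>' (f z) * D z h)) (at z)" if z: "z \<in> S" for z
 proof -
  have "f z \<in> A" using fA z closure_subset by blast
  hence "(\<theta> has_derivative (%h. \<theta>' (f z) * h)) (at (f z))" using \<theta> by (simp add: has_field_derivative_def)
  from has_derivative_compose[OF C1D(2)[OF f z] this] show ?thesis .
 qed
qed

lemma C1_closure_snd:
 fixes g :: "'b::euclidean_space => 'c::real_normed_vector" and S :: "('a::euclidean_space \<times> 'b) set"
 assumes "C1_closure UNIV g E"
 shows "C1_closure S (\<lambda>z. g (snd z)) (\<lambda>z h. E (snd z) (snd h))" unfolding C1_closure_def
proof (intro conjI ballI)
 have c: "continuous_on UNIV g" using C1D(1)[OF assms] by simp
 show "continuous_on (closure S) (%z. g (snd z))" by (rule continuous_on_compose2[OF c]) (auto intro!: continuous_intros)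
 have d: "(g has_derivative E x) (at x)" for x by (rule C1D(2)[OF assms]) simp
 show "((%z. g (snd z)) has_derivative (%h. E (snd z) (snd h))) (at z)" for z
  by (rule has_derivative_compose[OF _ d]) (auto intro!: derivative_eq_intros)
 have E0: "E x 0 = 0" for x using has_derivative_linear[OF d[of x]] by (rule linear_0)
 show "continuous_on (closure S) (%z. E (snd z) (snd e))" if "e \<in> Basis" for e :: "'a \<times> 'b"
 proof (cases "snd e = 0")
  case True thus ?thesis by (simp add: E0)
 next
  case False
  hence "snd e \<in> Basis" using that by (auto simp: Basis_prod_def)
  hence "continuous_on UNIV (%x. E x (snd e))" using C1D(3)[OF assms] by simp
  thus ?thesis by (rule continuous_on_compose2) (auto intro!: continuous_intros)
 qed
qed

lemma C1_closure_bounded: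
 assumes "C1_closure S f D" "bounded S"
 obtains M where "!!z. z \<in> closure S ==> norm (f z) <= M" "!!z e. z \<in> closure S ==> e \<in> Basis ==> norm (D z e) <= M"
proof -
 have cp: "compact (closure S)" using assms(2) by simp
 have "\<exists>B. \<forall>z\<in>closure S. norm (h z) <= B" if "continuous_on (closure S) h" for h :: "'a => 'b"
 proof -
  have "bounded (h ` closure S)" by (rule compact_imp_bounded[OF compact_continuous_image[OF that cp]])
  thus ?thesis by (auto simp: bounded_iff)
 qed
 note bd = this
 obtain B where B: "\<forall>z\<in>closure S. norm (f z) <= B" using bd[OF C1D(1)[OF assms(1)]] by blast
 have "\<forall>e\<in>Basis. \<exists>B. \<forall>z\<in>closure S. norm (D z e) <= B" using bd C1D(3)[OF assms(1)] by blast
 then obtain C where C: "\<forall>e\<in>Basis. \<forall>z\<in>closure S. norm (D z e) <= C e" by metis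
 show ?thesis
 proof (rule that[of "\<bar>B\<bar> + (\<Sum>e\<in>Basis. \<bar>C e\<bar>)"])
  show "norm (f z) <= \<bar>B\<bar> + (\<Sum>e\<in>Basis. \<bar>C e\<bar>)" if "z \<in> closure S" for z
  proof -
   have "norm (f z) <= B" using B that by blast
   moreover have "0 <= (\<Sum>e\<in>Basis. \<bar>C e\<bar>)" by (rule sum_nonneg) simp
   ultimately show ?thesis by linarith
  qed
  show "norm (D z e) <= \<bar>B\<bar> + (\<Sum>e\<in>Basis. \<bar>C e\<bar>)" if "z \<in> closure S" "e \<in> Basis" for z e
  proof -
   have "norm (D z e) <= \<bar>C e\<bar>" using C that by force
   also have "... <= (\<Sum>e\<in>Basis. \<bar>C e\<bar>)" using that by (intro member_le_sum) auto
   finally show ?thesis by simp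
  qed
 qed
qed

section \<open>Cutting off small values\<close>

text \<open>A \<open>C^1\<close> cut-off on the positive half line: zero for \<open>s \<le> e\<close> and \<open>s - 2 e +
 e^2 / s\<close> beyond; the maxima avoid a case distinction.\<close>

definition trunc_pos :: "real => real => real" where
 "trunc_pos e s = (max (s - e) 0)^2 / max s e"

definition trunc :: "real => real => real" where
 "trunc e s = trunc_pos e s - trunc_pos e (- s)"

definition trunc' :: "real => real => real" where
 "trunc' e s = 1 - (e / max \<bar>s\<bar> e)^2"

lemma trunc_pos_derivative:
 assumes e: "e > 0"
 shows "(trunc_pos e has_real_derivative 1 - (e / max s e)^2) (at s)"
proof -
 consider "s > e" | "s < e" | "s = e" by linarith
 thus ?thesis
 proof cases
  case 1
  have "((%s. (s - e)^2 / s) has_real_derivative 1 - (e / max s e)^2) (at s)"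
   using 1 e by (auto intro!: derivative_eq_intros simp: max_def field_simps power2_eq_square)
  thus ?thesis by (rule has_field_derivative_transform_within_open[of _ _ _ "{e<..}"])
     (use 1 in \<open>auto simp: trunc_pos_def max_def\<close>)
 next
  case 2
  have "((%s. 0) has_real_derivative 1 - (e / max s e)^2) (at s)" using 2 e by (simp add: max_def)
  thus ?thesis by (rule has_field_derivative_transform_within_open[of _ _ _ "{..<e}"])
     (use 2 in \<open>auto simp: trunc_pos_def max_def\<close>)
 next
  case 3
  have "((%y. (trunc_pos e y - trunc_pos e e) / (y - e)) \<longlongrightarrow> 0) (at e)"
  proof (rule Lim_null_comparison)
   show "\<forall>\<^sub>F y in at e. norm ((trunc_pos e y - trunc_pos e e) / (y - e)) <= \<bar>y - e\<bar> / e"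
   proof (intro always_eventually allI)
    fix y
    show "norm ((trunc_pos e y - trunc_pos e e) / (y - e)) <= \<bar>y - e\<bar> / e"
    proof (cases "y > e")
     case True
     hence "norm ((trunc_pos e y - trunc_pos e e) / (y - e)) = (y - e) / y" using e by (simp add: trunc_pos_def max_def power2_eq_square abs_mult)
     also have "... <= (y - e) / e" using True e by (intro divide_left_mono) auto
     finally show ?thesis using True by simp
    qed (use e in \<open>simp add: trunc_pos_def max_def\<close>)
   qed
   show "((%y. \<bar>y - e\<bar> / e) \<longlongrightarrow> 0) (at e)" using e by (auto intro!: tendsto_eq_intros)
  qed
  thus ?thesis using 3 e by (simp add: has_field_derivative_iff)
 qed
qed

lemma trunc_derivative:
 assumes e: "e > 0"
 shows "(trunc e has_real_derivative trunc' e s) (at s)"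
proof -
 have "((%s. trunc_pos e (- s)) has_real_derivative (1 - (e / max (- s) e)^2) * (- 1)) (at s)"
  by (rule DERIV_chain2[OF trunc_pos_derivative[OF e]]) (auto intro!: derivative_eq_intros)
 from DERIV_diff[OF trunc_pos_derivative[OF e, of s] this]
 have "(trunc e has_real_derivative 1 - (e / max s e)^2 - (1 - (e / max (- s) e)^2) * (- 1)) (at s)" unfolding trunc_def[abs_def] .
 moreover have "1 - (e / max s e)^2 - (1 - (e / max (- s) e)^2) * (- 1) = trunc' e s" using e by (cases "s >= 0") (auto simp: trunc'_def max_def)
 ultimately show ?thesis by simp
qed

lemma continuous_trunc': "e > 0 ==> continuous_on A (trunc' e)" unfolding trunc'_def by (intro continuous_intros) auto

lemma trunc'_bounds: "e > 0 ==> 0 <= trunc' e s & trunc' e s <= 1"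
proof -
 assume e: "e > 0"
 have "(e / max \<bar>s\<bar> e)^2 <= 1^2" by (rule power_mono) (use e in auto)
 thus ?thesis by (simp add: trunc'_def)
qed

lemma trunc_zero: "e > 0 ==> \<bar>s\<bar> <= e ==> trunc e s = 0" by (auto simp: trunc_def trunc_pos_def max_def)

lemma trunc'_zero: "e > 0 ==> \<bar>s\<bar> <= e ==> trunc' e s = 0" by (auto simp: trunc'_def max_def)

lemma trunc_eq: "e > 0 ==> \<bar>s\<bar> > e ==> trunc e s = s - 2 * e * sgn s + e^2 / s"
 by (cases "s > 0") (auto simp: trunc_def trunc_pos_def max_def field_simps power2_eq_square)

lemma abs_trunc_le: "e > 0 ==> \<bar>trunc e s\<bar> <= \<bar>s\<bar>"
proof -
 assume e: "e > 0"
 have p: "0 <= trunc_pos e t & trunc_pos e t <= max t 0" for t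
 proof (cases "t > e")
  case True
  hence "(t - e) * (t - e) <= t * t" using e by (intro mult_mono) auto
  thus ?thesis using True e by (simp add: trunc_pos_def max_def power2_eq_square divide_le_eq)
 qed (use e in \<open>simp add: trunc_pos_def max_def\<close>)
 have "0 <= trunc_pos e s" "trunc_pos e s <= max s 0" "0 <= trunc_pos e (- s)" "trunc_pos e (- s) <= max (- s) 0" using p by blast+
 thus ?thesis unfolding trunc_def by linarith
qed

definition trunc_seq :: "nat => real" where "trunc_seq n = 1 / real (Suc n)"

lemma trunc_seq_pos [simp]: "trunc_seq n > 0" by (simp add: trunc_seq_def)

lemma trunc_seq_tendsto: "trunc_seq \<longlonglongrightarrow> 0" unfolding trunc_seq_def[abs_def] using LIMSEQ_inverse_real_of_nat by (simp add: inverse_eq_divide)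

lemma trunc_tendsto: "(\<lambda>n. trunc (trunc_seq n) s) \<longlonglongrightarrow> s"
proof (cases "s = 0")
 case True thus ?thesis by (simp add: trunc_zero less_imp_le)
next
 case False
 have "\<forall>\<^sub>F n in sequentially. trunc_seq n < \<bar>s\<bar>" using order_tendstoD(2)[OF trunc_seq_tendsto] False by simp
 hence ev: "\<forall>\<^sub>F n in sequentially. s - 2 * trunc_seq n * sgn s + (trunc_seq n)^2 / s = trunc (trunc_seq n) s"
  by eventually_elim (simp add: trunc_eq)
 have "(%n. s - 2 * trunc_seq n * sgn s + (trunc_seq n)^2 / s) \<longlonglongrightarrow> s - 2 * 0 * sgn s + 0^2 / s"
  using False by (intro tendsto_intros trunc_seq_tendsto)
 hence "(%n. s - 2 * trunc_seq n * sgn s + (trunc_seq n)^2 / s) \<longlonglongrightarrow> s" by simp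
 thus ?thesis by (rule Lim_transform_eventually[OF _ ev])
qed

lemma trunc'_tendsto: "s ~= 0 ==> (\<lambda>n. trunc' (trunc_seq n) s) \<longlonglongrightarrow> 1"
proof -
 assume s: "s ~= 0"
 have "(%n. 1 - (trunc_seq n / max \<bar>s\<bar> (trunc_seq n))^2) \<longlonglongrightarrow> 1 - (0 / max \<bar>s\<bar> 0)^2"
  using s by (intro tendsto_intros trunc_seq_tendsto) auto
 thus ?thesis by (simp add: trunc'_def)
qed

lemma trunc'_mult_tendsto:
 assumes "s = 0 --> d = 0"
 shows "(\<lambda>n. trunc' (trunc_seq n) s * d) \<longlonglongrightarrow> d"
proof (cases "s = 0")
 case False
 from tendsto_mult[OF trunc'_tendsto[OF False] tendsto_const[of d]] show ?thesis by simp
qed (use assms in simp)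

lemma countable_if_isolated:
 fixes X :: "'a::second_countable_topology set"
 assumes iso: "!!x. x \<in> X ==> \<exists>T. open T & T \<inter> X = {x}"
 shows "countable X"
proof -
 obtain B :: "'a set set" where B: "countable B" "topological_basis B" using ex_countable_basis by blast
 have "X <= (%b. the_elem (b \<inter> X)) ` B"
 proof
  fix x assume "x \<in> X"
  then obtain T where T: "open T" "T \<inter> X = {x}" using iso by blast
  hence "x \<in> T" by blast
  with B(2) T(1) obtain b where "b \<in> B" "x \<in> b" "b <= T" by (rule topological_basisE)
  hence "b \<in> B" "b \<inter> X = {x}" using T(2) \<open>x \<in> X\<close> by blast+
  thus "x \<in> (%b. the_elem (b \<inter> X)) ` B" by (intro image_eqI[of _ _ b]) simp_all
 qed
 thus ?thesis by (rule countable_subset[OF _ countable_image[OF B(1)]])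
qed

text \<open>On every line parallel to \<open>e\<close> the points in question are isolated, hence countable. Averaging the
 translates of the set along \<open>e\<close> and exchanging the integrals shows that its measure is zero.\<close>

lemma negligible_transversal_zeros:
 fixes f :: "'a::euclidean_space => real"
 assumes S: "open S" and d: "!!z. z \<in> S ==> (f has_derivative D z) (at z)" and cD: "continuous_on S (\<lambda>z. D z e)"
 shows "negligible {z \<in> S. f z = 0 & D z e ~= 0}"
proof -
 let ?Z = "{z \<in> S. f z = 0 & D z e ~= 0}"
 have cf: "continuous_on S f" using d by (intro continuous_at_imp_continuous_on) (auto intro: has_derivative_continuous)
 have m: "(%z. indicator S z *\<^sub>R f z) \<in> borel_measurable borel" "(%z. indicator S z *\<^sub>R D z e) \<in> borel_measurable borel"
  using S by (intro borel_measurable_continuous_on_indicator cf cD; simp)+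
 have "?Z = S \<inter> {z \<in> space borel. indicator S z *\<^sub>R f z = 0 & indicator S z *\<^sub>R D z e ~= 0}" by (auto simp: indicator_def)
 also have "... \<in> sets borel" using S by (intro sets.Int borel_open sets.sets_Collect_conj borel_measurable_eq borel_measurable_neq m borel_measurable_const)
 finally have Z: "?Z \<in> sets borel" .
 have countable: "countable {s. z + s *\<^sub>R e \<in> ?Z}" for z
 proof (rule countable_if_isolated)
  fix s assume s: "s \<in> {s. z + s *\<^sub>R e \<in> ?Z}"
  let ?x = "z + s *\<^sub>R e" and ?h = "%t. f (z + t *\<^sub>R e)"
  have "((%t. z + t *\<^sub>R e) has_derivative (%t. t *\<^sub>R e)) (at s)" by (auto intro!: derivative_eq_intros)
  moreover have dx: "(f has_derivative D ?x) (at ?x)" using s d by simp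
  ultimately have "(?h has_derivative (%t. D ?x (t *\<^sub>R e))) (at s)" by (rule has_derivative_compose)
  hence "(?h has_real_derivative D ?x e) (at s)" by (simp add: has_field_derivative_def linear_cmul[OF has_derivative_linear[OF dx]] mult.commute[of _ "D ?x e"])
  hence "((%t. (?h t - ?h s) / (t - s)) \<longlongrightarrow> D ?x e) (at s)" by (simp add: has_field_derivative_iff)
  hence "\<forall>\<^sub>F t in at s. (?h t - ?h s) / (t - s) ~= 0" using s by (intro tendsto_imp_eventually_ne) auto
  hence "\<forall>\<^sub>F t in at s. ?h t ~= 0" by eventually_elim (use s in auto)
  then obtain W where W: "open W" "s \<in> W" "!!t. t \<in> W ==> t ~= s ==> ?h t ~= 0" unfolding eventually_at_topological by blast
  hence "W \<inter> {s. z + s *\<^sub>R e \<in> ?Z} = {s}" using s by auto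
  thus "\<exists>T. open T & T \<inter> {s. z + s *\<^sub>R e \<in> ?Z} = {s}" using W(1) by blast
 qed
 have shift: "(\<integral>\<^sup>+z. indicator ?Z (z + s *\<^sub>R e) \<partial>lborel) = emeasure lborel ?Z" for s
 proof -
  have "emeasure lborel ?Z = (\<integral>\<^sup>+z. indicator ?Z z \<partial>distr lborel borel ((+) (s *\<^sub>R e)))" using Z by (simp add: lborel_distr_plus)
  also have "... = (\<integral>\<^sup>+z. indicator ?Z (s *\<^sub>R e + z) \<partial>lborel)" by (rule nn_integral_distr) (use Z in simp_all)
  finally show ?thesis by (simp add: add.commute)
 qed
 have "emeasure lborel ?Z = (\<integral>\<^sup>+s. emeasure lborel ?Z * indicator {0..1::real} s \<partial>lborel)" by (simp add: nn_integral_cmult_indicator)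
 also have "... = (\<integral>\<^sup>+s. \<integral>\<^sup>+z. indicator ?Z (z + s *\<^sub>R e) * indicator {0..1} s \<partial>lborel \<partial>lborel)"
  using Z by (simp add: nn_integral_multc shift)
 also have "... = (\<integral>\<^sup>+z. \<integral>\<^sup>+s. indicator ?Z (z + s *\<^sub>R e) * indicator {0..1} s \<partial>lborel \<partial>lborel)"
  by (rule lborel_pair.Fubini'[symmetric]) (use Z in measurable)
 also have "... = (\<integral>\<^sup>+z. 0 \<partial>(lborel :: 'a measure))"
 proof (rule nn_integral_cong)
  fix z
  have "AE s in lborel. s ~: {s. z + s *\<^sub>R e \<in> ?Z}"
   by (rule AE_not_in) (rule null_setsI[OF emeasure_lborel_countable[OF countable] sets.countable[OF _ countable]], simp)
  hence "(\<integral>\<^sup>+s. indicator ?Z (z + s *\<^sub>R e) * indicator {0..1} s \<partial>lborel) = (\<integral>\<^sup>+s. 0 \<partial>(lborel :: real measure))"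
   by (intro nn_integral_cong_AE) (elim eventually_mono, auto simp: indicator_def)
  thus "(\<integral>\<^sup>+s. indicator ?Z (z + s *\<^sub>R e) * indicator {0..1} s \<partial>lborel) = 0" by simp
 qed
 finally have "?Z \<in> null_sets lborel" using Z by (simp add: null_sets_def)
 thus ?thesis unfolding negligible_iff_null_sets by (rule null_sets_completionI)
qed

section \<open>Compactly supported C^1 functions\<close>

definition compact_C1 :: "plane set => (plane => real) => (plane => plane) => bool" where
 "compact_C1 Om f g \<longleftrightarrow> (\<forall>x. (f has_derivative (\<lambda>h. g x \<bullet> h)) (at x)) & continuous_on UNIV g &
   (\<exists>K. compact K & K <= Om & (\<forall>x. x ~: K --> f x = 0 & g x = 0))"

lemma compact_C1D:
 assumes "compact_C1 Om f g"
 shows "!!x. (f has_derivative (\<lambda>h. g x \<bullet> h)) (at x)" "continuous_on UNIV f" "continuous_on UNIV g"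
  "\<exists>K. compact K & K <= Om & (\<forall>x. x ~: K --> f x = 0 & g x = 0)" using assms unfolding compact_C1_def
 by (auto intro!: continuous_at_imp_continuous_on has_derivative_continuous)

lemma compact_C1_mono: "compact_C1 Om f g ==> Om <= Om' ==> compact_C1 Om' f g"
 unfolding compact_C1_def by blast

lemma compact_C1_extend_by_zero:
 assumes op: "open Om" and K: "compact K" "K <= Om"
  and d: "!!x. x \<in> Om ==> (f has_derivative (\<lambda>h. g x \<bullet> h)) (at x)"
  and cg: "continuous_on Om g" and z: "!!x. x \<in> Om ==> x ~: K ==> f x = 0 & g x = 0"
 shows "compact_C1 Om (\<lambda>x. if x \<in> Om then f x else 0) (\<lambda>x. if x \<in> Om then g x else 0)"
proof -
 let ?f = "%x. if x \<in> Om then f x else 0" and ?g = "%x. if x \<in> Om then g x else 0"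
 have oK: "open (- K)" using compact_imp_closed[OF K(1)] by (simp add: open_Compl)
 have zK: "?f x = 0 & ?g x = 0" if "x ~: K" for x using z that by auto
 have "(?f has_derivative (%h. ?g x \<bullet> h)) (at x)" for x
 proof (cases "x \<in> Om")
  case True
  have "(?f has_derivative (%h. g x \<bullet> h)) (at x)" by (rule has_derivative_transform_within_open[OF d[OF True] op True]) simp
  thus ?thesis using True by simp
 next
  case False
  hence "x \<in> - K" using K by auto
  have "(?f has_derivative (%h. 0)) (at x)"
   by (rule has_derivative_transform_within_open[OF has_derivative_const[of 0] oK \<open>x \<in> - K\<close>]) (use zK in auto)
  thus ?thesis using False by simp
 qed
 moreover have "continuous_on UNIV ?g"
 proof -
  have "continuous_on Om ?g" using cg by (rule continuous_on_eq) simp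
  moreover have "continuous_on (- K) ?g" by (rule continuous_on_eq[OF continuous_on_const[of _ 0]]) (use zK in auto)
  ultimately have "continuous_on (Om \<union> - K) ?g" using op oK by (intro continuous_on_open_Un)
  moreover have "Om \<union> - K = UNIV" using K by blast
  ultimately show ?thesis by simp
 qed
 ultimately show ?thesis unfolding compact_C1_def using K zK by blast
qed

lemma compact_C1_mult_local:
 assumes op: "open Om" and f: "compact_C1 Om f g"
  and d: "!!x. x \<in> Om ==> (h has_derivative (\<lambda>v. h' x \<bullet> v)) (at x)" and c: "continuous_on Om h'"
 shows "compact_C1 Om (\<lambda>x. if x \<in> Om then f x * h x else 0)
  (\<lambda>x. if x \<in> Om then f x *\<^sub>R h' x + h x *\<^sub>R g x else 0)"
proof -
 obtain K where K: "compact K" "K <= Om" "!!x. x ~: K ==> f x = 0 & g x = 0" using compact_C1D(4)[OF f] by blast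
 show ?thesis
 proof (rule compact_C1_extend_by_zero[OF op K(1,2)])
  show "((%x. f x * h x) has_derivative (%v. (f x *\<^sub>R h' x + h x *\<^sub>R g x) \<bullet> v)) (at x)" if "x \<in> Om" for x
   by (rule has_derivative_eq_rhs[OF has_derivative_mult[OF compact_C1D(1)[OF f] d[OF that]]])
     (auto simp: inner_add_left algebra_simps)
  have "continuous_on Om h" by (intro continuous_at_imp_continuous_on ballI has_derivative_continuous[OF d])
  thus "continuous_on Om (%x. f x *\<^sub>R h' x + h x *\<^sub>R g x)"
   by (intro continuous_intros c continuous_on_subset[OF compact_C1D(2)[OF f]] continuous_on_subset[OF compact_C1D(3)[OF f]]) auto
 qed (use K(3) in auto)
qed

lemma compact_C1_mult:
 assumes f: "compact_C1 Om f g"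
  and d: "!!x. (h has_derivative (\<lambda>v. h' x \<bullet> v)) (at x)" and c: "continuous_on UNIV h'"
 shows "compact_C1 UNIV (\<lambda>x. f x * h x) (\<lambda>x. f x *\<^sub>R h' x + h x *\<^sub>R g x)"
 using compact_C1_mult_local[OF open_UNIV compact_C1_mono[OF f] d c] by simp

lemma integrable_compact_support:
 fixes f :: "plane => real"
 assumes "continuous_on UNIV f" "compact K" "!!x. x ~: K ==> f x = 0"
 shows "integrable lborel f"
proof -
 have "integrable lborel (%x. indicator K x *\<^sub>R f x)" using borel_integrable_compact[OF assms(2) continuous_on_subset[OF assms(1)]] by simp
 moreover have "(%x. indicator K x *\<^sub>R f x) = f" using assms(3) by (auto simp: fun_eq_iff indicator_def)
 ultimately show ?thesis by simp
qed

lemma compact_C1_integrable: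
 fixes w :: "plane => real"
 assumes "compact_C1 Om f g" "continuous_on UNIV w"
 shows "integrable lborel (\<lambda>x. f x * w x)" "integrable lborel (\<lambda>x. g x $ j * w x)"
proof -
 obtain K where K: "compact K" "K <= Om" "!!x. x ~: K ==> f x = 0 & g x = 0" using compact_C1D(4)[OF assms(1)] by blast
 show "integrable lborel (%x. f x * w x)" by (rule integrable_compact_support[OF _ K(1)])
    (use K(3) in \<open>auto intro!: continuous_intros assms(2) compact_C1D(2)[OF assms(1)]\<close>)
 show "integrable lborel (%x. g x $ j * w x)" by (rule integrable_compact_support[OF _ K(1)])
    (use K(3) in \<open>auto intro!: continuous_intros assms(2) compact_C1D(3)[OF assms(1)]\<close>)
qed

lemma compact_C1_lipschitz:
 assumes f: "compact_C1 Om f g"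
 shows "\<exists>M\<ge>0. \<forall>x v. \<bar>f (x + v) - f x\<bar> <= M * norm v"
proof -
 obtain K where K: "compact K" "!!x. x ~: K ==> f x = 0 & g x = 0" using compact_C1D(4)[OF f] by blast
 have "bounded (g ` K)" by (rule compact_imp_bounded[OF compact_continuous_image[OF continuous_on_subset[OF compact_C1D(3)[OF f]] K(1)]]) simp
 then obtain M where M: "!!x. x \<in> K ==> norm (g x) <= M" by (auto simp: bounded_iff)
 have gM: "norm (g x) <= \<bar>M\<bar>" for x using M[of x] K(2)[of x] by (cases "x \<in> K") auto
 have "norm (f y - f x) <= \<bar>M\<bar> * norm (y - x)" for x y
 proof (rule differentiable_bound[where S = UNIV])
  show "(f has_derivative (%h. g z \<bullet> h)) (at z within UNIV)" for z using compact_C1D(1)[OF f] by simp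
  show "onorm (%h. g z \<bullet> h) <= \<bar>M\<bar>" for z
   by (rule onorm_le) (metis Cauchy_Schwarz_ineq2 gM mult_right_mono norm_ge_zero order_trans real_norm_def)
 qed auto
 from this[of "x + v" x for x v] show ?thesis by (intro exI[of _ "\<bar>M\<bar>"]) auto
qed

lemma difference_quotient_limit:
 assumes f: "compact_C1 Om f g" and w: "continuous_on UNIV w" and wi: "integrable lborel w" and s: "s ~= 0"
 shows "(\<lambda>n. LINT x|lborel. w x * ((f (x + (s / real (Suc n)) *\<^sub>R axis j 1) - f x) / (s / real (Suc n))))
   \<longlonglongrightarrow> (LINT x|lborel. w x * g x $ j)"
proof -
 obtain M where M: "M >= 0" "!!x v. \<bar>f (x + v) - f x\<bar> <= M * norm v" using compact_C1_lipschitz[OF f] by blast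
 define t where "t n = s / real (Suc n)" for n
 have t0: "t n ~= 0" for n using s by (simp add: t_def)
 have tl: "t \<longlonglongrightarrow> 0" using tendsto_mult[OF tendsto_const[of s] LIMSEQ_inverse_real_of_nat] by (simp add: t_def[abs_def] divide_inverse)
 have "(%n. LINT x|lborel. w x * ((f (x + t n *\<^sub>R axis j 1) - f x) / t n)) \<longlonglongrightarrow> (LINT x|lborel. w x * g x $ j)"
 proof (rule integral_dominated_convergence[where w = "%x. \<bar>w x\<bar> * M"])
  show "(%x. w x * g x $ j) \<in> borel_measurable lborel" using w compact_C1D(3)[OF f] by (simp, intro borel_measurable_continuous_onI continuous_intros)
  show "(%x. w x * ((f (x + t n *\<^sub>R axis j 1) - f x) / t n)) \<in> borel_measurable lborel" for n
   using w t0[of n] by (simp, intro borel_measurable_continuous_onI continuous_intros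
     continuous_on_compose2[OF compact_C1D(2)[OF f]]) auto
  show "integrable lborel (%x. \<bar>w x\<bar> * M)" using wi by simp
  show "AE x in lborel. norm (w x * ((f (x + t n *\<^sub>R axis j 1) - f x) / t n)) <= \<bar>w x\<bar> * M" for n
  proof (intro AE_I2)
   fix x
   have "\<bar>f (x + t n *\<^sub>R axis j 1) - f x\<bar> <= M * \<bar>t n\<bar>" using M(2)[of x "t n *\<^sub>R axis j 1"] by simp
   hence "\<bar>(f (x + t n *\<^sub>R axis j 1) - f x) / t n\<bar> <= M" using t0[of n] by (simp add: abs_divide pos_divide_le_eq)
   thus "norm (w x * ((f (x + t n *\<^sub>R axis j 1) - f x) / t n)) <= \<bar>w x\<bar> * M" unfolding real_norm_def abs_mult by (rule mult_left_mono) simp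
  qed
  show "AE x in lborel. (%n. w x * ((f (x + t n *\<^sub>R axis j 1) - f x) / t n)) \<longlonglongrightarrow> w x * g x $ j"
  proof (intro AE_I2 tendsto_intros)
   fix x :: plane
   have "((%r. x + r *\<^sub>R axis j 1) has_derivative (%r. r *\<^sub>R axis j 1)) (at 0)" by (auto intro!: derivative_eq_intros)
   moreover have "(f has_derivative (%h. g x \<bullet> h)) (at (x + 0 *\<^sub>R axis j 1))" using compact_C1D(1)[OF f] by simp
   ultimately have "((%r. f (x + r *\<^sub>R axis j 1)) has_derivative (%r. g x \<bullet> (r *\<^sub>R axis j 1))) (at 0)"
    by (rule has_derivative_compose)
   hence "((%r. f (x + r *\<^sub>R axis j 1)) has_real_derivative g x $ j) (at 0)"
    by (simp add: has_field_derivative_def inner_axis mult.commute[of _ "g x $ j"])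
   hence "((%r. (f (x + r *\<^sub>R axis j 1) - f x) / r) \<longlongrightarrow> g x $ j) (at 0)" by (simp add: has_field_derivative_iff)
   moreover have "filterlim t (at 0) sequentially" using tl t0 by (simp add: filterlim_at)
   ultimately show "(%n. (f (x + t n *\<^sub>R axis j 1) - f x) / t n) \<longlonglongrightarrow> g x $ j" by (rule filterlim_compose)
  qed
 qed
 thus ?thesis by (simp add: t_def)
qed

lemma lborel_integral_shift:
 fixes f :: "'a::euclidean_space => real"
 assumes "f \<in> borel_measurable borel"
 shows "(LINT x|lborel. f (x + a)) = (LINT x|lborel. f x)"
proof -
 have "(LINT x|lborel. f x) = (LINT x|distr lborel borel ((+) a). f x)" by (simp add: lborel_distr_plus)
 also have "... = (LINT x|lborel. f (a + x))" by (rule integral_distr) (use assms in auto)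
 finally show ?thesis by (simp add: add.commute)
qed

lemma lborel_integrable_shift:
 fixes f :: "'a::euclidean_space => real"
 assumes "integrable lborel f"
 shows "integrable lborel (\<lambda>x. f (x + a))"
proof -
 have "integrable (distr lborel borel ((+) a)) f" using assms by (simp add: lborel_distr_plus)
 hence "integrable lborel (%x. f (a + x))" by (rule integrable_distr[rotated]) simp
 thus ?thesis by (simp add: add.commute)
qed

lemma integral_partial_derivative_zero:
 assumes f: "compact_C1 Om f g"
 shows "(LINT x|lborel. g x $ j) = 0"
proof -
 obtain K where K: "compact K" "!!x. x ~: K ==> f x = 0 & g x = 0" using compact_C1D(4)[OF f] by blast
 have fi: "integrable lborel f" using compact_C1_integrable(1)[OF f continuous_on_const[of _ 1]] by simp
 have fm: "f \<in> borel_measurable borel" by (rule borel_measurable_continuous_onI[OF compact_C1D(2)[OF f]])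
 obtain R where R: "R > 0" "!!x. x \<in> K ==> norm x <= R" using compact_imp_bounded[OF K(1)] by (auto simp: bounded_pos)
 define w where "w x = max 0 (min 1 (R + 2 - norm x))" for x :: plane
 have cw: "continuous_on UNIV w" unfolding w_def by (intro continuous_intros)
 have wi: "integrable lborel w" by (rule integrable_compact_support[OF cw, of "cball 0 (R + 2)"]) (auto simp: w_def)
 have w1: "w x = 1" if "norm x <= R + 1" for x using that by (simp add: w_def)
 have z: "(LINT x|lborel. w x * ((f (x + (1 / real (Suc n)) *\<^sub>R axis j 1) - f x) / (1 / real (Suc n)))) = 0" for n
 proof -
  let ?v = "(1 / real (Suc n)) *\<^sub>R axis j 1 :: plane"
  have nv: "norm ?v <= 1" by simp
  have "w x * ((f (x + ?v) - f x) / (1 / real (Suc n))) = real (Suc n) * (f (x + ?v) - f x)" for x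
  proof (cases "norm x <= R + 1")
   case True thus ?thesis using w1 by simp
  next
   case False
   have "norm x <= norm (x + ?v) + norm ?v" using norm_triangle_ineq4[of "x + ?v" ?v] by simp
   hence "norm (x + ?v) > R" using False nv by linarith
   hence "f (x + ?v) = 0" "f x = 0" using K(2) R(2) False by (meson not_less, fastforce)
   thus ?thesis by simp
  qed
  hence "(LINT x|lborel. w x * ((f (x + ?v) - f x) / (1 / real (Suc n)))) = (LINT x|lborel. real (Suc n) * (f (x + ?v) - f x))" by (simp only:)
  also have "... = real (Suc n) * ((LINT x|lborel. f (x + ?v)) - (LINT x|lborel. f x))" using lborel_integrable_shift[OF fi, of ?v] fi by simp
  also have "... = 0" using lborel_integral_shift[OF fm, of ?v] by simp
  finally show ?thesis .
 qed
 have "(LINT x|lborel. w x * g x $ j) = (LINT x|lborel. g x $ j)"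
 proof (rule Bochner_Integration.integral_cong[OF refl])
  fix x show "w x * g x $ j = g x $ j"
  proof (cases "x \<in> K")
   case True thus ?thesis using R(2)[OF True] w1[of x] by simp
  qed (use K(2) in simp)
 qed
 moreover have "(%n. 0) \<longlonglongrightarrow> (LINT x|lborel. w x * g x $ j)" using difference_quotient_limit[OF f cw wi, of 1 j] unfolding z by simp
 ultimately show ?thesis using LIMSEQ_unique[OF _ tendsto_const] by metis
qed

lemma compact_C1_parts:
 assumes f: "compact_C1 Om f g" and d: "!!x. (h has_derivative (\<lambda>v. h' x \<bullet> v)) (at x)" and c: "continuous_on UNIV h'"
 shows "(LINT x|lborel. g x $ j * h x) = - (LINT x|lborel. f x * h' x $ j)"
proof -
 have ch: "continuous_on UNIV h" by (intro continuous_at_imp_continuous_on ballI has_derivative_continuous[OF d])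
 have "(LINT x|lborel. (f x *\<^sub>R h' x + h x *\<^sub>R g x) $ j) = 0" by (rule integral_partial_derivative_zero[OF compact_C1_mult[OF f d c]])
 moreover have "(LINT x|lborel. (f x *\<^sub>R h' x + h x *\<^sub>R g x) $ j) = (LINT x|lborel. f x * h' x $ j + g x $ j * h x)" by (simp add: mult.commute)
 moreover have "... = (LINT x|lborel. f x * h' x $ j) + (LINT x|lborel. g x $ j * h x)"
  by (intro Bochner_Integration.integral_add compact_C1_integrable[OF f] ch continuous_intros c)
 ultimately show ?thesis by simp
qed

text \<open>Integrate \<open>\<partial>_1 (x_1 f^2)\<close>, which gives zero, and use the inequality of Cauchy and Schwarz
 in the form of a completed square.\<close>

lemma compact_C1_poincare:
 assumes f: "compact_C1 Om f g" and R: "!!x. x \<in> Om ==> norm x <= R"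
 shows "(LINT x|lborel. (f x)^2) <= 4 * R^2 * (LINT x|lborel. (g x $ 1)^2)"
proof -
 obtain K where K: "compact K" "K <= Om" "!!x. x ~: K ==> f x = 0 & g x = 0" using compact_C1D(4)[OF f] by blast
 have cf: "continuous_on UNIV f" and cg: "continuous_on UNIV g" using compact_C1D(2,3)[OF f] by auto
 define h where "h x = f x * x $ 1" for x
 define h' where "h' x = f x *\<^sub>R axis 1 1 + x $ 1 *\<^sub>R g x" for x
 have d: "(h has_derivative (%v. h' x \<bullet> v)) (at x)" for x unfolding h_def h'_def
  by (rule has_derivative_eq_rhs[OF has_derivative_mult[OF compact_C1D(1)[OF f] bounded_linear_imp_has_derivative[OF bounded_linear_vec_nth]]])
    (auto simp: inner_add_left inner_axis' fun_eq_iff mult.commute)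
 have ch': "continuous_on UNIV h'" unfolding h'_def by (intro continuous_intros cf cg)
 have p: "(LINT x|lborel. g x $ 1 * h x) = - (LINT x|lborel. f x * h' x $ 1)" by (rule compact_C1_parts[OF f d ch'])
 have i1: "integrable lborel (%x. (f x)^2)" using compact_C1_integrable(1)[OF f cf] by (simp add: power2_eq_square)
 have i2: "integrable lborel (%x. g x $ 1 * h x)" by (rule compact_C1_integrable(2)[OF f]) (unfold h_def, intro continuous_intros cf)
 have i3: "integrable lborel (%x. (g x $ 1)^2)"
  using compact_C1_integrable(2)[OF f, of "%x. g x $ 1" 1] cg by (simp add: power2_eq_square continuous_intros)
 have "f x * h' x $ 1 = (f x)^2 + g x $ 1 * h x" for x by (simp add: h'_def h_def algebra_simps power2_eq_square)
 hence "(LINT x|lborel. f x * h' x $ 1) = (LINT x|lborel. (f x)^2) + (LINT x|lborel. g x $ 1 * h x)" using i1 i2 by simp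
 hence eq: "(LINT x|lborel. (f x)^2) = (LINT x|lborel. (- 2) * (g x $ 1 * h x))" using p by simp
 also have "... <= (LINT x|lborel. (1 / 2) * (f x)^2 + (2 * R^2) * (g x $ 1)^2)"
 proof (rule integral_mono)
  fix x
  show "- 2 * (g x $ 1 * h x) <= 1 / 2 * (f x)^2 + 2 * R^2 * (g x $ 1)^2"
  proof (cases "x \<in> K")
   case False thus ?thesis using K(3) by (simp add: h_def)
  next
   case True
   have "\<bar>x $ 1\<bar> <= \<bar>R\<bar>" using R[of x] K(2) True component_le_norm_cart[of x 1] by force
   hence "(x $ 1)^2 <= R^2" by (simp add: abs_le_square_iff)
   hence "2 * ((x $ 1)^2 * (g x $ 1)^2) <= 2 * (R^2 * (g x $ 1)^2)" by (intro mult_left_mono mult_right_mono) auto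
   moreover have "0 <= (f x / 2 + x $ 1 * g x $ 1)^2 * 2" by simp
   hence "- 2 * (g x $ 1 * h x) <= 1 / 2 * (f x)^2 + 2 * ((x $ 1)^2 * (g x $ 1)^2)"
    unfolding h_def by (simp add: power2_eq_square algebra_simps)
   ultimately show ?thesis by simp
  qed
 qed (use i1 i2 i3 in auto)
 also have "... = (1 / 2) * (LINT x|lborel. (f x)^2) + (2 * R^2) * (LINT x|lborel. (g x $ 1)^2)" using i1 i3 by simp
 finally show ?thesis by simp
qed

text \<open>Second derivatives are not available, so one of the first derivatives is replaced by a difference quotient;
 moving it to the other factor is translation invariance of the integral.\<close>

lemma compact_C1_null_lagrangian:
 assumes f: "compact_C1 Om f f'" and g: "compact_C1 Om g g'"
 shows "(LINT x|lborel. f' x $ i * g' x $ j) = (LINT x|lborel. f' x $ j * g' x $ i)"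
proof -
 have cf: "continuous_on UNIV f" and cf': "continuous_on UNIV f'" using compact_C1D(2,3)[OF f] by auto
 have cg: "continuous_on UNIV g" and cg': "continuous_on UNIV g'" using compact_C1D(2,3)[OF g] by auto
 have fi: "integrable lborel (%x. f' x $ i)" using compact_C1_integrable(2)[OF f continuous_on_const[of _ 1]] by simp
 have gi: "integrable lborel (%x. g' x $ i)" using compact_C1_integrable(2)[OF g continuous_on_const[of _ 1]] by simp
 have L1: "(%n. LINT x|lborel. f' x $ i * ((g (x + (1 / real (Suc n)) *\<^sub>R axis j 1) - g x) / (1 / real (Suc n))))
   \<longlonglongrightarrow> (LINT x|lborel. f' x $ i * g' x $ j)" by (rule difference_quotient_limit[OF g _ fi]) (auto intro!: continuous_intros cf')
 have L2: "(%n. LINT x|lborel. g' x $ i * ((f (x + (- 1 / real (Suc n)) *\<^sub>R axis j 1) - f x) / (- 1 / real (Suc n))))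
   \<longlonglongrightarrow> (LINT x|lborel. g' x $ i * f' x $ j)" by (rule difference_quotient_limit[OF f _ gi]) (auto intro!: continuous_intros cg')
 have eq: "(LINT x|lborel. f' x $ i * ((g (x + (1 / real (Suc n)) *\<^sub>R axis j 1) - g x) / (1 / real (Suc n)))) =
   (LINT x|lborel. g' x $ i * ((f (x + (- 1 / real (Suc n)) *\<^sub>R axis j 1) - f x) / (- 1 / real (Suc n))))" for n
 proof -
  define c where "c = real (Suc n)"
  define a where "a = (1 / c) *\<^sub>R axis j 1 - (0 :: plane)"
  have cgs: "continuous_on UNIV (%x. g (x + a))" and cgs': "continuous_on UNIV (%x. g' (x + a))"
   by (auto intro!: continuous_on_compose2[OF cg] continuous_on_compose2[OF cg'] continuous_intros)
  have ds: "((%x. g (x + a)) has_derivative (%v. g' (x + a) \<bullet> v)) (at x)" for x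
   by (rule has_derivative_compose[OF _ compact_C1D(1)[OF g], of "%x. x + a" "%v. v"]) (auto intro!: derivative_eq_intros)
  have p1: "(LINT x|lborel. f' x $ i * g (x + a)) = - (LINT x|lborel. f x * g' (x + a) $ i)" by (rule compact_C1_parts[OF f ds cgs'])
  have p2: "(LINT x|lborel. f' x $ i * g x) = - (LINT x|lborel. f x * g' x $ i)" by (rule compact_C1_parts[OF f compact_C1D(1)[OF g] cg'])
  have m: "(%x. f (x - a) * g' x $ i) \<in> borel_measurable borel"
   by (intro borel_measurable_continuous_onI continuous_intros continuous_on_compose2[OF cf] cg') auto
  have sh: "(LINT x|lborel. f x * g' (x + a) $ i) = (LINT x|lborel. f (x - a) * g' x $ i)" using lborel_integral_shift[OF m, of a] by simp
  have I1: "integrable lborel (%x. f' x $ i * g (x + a))" by (rule compact_C1_integrable(2)[OF f cgs])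
  have I2: "integrable lborel (%x. f' x $ i * g x)" by (rule compact_C1_integrable(2)[OF f cg])
  have "continuous_on UNIV (%x. f (x - a))" by (auto intro!: continuous_on_compose2[OF cf] continuous_intros)
  from compact_C1_integrable(2)[OF g this] have I3: "integrable lborel (%x. f (x - a) * g' x $ i)" by (simp add: mult.commute)
  from compact_C1_integrable(2)[OF g cf] have I4: "integrable lborel (%x. f x * g' x $ i)" by (simp add: mult.commute)
  have "(LINT x|lborel. f' x $ i * ((g (x + a) - g x) / (1 / c))) = (LINT x|lborel. c * (f' x $ i * g (x + a) - f' x $ i * g x))"
   by (rule Bochner_Integration.integral_cong) (auto simp: algebra_simps)
  also have "... = c * ((LINT x|lborel. f' x $ i * g (x + a)) - (LINT x|lborel. f' x $ i * g x))" using I1 I2 by simp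
  also have "... = c * ((LINT x|lborel. f x * g' x $ i) - (LINT x|lborel. f (x - a) * g' x $ i))" using p1 p2 sh by simp
  also have "... = (LINT x|lborel. c * (f x * g' x $ i - f (x - a) * g' x $ i))" using I3 I4 by simp
  also have "... = (LINT x|lborel. g' x $ i * ((f (x - a) - f x) / (- 1 / c)))" by (rule Bochner_Integration.integral_cong) (auto simp: algebra_simps)
  finally show ?thesis by (simp add: a_def c_def)
 qed
 have "(LINT x|lborel. f' x $ i * g' x $ j) = (LINT x|lborel. g' x $ i * f' x $ j)" using LIMSEQ_unique[OF L1[unfolded eq] L2] .
 thus ?thesis by (simp add: mult.commute)
qed

section \<open>The Sobolev space of functions vanishing on the boundary\<close>

definition L2 :: "'a measure => ('a => real) => bool" where
 "L2 M f \<longleftrightarrow> f \<in> borel_measurable M & integrable M (\<lambda>x. (f x)^2)"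

lemma L2D:
 assumes "L2 M f"
 shows "f \<in> borel_measurable M" "integrable M (\<lambda>x. (f x)^2)" using assms by (auto simp: L2_def)

lemma L2_mult:
 assumes f: "L2 M f" and g: "L2 M g"
 shows "integrable M (\<lambda>x. f x * g x)"
proof (rule Bochner_Integration.integrable_bound)
 show "integrable M (%x. (f x)^2 + (g x)^2)" using L2D[OF f] L2D[OF g] by simp
 show "(%x. f x * g x) \<in> borel_measurable M" using L2D[OF f] L2D[OF g] by simp
 show "AE x in M. norm (f x * g x) <= norm ((f x)^2 + (g x)^2)"
 proof (intro AE_I2)
  fix x
  have "2 * (\<bar>f x\<bar> * \<bar>g x\<bar>) <= (f x)^2 + (g x)^2" using sum_squares_bound[of "\<bar>f x\<bar>" "\<bar>g x\<bar>"] by simp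
  moreover have "0 <= \<bar>f x\<bar> * \<bar>g x\<bar>" by simp
  ultimately have "\<bar>f x\<bar> * \<bar>g x\<bar> <= (f x)^2 + (g x)^2" by linarith
  thus "norm (f x * g x) <= norm ((f x)^2 + (g x)^2)" by (simp add: abs_mult)
 qed
qed

lemma L2_add:
 assumes f: "L2 M f" and g: "L2 M g"
 shows "L2 M (\<lambda>x. f x + g x)" unfolding L2_def
proof
 show "(%x. f x + g x) \<in> borel_measurable M" using L2D[OF f] L2D[OF g] by simp
 have "integrable M (%x. (f x)^2 + (g x)^2 + 2 * (f x * g x))" using L2D[OF f] L2D[OF g] L2_mult[OF f g]
  by (intro Bochner_Integration.integrable_add integrable_mult_right)
 thus "integrable M (%x. (f x + g x)^2)" by (simp add: power2_sum mult.assoc)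
qed

lemma L2_cmult:
 assumes f: "L2 M f"
 shows "L2 M (\<lambda>x. c * f x)" unfolding L2_def using L2D[OF f] by (simp add: power_mult_distrib)

lemma L2_diff:
 assumes f: "L2 M f" and g: "L2 M g"
 shows "L2 M (\<lambda>x. f x - g x)" using L2_add[OF f L2_cmult[OF g, of "-1"]] by simp

lemma L2_bounded:
 assumes "finite_measure M" "f \<in> borel_measurable M" "AE x in M. \<bar>f x\<bar> <= C"
 shows "L2 M f" unfolding L2_def
proof
 show "integrable M (%x. (f x)^2)"
 proof (rule finite_measure.integrable_const_bound[OF assms(1)])
  show "AE x in M. norm ((f x)^2) <= C^2" using assms(3)
  proof eventually_elim
   case (elim x)
   hence "\<bar>f x\<bar>^2 <= C^2" by (intro power_mono) auto
   thus ?case by simp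
  qed
 qed (use assms(2) in simp)
qed (rule assms(2))

lemma L2_product_tendsto:
 assumes f: "L2 M f" and g: "L2 M g"
  and fn: "!!n. L2 M (a n)" and gn: "!!n. L2 M (b n)"
  and fl: "(\<lambda>n. LINT x|M. (f x - a n x)^2) \<longlonglongrightarrow> 0" and gl: "(\<lambda>n. LINT x|M. (g x - b n x)^2) \<longlonglongrightarrow> 0"
 shows "(\<lambda>n. LINT x|M. a n x * b n x) \<longlonglongrightarrow> (LINT x|M. f x * g x)"
proof (rule LIMSEQ_I)
 fix e :: real assume e: "e > 0"
 define F where "F = (LINT x|M. (f x)^2)"
 define G where "G = (LINT x|M. (g x)^2)"
 define \<eta> where "\<eta> = e / (F + G + 1)"
 have FG: "F >= 0" "G >= 0" by (auto simp: F_def G_def)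
 have eta: "\<eta> > 0" using e FG by (simp add: \<eta>_def)
 define k where "k = 1 / \<eta> + 1"
 have k0: "k > 0" using eta by (simp add: k_def add_pos_pos)
 let ?A = "%n. LINT x|M. (f x - a n x)^2" and ?B = "%n. LINT x|M. (g x - b n x)^2"
 have "(%n. k * ?A n + k * ?B n) \<longlonglongrightarrow> k * 0 + k * 0" by (intro tendsto_intros fl gl)
 hence "\<forall>\<^sub>F n in sequentially. k * ?A n + k * ?B n < e / 2" using e by (intro order_tendstoD(2)) auto
 then obtain N where N: "!!n. n >= N ==> k * ?A n + k * ?B n < e / 2" unfolding eventually_sequentially by blast
 have "norm ((LINT x|M. a n x * b n x) - (LINT x|M. f x * g x)) < e" if "n >= N" for n
 proof -
  have df: "L2 M (%x. f x - a n x)" and dg: "L2 M (%x. g x - b n x)"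
   by (rule L2_diff[OF f fn] L2_diff[OF g gn])+
  have I: "integrable M (%x. a n x * b n x - f x * g x)" using L2_mult[OF fn gn] L2_mult[OF f g] by simp
  have "norm ((LINT x|M. a n x * b n x) - (LINT x|M. f x * g x)) = norm (LINT x|M. a n x * b n x - f x * g x)"
   using L2_mult[OF fn gn] L2_mult[OF f g] by simp
  also have "... <= (LINT x|M. norm (a n x * b n x - f x * g x))" by (rule integral_norm_bound)
  also have "... <= (LINT x|M. (\<eta> / 4) * ((f x)^2 + (g x)^2) + (k * (f x - a n x)^2 + k * (g x - b n x)^2))"
  proof (rule integral_mono)
   show "integrable M (%x. norm (a n x * b n x - f x * g x))" using I by simp
   show "integrable M (%x. (\<eta> / 4) * ((f x)^2 + (g x)^2) + (k * (f x - a n x)^2 + k * (g x - b n x)^2))"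
    using L2D(2)[OF f] L2D(2)[OF g] L2D(2)[OF df] L2D(2)[OF dg]
    by (intro Bochner_Integration.integrable_add integrable_mult_right)
   fix x
   define p q where "p = f x - a n x" and "q = g x - b n x"
   have young: "\<bar>u * v\<bar> <= (\<eta> / 4) * u^2 + (1 / \<eta>) * v^2" for u v :: real
   proof -
    have "0 <= (sqrt \<eta> / 2 * \<bar>u\<bar> - \<bar>v\<bar> / sqrt \<eta>)^2" by simp
    also have "... = (\<eta> / 4) * u^2 + (1 / \<eta>) * v^2 - \<bar>u * v\<bar>"
     using eta by (simp add: power2_diff power_mult_distrib power_divide abs_mult)
    finally show ?thesis by simp
   qed
   have pq: "\<bar>p * q\<bar> <= p^2 + q^2"
   proof -
    have "2 * \<bar>p\<bar> * \<bar>q\<bar> <= p^2 + q^2" using sum_squares_bound[of "\<bar>p\<bar>" "\<bar>q\<bar>"] by simp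
    moreover have "0 <= \<bar>p\<bar> * \<bar>q\<bar>" by simp
    ultimately show ?thesis unfolding abs_mult by linarith
   qed
   have "a n x * b n x - f x * g x = p * q - f x * q - g x * p" by (simp add: p_def q_def algebra_simps)
   hence "norm (a n x * b n x - f x * g x) <= \<bar>p * q\<bar> + \<bar>f x * q\<bar> + \<bar>g x * p\<bar>" by simp
   also have "... <= (p^2 + q^2) + ((\<eta> / 4) * (f x)^2 + (1 / \<eta>) * q^2) + ((\<eta> / 4) * (g x)^2 + (1 / \<eta>) * p^2)"
    using pq young[of "f x" q] young[of "g x" p] by linarith
   also have "... = (\<eta> / 4) * ((f x)^2 + (g x)^2) + (k * p^2 + k * q^2)" by (simp add: k_def algebra_simps)
   finally show "norm (a n x * b n x - f x * g x) <= (\<eta> / 4) * ((f x)^2 + (g x)^2) + (k * (f x - a n x)^2 + k * (g x - b n x)^2)"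
    by (simp add: p_def q_def)
  qed
  also have "... = (\<eta> / 4) * (F + G) + (k * ?A n + k * ?B n)"
   using L2D(2)[OF f] L2D(2)[OF g] L2D(2)[OF df] L2D(2)[OF dg] by (simp add: F_def G_def)
  finally have 1: "norm ((LINT x|M. a n x * b n x) - (LINT x|M. f x * g x)) <= (\<eta> / 4) * (F + G) + (k * ?A n + k * ?B n)" .
  have "(\<eta> / 4) * (F + G) <= (\<eta> / 4) * (F + G + 1)" using eta by (intro mult_left_mono) auto
  also have "... = e / 4"
  proof -
   have "F + G + 1 ~= 0" using FG by linarith
   thus ?thesis unfolding \<eta>_def by (metis nonzero_divide_eq_eq times_divide_eq_left mult.commute)
  qed
  finally show ?thesis using N[OF that] 1 e by linarith
 qed
 thus "\<exists>no. \<forall>n\<ge>no. norm ((LINT x|M. a n x * b n x) - (LINT x|M. f x * g x)) < e" by blast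
qed

text \<open>The closure of the compactly supported \<open>C^1\<close> functions in \<open>W^{1,2}\<close>, for scalar
 functions, with the gradient \<open>g\<close> as data.\<close>

definition H01 :: "plane set => (plane => real) => (plane => plane) => bool" where
 "H01 Om f g \<longleftrightarrow> L2 (lebesgue_on Om) f & (\<forall>j. L2 (lebesgue_on Om) (\<lambda>x. g x $ j)) &
   (\<exists>a b. (\<forall>n. compact_C1 Om (a n) (b n)) &
    (\<lambda>n. LINT x|lebesgue_on Om. (f x - a n x)^2) \<longlonglongrightarrow> 0 &
    (\<forall>j. (\<lambda>n. LINT x|lebesgue_on Om. (g x $ j - b n x $ j)^2) \<longlonglongrightarrow> 0))"

lemma finite_measure_lebesgue_on: "open Om ==> bounded Om ==> finite_measure (lebesgue_on (Om :: 'a::euclidean_space set))"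
 using lmeasurable_open finite_measure_lebesgue_on by blast

lemma lebesgue_on_integral_compact_support:
 fixes F :: "plane => real"
 assumes "open Om" "F \<in> borel_measurable borel" "!!x. x ~: Om ==> F x = 0"
 shows "(LINT x|lebesgue_on Om. F x) = (LINT x|lborel. F x)"
proof -
 have "(LINT x|lebesgue_on Om. F x) = (LINT x|lebesgue. indicator Om x *\<^sub>R F x)" using assms(1) by (subst integral_restrict_space) auto
 also have "... = (LINT x|lebesgue. F x)" by (rule Bochner_Integration.integral_cong[OF refl]) (use assms(3) in \<open>auto simp: indicator_def\<close>)
 also have "... = (LINT x|lborel. F x)" by (rule integral_completion) (use assms(2) in simp)
 finally show ?thesis .
qed

lemma measurable_lebesgue_on_borel:
 fixes f :: "'a::euclidean_space => real"
 assumes "f \<in> borel_measurable borel"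
 shows "f \<in> borel_measurable (lebesgue_on Om)" by (rule measurable_restrict_space1, rule measurable_completion) (use assms in simp)

lemma compact_C1_square_integrable:
 assumes "open Om" "bounded Om" and f: "compact_C1 Om f g"
 shows "L2 (lebesgue_on Om) f" "L2 (lebesgue_on Om) (\<lambda>x. g x $ j)"
proof -
 obtain K where K: "compact K" "!!x. x ~: K ==> f x = 0 & g x = 0" using compact_C1D(4)[OF f] by blast
 have bd: "\<exists>C. \<forall>x. \<bar>h x\<bar> <= C" if c: "continuous_on UNIV h" and z: "!!x. x ~: K ==> h x = 0" for h :: "plane => real"
 proof -
  have "bounded (h ` K)" by (rule compact_imp_bounded[OF compact_continuous_image[OF continuous_on_subset[OF c] K(1)]]) simp
  then obtain M where "\<forall>x\<in>K. \<bar>h x\<bar> <= M" by (auto simp: bounded_real)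
  hence "\<bar>h x\<bar> <= \<bar>M\<bar>" for x using z by (cases "x \<in> K") force+
  thus ?thesis by blast
 qed
 have main: "L2 (lebesgue_on Om) h" if c: "continuous_on UNIV h" and z: "!!x. x ~: K ==> h x = 0" for h
 proof -
  obtain C where "\<forall>x. \<bar>h x\<bar> <= C" using bd[OF c z] by blast
  thus ?thesis by (intro L2_bounded[where C = C] finite_measure_lebesgue_on assms(1,2)
     measurable_lebesgue_on_borel borel_measurable_continuous_onI c) auto
 qed
 show "L2 (lebesgue_on Om) f" by (rule main) (use compact_C1D(2)[OF f] K(2) in auto)
 show "L2 (lebesgue_on Om) (%x. g x $ j)" by (rule main) (use compact_C1D(3)[OF f] K(2) in \<open>auto intro!: continuous_intros\<close>)
qed

lemma H01_poincare:
 assumes op: "open Om" and bd: "bounded Om" and R: "!!x. x \<in> Om ==> norm x <= R" and h: "H01 Om f g"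
 shows "(LINT x|lebesgue_on Om. (f x)^2) <= 4 * R^2 * (LINT x|lebesgue_on Om. (g x $ 1)^2)"
proof -
 obtain a b where ab: "!!n. compact_C1 Om (a n) (b n)"
  and la: "(%n. LINT x|lebesgue_on Om. (f x - a n x)^2) \<longlonglongrightarrow> 0"
  and lb: "!!j. (%n. LINT x|lebesgue_on Om. (g x $ j - b n x $ j)^2) \<longlonglongrightarrow> 0"
  and sf: "L2 (lebesgue_on Om) f" and sg: "!!j. L2 (lebesgue_on Om) (%x. g x $ j)"
  using h unfolding H01_def by blast
 note sa = compact_C1_square_integrable(1)[OF op bd ab] and sb = compact_C1_square_integrable(2)[OF op bd ab]
 have 1: "(%n. LINT x|lebesgue_on Om. a n x * a n x) \<longlonglongrightarrow> (LINT x|lebesgue_on Om. f x * f x)"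
  by (rule L2_product_tendsto[OF sf sf sa sa la la])
 have 2: "(%n. LINT x|lebesgue_on Om. b n x $ 1 * b n x $ 1) \<longlonglongrightarrow> (LINT x|lebesgue_on Om. g x $ 1 * g x $ 1)"
  by (rule L2_product_tendsto[OF sg sg sb sb lb lb])
 have le: "(LINT x|lebesgue_on Om. a n x * a n x) <= 4 * R^2 * (LINT x|lebesgue_on Om. b n x $ 1 * b n x $ 1)" for n
 proof -
  obtain K where K: "K <= Om" "!!x. x ~: K ==> a n x = 0 & b n x = 0" using compact_C1D(4)[OF ab[of n]] by blast
  note c = compact_C1D(2,3)[OF ab[of n]]
  have "(LINT x|lebesgue_on Om. a n x * a n x) = (LINT x|lborel. a n x * a n x)" by (rule lebesgue_on_integral_compact_support[OF op])
     (use K c in \<open>auto intro!: borel_measurable_continuous_onI continuous_intros\<close>)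
  moreover have "(LINT x|lebesgue_on Om. b n x $ 1 * b n x $ 1) = (LINT x|lborel. b n x $ 1 * b n x $ 1)"
  proof (rule lebesgue_on_integral_compact_support[OF op])
   show "(%x. b n x $ 1 * b n x $ 1) \<in> borel_measurable borel" by (intro borel_measurable_continuous_onI continuous_intros c)
   show "b n x $ 1 * b n x $ 1 = 0" if "x ~: Om" for x
   proof -
    have "x ~: K" using that K(1) by blast
    thus ?thesis using K(2) by simp
   qed
  qed
  ultimately show ?thesis using compact_C1_poincare[OF ab[of n] R] by (simp add: power2_eq_square)
 qed
 have "(LINT x|lebesgue_on Om. f x * f x) <= 4 * R^2 * (LINT x|lebesgue_on Om. g x $ 1 * g x $ 1)"
  by (rule tendsto_le[OF _ tendsto_mult[OF tendsto_const 2] 1]) (use le in auto)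
 thus ?thesis by (simp add: power2_eq_square)
qed

lemma H01_null_lagrangian:
 assumes op: "open Om" and bd: "bounded Om" and h: "H01 Om f g" and h': "H01 Om f' g'"
 shows "(LINT x|lebesgue_on Om. g x $ i * g' x $ j) = (LINT x|lebesgue_on Om. g x $ j * g' x $ i)"
proof -
 obtain a b where ab: "!!n. compact_C1 Om (a n) (b n)"
  and lb: "!!j. (%n. LINT x|lebesgue_on Om. (g x $ j - b n x $ j)^2) \<longlonglongrightarrow> 0"
  and sg: "!!j. L2 (lebesgue_on Om) (%x. g x $ j)" using h unfolding H01_def by blast
 obtain a' b' where ab': "!!n. compact_C1 Om (a' n) (b' n)"
  and lb': "!!j. (%n. LINT x|lebesgue_on Om. (g' x $ j - b' n x $ j)^2) \<longlonglongrightarrow> 0"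
  and sg': "!!j. L2 (lebesgue_on Om) (%x. g' x $ j)" using h' unfolding H01_def by blast
 note sb = compact_C1_square_integrable(2)[OF op bd ab] and sb' = compact_C1_square_integrable(2)[OF op bd ab']
 have lim: "(%n. LINT x|lebesgue_on Om. b n x $ i * b' n x $ j) \<longlonglongrightarrow> (LINT x|lebesgue_on Om. g x $ i * g' x $ j)" for i j
  by (rule L2_product_tendsto[OF sg sg' sb sb' lb lb'])
 have z: "(LINT x|lebesgue_on Om. b n x $ i * b' n x $ j) = (LINT x|lborel. b n x $ i * b' n x $ j)" for n i j
 proof (rule lebesgue_on_integral_compact_support[OF op])
  show "(%x. b n x $ i * b' n x $ j) \<in> borel_measurable borel"
   by (intro borel_measurable_continuous_onI continuous_intros compact_C1D(3)[OF ab] compact_C1D(3)[OF ab'])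
  obtain K where K: "K <= Om" "!!x. x ~: K ==> a n x = 0 & b n x = 0" using compact_C1D(4)[OF ab[of n]] by blast
  show "b n x $ i * b' n x $ j = 0" if "x ~: Om" for x
  proof -
   have "x ~: K" using that K(1) by blast
   thus ?thesis using K(2) by simp
  qed
 qed
 show ?thesis by (rule LIMSEQ_unique[OF lim]) (use lim[of j i] in \<open>simp add: z compact_C1_null_lagrangian[OF ab ab', where i = i and j = j]\<close>)
qed

lemma H01_parts:
 assumes op: "open Om" and bd: "bounded Om" and h: "H01 Om f g"
  and d: "!!x. x \<in> Om ==> (s has_derivative (\<lambda>v. s' x \<bullet> v)) (at x)" and c: "continuous_on Om s'"
  and b: "!!x. x \<in> Om ==> \<bar>s x\<bar> <= C" "!!x. x \<in> Om ==> \<bar>s' x $ j\<bar> <= C"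
 shows "(LINT x|lebesgue_on Om. f x * s' x $ j) = - (LINT x|lebesgue_on Om. g x $ j * s x)"
proof -
 obtain a b where ab: "!!n. compact_C1 Om (a n) (b n)"
  and la: "(%n. LINT x|lebesgue_on Om. (f x - a n x)^2) \<longlonglongrightarrow> 0"
  and lb: "!!j. (%n. LINT x|lebesgue_on Om. (g x $ j - b n x $ j)^2) \<longlonglongrightarrow> 0"
  and sf: "L2 (lebesgue_on Om) f" and sg: "!!j. L2 (lebesgue_on Om) (%x. g x $ j)"
  using h unfolding H01_def by blast
 note sa = compact_C1_square_integrable(1)[OF op bd ab] and sb = compact_C1_square_integrable(2)[OF op bd ab]
 have cs: "continuous_on Om s" by (intro continuous_at_imp_continuous_on ballI has_derivative_continuous[OF d])
 have O: "Om \<in> sets lebesgue" using op by simp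
 note fm = finite_measure_lebesgue_on[OF op bd]
 have sps: "space (lebesgue_on Om) = Om" by simp
 have ss: "L2 (lebesgue_on Om) s" by (rule L2_bounded[OF fm continuous_imp_measurable_on_sets_lebesgue[OF cs O], of C])
    (use assms(6) in \<open>intro AE_I2, simp\<close>)
 have cj: "continuous_on Om (%x. s' x $ j)" by (intro continuous_intros c)
 have ss': "L2 (lebesgue_on Om) (%x. s' x $ j)"
  by (rule L2_bounded[OF fm continuous_imp_measurable_on_sets_lebesgue[OF cj O], of C])
    (use assms(7) in \<open>intro AE_I2, simp\<close>)
 have 1: "(%n. LINT x|lebesgue_on Om. a n x * s' x $ j) \<longlonglongrightarrow> (LINT x|lebesgue_on Om. f x * s' x $ j)"
  by (rule L2_product_tendsto[OF sf ss' sa ss' la]) simp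
 have 2: "(%n. LINT x|lebesgue_on Om. b n x $ j * s x) \<longlonglongrightarrow> (LINT x|lebesgue_on Om. g x $ j * s x)"
  by (rule L2_product_tendsto[OF sg ss sb ss lb]) simp
 have eq: "(LINT x|lebesgue_on Om. a n x * s' x $ j) = - (LINT x|lebesgue_on Om. b n x $ j * s x)" for n
 proof -
  obtain K where K: "K <= Om" "!!x. x ~: K ==> a n x = 0 & b n x = 0" using compact_C1D(4)[OF ab[of n]] by blast
  let ?G = "%x. if x \<in> Om then a n x *\<^sub>R s' x + s x *\<^sub>R b n x else 0"
  have C1: "compact_C1 Om (%x. if x \<in> Om then a n x * s x else 0) ?G" by (rule compact_C1_mult_local[OF op ab d c])
  have "0 = (LINT x|lborel. ?G x $ j)" by (rule integral_partial_derivative_zero[OF C1, symmetric])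
  also have "... = (LINT x|lebesgue_on Om. ?G x $ j)"
  proof (rule lebesgue_on_integral_compact_support[OF op, symmetric])
   have "continuous_on UNIV (%x. ?G x $ j)" by (rule continuous_on_component[OF compact_C1D(3)[OF C1]])
   thus "(%x. ?G x $ j) \<in> borel_measurable borel" by (rule borel_measurable_continuous_onI)
  qed simp
  also have "... = (LINT x|lebesgue_on Om. a n x * s' x $ j + b n x $ j * s x)" by (rule Bochner_Integration.integral_cong) (auto simp: mult.commute)
  also have "... = (LINT x|lebesgue_on Om. a n x * s' x $ j) + (LINT x|lebesgue_on Om. b n x $ j * s x)"
   by (intro Bochner_Integration.integral_add L2_mult sa sb ss ss')
  finally show ?thesis by simp
 qed
 show ?thesis by (rule LIMSEQ_unique[OF 1]) (use tendsto_minus[OF 2] in \<open>simp add: eq\<close>)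
qed

lemma L2_diff_tendsto:
 assumes p: "L2 M p" and p': "L2 M p'"
  and q: "!!n. L2 M (q n)" and q': "!!n. L2 M (q' n)"
  and l: "(\<lambda>n. LINT x|M. (p x - q n x)^2) \<longlonglongrightarrow> 0" and l': "(\<lambda>n. LINT x|M. (p' x - q' n x)^2) \<longlonglongrightarrow> 0"
 shows "(\<lambda>n. LINT x|M. ((p x - p' x) - (q n x - q' n x))^2) \<longlonglongrightarrow> 0"
proof (rule tendsto_sandwich[OF always_eventually always_eventually tendsto_const])
 let ?l = "%n. LINT x|M. (p x - q n x)^2" and ?l' = "%n. LINT x|M. (p' x - q' n x)^2"
 show "\<forall>n. 0 <= (LINT x|M. ((p x - p' x) - (q n x - q' n x))^2)" by simp
 show "(%n. 2 * ?l n + 2 * ?l' n) \<longlonglongrightarrow> 0"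
  using tendsto_add[OF tendsto_mult[OF tendsto_const[of 2] l] tendsto_mult[OF tendsto_const[of 2] l']] by simp
 show "\<forall>n. (LINT x|M. ((p x - p' x) - (q n x - q' n x))^2) <= 2 * ?l n + 2 * ?l' n"
 proof
  fix n
  note i1 = L2D(2)[OF L2_diff[OF p q[of n]]]
  note i2 = L2D(2)[OF L2_diff[OF p' q'[of n]]]
  note i3 = L2D(2)[OF L2_diff[OF L2_diff[OF p p'] L2_diff[OF q[of n] q'[of n]]]]
  have "(LINT x|M. ((p x - p' x) - (q n x - q' n x))^2) <= (LINT x|M. 2 * (p x - q n x)^2 + 2 * (p' x - q' n x)^2)"
  proof (rule integral_mono[OF i3])
   show "integrable M (%x. 2 * (p x - q n x)^2 + 2 * (p' x - q' n x)^2)" using i1 i2 by simp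
   fix x
   have "0 <= ((p x - q n x) + (p' x - q' n x))^2" by simp
   thus "((p x - p' x) - (q n x - q' n x))^2 <= 2 * (p x - q n x)^2 + 2 * (p' x - q' n x)^2" by (simp add: power2_eq_square algebra_simps)
  qed
  thus "(LINT x|M. ((p x - p' x) - (q n x - q' n x))^2) <= 2 * ?l n + 2 * ?l' n" using i1 i2 by simp
 qed
qed

lemma H01_diff:
 assumes op: "open Om" and bd: "bounded Om" and h: "H01 Om f g" and h': "H01 Om f' g'"
 shows "H01 Om (\<lambda>x. f x - f' x) (\<lambda>x. g x - g' x)"
proof -
 obtain a b where ab: "!!n. compact_C1 Om (a n) (b n)"
  and la: "(%n. LINT x|lebesgue_on Om. (f x - a n x)^2) \<longlonglongrightarrow> 0"
  and lb: "!!j. (%n. LINT x|lebesgue_on Om. (g x $ j - b n x $ j)^2) \<longlonglongrightarrow> 0"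
  and sf: "L2 (lebesgue_on Om) f" and sg: "!!j. L2 (lebesgue_on Om) (%x. g x $ j)"
  using h unfolding H01_def by blast
 obtain a' b' where ab': "!!n. compact_C1 Om (a' n) (b' n)"
  and la': "(%n. LINT x|lebesgue_on Om. (f' x - a' n x)^2) \<longlonglongrightarrow> 0"
  and lb': "!!j. (%n. LINT x|lebesgue_on Om. (g' x $ j - b' n x $ j)^2) \<longlonglongrightarrow> 0"
  and sf': "L2 (lebesgue_on Om) f'" and sg': "!!j. L2 (lebesgue_on Om) (%x. g' x $ j)"
  using h' unfolding H01_def by blast
 note sa = compact_C1_square_integrable(1)[OF op bd ab] and sb = compact_C1_square_integrable(2)[OF op bd ab]
 note sa' = compact_C1_square_integrable(1)[OF op bd ab'] and sb' = compact_C1_square_integrable(2)[OF op bd ab']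
 note lim = L2_diff_tendsto
 have C: "compact_C1 Om (%x. a n x - a' n x) (%x. b n x - b' n x)" for n
 proof -
  obtain K where K: "compact K" "K <= Om" "!!x. x ~: K ==> a n x = 0 & b n x = 0" using compact_C1D(4)[OF ab[of n]] by blast
  obtain K' where K': "compact K'" "K' <= Om" "!!x. x ~: K' ==> a' n x = 0 & b' n x = 0" using compact_C1D(4)[OF ab'[of n]] by blast
  show ?thesis unfolding compact_C1_def
  proof (intro conjI allI exI[of _ "K \<union> K'"])
   show "((%x. a n x - a' n x) has_derivative (%h. (b n x - b' n x) \<bullet> h)) (at x)" for x
    using has_derivative_diff[OF compact_C1D(1)[OF ab[of n]] compact_C1D(1)[OF ab'[of n]]] by (simp add: inner_diff_left)
   show "continuous_on UNIV (%x. b n x - b' n x)" by (intro continuous_intros compact_C1D(3)[OF ab[of n]] compact_C1D(3)[OF ab'[of n]])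
  qed (use K K' in \<open>auto intro!: compact_Un\<close>)
 qed
 show ?thesis unfolding H01_def
 proof (intro conjI allI exI[of _ "%n x. a n x - a' n x"] exI[of _ "%n x. b n x - b' n x"])
  show "L2 (lebesgue_on Om) (%x. f x - f' x)" by (rule L2_diff[OF sf sf'])
  show "L2 (lebesgue_on Om) (%x. (g x - g' x) $ j)" for j using L2_diff[OF sg[of j] sg'[of j]] by simp
  show "(%n. LINT x|lebesgue_on Om. (f x - f' x - (a n x - a' n x))^2) \<longlonglongrightarrow> 0" by (rule lim[OF sf sf' sa sa' la la'])
  show "(%n. LINT x|lebesgue_on Om. ((g x - g' x) $ j - (b n x - b' n x) $ j)^2) \<longlonglongrightarrow> 0" for j
   using lim[OF sg[of j] sg'[of j] sb sb' lb[of j] lb'[of j]] by simp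
 qed (rule C)
qed

text \<open>Cutting off the values below \<open>e\<close> gives compact support, since the function is small near the
 boundary.\<close>

lemma H01_if_vanishing_on_frontier:
 assumes op: "open Om" and bd: "bounded Om"
  and cf: "continuous_on (closure Om) f" and zf: "!!x. x \<in> frontier Om ==> f x = 0"
  and d: "!!x. x \<in> Om ==> (f has_derivative (\<lambda>v. g x \<bullet> v)) (at x)" and cg: "continuous_on Om g"
  and bg: "!!x j. x \<in> Om ==> \<bar>g x $ j\<bar> <= C"
 shows "H01 Om f g"
proof -
 have bgC: "\<bar>g x $ j\<bar> <= C" if "x \<in> Om" for x j using bg that by blast
 have O: "Om \<in> sets lebesgue" using op by simp
 note fm = finite_measure_lebesgue_on[OF op bd]
 have cpt: "compact (closure Om)" using bd by simp
 have cf': "continuous_on Om f" by (rule continuous_on_subset[OF cf closure_subset])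
 obtain B where B: "!!x. x \<in> closure Om ==> \<bar>f x\<bar> <= B"
  using compact_imp_bounded[OF compact_continuous_image[OF cf cpt]] by (auto simp: bounded_real)
 have BO: "\<bar>f x\<bar> <= B" if "x \<in> Om" for x using B that closure_subset by blast
 have fm1: "f \<in> borel_measurable (lebesgue_on Om)" by (rule continuous_imp_measurable_on_sets_lebesgue[OF cf' O])
 have gm1: "(%x. g x $ j) \<in> borel_measurable (lebesgue_on Om)" for j
  by (rule continuous_imp_measurable_on_sets_lebesgue[OF _ O]) (intro continuous_intros cg)
 have sf: "L2 (lebesgue_on Om) f" by (rule L2_bounded[OF fm fm1, of B]) (use BO in \<open>intro AE_I2, simp\<close>)
 have sg: "L2 (lebesgue_on Om) (%x. g x $ j)" for j
  by (rule L2_bounded[OF fm gm1, where C = C]) (use bgC in \<open>intro AE_I2, simp\<close>)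
 define a where "a n x = (if x \<in> Om then trunc (trunc_seq n) (f x) else 0)" for n x
 define b where "b n x = (if x \<in> Om then trunc' (trunc_seq n) (f x) *\<^sub>R g x else 0)" for n x
 have ab: "compact_C1 Om (a n) (b n)" for n
 proof -
  let ?e = "trunc_seq n"
  define K where "K = {x \<in> closure Om. ?e <= \<bar>f x\<bar>}"
  have "compact K"
  proof -
   have "closed (closure Om \<inter> (%x. \<bar>f x\<bar>) -` {?e..})" by (rule continuous_closed_preimage) (auto intro!: continuous_intros cf)
   moreover have "K = closure Om \<inter> (closure Om \<inter> (%x. \<bar>f x\<bar>) -` {?e..})" by (auto simp: K_def)
   ultimately show ?thesis using compact_Int_closed[OF cpt] by metis
  qed
  moreover have "K <= Om"
  proof
   fix x assume x: "x \<in> K"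
   have "f x ~= 0"
   proof
    assume "f x = 0"
    hence "trunc_seq n <= 0" using x by (simp add: K_def)
    thus False using trunc_seq_pos[of n] by linarith
   qed
   hence "x ~: frontier Om" using zf[of x] by blast
   thus "x \<in> Om" using x op by (auto simp: K_def frontier_def interior_open)
  qed
  ultimately show ?thesis unfolding a_def[abs_def] b_def[abs_def]
  proof (rule compact_C1_extend_by_zero[OF op])
   show "((%x. trunc ?e (f x)) has_derivative (%h. (trunc' ?e (f x) *\<^sub>R g x) \<bullet> h)) (at x)" if "x \<in> Om" for x
   proof -
    have "(trunc ?e has_derivative (%h. trunc' ?e (f x) * h)) (at (f x))" using trunc_derivative[of ?e "f x"] by (simp add: has_field_derivative_def)
    from has_derivative_compose[OF d[OF that] this] show ?thesis by simp
   qed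
   show "continuous_on Om (%x. trunc' ?e (f x) *\<^sub>R g x)"
    by (intro continuous_intros cg continuous_on_compose2[OF continuous_trunc'[of ?e UNIV] cf']) auto
   show "trunc ?e (f x) = 0 & trunc' ?e (f x) *\<^sub>R g x = 0" if "x \<in> Om" "x ~: K" for x
   proof -
    have "\<bar>f x\<bar> <= ?e" using that closure_subset[of Om] by (auto simp: K_def)
    thus ?thesis by (simp add: trunc_zero trunc'_zero)
   qed
  qed
 qed
 have dom: "(%n. LINT x|lebesgue_on Om. (p x - q n x)^2) \<longlonglongrightarrow> 0"
  if p: "p \<in> borel_measurable (lebesgue_on Om)" and q: "!!n. q n \<in> borel_measurable (lebesgue_on Om)"
   and bp: "!!n x. x \<in> Om ==> \<bar>p x - q n x\<bar> <= M" and l: "AE x in lebesgue_on Om. (%n. q n x) \<longlonglongrightarrow> p x"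
  for p :: "plane => real" and q :: "nat => plane => real" and M
 proof -
  have "(%n. LINT x|lebesgue_on Om. (p x - q n x)^2) \<longlonglongrightarrow> (LINT x|lebesgue_on Om. 0)"
  proof (rule integral_dominated_convergence[where w = "%x. M^2"])
   show "integrable (lebesgue_on Om) (%x. M^2)" by (rule finite_measure.integrable_const[OF fm])
   show "AE x in lebesgue_on Om. (%n. (p x - q n x)^2) \<longlonglongrightarrow> 0" using l
   proof eventually_elim
    case (elim x)
    from tendsto_power[OF tendsto_diff[OF tendsto_const[of "p x"] elim], of 2] show ?case by simp
   qed
   show "AE x in lebesgue_on Om. norm ((p x - q n x)^2) <= M^2" for n
   proof (rule AE_I2)
    fix x assume "x \<in> space (lebesgue_on Om)"
    hence "\<bar>p x - q n x\<bar>^2 <= M^2" using bp[of x n] by (intro power_mono) auto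
    thus "norm ((p x - q n x)^2) <= M^2" by simp
   qed
  qed (use p q in auto)
  thus ?thesis by simp
 qed
 show ?thesis unfolding H01_def
 proof (intro conjI allI exI[of _ a] exI[of _ b] sf sg ab)
  show "(%n. LINT x|lebesgue_on Om. (f x - a n x)^2) \<longlonglongrightarrow> 0"
  proof (rule dom[OF fm1])
   show "a n \<in> borel_measurable (lebesgue_on Om)" for n by (rule measurable_lebesgue_on_borel[OF borel_measurable_continuous_onI[OF compact_C1D(2)[OF ab]]])
   show "\<bar>f x - a n x\<bar> <= 2 * B" if "x \<in> Om" for n x using abs_trunc_le[OF trunc_seq_pos, of n "f x"] BO[OF that] that by (simp add: a_def)
   show "AE x in lebesgue_on Om. (%n. a n x) \<longlonglongrightarrow> f x" by (rule AE_I2) (simp add: a_def trunc_tendsto)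
  qed
  fix j
  have gb: "\<bar>g x $ j - b n x $ j\<bar> <= C" if "x \<in> Om" for n x
  proof -
   have t: "0 <= trunc' (trunc_seq n) (f x)" "trunc' (trunc_seq n) (f x) <= 1" using trunc'_bounds[OF trunc_seq_pos] by blast+
   have "g x $ j - b n x $ j = (1 - trunc' (trunc_seq n) (f x)) * g x $ j" using that by (simp add: b_def algebra_simps)
   also have "\<bar>...\<bar> <= 1 * \<bar>g x $ j\<bar>" unfolding abs_mult using t by (intro mult_right_mono) auto
   finally show ?thesis using bgC[OF that, of j] by simp
  qed
  have neg: "negligible {x \<in> Om. f x = 0 & g x \<bullet> axis j 1 ~= 0}"
   by (rule negligible_transversal_zeros[OF op d]) (assumption, intro continuous_intros cg)
  hence ae: "AE x in lebesgue. x ~: {x \<in> Om. f x = 0 & g x \<bullet> axis j 1 ~= 0}"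
   unfolding negligible_iff_null_sets by (rule AE_not_in)
  show "(%n. LINT x|lebesgue_on Om. (g x $ j - b n x $ j)^2) \<longlonglongrightarrow> 0"
  proof (rule dom[OF gm1 _ gb])
   show "(%x. b n x $ j) \<in> borel_measurable (lebesgue_on Om)" for n
    by (rule measurable_lebesgue_on_borel[OF borel_measurable_continuous_onI[OF continuous_on_component[OF compact_C1D(3)[OF ab]]]])
   have "AE x in lebesgue. x \<in> Om --> (%n. b n x $ j) \<longlonglongrightarrow> g x $ j" using ae
   proof eventually_elim
    case (elim x)
    thus ?case using trunc'_mult_tendsto[of "f x" "g x $ j"] by (auto simp: b_def inner_axis)
   qed
   thus "AE x in lebesgue_on Om. (%n. b n x $ j) \<longlonglongrightarrow> g x $ j" using O by (simp add: AE_restrict_space_iff)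
  qed
 qed
qed

section \<open>The viscous stress\<close>

lemma stress_inner:
 "stress mu lam D \<bullet> E = mu * (D $ 1 $ 1 * E $ 1 $ 1 * 2 + D $ 2 $ 2 * E $ 2 $ 2 * 2
   + (D $ 1 $ 2 + D $ 2 $ 1) * (E $ 1 $ 2 + E $ 2 $ 1)) + lam * (D $ 1 $ 1 + D $ 2 $ 2) * (E $ 1 $ 1 + E $ 2 $ 2)"
 by (simp add: stress_def inner_vec_def sum_2 transpose_def trace_def mat_def algebra_simps)

lemma norm_matrix_square:
 fixes D :: "real ^ 2 ^ 2"
 shows "(norm D)^2 = (D $ 1 $ 1)^2 + (D $ 1 $ 2)^2 + (D $ 2 $ 1)^2 + (D $ 2 $ 2)^2"
 by (simp add: power2_norm_eq_inner inner_vec_def sum_2) (simp add: power2_eq_square)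

lemma norm_plane_square: "(norm (x :: plane))^2 = (x $ 1)^2 + (x $ 2)^2"
 by (simp add: power2_norm_eq_inner inner_vec_def sum_2) (simp add: power2_eq_square)

text \<open>For \<open>2 mu + lam > 0\<close> the dissipation need not be pointwise coercive, but it becomes so after
 subtracting a multiple of the determinant.\<close>

lemma stress_coercive_modulo_determinant:
 assumes "mu > 0" "2 * mu + lam > 0"
 shows "\<exists>c>0. \<exists>k. \<forall>D :: real ^ 2 ^ 2.
  c * (norm D)^2 + k * (D $ 1 $ 1 * D $ 2 $ 2 - D $ 1 $ 2 * D $ 2 $ 1) <= stress mu lam D \<bullet> D"
proof (cases "mu + lam >= 0")
 case True
 have "mu * (norm D)^2 + (- 2 * mu) * (D $ 1 $ 1 * D $ 2 $ 2 - D $ 1 $ 2 * D $ 2 $ 1) <= stress mu lam D \<bullet> D" for D :: "real ^ 2 ^ 2"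
 proof -
  have "0 <= (mu + lam) * (D $ 1 $ 1 + D $ 2 $ 2)^2" using True by simp
  thus ?thesis unfolding stress_inner norm_matrix_square by (simp add: power2_eq_square algebra_simps)
 qed
 thus ?thesis using assms(1) by blast
next
 case False
 have "(2 * mu + lam) * (norm D)^2 + (2 * lam) * (D $ 1 $ 1 * D $ 2 $ 2 - D $ 1 $ 2 * D $ 2 $ 1) <= stress mu lam D \<bullet> D" for D :: "real ^ 2 ^ 2"
 proof -
  have "0 <= - (mu + lam) * (D $ 1 $ 2 - D $ 2 $ 1)^2" using False by (intro mult_nonneg_nonneg) auto
  thus ?thesis unfolding stress_inner norm_matrix_square by (simp add: power2_eq_square algebra_simps)
 qed
 thus ?thesis using assms(2) by blast
qed

definition H01_vec :: "plane set => (plane => plane) => (plane => real ^ 2 ^ 2) => bool" where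
 "H01_vec Om v G \<longleftrightarrow> (\<forall>i. H01 Om (\<lambda>x. v x $ i) (\<lambda>x. G x $ i))"

lemma H01_square_integrable:
 "H01 Om f g ==> L2 (lebesgue_on Om) f" "H01 Om f g ==> L2 (lebesgue_on Om) (\<lambda>x. g x $ j)"
 by (simp_all add: H01_def)

text \<open>The determinant integrates to zero, and the full gradient controls the velocity by Poincare's inequality.\<close>

lemma viscous_dissipation_controls_velocity:
 assumes op: "open Om" and bd: "bounded Om" and par: "mu > 0" "2 * mu + lam > 0"
 shows "\<exists>c>0. \<forall>v G. H01_vec Om v G -->
  c * (LINT x|lebesgue_on Om. (norm (v x))^2) <= (LINT x|lebesgue_on Om. stress mu lam (G x) \<bullet> G x)"
proof -
 let ?M = "lebesgue_on Om"
 obtain R where R: "R > 0" "!!x. x \<in> Om ==> norm x <= R" using bd by (auto simp: bounded_pos)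
 obtain c k where c: "c > 0" and ck: "!!D :: real ^ 2 ^ 2.
  c * (norm D)^2 + k * (D $ 1 $ 1 * D $ 2 $ 2 - D $ 1 $ 2 * D $ 2 $ 1) <= stress mu lam D \<bullet> D"
  using stress_coercive_modulo_determinant[OF par] by blast
 have "c / (4 * R^2) * (LINT x|?M. (norm (v x))^2) <= (LINT x|?M. stress mu lam (G x) \<bullet> G x)" if h: "H01_vec Om v G" for v G
 proof -
  have hi: "H01 Om (%x. v x $ i) (%x. G x $ i)" for i using h by (simp add: H01_vec_def)
  note sv = H01_square_integrable(1)[OF hi] and sG = H01_square_integrable(2)[OF hi]
  note iG = L2_mult[OF sG sG] and iG2 = L2D(2)[OF sG] and iv2 = L2D(2)[OF sv]
  have det: "(LINT x|?M. G x $ 1 $ 1 * G x $ 2 $ 2) = (LINT x|?M. G x $ 1 $ 2 * G x $ 2 $ 1)" by (rule H01_null_lagrangian[OF op bd hi hi])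
  have p: "(LINT x|?M. (v x $ i)^2) <= 4 * R^2 * (LINT x|?M. (G x $ i $ 1)^2)" for i using H01_poincare[OF op bd R(2) hi] .
  have "(LINT x|?M. (norm (v x))^2) = (LINT x|?M. (v x $ 1)^2) + (LINT x|?M. (v x $ 2)^2)" unfolding norm_plane_square using iv2 by simp
  also have "... <= 4 * R^2 * ((LINT x|?M. (G x $ 1 $ 1)^2) + (LINT x|?M. (G x $ 2 $ 1)^2))" using p[of 1] p[of 2] by (simp add: distrib_left)
  also have "... <= 4 * R^2 * (LINT x|?M. (norm (G x))^2)"
  proof (rule mult_left_mono)
   have "(LINT x|?M. (norm (G x))^2) = (LINT x|?M. (G x $ 1 $ 1)^2) + (LINT x|?M. (G x $ 1 $ 2)^2)
     + (LINT x|?M. (G x $ 2 $ 1)^2) + (LINT x|?M. (G x $ 2 $ 2)^2)" unfolding norm_matrix_square using iG2 by simp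
   moreover have "(LINT x|?M. (G x $ 1 $ 2)^2) >= 0" "(LINT x|?M. (G x $ 2 $ 2)^2) >= 0" by simp_all
   ultimately show "(LINT x|?M. (G x $ 1 $ 1)^2) + (LINT x|?M. (G x $ 2 $ 1)^2) <= (LINT x|?M. (norm (G x))^2)" by linarith
  qed simp
  finally have 1: "c / (4 * R^2) * (LINT x|?M. (norm (v x))^2) <= c * (LINT x|?M. (norm (G x))^2)" using c R(1) by (simp add: field_simps)
  have iN: "integrable ?M (%x. (norm (G x))^2)" unfolding norm_matrix_square using iG2 by simp
  have "c * (LINT x|?M. (norm (G x))^2) = (LINT x|?M. c * (norm (G x))^2 + k * (G x $ 1 $ 1 * G x $ 2 $ 2 - G x $ 1 $ 2 * G x $ 2 $ 1))"
   using iN iG det by simp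
  also have "... <= (LINT x|?M. stress mu lam (G x) \<bullet> G x)"
  proof (rule integral_mono)
   show "integrable ?M (%x. c * (norm (G x))^2 + k * (G x $ 1 $ 1 * G x $ 2 $ 2 - G x $ 1 $ 2 * G x $ 2 $ 1))" using iN iG by simp
   have "integrable ?M (%x. mu * (G x $ 1 $ 1 * G x $ 1 $ 1 * 2 + G x $ 2 $ 2 * G x $ 2 $ 2 * 2
     + (G x $ 1 $ 2 * G x $ 1 $ 2 + G x $ 1 $ 2 * G x $ 2 $ 1 + G x $ 2 $ 1 * G x $ 1 $ 2 + G x $ 2 $ 1 * G x $ 2 $ 1))
     + lam * (G x $ 1 $ 1 * G x $ 1 $ 1 + G x $ 1 $ 1 * G x $ 2 $ 2 + G x $ 2 $ 2 * G x $ 1 $ 1 + G x $ 2 $ 2 * G x $ 2 $ 2))"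
    using iG by (intro Bochner_Integration.integrable_add integrable_mult_right integrable_mult_left)
   thus "integrable ?M (%x. stress mu lam (G x) \<bullet> G x)" unfolding stress_inner by (simp add: algebra_simps)
  qed (rule ck)
  finally show ?thesis using 1 by linarith
 qed
 moreover have "c / (4 * R^2) > 0" using c R(1) by simp
 ultimately show ?thesis by blast
qed

lemma matrix_jacobian_nth: "jacobian f (at x) $ i $ j = frechet_derivative f (at x) (axis j 1) $ i" by (simp add: jacobian_def matrix_def)

lemma test_function_compact_C1:
 fixes \<phi> :: "plane => real ^ 2"
 assumes "test_function Om \<phi>"
 shows "compact_C1 Om (\<lambda>x. \<phi> x $ i) (\<lambda>x. jacobian \<phi> (at x) $ i)"
proof -
 have "Ck_closure (Suc 0) UNIV \<phi>" using assms unfolding test_function_def by blast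
 then obtain D where D: "C1_closure UNIV \<phi> D" "!!z. linear (D z)" by (rule Ck_closure_Suc_derivative) (rule that)
 have d: "(\<phi> has_derivative D x) (at x)" for x by (rule C1D(2)[OF D(1)]) simp
 have J: "jacobian \<phi> (at x) $ i $ j = D x (axis j 1) $ i" for x i j unfolding matrix_jacobian_nth frechet_derivative_at[OF d, symmetric] by simp
 have lin: "D x h $ i = jacobian \<phi> (at x) $ i \<bullet> h" for x h
 proof -
  have "D x h = jacobian \<phi> (at x) *v h" using frechet_derivative_at[OF d] jacobian_works[of \<phi> "at x"] d has_derivative_unique by (metis differentiableI)
  thus ?thesis by (simp add: matrix_vector_mult_def inner_vec_def)
 qed
 define K where "K = closure {x. \<phi> x ~= 0}"
 have K: "compact K" "K <= Om" using assms unfolding test_function_def compactly_supported_def K_def by auto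
 have z: "\<phi> x = 0" if "x ~: K" for x
 proof (rule ccontr)
  assume "\<phi> x ~= 0"
  hence "x \<in> {x. \<phi> x ~= 0}" by (rule CollectI)
  hence "x \<in> K" unfolding K_def by (rule subsetD[OF closure_subset])
  with that show False by (rule notE)
 qed
 have Dz: "D x = (%h. 0)" if "x ~: K" for x
 proof -
  have o: "open (- K)" using compact_imp_closed[OF K(1)] by (rule open_Compl)
  have "(\<phi> has_derivative (%h. 0)) (at x)"
  proof (rule has_derivative_transform_within_open[OF has_derivative_const[of 0] o])
   show "x \<in> - K" using that by simp
   show "0 = \<phi> y" if "y \<in> - K" for y using z[of y] that by simp
  qed
  thus ?thesis using d[of x] by (rule has_derivative_unique[rotated])
 qed
 show ?thesis unfolding compact_C1_def
 proof (intro conjI allI exI[of _ K] impI K)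
  show "((%x. \<phi> x $ i) has_derivative (%h. jacobian \<phi> (at x) $ i \<bullet> h)) (at x)" for x
   using bounded_linear.has_derivative[OF bounded_linear_vec_nth[of i] d[of x]] unfolding lin .
  have "continuous_on UNIV (%x. D x (axis j 1) $ i)" for j
   using C1D(3)[OF D(1), of "axis j 1"] by (auto intro!: continuous_on_component simp: axis_in_Basis_iff)
  hence "continuous_on UNIV (%x. \<chi> j. jacobian \<phi> (at x) $ i $ j)" unfolding J by (rule continuous_on_vec_lambda)
  thus "continuous_on UNIV (%x. jacobian \<phi> (at x) $ i)" by simp
  fix x assume x: "x ~: K"
  show "\<phi> x $ i = 0" using z[OF x] by simp
  show "jacobian \<phi> (at x) $ i = 0" by (simp add: vec_eq_iff J Dz[OF x])
 qed
qed

lemma Lp_2_square_integrable: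
 fixes v :: "plane => 'b::euclidean_space"
 assumes "Lp 2 Om v" "Om \<in> sets lebesgue" "!!y. \<bar>L y\<bar> <= norm y" "L \<in> borel_measurable borel"
 shows "L2 (lebesgue_on Om) (\<lambda>x. L (v x))"
proof -
 have m: "v \<in> borel_measurable (lebesgue_on Om)" using assms(1,2) by (simp add: Lp_def set_borel_measurable_def borel_measurable_restrict_space_iff)
 have mL: "(%x. L (v x)) \<in> borel_measurable (lebesgue_on Om)" by (rule measurable_compose[OF m assms(4)])
 have "integrable (lebesgue_on Om) (%x. norm (v x) powr 2)" using assms(1,2) by (simp add: Lp_def set_integrable_def integrable_restrict_space)
 hence "integrable (lebesgue_on Om) (%x. (L (v x))^2)"
 proof (rule Bochner_Integration.integrable_bound)
  show "AE x in lebesgue_on Om. norm ((L (v x))^2) <= norm (norm (v x) powr 2)"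
  proof (rule AE_I2)
   fix x
   have "\<bar>L (v x)\<bar>^2 <= (norm (v x))^2" using assms(3) by (intro power_mono) auto
   thus "norm ((L (v x))^2) <= norm (norm (v x) powr 2)" by (simp add: powr_numeral)
  qed
 qed (use mL in simp)
 thus ?thesis using mL by (simp add: L2_def)
qed

text \<open>Convergence of the integral in the definition of \<open>W12_zero\<close> dominates that of every component.\<close>

lemma W12_zero_H01_vec:
 assumes op: "open Om" and bd: "bounded Om" and w: "W12_zero Om v G"
 shows "H01_vec Om v G"
proof -
 let ?M = "lebesgue_on Om"
 have O: "Om \<in> sets lebesgue" using op by simp
 have Lv: "Lp 2 Om v" and LG: "Lp 2 Om G" using w by (auto simp: W12_zero_def W12_def)
 obtain \<phi> :: "nat => plane => real ^ 2" where \<phi>: "!!n. test_function Om (\<phi> n)"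
  and lim: "(%n. LINT x:Om|lebesgue. (norm (v x - \<phi> n x))^2 + (norm (G x - jacobian (\<phi> n) (at x)))^2) \<longlonglongrightarrow> 0"
  using w unfolding W12_zero_def by blast
 have mnth: "(%y::real^2. y $ i) \<in> borel_measurable borel" for i by (intro borel_measurable_continuous_onI continuous_intros)
 have mnth2: "(%y::real^2^2. y $ i $ j) \<in> borel_measurable borel" for i j by (intro borel_measurable_continuous_onI continuous_intros)
 have nth2: "\<bar>(y::real^2^2) $ i $ j\<bar> <= norm y" for y i j
  using component_le_norm_cart[of "y $ i" j] Finite_Cartesian_Product.norm_nth_le[of y i] by linarith
 have sv: "L2 ?M (%x. v x $ i)" for i by (rule Lp_2_square_integrable[OF Lv O component_le_norm_cart mnth])
 have sG: "L2 ?M (%x. G x $ i $ j)" for i j by (rule Lp_2_square_integrable[OF LG O nth2 mnth2])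
 note C = test_function_compact_C1[OF \<phi>]
 note sa = compact_C1_square_integrable(1)[OF op bd C] and sb = compact_C1_square_integrable(2)[OF op bd C]
 let ?T = "%n x. (norm (v x - \<phi> n x))^2 + (norm (G x - jacobian (\<phi> n) (at x)))^2"
 have lim': "(%n. LINT x|?M. ?T n x) \<longlonglongrightarrow> 0" using lim op by (simp add: set_lebesgue_integral_def integral_restrict_space)
 have iT: "integrable ?M (?T n)" for n unfolding norm_plane_square norm_matrix_square
  using L2D(2)[OF L2_diff[OF sv sa]] L2D(2)[OF L2_diff[OF sG sb]] by simp
 have sq: "(LINT x|?M. (h x)^2) <= (LINT x|?M. ?T n x)"
  if "L2 ?M h" "!!x. (h x)^2 <= ?T n x" for h n by (rule integral_mono[OF L2D(2)[OF that(1)] iT]) (use that(2) in simp)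
 have to0: "(%n. LINT x|?M. (h n x)^2) \<longlonglongrightarrow> 0"
  if "!!n. L2 ?M (h n)" "!!n x. (h n x)^2 <= ?T n x" for h
 proof (rule tendsto_sandwich[OF always_eventually always_eventually tendsto_const lim'])
  show "\<forall>n. (LINT x|?M. (h n x)^2) <= (LINT x|?M. ?T n x)" using sq that by blast
 qed simp
 show ?thesis unfolding H01_vec_def
 proof
  fix i
  show "H01 Om (%x. v x $ i) (%x. G x $ i)" unfolding H01_def
  proof (intro conjI allI exI[of _ "%n x. \<phi> n x $ i"] exI[of _ "%n x. jacobian (\<phi> n) (at x) $ i"] sv sG C)
   show "(%n. LINT x|?M. (v x $ i - \<phi> n x $ i)^2) \<longlonglongrightarrow> 0"
   proof (rule to0)
    show "L2 ?M (%x. v x $ i - \<phi> n x $ i)" for n by (rule L2_diff[OF sv sa])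
    fix n x
    have "\<bar>(v x - \<phi> n x) $ i\<bar>^2 <= (norm (v x - \<phi> n x))^2" by (intro power_mono component_le_norm_cart) simp
    thus "(v x $ i - \<phi> n x $ i)^2 <= ?T n x" by (simp add: add_increasing2)
   qed
   fix j
   show "(%n. LINT x|?M. (G x $ i $ j - jacobian (\<phi> n) (at x) $ i $ j)^2) \<longlonglongrightarrow> 0"
   proof (rule to0)
    show "L2 ?M (%x. G x $ i $ j - jacobian (\<phi> n) (at x) $ i $ j)" for n by (rule L2_diff[OF sG sb])
    fix n x
    have "\<bar>(G x - jacobian (\<phi> n) (at x)) $ i $ j\<bar>^2 <= (norm (G x - jacobian (\<phi> n) (at x)))^2" by (intro power_mono nth2) simp
    thus "(G x $ i $ j - jacobian (\<phi> n) (at x) $ i $ j)^2 <= ?T n x" by (simp add: add_increasing)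
   qed
  qed
 qed
qed

section \<open>Balance laws in space-time\<close>

lemma closure_cylinder: "0 < T ==> closure (cyl T Om) = {0..T} \<times> closure (Om :: 'a::euclidean_space set)" for T :: real
 by (simp add: closure_Times closure_greaterThanLessThan)

lemma open_cylinder: "open Om ==> open (cyl T Om)" by (intro open_Times) auto

lemma bounded_cylinder: "bounded Om ==> bounded (cyl T Om)" by (intro bounded_Times) auto

lemma st_basis: "(1, 0) \<in> (Basis :: spacetime set)" "(0, axis j 1) \<in> (Basis :: spacetime set)" by (auto simp: Basis_prod_def axis_in_Basis_iff)

lemma ddt_eq: "(f has_derivative D) (at z) ==> ddt f z = D (1, 0)" by (simp add: ddt_def frechet_derivative_at[symmetric])

lemma ddx_eq: "(f has_derivative D) (at z) ==> ddx j f z = D (0, axis j 1)" by (simp add: ddx_def frechet_derivative_at[symmetric])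

lemma set_integrable_cont_bounded:
 fixes f :: "'a::euclidean_space => real"
 assumes "open S" "bounded S" "continuous_on S f" "!!z. z \<in> S ==> \<bar>f z\<bar> <= C"
 shows "set_integrable lborel S f" "set_integrable lebesgue S f" "(LINT x:S|lebesgue. f x) = (LINT x:S|lborel. f x)"
proof -
 have m: "(%x. indicator S x *\<^sub>R f x) \<in> borel_measurable lborel" using borel_measurable_continuous_on_indicator[OF _ assms(3)] assms(1) by simp
 show i: "set_integrable lborel S f" unfolding set_integrable_def
 proof (rule integrableI_bounded_set[OF _ m])
  show "S \<in> sets lborel" using assms(1) by simp
  show "emeasure lborel S < \<infinity>" using emeasure_bounded_finite[OF assms(2)] by simp
  show "AE x in lborel. x \<in> S --> norm (indicator S x *\<^sub>R f x) <= C" using assms(4) by (intro AE_I2) simp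
 qed simp
 thus "set_integrable lebesgue S f" unfolding set_integrable_def using m by (simp add: integrable_completion)
 show "(LINT x:S|lebesgue. f x) = (LINT x:S|lborel. f x)" unfolding set_lebesgue_integral_def by (rule integral_completion[OF m])
qed

text \<open>The derivative exists only in the open cylinder; continuity up to the closure is what gives the values at
 \<open>0\<close> and \<open>\<tau>\<close>.\<close>

lemma time_integral_of_derivative:
 fixes F :: "spacetime => real"
 assumes T: "0 < T" and \<tau>: "\<tau> \<in> {0..T}" and op: "open Om" and bd: "bounded Om"
  and F: "C1_closure (cyl T Om) F D"
 shows "bulk_integral \<tau> Om (\<lambda>z. D z (1, 0)) = (LINT x:Om|lebesgue. F (\<tau>, x)) - (LINT x:Om|lebesgue. F (0, x))"
proof -
 let ?S = "cyl T Om" and ?Q = "cyl \<tau> Om"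
 have cl: "closure ?S = {0..T} \<times> closure Om" by (rule closure_cylinder[OF T])
 obtain M where M: "!!z. z \<in> closure ?S ==> norm (F z) <= M" "!!z e. z \<in> closure ?S ==> e \<in> Basis ==> norm (D z e) <= M"
  using C1_closure_bounded[OF F bounded_cylinder[OF bd]] by metis
 have QS: "?Q <= ?S" using \<tau> by auto
 have Qcl: "?Q <= closure ?S" using QS closure_subset by blast
 have cD: "continuous_on ?Q (%z. D z (1, 0))" by (rule continuous_on_subset[OF C1D(3)[OF F st_basis(1)] Qcl])
 have bdD: "\<bar>D z (1, 0)\<bar> <= M" if "z \<in> ?Q" for z using M(2)[of z "(1,0)"] that Qcl st_basis(1) by auto
 note I = set_integrable_cont_bounded[OF open_cylinder[OF op] bounded_cylinder[OF bd] cD bdD]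
 define f where "f = (%t x. indicator {0<..<\<tau>} t * (indicator Om x * D (t, x) (1, 0)))"
 have fi: "integrable (lborel \<Otimes>\<^sub>M lborel) (case_prod f)"
 proof -
  have "(%z. indicator ?Q z *\<^sub>R D z (1, 0)) = case_prod f" by (auto simp: f_def fun_eq_iff indicator_def)
  thus ?thesis using I(1) by (simp add: set_integrable_def lborel_prod)
 qed
 have inner: "(LINT t|lborel. f t x) = indicator Om x * (F (\<tau>, x) - F (0, x))" for x
 proof (cases "x \<in> Om")
  case True
  have xcl: "x \<in> closure Om" using True closure_subset by blast
  have "((%t. D (t, x) (1, 0)) has_integral (F (\<tau>, x) - F (0, x))) {0..\<tau>}"
  proof (rule fundamental_theorem_of_calculus_interior)
   show "continuous_on {0..\<tau>} (%t. F (t, x))" by (rule continuous_on_compose2[OF C1D(1)[OF F]])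
      (use \<tau> xcl in \<open>auto intro!: continuous_intros simp: cl\<close>)
   fix t assume t: "t \<in> {0<..<\<tau>}"
   hence tx: "(t, x) \<in> ?S" using \<tau> True by auto
   have lin: "linear (D (t, x))" using C1D(2)[OF F tx] by (rule has_derivative_linear)
   have "((%t. (t, x)) has_derivative (%h. (h, 0))) (at t)" by (auto intro!: derivative_eq_intros)
   from has_derivative_compose[OF this C1D(2)[OF F tx]]
   have "((%t. F (t, x)) has_derivative (%h. D (t, x) (h, 0))) (at t)" .
   moreover have "(%h. D (t, x) (h, 0)) = (%h. h *\<^sub>R D (t, x) (1, 0))"
   proof
    fix h :: real
    have "(h, 0 :: plane) = h *\<^sub>R (1, 0)" by simp
    thus "D (t, x) (h, 0) = h *\<^sub>R D (t, x) (1, 0)" using linear_cmul[OF lin] by metis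
   qed
   ultimately show "((%t. F (t, x)) has_vector_derivative D (t, x) (1, 0)) (at t)" unfolding has_vector_derivative_def by (rule subst[rotated])
  qed (use \<tau> in simp)
  hence hk: "integral {0<..<\<tau>} (%t. D (t, x) (1, 0)) = F (\<tau>, x) - F (0, x)" by (simp add: has_integral_Icc_iff_Ioo integral_unique)
  have "set_integrable lborel {0<..<\<tau>} (%t. D (t, x) (1, 0))"
  proof (rule set_integrable_cont_bounded(1))
   show "continuous_on {0<..<\<tau>} (%t. D (t, x) (1, 0))" by (rule continuous_on_compose2[OF cD]) (use True in \<open>auto intro!: continuous_intros\<close>)
   show "\<bar>D (t, x) (1, 0)\<bar> <= M" if "t \<in> {0<..<\<tau>}" for t using bdD[of "(t, x)"] that True by simp
  qed auto
  from set_borel_integral_eq_integral(2)[OF this] hk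
  have "(LINT t:{0<..<\<tau>}|lborel. D (t, x) (1, 0)) = F (\<tau>, x) - F (0, x)" by simp
  thus ?thesis using True by (simp add: f_def set_lebesgue_integral_def)
 qed (simp add: f_def)
 have "bulk_integral \<tau> Om (%z. D z (1, 0)) = (LINT z:?Q|lborel. D z (1, 0))" unfolding bulk_integral_def by (rule I(3))
 also have "... = (LINT z|(lborel \<Otimes>\<^sub>M lborel). case_prod f z)" unfolding set_lebesgue_integral_def lborel_prod
  by (rule Bochner_Integration.integral_cong) (auto simp: f_def indicator_def)
 also have "... = (LINT x|lborel. (LINT t|lborel. f t x))" using lborel_pair.integral_snd[OF fi] by simp
 also have "... = (LINT x:Om|lborel. F (\<tau>, x) - F (0, x))" unfolding inner set_lebesgue_integral_def by simp
 also have "... = (LINT x:Om|lebesgue. F (\<tau>, x)) - (LINT x:Om|lebesgue. F (0, x))"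
 proof -
  have cs: "continuous_on Om (%x. F (s, x))" if "s \<in> {0..T}" for s by (rule continuous_on_compose2[OF C1D(1)[OF F]])
     (use that closure_subset[of Om] in \<open>auto intro!: continuous_intros simp: cl\<close>)
  have bs: "\<bar>F (s, x)\<bar> <= M" if "s \<in> {0..T}" "x \<in> Om" for s x using M(1)[of "(s, x)"] that closure_subset[of Om] unfolding cl by auto
  have t0: "0 \<in> {0..T}" using T by simp
  note s\<tau> = set_integrable_cont_bounded[OF op bd cs[OF \<tau>] bs[OF \<tau>]]
   and s0 = set_integrable_cont_bounded[OF op bd cs[OF t0] bs[OF t0]]
  show ?thesis using set_integral_diff(2)[OF s\<tau>(1) s0(1)] s\<tau>(3) s0(3) by linarith
 qed
 finally show ?thesis .
qed

lemma slice_has_derivative: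
 assumes "(F has_derivative D) (at (t, x))"
 shows "((\<lambda>x. F (t, x)) has_derivative (\<lambda>h. D (0, h))) (at x)"
proof -
 have "((%x. (t, x)) has_derivative (%h. (0, h))) (at x)" by (auto intro!: derivative_eq_intros)
 from has_derivative_compose[OF this assms] show ?thesis .
qed

lemma bulk_integral_partial_derivative:
 fixes F :: "spacetime => real" and i :: 2
 assumes T: "0 < T" and \<tau>: "\<tau> \<in> {0..T}" and dom: "piecewise_regular_lipschitz_domain Om"
  and F: "C1_closure (cyl T Om) F D"
 defines "\<Phi> \<equiv> \<lambda>t. LINT x:frontier Om|surface_measure Om. F (t, x) * outer_normal Om x $ i"
 shows "bulk_integral \<tau> Om (\<lambda>z. D z (0, axis i 1)) = (LINT t:{0<..<\<tau>}|lebesgue. \<Phi> t)"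
  and "set_integrable lebesgue {0<..<\<tau>} \<Phi>"
proof -
 have op: "open Om" and bd: "bounded Om" using dom by (auto simp: piecewise_regular_lipschitz_domain_def)
 let ?S = "cyl T Om" and ?Q = "cyl \<tau> Om"
 have cl: "closure ?S = {0..T} \<times> closure Om" by (rule closure_cylinder[OF T])
 obtain M where M: "!!z e. z \<in> closure ?S ==> e \<in> Basis ==> norm (D z e) <= M"
  using C1_closure_bounded[OF F bounded_cylinder[OF bd]] by metis
 have Qcl: "?Q <= closure ?S" using \<tau> closure_subset[of ?S] by auto
 have cD: "continuous_on ?Q (%z. D z (0, axis i 1))" by (rule continuous_on_subset[OF C1D(3)[OF F st_basis(2)] Qcl])
 have bdD: "\<bar>D z (0, axis i 1)\<bar> <= M" if "z \<in> ?Q" for z using M[of z "(0, axis i 1)"] that Qcl st_basis(2)[of i] by auto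
 note I = set_integrable_cont_bounded[OF open_cylinder[OF op] bounded_cylinder[OF bd] cD bdD]
 have slice: "(LINT x:Om|lebesgue. D (t, x) (0, axis i 1)) = \<Phi> t" if t: "t \<in> {0<..<\<tau>}" for t
 proof -
  have c1: "continuous_on Om (%x. D (t, x) (0, axis i 1))"
   by (rule continuous_on_compose2[OF cD]) (use t in \<open>auto intro!: continuous_intros\<close>)
  have b1: "\<bar>D (t, x) (0, axis i 1)\<bar> <= M" if "x \<in> Om" for x using bdD[of "(t, x)"] that t by simp
  have "(LINT x:Om|lebesgue. D (t, x) (0, axis i 1)) = (LINT x:Om|lborel. D (t, x) (0, axis i 1))"
   by (rule set_integrable_cont_bounded(3)[OF op bd c1 b1])
  also have "... = \<Phi> t" unfolding \<Phi>_def
  proof (rule divergence_theorem_component[OF dom, where F' = "%x h. D (t, x) (0, h)"])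
   show "continuous_on (closure Om) (%x. F (t, x))" by (rule continuous_on_compose2[OF C1D(1)[OF F]])
      (use t \<tau> in \<open>auto intro!: continuous_intros simp: cl\<close>)
   show "((%x. F (t, x)) has_derivative (%h. D (t, x) (0, h))) (at x)" if "x \<in> Om" for x
    by (rule slice_has_derivative, rule C1D(2)[OF F]) (use that t \<tau> in auto)
  qed (use c1 b1 in auto)
  finally show ?thesis .
 qed
 have "bulk_integral \<tau> Om (%z. D z (0, axis i 1)) = (LINT t:{0<..<\<tau>}|lebesgue. (LINT x:Om|lebesgue. D (t, x) (0, axis i 1)))"
  unfolding bulk_integral_def by (rule set_lebesgue_Fubini(3)[OF I(2), symmetric])
 also have "... = (LINT t:{0<..<\<tau>}|lebesgue. \<Phi> t)" by (rule set_lebesgue_integral_cong) (use slice in auto)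
 finally show "bulk_integral \<tau> Om (%z. D z (0, axis i 1)) = (LINT t:{0<..<\<tau>}|lebesgue. \<Phi> t)" .
 have "set_integrable lebesgue {0<..<\<tau>} (%t. LINT x:Om|lebesgue. D (t, x) (0, axis i 1)) = set_integrable lebesgue {0<..<\<tau>} \<Phi>"
  using slice by (intro set_integrable_cong) auto
 thus "set_integrable lebesgue {0<..<\<tau>} \<Phi>" using set_lebesgue_Fubini(2)[OF I(2)] by simp
qed

definition normal_flux :: "plane set => (plane => plane) => plane => real" where
 "normal_flux Om uB x = uB x \<bullet> outer_normal Om x"

locale boundary_flux =
 fixes Om :: "plane set" and uB :: "plane => plane"
 assumes dom: "piecewise_regular_lipschitz_domain Om" and cuB: "continuous_on UNIV uB"

begin

abbreviation "flux \<equiv> normal_flux Om uB"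

abbreviation "BM \<equiv> (lborel :: real measure) \<Otimes>\<^sub>M surface_measure Om"

lemma op: "open Om" and bd: "bounded Om" using dom by (auto simp: piecewise_regular_lipschitz_domain_def)

sublocale surf: finite_measure "surface_measure Om" by (rule finite_surface_measure[OF dom])

sublocale BMp: pair_sigma_finite "lborel :: real measure" "surface_measure Om" ..

lemma sets_BM: "sets BM = sets (borel :: spacetime measure)"
proof -
 have "sets BM = sets ((borel :: real measure) \<Otimes>\<^sub>M (borel :: plane measure))" by (rule sets_pair_measure_cong) simp_all
 also have "... = sets (borel :: spacetime measure)" by (rule arg_cong[OF borel_prod])
 finally show ?thesis .
qed

lemma frontier_bounded: "bounded (frontier Om)" using bd bounded_closure bounded_subset by (metis frontier_def Diff_subset)

lemma flux_measurable: "(\<lambda>x. indicator (frontier Om) x *\<^sub>R flux x) \<in> borel_measurable borel"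
proof -
 have "uB \<in> borel_measurable borel" by (rule borel_measurable_continuous_onI[OF cuB])
 hence "(%x. uB x \<bullet> (indicator (frontier Om) x *\<^sub>R outer_normal Om x)) \<in> borel_measurable borel"
  using measurable_outer_normal[OF dom] by (rule borel_measurable_inner)
 thus ?thesis by (simp add: normal_flux_def)
qed

lemma flux_bounded: "\<exists>C. \<forall>x\<in>frontier Om. \<bar>flux x\<bar> <= C"
proof -
 have "compact (frontier Om)" using frontier_bounded by (simp add: compact_eq_bounded_closed)
 hence "bounded (uB ` frontier Om)" by (intro compact_imp_bounded compact_continuous_image continuous_on_subset[OF cuB]) auto
 then obtain C where C: "!!x. x \<in> frontier Om ==> norm (uB x) <= C" by (auto simp: bounded_iff)
 have "\<bar>flux x\<bar> <= C" if x: "x \<in> frontier Om" for x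
 proof -
  have "\<bar>flux x\<bar> <= norm (uB x) * norm (outer_normal Om x)" unfolding normal_flux_def by (rule Cauchy_Schwarz_ineq2)
  also have "... <= norm (uB x) * 1" by (intro mult_left_mono norm_outer_normal_le_1) simp
  finally show ?thesis using C[OF x] by simp
 qed
 thus ?thesis by blast
qed

lemma inflow_eq: "inflow Om uB = {x. indicator (frontier Om) x *\<^sub>R flux x < 0}"
 and outflow_eq: "outflow Om uB = {x. indicator (frontier Om) x *\<^sub>R flux x > 0}" by (auto simp: inflow_def outflow_def normal_flux_def indicator_def)

lemma inflow_sets [measurable]: "inflow Om uB \<in> sets borel" unfolding inflow_eq using borel_measurable_less[OF flux_measurable borel_measurable_const[of 0]]
 by (simp only: space_borel UNIV_I simp_thms)

lemma outflow_sets [measurable]: "outflow Om uB \<in> sets borel" unfolding outflow_eq using borel_measurable_less[OF borel_measurable_const[of 0] flux_measurable]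
 by (simp only: space_borel UNIV_I simp_thms)

lemma in_out_frontier: "inflow Om uB <= frontier Om" "outflow Om uB <= frontier Om" by (auto simp: inflow_def outflow_def)

lemma emeasure_cylinder_finite:
 assumes "\<Gamma> \<in> sets borel"
 shows "{0<..<\<tau>} \<times> \<Gamma> \<in> sets BM" "emeasure BM ({0<..<\<tau>} \<times> \<Gamma>) < \<infinity>"
proof -
 show "{0<..<\<tau>} \<times> \<Gamma> \<in> sets BM" using assms by (intro pair_measureI) auto
 have "emeasure BM ({0<..<\<tau>} \<times> \<Gamma>) = emeasure lborel {0<..<\<tau>} * emeasure (surface_measure Om) \<Gamma>"
  using assms by (intro surf.emeasure_pair_measure_Times) auto
 moreover have "emeasure lborel {0<..<\<tau>} < \<infinity>" using emeasure_bounded_finite[of "{0<..<\<tau>}"] by simp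
 moreover have "emeasure (surface_measure Om) \<Gamma> < \<infinity>" using surf.emeasure_finite[of \<Gamma>] by (simp add: less_top[symmetric])
 ultimately show "emeasure BM ({0<..<\<tau>} \<times> \<Gamma>) < \<infinity>" by (simp add: ennreal_mult_less_top)
qed

text \<open>Boundary values are integrable only against the flux, so a product is dominated by an integrable
 \<open>w\<close> after multiplication by it.\<close>

lemma integrable_boundary_product:
 assumes \<Gamma>: "\<Gamma> \<in> sets borel" "\<Gamma> <= frontier Om" and \<tau>: "\<tau> <= T"
  and f: "set_borel_measurable BM ({0<..<T} \<times> frontier Om) f"
  and w: "set_integrable BM ({0<..<T} \<times> frontier Om) w"
  and le: "!!t x. t \<in> {0<..<T} ==> x \<in> frontier Om ==> \<bar>f (t, x) * flux x\<bar> <= \<bar>w (t, x)\<bar>"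
 shows "set_integrable BM ({0<..<\<tau>} \<times> \<Gamma>) (\<lambda>(t, x). f (t, x) * flux x)"
proof (rule set_integrable_subset)
 have fr: "frontier Om \<in> sets borel" by simp
 show "set_integrable BM ({0<..<T} \<times> frontier Om) (%(t, x). f (t, x) * flux x)" unfolding set_integrable_def
 proof (rule Bochner_Integration.integrable_bound[OF w[unfolded set_integrable_def]])
  have m1: "(%z. indicator ({0<..<T} \<times> frontier Om) z *\<^sub>R f z) \<in> borel_measurable BM" using f by (simp add: set_borel_measurable_def)
  have m2: "(%z. indicator (frontier Om) (snd z) *\<^sub>R flux (snd z)) \<in> borel_measurable BM"
  proof (rule measurable_compose[OF measurable_snd])
   show "(%x. indicator (frontier Om) x *\<^sub>R flux x) \<in> borel_measurable (surface_measure Om)" using flux_measurable by simp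
  qed
  have "(%z. indicat_real ({0<..<T} \<times> frontier Om) z *\<^sub>R (case z of (t, x) => f (t, x) * flux x))
   = (%z. (indicator ({0<..<T} \<times> frontier Om) z *\<^sub>R f z) * (indicator (frontier Om) (snd z) *\<^sub>R flux (snd z)))"
   by (auto simp: fun_eq_iff indicator_def)
  thus "(%z. indicat_real ({0<..<T} \<times> frontier Om) z *\<^sub>R (case z of (t, x) => f (t, x) * flux x)) \<in> borel_measurable BM"
   using m1 m2 by simp
  show "AE z in BM. norm (indicat_real ({0<..<T} \<times> frontier Om) z *\<^sub>R (case z of (t, x) => f (t, x) * flux x))
    <= norm (indicat_real ({0<..<T} \<times> frontier Om) z *\<^sub>R w z)" by (intro AE_I2) (use le in \<open>auto simp: indicator_def\<close>)
 qed
 show "{0<..<\<tau>} \<times> \<Gamma> \<in> sets BM" by (rule emeasure_cylinder_finite(1)[OF \<Gamma>(1)])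
 show "{0<..<\<tau>} \<times> \<Gamma> <= {0<..<T} \<times> frontier Om" using \<Gamma>(2) \<tau> by auto
qed

lemma continuous_boundary_measurable:
 fixes F :: "spacetime => real"
 assumes "continuous_on ({0..T} \<times> closure Om) F"
 shows "set_borel_measurable BM ({0<..<T} \<times> frontier Om) F"
proof -
 have m: "(%z. indicator ({0..T} \<times> closure Om) z *\<^sub>R F z) \<in> borel_measurable borel"
  by (rule borel_measurable_continuous_on_indicator[OF _ assms]) (intro borel_closed closed_Times, auto)
 have s: "{0<..<T} \<times> frontier Om \<in> sets BM" by (rule emeasure_cylinder_finite(1)) simp
 have "(%z. indicator ({0<..<T} \<times> frontier Om) z *\<^sub>R F z) =
   (%z. indicator ({0<..<T} \<times> frontier Om) z *\<^sub>R (indicator ({0..T} \<times> closure Om) z *\<^sub>R F z))"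
  by (auto simp: fun_eq_iff indicator_def frontier_def)
 moreover have "(%z. indicator ({0..T} \<times> closure Om) z *\<^sub>R F z) \<in> borel_measurable BM"
  using m by (simp only: measurable_cong_sets[OF sets_BM refl])
 ultimately show ?thesis unfolding set_borel_measurable_def using borel_measurable_scaleR[OF borel_measurable_indicator[OF s]] by simp
qed

lemma integrable_boundary_constant: "set_integrable BM ({0<..<T} \<times> frontier Om) (\<lambda>z. c :: real)" unfolding set_integrable_def
 by (rule integrableI_bounded_set[where A = "{0<..<T} \<times> frontier Om" and B = "\<bar>c\<bar>"])
   (use emeasure_cylinder_finite[of "frontier Om" T] in \<open>auto simp: indicator_def\<close>)

lemma integrable_boundary_continuous:
 assumes F: "continuous_on ({0..T} \<times> closure Om) F" and \<tau>: "\<tau> <= T" and \<Gamma>: "\<Gamma> \<in> sets borel" "\<Gamma> <= frontier Om"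
 shows "set_integrable BM ({0<..<\<tau>} \<times> \<Gamma>) (\<lambda>(t, x). F (t, x) * flux x)"
proof -
 have "compact ({0..T} \<times> closure Om)" using bd by (intro compact_Times) auto
 hence "bounded (F ` ({0..T} \<times> closure Om))" by (intro compact_imp_bounded compact_continuous_image F)
 then obtain A where A: "!!z. z \<in> {0..T} \<times> closure Om ==> \<bar>F z\<bar> <= A" by (auto simp: bounded_real)
 obtain C where C: "!!x. x \<in> frontier Om ==> \<bar>flux x\<bar> <= C" using flux_bounded by blast
 show ?thesis
 proof (rule integrable_boundary_product[OF \<Gamma> \<tau> continuous_boundary_measurable[OF F] integrable_boundary_constant[of T "\<bar>A\<bar> * \<bar>C\<bar>"]])
  fix t x assume t: "t \<in> {0<..<T}" and x: "x \<in> frontier Om"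
  have "(t, x) \<in> {0..T} \<times> closure Om" using t x by (auto simp: frontier_def)
  hence "\<bar>F (t, x)\<bar> <= \<bar>A\<bar>" using A by force
  moreover have "\<bar>flux x\<bar> <= \<bar>C\<bar>" using C[OF x] by simp
  ultimately show "\<bar>F (t, x) * flux x\<bar> <= \<bar>\<bar>A\<bar> * \<bar>C\<bar>\<bar>" unfolding abs_mult by (simp add: mult_mono)
 qed
qed

lemma in_plus_out:
 assumes F: "continuous_on ({0..T} \<times> closure Om) F" and \<tau>: "\<tau> <= T"
 shows "boundary_integral \<tau> Om (inflow Om uB) (\<lambda>(t, x). F (t, x) * flux x)
   + boundary_integral \<tau> Om (outflow Om uB) (\<lambda>(t, x). F (t, x) * flux x)
  = (LINT t:{0<..<\<tau>}|lebesgue. (LINT x:frontier Om|surface_measure Om. F (t, x) * flux x))"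
proof -
 let ?f = "%(t, x). F (t, x) * flux x"
 note i1 = integrable_boundary_continuous[OF F \<tau> inflow_sets in_out_frontier(1)]
  and i2 = integrable_boundary_continuous[OF F \<tau> outflow_sets in_out_frontier(2)]
  and i3 = integrable_boundary_continuous[OF F \<tau> _ order_refl]
 have fr: "frontier Om \<in> sets borel" by simp
 have "boundary_integral \<tau> Om (inflow Om uB) ?f + boundary_integral \<tau> Om (outflow Om uB) ?f
   = (LINT z:({0<..<\<tau>} \<times> inflow Om uB) \<union> ({0<..<\<tau>} \<times> outflow Om uB)|BM. ?f z)" unfolding boundary_integral_def
  by (rule set_integral_Un[OF _ i1 i2, symmetric]) (auto simp: inflow_def outflow_def)
 also have "... = (LINT z:{0<..<\<tau>} \<times> frontier Om|BM. ?f z)" unfolding set_lebesgue_integral_def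
  by (rule Bochner_Integration.integral_cong[OF refl])
    (auto simp: indicator_def inflow_def outflow_def normal_flux_def)
 also have "... = (LINT t|lborel. (LINT x|surface_measure Om. indicator ({0<..<\<tau>} \<times> frontier Om) (t, x) *\<^sub>R ?f (t, x)))"
  unfolding set_lebesgue_integral_def by (rule BMp.integral_fst'[symmetric]) (use i3[OF fr] in \<open>simp add: set_integrable_def\<close>)
 also have "... = (LINT t|lborel. indicator {0<..<\<tau>} t *\<^sub>R (LINT x:frontier Om|surface_measure Om. F (t, x) * flux x))"
 proof (rule Bochner_Integration.integral_cong[OF refl])
  fix t :: real
  have "(%x. indicator ({0<..<\<tau>} \<times> frontier Om) (t, x) *\<^sub>R ?f (t, x)) =
    (%x. indicator {0<..<\<tau>} t *\<^sub>R (indicator (frontier Om) x *\<^sub>R (F (t, x) * flux x)))" by (auto simp: fun_eq_iff indicator_def)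
  thus "(LINT x|surface_measure Om. indicator ({0<..<\<tau>} \<times> frontier Om) (t, x) *\<^sub>R ?f (t, x)) =
    indicator {0<..<\<tau>} t *\<^sub>R (LINT x:frontier Om|surface_measure Om. F (t, x) * flux x)" by (simp add: set_lebesgue_integral_def)
 qed
 also have "... = (LINT t|lebesgue. indicator {0<..<\<tau>} t *\<^sub>R (LINT x:frontier Om|surface_measure Om. F (t, x) * flux x))"
 proof (rule integral_completion[symmetric])
  have "(%t. LINT x|surface_measure Om. indicator ({0<..<\<tau>} \<times> frontier Om) (t, x) *\<^sub>R ?f (t, x)) \<in> borel_measurable lborel"
   using BMp.integrable_fst'[OF i3[OF fr, unfolded set_integrable_def]] by (rule borel_measurable_integrable)
  moreover have "(%t. LINT x|surface_measure Om. indicator ({0<..<\<tau>} \<times> frontier Om) (t, x) *\<^sub>R ?f (t, x)) =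
   (%t. indicator {0<..<\<tau>} t *\<^sub>R (LINT x:frontier Om|surface_measure Om. F (t, x) * flux x))"
  proof
   fix t :: real
   have "(%x. indicator ({0<..<\<tau>} \<times> frontier Om) (t, x) *\<^sub>R ?f (t, x)) =
     (%x. indicator {0<..<\<tau>} t *\<^sub>R (indicator (frontier Om) x *\<^sub>R (F (t, x) * flux x)))" by (auto simp: fun_eq_iff indicator_def)
   thus "(LINT x|surface_measure Om. indicator ({0<..<\<tau>} \<times> frontier Om) (t, x) *\<^sub>R ?f (t, x)) =
     indicator {0<..<\<tau>} t *\<^sub>R (LINT x:frontier Om|surface_measure Om. F (t, x) * flux x)" by (simp add: set_lebesgue_integral_def)
  qed
  ultimately show "(%t. indicator {0<..<\<tau>} t *\<^sub>R (LINT x:frontier Om|surface_measure Om. F (t, x) * flux x)) \<in> borel_measurable lborel"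
   by simp
 qed
 finally show ?thesis by (simp add: set_lebesgue_integral_def)
qed

text \<open>The time derivative is integrated by the fundamental theorem of calculus and the spatial divergence by the
 divergence theorem; the boundary values turn the normal component of \<open>U\<close> into the prescribed flux.\<close>

lemma transported_quantity_balance:
 assumes T: "0 < T" and \<tau>: "\<tau> \<in> {0..T}"
  and P: "C1_closure (cyl T Om) P DP" and U: "C1_closure (cyl T Om) U DU"
  and bv: "!!t x. t \<in> {0..T} ==> x \<in> frontier Om ==> U (t, x) = uB x"
 shows "bulk_integral \<tau> Om (\<lambda>z. DP z (1, 0) + (\<Sum>j\<in>UNIV. P z * DU z (0, axis j 1) $ j + DP z (0, axis j 1) * U z $ j))
  = (LINT x:Om|lebesgue. P (\<tau>, x)) - (LINT x:Om|lebesgue. P (0, x))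
   + boundary_integral \<tau> Om (inflow Om uB) (\<lambda>(t, x). P (t, x) * flux x)
   + boundary_integral \<tau> Om (outflow Om uB) (\<lambda>(t, x). P (t, x) * flux x)"
proof -
 let ?S = "cyl T Om" and ?Q = "cyl \<tau> Om"
 have cl: "closure ?S = {0..T} \<times> closure Om" by (rule closure_cylinder[OF T])
 have Qcl: "?Q <= closure ?S" using \<tau> closure_subset[of ?S] by auto
 define F where "F j z = P z * U z $ j" for j z
 define DF where "DF j z h = P z * DU z h $ j + DP z h * U z $ j" for j z h
 have F: "C1_closure ?S (F j) (DF j)" for j unfolding F_def[abs_def] DF_def[abs_def] by (rule C1_closure_mult[OF P C1_closure_nth[OF U]])
 have int: "set_integrable lebesgue ?Q (%z. D z e)" if G: "C1_closure ?S G D" and e: "e \<in> Basis"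
  for G :: "spacetime => real" and D e
 proof -
  obtain M where M: "!!z e. z \<in> closure ?S ==> e \<in> Basis ==> norm (D z e) <= M"
   using C1_closure_bounded[OF G bounded_cylinder[OF bd]] by metis
  show ?thesis by (rule set_integrable_cont_bounded(2)[OF open_cylinder[OF op] bounded_cylinder[OF bd]
      continuous_on_subset[OF C1D(3)[OF G e] Qcl], of M])
     (use M[OF subsetD[OF Qcl] e] in auto)
 qed
 note iP = int[OF P st_basis(1)] and iF = int[OF F st_basis(2)]
 have "bulk_integral \<tau> Om (%z. DP z (1, 0) + (\<Sum>j\<in>UNIV. DF j z (0, axis j 1)))
   = bulk_integral \<tau> Om (%z. DP z (1, 0)) + (\<Sum>j\<in>UNIV. bulk_integral \<tau> Om (%z. DF j z (0, axis j 1)))"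
  unfolding bulk_integral_def sum_2 using iP iF by (simp add: set_integral_add)
 also have "(\<Sum>j\<in>UNIV. bulk_integral \<tau> Om (%z. DF j z (0, axis j 1)))
   = (LINT t:{0<..<\<tau>}|lebesgue. (LINT x:frontier Om|surface_measure Om. P (t, x) * flux x))"
 proof -
  have cF: "continuous_on ({0..T} \<times> closure Om) (F j)" for j using C1D(1)[OF F] unfolding cl .
  have slint: "set_integrable (surface_measure Om) (frontier Om) (%x. F j (t, x) * outer_normal Om x $ j)"
   if t: "t \<in> {0..T}" for t j
  proof -
   have cs: "continuous_on (closure Om) (%x. F j (t, x))"
    by (rule continuous_on_compose2[OF cF]) (use t in \<open>auto intro!: continuous_intros\<close>)
   have "compact (closure Om)" using bd by simp
   hence "bounded ((%x. F j (t, x)) ` closure Om)" by (intro compact_imp_bounded compact_continuous_image cs)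
   then obtain A where A: "!!x. x \<in> closure Om ==> \<bar>F j (t, x)\<bar> <= A" by (auto simp: bounded_real)
   have m1: "(%x. indicator (frontier Om) x *\<^sub>R F j (t, x)) \<in> borel_measurable borel"
    by (rule borel_measurable_continuous_on_indicator[OF _ continuous_on_subset[OF cs]]) (auto simp: frontier_def)
   have m2: "(%x. (indicator (frontier Om) x *\<^sub>R outer_normal Om x) $ j) \<in> borel_measurable borel"
   proof (rule measurable_compose[OF measurable_outer_normal[OF dom]])
    show "(%x::plane. x $ j) \<in> borel_measurable borel" by (intro borel_measurable_continuous_onI continuous_intros)
   qed
   have eq: "(%x. indicator (frontier Om) x *\<^sub>R (F j (t, x) * outer_normal Om x $ j)) =
    (%x. (indicator (frontier Om) x *\<^sub>R F j (t, x)) * (indicator (frontier Om) x *\<^sub>R outer_normal Om x) $ j)"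
    by (auto simp: fun_eq_iff indicator_def)
   show ?thesis unfolding set_integrable_def
   proof (rule surf.integrable_const_bound)
    show "(%x. indicator (frontier Om) x *\<^sub>R (F j (t, x) * outer_normal Om x $ j)) \<in> borel_measurable (surface_measure Om)"
     unfolding eq using m1 m2 by simp
    show "AE x in surface_measure Om. norm (indicator (frontier Om) x *\<^sub>R (F j (t, x) * outer_normal Om x $ j)) <= \<bar>A\<bar> * 1"
    proof (intro AE_I2)
     fix x
     show "norm (indicator (frontier Om) x *\<^sub>R (F j (t, x) * outer_normal Om x $ j)) <= \<bar>A\<bar> * 1"
     proof (cases "x \<in> frontier Om")
      case True
      hence "\<bar>F j (t, x)\<bar> <= \<bar>A\<bar>" using A[of x] by (auto simp: frontier_def)
      moreover have "\<bar>outer_normal Om x $ j\<bar> <= 1"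
       using component_le_norm_cart[of "outer_normal Om x" j] norm_outer_normal_le_1[of Om x] by linarith
      ultimately have "\<bar>F j (t, x)\<bar> * \<bar>outer_normal Om x $ j\<bar> <= \<bar>A\<bar> * 1" by (intro mult_mono) auto
      thus ?thesis using True by (simp add: abs_mult)
     qed simp
    qed
   qed
  qed
  define g where "g j t = (LINT x:frontier Om|surface_measure Om. F j (t, x) * outer_normal Om x $ j)" for j t
  have gint: "set_integrable lebesgue {0<..<\<tau>} (g j)" for j unfolding g_def by (rule bulk_integral_partial_derivative(2)[OF T \<tau> dom F])
  have "(\<Sum>j\<in>UNIV. bulk_integral \<tau> Om (%z. DF j z (0, axis j 1))) = (\<Sum>j\<in>UNIV. LINT t:{0<..<\<tau>}|lebesgue. g j t)"
   unfolding g_def by (intro sum.cong refl bulk_integral_partial_derivative(1)[OF T \<tau> dom F])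
  also have "... = (LINT t:{0<..<\<tau>}|lebesgue. g 1 t + g 2 t)" unfolding sum_2 by (rule set_integral_add(2)[symmetric]) (rule gint)+
  also have "... = (LINT t:{0<..<\<tau>}|lebesgue. (LINT x:frontier Om|surface_measure Om. P (t, x) * flux x))"
  proof (rule set_lebesgue_integral_cong)
   show "\<forall>t. t \<in> {0<..<\<tau>} --> g 1 t + g 2 t = (LINT x:frontier Om|surface_measure Om. P (t, x) * flux x)"
   proof (intro allI impI)
    fix t assume "t \<in> {0<..<\<tau>}"
    hence t: "t \<in> {0..T}" using \<tau> by auto
    have "g 1 t + g 2 t = (LINT x:frontier Om|surface_measure Om. F 1 (t, x) * outer_normal Om x $ 1 + F 2 (t, x) * outer_normal Om x $ 2)"
     unfolding g_def by (rule set_integral_add(2)[symmetric]) (rule slint[OF t])+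
    also have "... = (LINT x:frontier Om|surface_measure Om. P (t, x) * flux x)" by (rule set_lebesgue_integral_cong)
       (use bv[OF t] in \<open>auto simp: F_def normal_flux_def inner_vec_def sum_2 algebra_simps\<close>)
    finally show "g 1 t + g 2 t = (LINT x:frontier Om|surface_measure Om. P (t, x) * flux x)" .
   qed
  qed simp
  finally show ?thesis .
 qed
 also have "... = boundary_integral \<tau> Om (inflow Om uB) (%(t, x). P (t, x) * flux x)
   + boundary_integral \<tau> Om (outflow Om uB) (%(t, x). P (t, x) * flux x)"
  by (rule in_plus_out[symmetric, of T]) (use C1D(1)[OF P] \<tau> in \<open>auto simp: cl\<close>)
 also have "bulk_integral \<tau> Om (%z. DP z (1, 0)) = (LINT x:Om|lebesgue. P (\<tau>, x)) - (LINT x:Om|lebesgue. P (0, x))"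
  by (rule time_integral_of_derivative[OF T \<tau> op bd P])
 finally show ?thesis by (simp add: DF_def)
qed

end

section \<open>Testing the momentum equation\<close>

lemma C1_closure_vec:
 fixes f :: "'a::euclidean_space => real ^ 'n"
 assumes "!!i. C1_closure S (\<lambda>z. f z $ i) (D i)"
 shows "C1_closure S f (\<lambda>z h. \<chi> i. D i z h)" unfolding C1_closure_def
proof (intro conjI ballI)
 have "continuous_on (closure S) (%z. \<chi> i. f z $ i)" by (intro continuous_on_vec_lambda C1D(1)[OF assms])
 thus "continuous_on (closure S) f" by simp
 show "continuous_on (closure S) (%z. \<chi> i. D i z e)" if "e \<in> Basis" for e by (intro continuous_on_vec_lambda C1D(3)[OF assms that])
 show "(f has_derivative (%h. \<chi> i. D i z h)) (at z)" if "z \<in> S" for z unfolding has_derivative_componentwise_within[of f]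
 proof
  fix e :: "real ^ 'n" assume "e \<in> Basis"
  then obtain i where e: "e = axis i 1" by (auto simp: Basis_vec_def)
  show "((%x. f x \<bullet> e) has_derivative (%x. (\<chi> i. D i z x) \<bullet> e)) (at z)"
   using C1D(2)[OF assms that, of i] by (simp add: e inner_axis)
 qed
qed

lemma set_integral_dominated_limit:
 fixes f :: "'a => real" and s :: "nat => 'a => real"
 assumes A: "A \<in> sets M" and w: "set_integrable M A w" and f: "set_borel_measurable M A f"
  and s: "!!n. set_borel_measurable M A (s n)"
  and le: "!!n x. x \<in> A ==> \<bar>s n x\<bar> <= w x"
  and lim: "AE x in M. x \<in> A --> (\<lambda>n. s n x) \<longlonglongrightarrow> f x"
 shows "(\<lambda>n. LINT x:A|M. s n x) \<longlonglongrightarrow> (LINT x:A|M. f x)" unfolding set_lebesgue_integral_def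
proof (rule integral_dominated_convergence[where w = "%x. indicator A x *\<^sub>R w x"])
 show "(%x. indicator A x *\<^sub>R f x) \<in> borel_measurable M" using f by (simp add: set_borel_measurable_def)
 show "!!n. (%x. indicator A x *\<^sub>R s n x) \<in> borel_measurable M" using s by (simp add: set_borel_measurable_def)
 show "integrable M (%x. indicator A x *\<^sub>R w x)" using w by (simp add: set_integrable_def)
 show "AE x in M. (%n. indicat_real A x *\<^sub>R s n x) \<longlonglongrightarrow> indicat_real A x *\<^sub>R f x"
  using lim by eventually_elim (auto simp: indicator_def)
 show "!!n. AE x in M. norm (indicat_real A x *\<^sub>R s n x) <= indicat_real A x *\<^sub>R w x"
  by (intro AE_I2) (use le in \<open>auto simp: indicator_def\<close>)
qed

lemma set_integrable_mult_bounded: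
 fixes f g :: "'a::euclidean_space => real"
 assumes f: "set_integrable lebesgue A f" and A: "A \<in> sets lebesgue" and g: "continuous_on A g" and le: "!!x. x \<in> A ==> \<bar>g x\<bar> <= C"
 shows "set_integrable lebesgue A (\<lambda>x. f x * g x)"
proof -
 have m: "(%x. indicator A x *\<^sub>R g x) \<in> borel_measurable lebesgue"
  using continuous_imp_measurable_on_sets_lebesgue[OF g A] A by (simp add: borel_measurable_restrict_space_iff)
 have eq: "(%x. indicator A x *\<^sub>R (f x * g x)) = (%x. (indicator A x *\<^sub>R f x) * (indicator A x *\<^sub>R g x))"
  by (auto simp: fun_eq_iff indicator_def)
 show ?thesis unfolding set_integrable_def
 proof (rule Bochner_Integration.integrable_bound[where f = "%x. \<bar>C\<bar> * (indicator A x *\<^sub>R f x)"])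
  show "integrable lebesgue (%x. \<bar>C\<bar> * (indicator A x *\<^sub>R f x))"
   by (intro integrable_mult_right) (use f in \<open>simp add: set_integrable_def\<close>)
  show "(%x. indicator A x *\<^sub>R (f x * g x)) \<in> borel_measurable lebesgue" unfolding eq
   using m f by (simp add: set_integrable_def borel_measurable_integrable borel_measurable_times)
  show "AE x in lebesgue. norm (indicator A x *\<^sub>R (f x * g x)) <= norm (\<bar>C\<bar> * (indicator A x *\<^sub>R f x))"
  proof (intro AE_I2)
   fix x
   show "norm (indicator A x *\<^sub>R (f x * g x)) <= norm (\<bar>C\<bar> * (indicator A x *\<^sub>R f x))"
   proof (cases "x \<in> A")
    case True
    have "\<bar>g x\<bar> * \<bar>f x\<bar> <= \<bar>C\<bar> * \<bar>f x\<bar>" using le[OF True] by (intro mult_right_mono) auto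
    thus ?thesis using True by (simp add: abs_mult mult.commute)
   qed simp
  qed
 qed
qed

text \<open>Cutting off the components near zero gives test functions with compact support. In the limit the cut-off
 gradients could lose mass only where a component vanishes and its derivative does not, a null set.\<close>

lemma weak_momentum_vanishing_test:
 fixes Om :: "plane set" and V :: "spacetime => plane" and u :: "spacetime => plane"
 assumes T: "0 < T" and \<tau>: "\<tau> \<in> {0..T}" and op: "open Om" and bd: "bounded Om"
  and wm: "weak_momentum Om T \<gamma> mu lam rho0 u0 rho u Du b m"
  and V: "C1_closure (cyl T Om) V DV"
  and V0: "!!t x. t \<in> {0..T} ==> x \<in> frontier Om ==> V (t, x) = 0"
  and A: "!!z. A z = rho z *\<^sub>R tensor (u z) (u z) + (rho z powr \<gamma> + (b z)^2 / 2) *\<^sub>R mat 1 - stress mu lam (Du z)"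
  and ia: "!!i. set_integrable lebesgue (cyl \<tau> Om) (\<lambda>z. rho z * u z $ i)"
  and iA: "!!i j. set_integrable lebesgue (cyl \<tau> Om) (\<lambda>z. A z $ i $ j)"
  and im: "!!i. set_integrable lebesgue Om (\<lambda>x. m (\<tau>, x) $ i)"
  and i0: "!!i. set_integrable lebesgue Om (\<lambda>x. rho0 x * u0 x $ i)"
 shows "bulk_integral \<tau> Om (\<lambda>z. \<Sum>i\<in>UNIV. rho z * u z $ i * DV z (1, 0) $ i + (\<Sum>j\<in>UNIV. A z $ i $ j * DV z (0, axis j 1) $ i))
  = (LINT x:Om|lebesgue. m (\<tau>, x) \<bullet> V (\<tau>, x)) - (LINT x:Om|lebesgue. rho0 x *\<^sub>R u0 x \<bullet> V (0, x))"
proof -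
 let ?S = "cyl T Om" and ?Q = "cyl \<tau> Om"
 have cl: "closure ?S = {0..T} \<times> closure Om" by (rule closure_cylinder[OF T])
 have QS: "?Q <= ?S" using \<tau> by auto
 have Qcl: "?Q <= closure ?S" using QS closure_subset[of ?S] by (rule subset_trans)
 have opS: "open ?S" by (rule open_cylinder[OF op])
 have Q: "?Q \<in> sets lebesgue" using open_cylinder[OF op, of \<tau>] by simp
 have O: "Om \<in> sets lebesgue" using op by simp
 obtain M where M: "!!z. z \<in> closure ?S ==> norm (V z) <= M" "!!z e. z \<in> closure ?S ==> e \<in> Basis ==> norm (DV z e) <= M"
  using C1_closure_bounded[OF V bounded_cylinder[OF bd]] by metis
 define c where "c i z = rho z * u z $ i * DV z (1, 0) $ i + (\<Sum>j\<in>UNIV. A z $ i $ j * DV z (0, axis j 1) $ i)" for i z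
 have mulint: "set_integrable lebesgue ?Q (%z. f z * DV z e $ i)" if "set_integrable lebesgue ?Q f" "e \<in> Basis" for f e i
 proof (rule set_integrable_mult_bounded[OF that(1) Q, of _ M])
  show "continuous_on ?Q (%z. DV z e $ i)" by (intro continuous_on_component continuous_on_subset[OF C1D(3)[OF V that(2)] Qcl])
  show "\<bar>DV z e $ i\<bar> <= M" if "z \<in> ?Q" for z
   using M(2)[OF subsetD[OF Qcl that] \<open>e \<in> Basis\<close>] component_le_norm_cart[of "DV z e" i] by linarith
 qed
 have ci: "set_integrable lebesgue ?Q (c i)" for i unfolding c_def[abs_def] sum_2 by (intro set_integral_add(1) mulint ia iA st_basis)
 define \<theta> where "\<theta> n = trunc' (trunc_seq n)" for n
 define \<phi> where "\<phi> n z = (\<chi> i. trunc (trunc_seq n) (V z $ i))" for n z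
 define D\<phi> where "D\<phi> n z h = (\<chi> i. \<theta> n (V z $ i) * DV z h $ i)" for n z h
 have Vi: "C1_closure ?S (%z. V z $ i) (%z h. DV z h $ i)" for i by (rule C1_closure_nth[OF V])
 have \<phi>i: "C1_closure ?S (%z. \<phi> n z $ i) (%z h. \<theta> n (V z $ i) * DV z h $ i)" for n i unfolding \<phi>_def \<theta>_def vec_lambda_beta
  by (rule C1_closure_compose[OF Vi trunc_derivative continuous_trunc'[of _ UNIV]]) simp_all
 have \<phi>C: "C1_closure ?S (\<phi> n) (D\<phi> n)" for n unfolding D\<phi>_def[abs_def] by (rule C1_closure_vec[OF \<phi>i])
 have supp: "\<exists>K. compact K & K <= Om & (\<forall>t\<in>{0..T}. \<forall>x\<in>closure Om - K. \<phi> n (t, x) = 0)" for n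
 proof -
  let ?e = "trunc_seq n"
  \<comment> \<open>the set where the cut-off does not vanish, which stays away from the boundary because \<open>V\<close> is continuous\<close>
  define Z where "Z i = {z \<in> {0..T} \<times> closure Om. ?e <= \<bar>V z $ i\<bar>}" for i
  have cV: "continuous_on ({0..T} \<times> closure Om) (%z. V z $ i)" for i using C1D(1)[OF Vi] unfolding cl .
  have cpt: "compact ({0..T} \<times> closure Om)" using bd by (intro compact_Times) auto
  have "compact (Z i)" for i
  proof -
   have "closed (({0..T} \<times> closure Om) \<inter> (%z. \<bar>V z $ i\<bar>) -` {?e..})"
    by (rule continuous_closed_preimage) (auto intro!: continuous_intros cV closed_Times)
   moreover have "Z i = ({0..T} \<times> closure Om) \<inter> (({0..T} \<times> closure Om) \<inter> (%z. \<bar>V z $ i\<bar>) -` {?e..})"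
    by (auto simp: Z_def)
   ultimately show ?thesis using compact_Int_closed[OF cpt] by metis
  qed
  hence cK: "compact (\<Union>i\<in>UNIV. snd ` Z i)" by (intro compact_UN compact_continuous_image continuous_intros) auto
  have KO: "(\<Union>i\<in>UNIV. snd ` Z i) <= Om"
  proof
   fix x assume "x \<in> (\<Union>i\<in>UNIV. snd ` Z i)"
   then obtain i t where tx: "(t, x) \<in> Z i" by auto
   hence t: "t \<in> {0..T}" and x: "x \<in> closure Om" and e: "?e <= \<bar>V (t, x) $ i\<bar>" by (auto simp: Z_def)
   have "V (t, x) ~= 0"
   proof
    assume "V (t, x) = 0"
    hence "?e <= 0" using e by simp
    thus False using trunc_seq_pos[of n] by linarith
   qed
   hence "x ~: frontier Om" using V0[OF t] by blast
   thus "x \<in> Om" using x op by (auto simp: frontier_def interior_open)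
  qed
  have zero: "\<phi> n (t, x) = 0" if "t \<in> {0..T}" "x \<in> closure Om - (\<Union>i\<in>UNIV. snd ` Z i)" for t x
  proof -
   have "\<bar>V (t, x) $ i\<bar> <= ?e" for i
   proof (rule ccontr)
    assume "\<not> \<bar>V (t, x) $ i\<bar> <= ?e"
    hence "(t, x) \<in> Z i" using that unfolding Z_def mem_Collect_eq by simp
    hence "x \<in> (\<Union>i\<in>UNIV. snd ` Z i)" by (intro UN_I[OF UNIV_I] image_eqI[where x = "(t, x)"]) simp_all
    thus False using that(2) by blast
   qed
   hence "trunc ?e (V (t, x) $ i) = 0" for i by (rule trunc_zero[OF trunc_seq_pos])
   thus ?thesis unfolding \<phi>_def vec_eq_iff vec_lambda_beta zero_index by blast
  qed
  show ?thesis by (rule exI[where x = "\<Union>i\<in>UNIV. snd ` Z i"], intro conjI ballI cK KO zero)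
 qed
 have id: "bulk_integral \<tau> Om (%z. rho z *\<^sub>R u z \<bullet> ddt (\<phi> n) z
      + (rho z *\<^sub>R tensor (u z) (u z)) \<bullet> space_jacobian (\<phi> n) z
      + (rho z powr \<gamma> + (b z)^2 / 2) * space_div (\<phi> n) z
      - stress mu lam (Du z) \<bullet> space_jacobian (\<phi> n) z)
    = (LINT x:Om|lebesgue. m (\<tau>, x) \<bullet> \<phi> n (\<tau>, x)) - (LINT x:Om|lebesgue. rho0 x *\<^sub>R u0 x \<bullet> \<phi> n (0, x))" for n
  using wm \<tau> C1_closure_imp_Ck_closure[OF \<phi>C[of n]] supp[of n] unfolding weak_momentum_def by blast
 have integrand: "rho z *\<^sub>R u z \<bullet> ddt (\<phi> n) z
      + (rho z *\<^sub>R tensor (u z) (u z)) \<bullet> space_jacobian (\<phi> n) z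
      + (rho z powr \<gamma> + (b z)^2 / 2) * space_div (\<phi> n) z
      - stress mu lam (Du z) \<bullet> space_jacobian (\<phi> n) z
   = (\<Sum>i\<in>UNIV. \<theta> n (V z $ i) * c i z)" if z: "z \<in> ?S" for z n
 proof -
  have d: "ddt (\<phi> n) z = D\<phi> n z (1, 0)" by (rule ddt_eq[OF C1D(2)[OF \<phi>C z]])
  have x: "ddx j (%w. \<phi> n w $ i) z = \<theta> n (V z $ i) * DV z (0, axis j 1) $ i" for i j by (rule ddx_eq[OF C1D(2)[OF \<phi>i z]])
  show ?thesis unfolding space_jacobian_def space_div_def x d D\<phi>_def c_def A by (simp add: inner_vec_def sum_2 mat_def algebra_simps)
 qed
 have lhs: "(%n. LINT z:?Q|lebesgue. \<theta> n (V z $ i) * c i z) \<longlonglongrightarrow> (LINT z:?Q|lebesgue. c i z)" for i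
 proof (rule set_integral_dominated_limit[OF Q set_integrable_abs[OF ci]])
  show "set_borel_measurable lebesgue ?Q (c i)" using ci[of i] by (simp add: set_integrable_def set_borel_measurable_def borel_measurable_integrable)
  have \<theta>b: "\<bar>\<theta> n s\<bar> <= 1" for n s using trunc'_bounds[OF trunc_seq_pos, of n s] by (simp add: \<theta>_def)
  show "set_borel_measurable lebesgue ?Q (%z. \<theta> n (V z $ i) * c i z)" for n
  proof -
   have "continuous_on ?Q (%z. \<theta> n (V z $ i))" unfolding \<theta>_def by (rule continuous_on_compose2[OF continuous_trunc'[of _ UNIV]])
      (auto intro!: continuous_on_component continuous_on_subset[OF C1D(1)[OF V] Qcl])
   hence "set_integrable lebesgue ?Q (%z. c i z * \<theta> n (V z $ i))" by (rule set_integrable_mult_bounded[OF ci Q]) (use \<theta>b in auto)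
   thus ?thesis by (simp add: set_integrable_def set_borel_measurable_def borel_measurable_integrable mult.commute)
  qed
  show "\<bar>\<theta> n (V z $ i) * c i z\<bar> <= \<bar>c i z\<bar>" for n z
   using mult_right_mono[OF \<theta>b, of "\<bar>c i z\<bar>" n "V z $ i"] by (simp add: abs_mult)
  have ae: "AE z in lebesgue. z ~: {z \<in> ?S. V z $ i = 0 & DV z e $ i ~= 0}" if "e \<in> Basis" for e
  proof (rule AE_not_in)
   show "{z \<in> ?S. V z $ i = 0 & DV z e $ i ~= 0} \<in> null_sets lebesgue" unfolding negligible_iff_null_sets[symmetric]
    by (rule negligible_transversal_zeros[OF opS C1D(2)[OF Vi] continuous_on_subset[OF C1D(3)[OF Vi that] closure_subset]])
  qed
  show "AE z in lebesgue. z \<in> ?Q --> (%n. \<theta> n (V z $ i) * c i z) \<longlonglongrightarrow> c i z"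
   using ae[OF st_basis(1)] ae[OF st_basis(2)[of 1]] ae[OF st_basis(2)[of 2]]
  proof eventually_elim
   case (elim z)
   show ?case
   proof
    assume z: "z \<in> ?Q"
    hence "z \<in> ?S" using QS by blast
    hence "V z $ i = 0 --> c i z = 0" using elim by (auto simp: c_def sum_2)
    thus "(%n. \<theta> n (V z $ i) * c i z) \<longlonglongrightarrow> c i z" unfolding \<theta>_def by (rule trunc'_mult_tendsto)
   qed
  qed
 qed
 have rhs: "(%n. LINT x:Om|lebesgue. f x \<bullet> \<phi> n (s, x)) \<longlonglongrightarrow> (LINT x:Om|lebesgue. f x \<bullet> V (s, x))"
  if f: "!!i. set_integrable lebesgue Om (%x. f x $ i)" and s: "s \<in> {0..T}" for f :: "plane => plane" and s
 proof -
  have cs: "continuous_on Om (%x. F (s, x))" if F: "continuous_on (closure ?S) F" for F :: "spacetime => real"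
   by (rule continuous_on_compose2[OF F]) (use s closure_subset[of Om] in \<open>auto intro!: continuous_intros simp: cl\<close>)
  have sx: "(s, x) \<in> closure ?S" if "x \<in> Om" for x using s that closure_subset[of Om] unfolding cl by blast
  have bV: "\<bar>V (s, x) $ i\<bar> <= M" if "x \<in> Om" for x i using M(1)[OF sx[OF that]] component_le_norm_cart[of "V (s, x)" i] by linarith
  have b\<phi>: "\<bar>\<phi> n (s, x) $ i\<bar> <= M" if "x \<in> Om" for n x i
   using abs_trunc_le[OF trunc_seq_pos, of n "V (s, x) $ i"] bV[OF that, of i] by (simp add: \<phi>_def)
  have iV: "set_integrable lebesgue Om (%x. f x $ i * V (s, x) $ i)" for i by (rule set_integrable_mult_bounded[OF f O cs[OF C1D(1)[OF Vi]] bV])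
  have i\<phi>: "set_integrable lebesgue Om (%x. f x $ i * \<phi> n (s, x) $ i)" for n i
   by (rule set_integrable_mult_bounded[OF f O cs[OF C1D(1)[OF \<phi>i]] b\<phi>])
  have lim: "(%n. LINT x:Om|lebesgue. f x $ i * \<phi> n (s, x) $ i) \<longlonglongrightarrow> (LINT x:Om|lebesgue. f x $ i * V (s, x) $ i)" for i
  proof (rule set_integral_dominated_limit[OF O])
   show "set_integrable lebesgue Om (%x. \<bar>f x $ i\<bar> * \<bar>M\<bar>)" using set_integrable_mult_left[OF set_integrable_abs[OF f[of i]]] by blast
   show "set_borel_measurable lebesgue Om (%x. f x $ i * V (s, x) $ i)"
    using iV[of i] by (simp add: set_integrable_def set_borel_measurable_def borel_measurable_integrable)
   show "set_borel_measurable lebesgue Om (%x. f x $ i * \<phi> n (s, x) $ i)" for n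
    using i\<phi>[of i n] by (simp add: set_integrable_def set_borel_measurable_def borel_measurable_integrable)
   show "\<bar>f x $ i * \<phi> n (s, x) $ i\<bar> <= \<bar>f x $ i\<bar> * \<bar>M\<bar>" if "x \<in> Om" for n x
    unfolding abs_mult using b\<phi>[OF that, of n i] by (intro mult_left_mono) auto
   show "AE x in lebesgue. x \<in> Om --> (%n. f x $ i * \<phi> n (s, x) $ i) \<longlonglongrightarrow> f x $ i * V (s, x) $ i"
   proof (intro AE_I2 impI tendsto_mult tendsto_const)
    show "(%n. \<phi> n (s, x) $ i) \<longlonglongrightarrow> V (s, x) $ i" for x unfolding \<phi>_def vec_lambda_beta by (rule trunc_tendsto)
   qed
  qed
  have "(LINT x:Om|lebesgue. f x \<bullet> \<phi> n (s, x)) = (LINT x:Om|lebesgue. f x $ 1 * \<phi> n (s, x) $ 1) + (LINT x:Om|lebesgue. f x $ 2 * \<phi> n (s, x) $ 2)" for n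
   unfolding inner_vec_def sum_2 inner_real_def by (rule set_integral_add(2)[OF i\<phi> i\<phi>])
  moreover have "(LINT x:Om|lebesgue. f x \<bullet> V (s, x)) = (LINT x:Om|lebesgue. f x $ 1 * V (s, x) $ 1) + (LINT x:Om|lebesgue. f x $ 2 * V (s, x) $ 2)"
   unfolding inner_vec_def sum_2 inner_real_def by (rule set_integral_add(2)[OF iV iV])
  ultimately show ?thesis using tendsto_add[OF lim[of 1] lim[of 2]] by simp
 qed
 have \<theta>ci: "set_integrable lebesgue ?Q (%z. \<theta> n (V z $ i) * c i z)" for n i
 proof -
  have "continuous_on ?Q (%z. \<theta> n (V z $ i))" unfolding \<theta>_def by (rule continuous_on_compose2[OF continuous_trunc'[of _ UNIV]])
     (auto intro!: continuous_on_component continuous_on_subset[OF C1D(1)[OF V] Qcl])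
  moreover have "\<bar>\<theta> n s\<bar> <= 1" for s using trunc'_bounds[OF trunc_seq_pos, of n s] by (simp add: \<theta>_def)
  ultimately have "set_integrable lebesgue ?Q (%z. c i z * \<theta> n (V z $ i))" by (intro set_integrable_mult_bounded[OF ci Q]) auto
  thus ?thesis by (simp add: mult.commute)
 qed
 have eqn: "(\<Sum>i\<in>UNIV. LINT z:?Q|lebesgue. \<theta> n (V z $ i) * c i z) =
   (LINT x:Om|lebesgue. m (\<tau>, x) \<bullet> \<phi> n (\<tau>, x)) - (LINT x:Om|lebesgue. rho0 x *\<^sub>R u0 x \<bullet> \<phi> n (0, x))" for n
 proof -
  have "(\<Sum>i\<in>UNIV. LINT z:?Q|lebesgue. \<theta> n (V z $ i) * c i z) = (LINT z:?Q|lebesgue. (\<Sum>i\<in>UNIV. \<theta> n (V z $ i) * c i z))"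
   unfolding sum_2 by (rule set_integral_add(2)[symmetric]) (rule \<theta>ci)+
  also have "... = (LINT z:?Q|lebesgue. rho z *\<^sub>R u z \<bullet> ddt (\<phi> n) z
      + (rho z *\<^sub>R tensor (u z) (u z)) \<bullet> space_jacobian (\<phi> n) z
      + (rho z powr \<gamma> + (b z)^2 / 2) * space_div (\<phi> n) z
      - stress mu lam (Du z) \<bullet> space_jacobian (\<phi> n) z)"
  proof (rule set_lebesgue_integral_cong[OF Q], intro allI impI)
   fix z assume "z \<in> ?Q"
   hence "z \<in> ?S" by (rule subsetD[OF QS])
   thus "(\<Sum>i\<in>UNIV. \<theta> n (V z $ i) * c i z) = rho z *\<^sub>R u z \<bullet> ddt (\<phi> n) z
      + (rho z *\<^sub>R tensor (u z) (u z)) \<bullet> space_jacobian (\<phi> n) z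
      + (rho z powr \<gamma> + (b z)^2 / 2) * space_div (\<phi> n) z
      - stress mu lam (Du z) \<bullet> space_jacobian (\<phi> n) z" by (rule integrand[symmetric])
  qed
  finally show ?thesis using id[of n] by (simp add: bulk_integral_def)
 qed
 have s0: "(0::real) \<in> {0..T}" using T by simp
 have L: "(%n. \<Sum>i\<in>UNIV. LINT z:?Q|lebesgue. \<theta> n (V z $ i) * c i z) \<longlonglongrightarrow> (\<Sum>i\<in>UNIV. LINT z:?Q|lebesgue. c i z)"
  by (intro tendsto_sum lhs)
 have L': "(%n. (LINT x:Om|lebesgue. m (\<tau>, x) \<bullet> \<phi> n (\<tau>, x)) - (LINT x:Om|lebesgue. rho0 x *\<^sub>R u0 x \<bullet> \<phi> n (0, x)))
   \<longlonglongrightarrow> (LINT x:Om|lebesgue. m (\<tau>, x) \<bullet> V (\<tau>, x)) - (LINT x:Om|lebesgue. rho0 x *\<^sub>R u0 x \<bullet> V (0, x))"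
  by (intro tendsto_diff rhs \<tau> s0) (use im i0 in simp_all)
 have 1: "(\<Sum>i\<in>UNIV. LINT z:?Q|lebesgue. c i z) =
   (LINT x:Om|lebesgue. m (\<tau>, x) \<bullet> V (\<tau>, x)) - (LINT x:Om|lebesgue. rho0 x *\<^sub>R u0 x \<bullet> V (0, x))"
  by (rule LIMSEQ_unique[OF L[unfolded eqn] L'])
 have 2: "(\<Sum>i\<in>UNIV. LINT z:?Q|lebesgue. c i z) = bulk_integral \<tau> Om (%z. \<Sum>i\<in>UNIV. c i z)"
  unfolding bulk_integral_def sum_2 by (rule set_integral_add(2)[symmetric]) (rule ci)+
 show ?thesis using trans[OF 2[symmetric] 1] unfolding c_def .
qed

section \<open>The relative energy\<close>

lemma lebesgue_set_integral_AE_cong: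
 fixes f g :: "'a::euclidean_space => real"
 assumes ae: "AE x in lebesgue. x \<in> A --> f x = g x"
 shows "set_integrable lebesgue A f \<longleftrightarrow> set_integrable lebesgue A g"
  and "(LINT x:A|lebesgue. f x) = (LINT x:A|lebesgue. g x)"
proof -
 let ?f = "%x. indicator A x *\<^sub>R f x" and ?g = "%x. indicator A x *\<^sub>R g x"
 have fg: "AE x in lebesgue. ?f x = ?g x" using ae by eventually_elim (auto simp: indicator_def)
 hence gf: "AE x in lebesgue. ?g x = ?f x" by eventually_elim (rule sym)
 have m: "?f \<in> borel_measurable lebesgue \<longleftrightarrow> ?g \<in> borel_measurable lebesgue"
  using measurable_completion_AE_cong[OF _ fg] measurable_completion_AE_cong[OF _ gf] by blast
 show i: "set_integrable lebesgue A f \<longleftrightarrow> set_integrable lebesgue A g" unfolding set_integrable_def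
  using integrable_cong_AE_imp[OF _ _ fg] integrable_cong_AE_imp[OF _ _ gf] m borel_measurable_integrable by blast
 show "(LINT x:A|lebesgue. f x) = (LINT x:A|lebesgue. g x)"
 proof (cases "set_integrable lebesgue A f")
  case True
  thus ?thesis unfolding set_lebesgue_integral_def using i by (intro integral_cong_AE fg) (auto simp: set_integrable_def borel_measurable_integrable)
 next
  case False
  thus ?thesis using i unfolding set_lebesgue_integral_def set_integrable_def by (simp add: not_integrable_integral_eq)
 qed
qed

lemma stress_nth: "stress mu lam D $ i $ j = mu * (D $ i $ j + D $ j $ i) + (if i = j then lam * (D $ 1 $ 1 + D $ 2 $ 2) else 0)"
 by (simp add: stress_def transpose_def trace_def sum_2 mat_def)

text \<open>The pointwise computation without viscosity, in components: \<open>Uij\<close> is the derivative of the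
 \<open>i\<close>th component in direction \<open>j\<close>, \<open>V\<close> stands for \<open>uB\<close>,
 \<open>q = r^(\<gamma> - 2)\<close>, and \<open>\<kappa> = rho / r\<close> keeps the identity polynomial. The
 hypotheses are the strong equations solved for the time derivatives of \<open>r\<close> and \<open>B\<close> and
 for the viscous force \<open>K\<close>.\<close>

lemma relative_energy_transport_identity:
 fixes \<rho> b r B q g p :: real
 assumes \<rho>: "\<rho> = \<kappa> * r"
  and rt: "rt = - (r1 * U1 + r2 * U2 + r * (U11 + U22))"
  and Bt: "Bt = - (B1 * U1 + B2 * U2 + B * (U11 + U22))"
  and K1: "K1 = r * (U1t + (U1 * U11 + U2 * U12)) + g * (r * q) * r1 + B * B1"
  and K2: "K2 = r * (U2t + (U1 * U21 + U2 * U22)) + g * (r * q) * r2 + B * B2"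
 shows "- (p + b^2 / 2) * (V11 + V22) - \<rho> * ((V11 * u1 + V12 * u2) * (u1 - V1) + (V21 * u1 + V22 * u2) * (u2 - V2))
  - (\<rho> * u1 * U1t + \<rho> * u2 * U2t + (\<rho> * u1 * u1 + (p + b^2 / 2)) * (U11 - V11) + \<rho> * u1 * u2 * (U12 - V12)
    + \<rho> * u2 * u1 * (U21 - V21) + (\<rho> * u2 * u2 + (p + b^2 / 2)) * (U22 - V22))
  + (\<rho> * (U1 * U1t + U2 * U2t - g * q * rt)
    + \<rho> * (u1 * (U1 * U11 + U2 * U21 - V1 * V11 - V2 * V21 - g * q * r1) + u2 * (U1 * U12 + U2 * U22 - V1 * V12 - V2 * V22 - g * q * r2)))
  - (b * Bt + b * (u1 * B1 + u2 * B2))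
  + (g * (r * q) * rt + B * Bt + ((r * r * q + B^2 / 2) * (U11 + U22)
    + (g * (r * q) * r1 + B * B1) * U1 + (g * (r * q) * r2 + B * B2) * U2))
  = - (U11 + U22) * (p - g * (r * q) * \<rho> + (g - 1) * (r * r * q) + (b - B)^2 / 2)
   - \<rho> * ((u1 - U1) * (U11 * (u1 - U1) + U12 * (u2 - U2)) + (u2 - U2) * (U21 * (u1 - U1) + U22 * (u2 - U2)))
   + (1 - \<kappa>) * ((u1 - U1) * K1 + (u2 - U2) * K2) + (\<kappa> * B - b) * ((u1 - U1) * B1 + (u2 - U2) * B2)
   - ((u1 - U1) * K1 + (u2 - U2) * K2)" unfolding rt Bt K1 K2 \<rho> power2_eq_square by (simp add: field_simps)

lemma stress_relative_identity:
 "stress mu lam D \<bullet> V - stress mu lam D \<bullet> D + stress mu lam D \<bullet> (G - V)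
  = - (stress mu lam (D - G) \<bullet> (D - G)) - stress mu lam G \<bullet> (D - G)"
proof -
 have 1: "stress mu lam D \<bullet> V - stress mu lam D \<bullet> D + stress mu lam D \<bullet> (G - V) = - (stress mu lam D \<bullet> (D - G))"
  by (simp add: inner_diff_right)
 have 2: "stress mu lam D = stress mu lam (D - G) + stress mu lam G" by (simp add: vec_eq_iff stress_nth algebra_simps)
 show ?thesis unfolding 1 using arg_cong[OF 2, of "%M. M \<bullet> (D - G)"] by (simp add: inner_add_left)
qed

text \<open>The weak and the strong solution, with the derivatives that the existential quantifiers of the function classes
 provide made explicit. The initial data are written as the values of the strong solution at time 0.\<close>

locale weak_strong_pair = boundary_flux Om uB for Om uB +
 fixes T \<gamma> mu lam c1 :: real
  and rhoB bB :: "plane => real" and DuB :: "plane => plane => plane"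
  and rho b r B :: "spacetime => real"
  and u U m :: "spacetime => plane" and Du :: "spacetime => real ^ 2 ^ 2"
  and Dr DB :: "spacetime => spacetime => real" and DU :: "spacetime => spacetime => plane"
  and D2 :: "2 => spacetime => spacetime => plane"
 assumes \<gamma>: "1 < \<gamma>" and T: "0 < T" and mu: "0 < mu" "0 < 2 * mu + lam"
  and uB_C1: "C1_closure UNIV uB DuB" and linear_DuB: "!!x. linear (DuB x)"
  and rho_nonneg: "AE z in lebesgue. z \<in> cyl T Om --> 0 <= rho z"
  and rho_Lp: "Linf_Lp T \<gamma> Om rho" "boundary_Lp T \<gamma> Om uB rho"
  and b_Lp: "Linf_Lp T 2 Om b" "boundary_Lp T 2 Om uB b"
  and kinetic: "Linf_Lp T 1 Om (\<lambda>(t, x). rho (t, x) * (norm (u (t, x) - uB x))^2)"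
  and continuity_rho: "weak_transport Om T uB u rhoB (\<lambda>x. r (0, x)) rho"
  and continuity_b: "weak_transport Om T uB u bB (\<lambda>x. B (0, x)) b"
  and velocity: "L2_W12_zero T Om (\<lambda>(t, x). u (t, x) - uB x) (\<lambda>(t, x). Du (t, x) - jacobian uB (at x))"
  and momentum_AE: "AE z in lebesgue. z \<in> cyl T Om --> m z = rho z *\<^sub>R u z"
  and momentum: "weak_momentum Om T \<gamma> mu lam (\<lambda>x. r (0, x)) (\<lambda>x. U (0, x)) rho u Du b m"
  and energy: "energy_inequality Om T \<gamma> mu lam rhoB uB bB (\<lambda>x. r (0, x)) (\<lambda>x. U (0, x)) (\<lambda>x. B (0, x)) rho u Du b"
  and r_C1: "C1_closure (cyl T Om) r Dr" and B_C1: "C1_closure (cyl T Om) B DB"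
  and U_C1: "C1_closure (cyl T Om) U DU"
  and DU_C1: "!!j. C1_closure (cyl T Om) (\<lambda>z. DU z (0, axis j 1)) (D2 j)"
  and c1: "0 < c1" and r_ge: "!!z. z \<in> {0..T} \<times> closure Om ==> c1 <= r z"
  and classical: "solves_system_classically Om T \<gamma> mu lam r U B"
  and U_boundary: "!!t x. t \<in> {0..T} ==> x \<in> frontier Om ==> U (t, x) = uB x"
  and rB_inflow: "!!t x. t \<in> {0..T} ==> x \<in> inflow Om uB ==> r (t, x) = rhoB x & B (t, x) = bB x"

begin

abbreviation "S \<equiv> cyl T Om"
abbreviation "cont \<equiv> continuous_on (closure S)"

lemma open_S: "open S" and bounded_S: "bounded S" and S_sets: "S \<in> sets lebesgue"
 and closure_S: "closure S = {0..T} \<times> closure Om"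
 using open_cylinder[OF op, of T] bounded_cylinder[OF bd, of T] closure_cylinder[OF T, of Om] by simp_all

lemma Omega_sets: "Om \<in> sets lebesgue" using op by simp

lemma S_subset_closure: "S <= closure S" by (rule closure_subset)

lemma r_pos: "z \<in> closure S ==> 0 < r z" using r_ge[of z] c1 unfolding closure_S by linarith

lemma slice_cont:
 fixes F :: "spacetime => real"
 assumes F: "cont F" and t: "t \<in> {0..T}"
 shows "continuous_on (closure Om) (\<lambda>x. F (t, x))"
 by (rule continuous_on_compose2[OF F]) (use t in \<open>auto intro!: continuous_intros simp: closure_S\<close>)

text \<open>The test function of the continuity equation: the kinetic part completes the square, the other part is minus the
 derivative of the pressure potential at \<open>r\<close>.\<close>

definition phi :: "spacetime => real" where
 "phi z = (U z $ 1 * U z $ 1 + U z $ 2 * U z $ 2 - (uB (snd z) $ 1 * uB (snd z) $ 1 + uB (snd z) $ 2 * uB (snd z) $ 2)) * (1 / 2)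
   - \<gamma> / (\<gamma> - 1) * r z powr (\<gamma> - 1)"

definition Dphi :: "spacetime => spacetime => real" where
 "Dphi z h = U z $ 1 * DU z h $ 1 + U z $ 2 * DU z h $ 2
   - uB (snd z) $ 1 * DuB (snd z) (snd h) $ 1 - uB (snd z) $ 2 * DuB (snd z) (snd h) $ 2
   - \<gamma> * r z powr (\<gamma> - 2) * Dr z h"

lemma uB_snd_C1: "C1_closure S (\<lambda>z. uB (snd z)) (\<lambda>z h. DuB (snd z) (snd h))" by (rule C1_closure_snd[OF uB_C1])

lemma r_powr_C1:
 "C1_closure S (\<lambda>z. k * r z powr a) (\<lambda>z h. (k * (a * r z powr (a - 1))) * Dr z h)"
proof (rule C1_closure_compose[OF r_C1, where A = "{0<..}"])
 show "((%s. k * s powr a) has_real_derivative k * (a * s powr (a - 1))) (at s)" if "s \<in> {0<..}" for s using that by (auto intro!: derivative_eq_intros)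
 show "continuous_on {0<..} (%s. k * (a * s powr (a - 1)))" by (auto intro!: continuous_intros)
 show "r z \<in> {0<..}" if "z \<in> closure S" for z using r_pos[OF that] by simp
qed

lemma phi_C1: "C1_closure S phi Dphi"
proof -
 note sq = C1_closure_mult[OF C1_closure_nth C1_closure_nth]
 have 1: "C1_closure S (%z. (U z $ 1 * U z $ 1 + U z $ 2 * U z $ 2 - (uB (snd z) $ 1 * uB (snd z) $ 1 + uB (snd z) $ 2 * uB (snd z) $ 2)) * (1 / 2)
   - \<gamma> / (\<gamma> - 1) * r z powr (\<gamma> - 1))
  (%z h. ((U z $ 1 * U z $ 1 + U z $ 2 * U z $ 2 - (uB (snd z) $ 1 * uB (snd z) $ 1 + uB (snd z) $ 2 * uB (snd z) $ 2)) * 0 +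
   ((U z $ 1 * DU z h $ 1 + DU z h $ 1 * U z $ 1) + (U z $ 2 * DU z h $ 2 + DU z h $ 2 * U z $ 2)
   - ((uB (snd z) $ 1 * DuB (snd z) (snd h) $ 1 + DuB (snd z) (snd h) $ 1 * uB (snd z) $ 1)
    + (uB (snd z) $ 2 * DuB (snd z) (snd h) $ 2 + DuB (snd z) (snd h) $ 2 * uB (snd z) $ 2))) * (1 / 2))
   - (\<gamma> / (\<gamma> - 1) * ((\<gamma> - 1) * r z powr (\<gamma> - 1 - 1))) * Dr z h)"
  by (intro C1_closure_diff C1_closure_add r_powr_C1 C1_closure_mult[OF _ C1_closure_const] sq U_C1 uB_snd_C1)
 have 2: "\<gamma> / (\<gamma> - 1) * ((\<gamma> - 1) * x powr (\<gamma> - 1 - 1)) = \<gamma> * x powr (\<gamma> - 2)" for x using \<gamma> by simp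
 show ?thesis using 1[unfolded 2] unfolding phi_def[abs_def] Dphi_def[abs_def] by (simp add: algebra_simps)
qed

definition pressure :: "spacetime => real" where
 "pressure z = 1 * r z powr \<gamma> + B z * B z * (1 / 2)"

definition Dpressure :: "spacetime => spacetime => real" where
 "Dpressure z h = \<gamma> * r z powr (\<gamma> - 1) * Dr z h + B z * DB z h"

lemma pressure_C1: "C1_closure S pressure Dpressure"
proof -
 have "C1_closure S pressure (%z h. (1 * (\<gamma> * r z powr (\<gamma> - 1))) * Dr z h + ((B z * B z) * 0 + (B z * DB z h + DB z h * B z) * (1 / 2)))"
  unfolding pressure_def[abs_def] by (intro C1_closure_add r_powr_C1 C1_closure_mult[OF _ C1_closure_const] C1_closure_mult B_C1)
 thus ?thesis unfolding Dpressure_def[abs_def] by (simp add: algebra_simps)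
qed

definition gradU :: "spacetime => real ^ 2 ^ 2" where
 "gradU z = (\<chi> i j. DU z (0, axis j 1) $ i)"

definition Dstress :: "spacetime => spacetime => real ^ 2 ^ 2" where
 "Dstress z h = stress mu lam (\<chi> i j. D2 j z h $ i)"

definition K :: "spacetime => real ^ 2" where
 "K z = (\<chi> i. \<Sum>j\<in>UNIV. Dstress z (0, axis j 1) $ i $ j)"

lemma stress_C1: "C1_closure S (\<lambda>z. stress mu lam (gradU z) $ i $ j) (\<lambda>z h. Dstress z h $ i $ j)"
proof -
 have "C1_closure S (%z. mu * (gradU z $ i $ j + gradU z $ j $ i) + (if i = j then lam else 0) * (gradU z $ 1 $ 1 + gradU z $ 2 $ 2))
   (%z h. (mu * (D2 j z h $ i + D2 i z h $ j) + 0 * (gradU z $ i $ j + gradU z $ j $ i)) +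
    ((if i = j then lam else 0) * (D2 1 z h $ 1 + D2 2 z h $ 2) + 0 * (gradU z $ 1 $ 1 + gradU z $ 2 $ 2)))" unfolding gradU_def vec_lambda_beta
  by (intro C1_closure_add C1_closure_mult[OF C1_closure_const] C1_closure_nth DU_C1)
 moreover have "(%z. mu * (gradU z $ i $ j + gradU z $ j $ i) + (if i = j then lam else 0) * (gradU z $ 1 $ 1 + gradU z $ 2 $ 2))
  = (%z. stress mu lam (gradU z) $ i $ j)" by (auto simp: fun_eq_iff stress_nth)
 moreover have "(%z h. (mu * (D2 j z h $ i + D2 i z h $ j) + 0 * (gradU z $ i $ j + gradU z $ j $ i)) +
    ((if i = j then lam else 0) * (D2 1 z h $ 1 + D2 2 z h $ 2) + 0 * (gradU z $ 1 $ 1 + gradU z $ 2 $ 2)))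
  = (%z h. Dstress z h $ i $ j)" by (auto simp: fun_eq_iff Dstress_def stress_nth)
 ultimately show ?thesis by simp
qed

lemma continuous_K: "cont (\<lambda>z. K z $ i)" unfolding K_def vec_lambda_beta sum_2 by (intro continuous_intros C1D(3)[OF stress_C1 st_basis(2)])

lemma space_jacobian_U: "z \<in> S ==> space_jacobian U z = gradU z" unfolding space_jacobian_def gradU_def vec_eq_iff vec_lambda_beta
 using ddx_eq[OF C1D(2)[OF C1_closure_nth[OF U_C1]]] by blast

lemma space_matrix_div_stress:
 assumes z: "z \<in> S"
 shows "space_matrix_div (\<lambda>w. stress mu lam (space_jacobian U w)) z = K z"
proof -
 have "ddx j (%w. stress mu lam (space_jacobian U w) $ i $ j) z = Dstress z (0, axis j 1) $ i $ j" for i j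
 proof (rule ddx_eq)
  have "((%w. stress mu lam (gradU w) $ i $ j) has_derivative (%h. Dstress z h $ i $ j)) (at z)" by (rule C1D(2)[OF stress_C1 z])
  thus "((%w. stress mu lam (space_jacobian U w) $ i $ j) has_derivative (%h. Dstress z h $ i $ j)) (at z)"
   by (rule has_derivative_transform_within_open[OF _ open_S z]) (simp add: space_jacobian_U)
 qed
 thus ?thesis by (simp add: space_matrix_div_def K_def)
qed

lemma strong_transport:
 assumes z: "z \<in> S" and f: "C1_closure S f Df" and eq: "ddt f z + space_div (\<lambda>w. f w *\<^sub>R U w) z = 0"
 shows "Df z (1, 0) = - (Df z (0, axis 1 1) * U z $ 1 + Df z (0, axis 2 1) * U z $ 2
   + f z * (gradU z $ 1 $ 1 + gradU z $ 2 $ 2))"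
proof -
 have t: "ddt f z = Df z (1, 0)" by (rule ddt_eq[OF C1D(2)[OF f z]])
 have "ddx j (%w. f w * U w $ j) z = f z * DU z (0, axis j 1) $ j + Df z (0, axis j 1) * U z $ j" for j
  by (rule ddx_eq[OF C1D(2)[OF C1_closure_mult[OF f C1_closure_nth[OF U_C1]] z]])
 thus ?thesis using eq unfolding space_div_def t by (simp add: sum_2 gradU_def algebra_simps)
qed

lemma strong_continuity:
 assumes z: "z \<in> S"
 shows "Dr z (1, 0) = - (Dr z (0, axis 1 1) * U z $ 1 + Dr z (0, axis 2 1) * U z $ 2 + r z * (gradU z $ 1 $ 1 + gradU z $ 2 $ 2))"
  and "DB z (1, 0) = - (DB z (0, axis 1 1) * U z $ 1 + DB z (0, axis 2 1) * U z $ 2 + B z * (gradU z $ 1 $ 1 + gradU z $ 2 $ 2))"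
 using strong_transport[OF z r_C1] strong_transport[OF z B_C1] classical z unfolding solves_system_classically_def by blast+

lemma strong_momentum:
 assumes z: "z \<in> S"
 shows "K z $ i = r z * (DU z (1, 0) $ i + (U z $ 1 * gradU z $ i $ 1 + U z $ 2 * gradU z $ i $ 2))
   + \<gamma> * r z powr (\<gamma> - 1) * Dr z (0, axis i 1) + B z * DB z (0, axis i 1)"
proof -
 have e: "(ddt (%w. r w *\<^sub>R U w) z + space_matrix_div (%w. r w *\<^sub>R tensor (U w) (U w)) z
     + space_grad (%w. r w powr \<gamma> + (B w)^2 / 2) z) $ i = K z $ i"
  using classical[unfolded solves_system_classically_def, THEN bspec, OF z] unfolding space_matrix_div_stress[OF z] by simp
 have rU: "C1_closure S (%w. r w * U w $ i) (%z h. r z * DU z h $ i + Dr z h * U z $ i)" for i by (rule C1_closure_mult[OF r_C1 C1_closure_nth[OF U_C1]])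
 have "((%w. r w *\<^sub>R U w) has_derivative (%h. r z *\<^sub>R DU z h + Dr z h *\<^sub>R U z)) (at z)"
  by (rule has_derivative_scaleR[OF C1D(2)[OF r_C1 z] C1D(2)[OF U_C1 z]])
 hence t: "ddt (%w. r w *\<^sub>R U w) z $ i = r z * DU z (1, 0) $ i + Dr z (1, 0) * U z $ i" by (simp add: ddt_eq)
 have x: "ddx j (%w. (r w *\<^sub>R tensor (U w) (U w)) $ i $ j) z =
   r z * U z $ i * DU z (0, axis j 1) $ j + (r z * DU z (0, axis j 1) $ i + Dr z (0, axis j 1) * U z $ i) * U z $ j" for j
  using ddx_eq[OF C1D(2)[OF C1_closure_mult[OF rU[of i] C1_closure_nth[OF U_C1, of j]] z], of j] by (simp add: tensor_def mult.assoc)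
 have "(%w. r w powr \<gamma> + (B w)^2 / 2) = pressure" by (simp add: fun_eq_iff pressure_def power2_eq_square)
 hence p: "ddx i (%w. r w powr \<gamma> + (B w)^2 / 2) z = Dpressure z (0, axis i 1)" using ddx_eq[OF C1D(2)[OF pressure_C1 z]] by simp
 have "K z $ i = r z * DU z (1, 0) $ i + Dr z (1, 0) * U z $ i
  + (\<Sum>j\<in>UNIV. r z * U z $ i * DU z (0, axis j 1) $ j + (r z * DU z (0, axis j 1) $ i + Dr z (0, axis j 1) * U z $ i) * U z $ j)
  + Dpressure z (0, axis i 1)" unfolding e[symmetric] vector_add_component t space_matrix_div_def space_grad_def vec_lambda_beta x p by (rule refl)
 thus ?thesis unfolding strong_continuity(1)[OF z] Dpressure_def by (simp add: sum_2 gradU_def algebra_simps)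
qed

abbreviation integ :: "(spacetime => real) => bool" where "integ f \<equiv> set_integrable lebesgue S f"

lemma integ_mult:
 assumes f: "integ f" and g: "cont g"
 shows "integ (\<lambda>z. f z * g z)"
proof -
 have "compact (closure S)" using bounded_S by simp
 hence "bounded (g ` closure S)" by (intro compact_imp_bounded compact_continuous_image g)
 then obtain C where C: "!!z. z \<in> closure S ==> \<bar>g z\<bar> <= C" by (auto simp: bounded_real)
 show ?thesis by (rule set_integrable_mult_bounded[OF f S_sets continuous_on_subset[OF g S_subset_closure] C[OF subsetD[OF S_subset_closure]]])
qed

lemma measurable_S: "set_borel_measurable lebesgue S f \<longleftrightarrow> f \<in> borel_measurable (lebesgue_on S)"
 for f :: "spacetime => 'b::real_normed_vector" unfolding set_borel_measurable_def using S_sets by (simp add: borel_measurable_restrict_space_iff)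

lemma integ_imp_measurable: "integ f ==> f \<in> borel_measurable (lebesgue_on S)"
 unfolding measurable_S[symmetric] set_integrable_def set_borel_measurable_def by (rule borel_measurable_integrable)

text \<open>Integrability of all products below comes from domination by the few quantities that the weak formulation
 bounds.\<close>

lemma integ_dominated:
 assumes f: "f \<in> borel_measurable (lebesgue_on S)" and g: "integ g" and le: "AE z in lebesgue. z \<in> S --> \<bar>f z\<bar> <= g z"
 shows "integ f" unfolding set_integrable_def
proof (rule Bochner_Integration.integrable_bound[OF g[unfolded set_integrable_def]])
 show "(%z. indicator S z *\<^sub>R f z) \<in> borel_measurable lebesgue" using f unfolding measurable_S[symmetric] set_borel_measurable_def .
 show "AE z in lebesgue. norm (indicator S z *\<^sub>R f z) <= norm (indicator S z *\<^sub>R g z)" using le by eventually_elim (auto simp: indicator_def)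
qed

lemma integ_const: "integ (\<lambda>z. c)" by (rule set_integrable_cont_bounded(2)[OF open_S bounded_S, of _ "\<bar>c\<bar>"]) auto

lemma integ_continuous: "cont g ==> integ g" using integ_mult[OF integ_const[of 1]] by simp

lemma integ_product:
 assumes f: "f \<in> borel_measurable (lebesgue_on S)" "integ (\<lambda>z. (f z)^2)"
  and g: "g \<in> borel_measurable (lebesgue_on S)" "integ (\<lambda>z. (g z)^2)"
 shows "integ (\<lambda>z. f z * g z)"
proof (rule integ_dominated[OF _ set_integral_add(1)[OF f(2) g(2)]])
 show "(%z. f z * g z) \<in> borel_measurable (lebesgue_on S)" using f(1) g(1) by simp
 have "\<bar>x * y\<bar> <= x^2 + y^2" for x y :: real
 proof -
  have "0 <= (\<bar>x\<bar> - \<bar>y\<bar>)^2" by simp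
  hence "2 * (\<bar>x\<bar> * \<bar>y\<bar>) <= x^2 + y^2" by (simp add: power2_diff)
  moreover have "0 <= \<bar>x\<bar> * \<bar>y\<bar>" by simp
  ultimately show ?thesis unfolding abs_mult by linarith
 qed
 thus "AE z in lebesgue. z \<in> S --> \<bar>f z * g z\<bar> <= (f z)^2 + (g z)^2" by auto
qed

lemma Linf_Lp_integ:
 fixes f :: "spacetime => real"
 assumes f: "Linf_Lp T p Om f" and p: "0 < p"
 shows "f \<in> borel_measurable (lebesgue_on S)" "integ (\<lambda>z. \<bar>f z\<bar> powr p)"
proof -
 show m: "f \<in> borel_measurable (lebesgue_on S)" using f unfolding Linf_Lp_def measurable_S[symmetric] by blast
 obtain C where C: "AE t in lebesgue. t \<in> {0<..<T} --> Lp p Om (%x. f (t, x)) &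
    (LINT x:Om|lebesgue. norm (f (t, x)) powr p) <= C" using f unfolding Linf_Lp_def by blast
 show "integ (%z. \<bar>f z\<bar> powr p)"
 proof (rule set_integrable_Times_if_slices_bounded)
  show "set_borel_measurable lebesgue S (%z. \<bar>f z\<bar> powr p)" unfolding measurable_S using m by simp
  show "AE t in lebesgue. t \<in> {0<..<T} --> set_integrable lebesgue Om (%x. \<bar>f (t, x)\<bar> powr p) &
    (LINT x:Om|lebesgue. \<bar>\<bar>f (t, x)\<bar> powr p\<bar>) <= C" using C by eventually_elim (simp add: Lp_def)
 qed
qed

lemma abs_powr: "\<bar>x\<bar> powr a = x powr a" for x a :: real by (auto simp: abs_if uminus_powr_eq)

abbreviation jB :: "plane => real ^ 2 ^ 2" where "jB x \<equiv> jacobian uB (at x)"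

lemma jB_nth: "jB x $ i $ j = DuB x (axis j 1) $ i"
proof -
 have "(uB has_derivative DuB x) (at x)" by (rule C1D(2)[OF uB_C1]) simp
 hence "frechet_derivative uB (at x) = DuB x" by (rule frechet_derivative_at[symmetric])
 thus ?thesis by (simp add: matrix_jacobian_nth)
qed

lemma cont_coeff:
 "cont (\<lambda>z. U z $ i)" "cont (\<lambda>z. uB (snd z) $ i)"
 "cont (\<lambda>z. jB (snd z) $ i $ j)" "cont (\<lambda>z. gradU z $ i $ j)"
 "cont (\<lambda>z. DU z (1, 0) $ i)"
 "cont B" "cont (\<lambda>z. DB z (1, 0))" "cont (\<lambda>z. DB z (0, axis j 1))"
 "cont phi" "cont (\<lambda>z. Dphi z (1, 0))" "cont (\<lambda>z. Dphi z (0, axis j 1))"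
 "cont pressure" "cont (\<lambda>z. Dpressure z (1, 0))" "cont (\<lambda>z. Dpressure z (0, axis j 1))"
 "cont (\<lambda>z. K z $ i)" "cont (\<lambda>z. stress mu lam (gradU z) $ i $ j)"
 "cont r"
proof -
 note D1 = C1D(1) and D3 = C1D(3)[OF _ st_basis(1)] C1D(3)[OF _ st_basis(2)]
 show "cont (%z. U z $ i)" by (rule D1[OF C1_closure_nth[OF U_C1]])
 show "cont (%z. uB (snd z) $ i)" by (rule D1[OF C1_closure_nth[OF uB_snd_C1]])
 show "cont (%z. jB (snd z) $ i $ j)" unfolding jB_nth using D3(2)[OF C1_closure_nth[OF uB_snd_C1], of j i] by simp
 show "cont (%z. gradU z $ i $ j)" unfolding gradU_def vec_lambda_beta by (rule D3(2)[OF C1_closure_nth[OF U_C1]])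
 show "cont (%z. DU z (1, 0) $ i)" by (rule D3(1)[OF C1_closure_nth[OF U_C1]])
qed (rule C1D(1)[OF B_C1] C1D(3)[OF B_C1 st_basis(1)] C1D(3)[OF B_C1 st_basis(2)]
  C1D(1)[OF phi_C1] C1D(3)[OF phi_C1 st_basis(1)] C1D(3)[OF phi_C1 st_basis(2)]
  C1D(1)[OF pressure_C1] C1D(3)[OF pressure_C1 st_basis(1)] C1D(3)[OF pressure_C1 st_basis(2)]
  C1D(1)[OF r_C1] C1D(1)[OF stress_C1] continuous_K)+

lemma rho_measurable: "rho \<in> borel_measurable (lebesgue_on S)"
 and integ_rho_powr: "integ (\<lambda>z. rho z powr \<gamma>)" using Linf_Lp_integ[OF rho_Lp(1)] \<gamma> by (simp_all add: abs_powr)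

lemma b_measurable: "b \<in> borel_measurable (lebesgue_on S)"
 and integ_b2: "integ (\<lambda>z. (b z)^2)" using Linf_Lp_integ[OF b_Lp(1)] by simp_all

lemma abs_le_powr: "\<bar>s\<bar> <= 1 + s powr \<gamma>" for s
proof (cases "\<bar>s\<bar> <= 1")
 case False
 hence "\<bar>s\<bar> powr 1 <= \<bar>s\<bar> powr \<gamma>" using \<gamma> by (intro powr_mono) auto
 thus ?thesis using False by (simp add: abs_powr)
qed (use powr_ge_zero[of s \<gamma>] in linarith)

lemma integ_rho: "integ rho" by (rule integ_dominated[OF rho_measurable set_integral_add(1)[OF integ_const[of 1] integ_rho_powr]]) (simp add: abs_le_powr)

lemma integ_b: "integ b" using integ_product[OF b_measurable integ_b2, of "\<lambda>z. 1"] integ_const[of 1] by simp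

lemma velocity_difference_integ:
 shows "(\<lambda>z. u z $ i - uB (snd z) $ i) \<in> borel_measurable (lebesgue_on S)"
  "(\<lambda>z. Du z $ i $ j - jB (snd z) $ i $ j) \<in> borel_measurable (lebesgue_on S)"
  "integ (\<lambda>z. (u z $ i - uB (snd z) $ i)^2)" "integ (\<lambda>z. (Du z $ i $ j - jB (snd z) $ i $ j)^2)"
proof -
 let ?v = "%(t, x). u (t, x) - uB x" and ?G = "%(t, x). Du (t, x) - jB x"
 have mv: "?v \<in> borel_measurable (lebesgue_on S)" and mG: "?G \<in> borel_measurable (lebesgue_on S)"
  and i: "integ (%z. (norm (?v z))^2 + (norm (?G z))^2)" using velocity unfolding L2_W12_zero_def measurable_S[symmetric] by auto
 have ve: "?v z $ i = u z $ i - uB (snd z) $ i" and Ge: "?G z $ i $ j = Du z $ i $ j - jB (snd z) $ i $ j" for z by (simp_all add: case_prod_unfold)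
 have c1: "(%y::plane. y $ i) \<in> borel_measurable borel" "(%y::real^2^2. y $ i $ j) \<in> borel_measurable borel"
  by (intro borel_measurable_continuous_onI continuous_intros)+
 show m1: "(%z. u z $ i - uB (snd z) $ i) \<in> borel_measurable (lebesgue_on S)" using measurable_compose[OF mv c1(1)] unfolding ve .
 show m2: "(%z. Du z $ i $ j - jB (snd z) $ i $ j) \<in> borel_measurable (lebesgue_on S)" using measurable_compose[OF mG c1(2)] unfolding Ge .
 show "integ (%z. (u z $ i - uB (snd z) $ i)^2)"
 proof (rule integ_dominated[OF _ i], use m1 in simp, intro AE_I2 impI)
  fix z
  have "\<bar>?v z $ i\<bar>^2 <= (norm (?v z))^2" by (intro power_mono component_le_norm_cart) simp
  thus "\<bar>(u z $ i - uB (snd z) $ i)^2\<bar> <= (norm (?v z))^2 + (norm (?G z))^2" unfolding ve by (simp add: add_increasing2)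
 qed
 show "integ (%z. (Du z $ i $ j - jB (snd z) $ i $ j)^2)"
 proof (rule integ_dominated[OF _ i], use m2 in simp, intro AE_I2 impI)
  fix z
  have "\<bar>?G z $ i $ j\<bar> <= norm (?G z $ i)" by (rule component_le_norm_cart)
  also have "... <= norm (?G z)" by (rule Finite_Cartesian_Product.norm_nth_le)
  finally have "\<bar>?G z $ i $ j\<bar>^2 <= (norm (?G z))^2" by (intro power_mono) simp_all
  thus "\<bar>(Du z $ i $ j - jB (snd z) $ i $ j)^2\<bar> <= (norm (?v z))^2 + (norm (?G z))^2" unfolding Ge by (simp add: add_increasing)
 qed
qed

lemma L2_add_continuous:
 assumes f: "(\<lambda>z. f z - g z) \<in> borel_measurable (lebesgue_on S)" "integ (\<lambda>z. (f z - g z)^2)"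
  and g: "cont g"
 shows "f \<in> borel_measurable (lebesgue_on S)" "integ (\<lambda>z. (f z)^2)"
proof -
 have mg: "g \<in> borel_measurable (lebesgue_on S)" by (rule integ_imp_measurable[OF integ_continuous[OF g]])
 show m: "f \<in> borel_measurable (lebesgue_on S)" using borel_measurable_add[OF f(1) mg] by simp
 have g2: "integ (%z. 2 * (g z)^2)" by (intro integ_continuous continuous_intros g)
 have f2: "integ (%z. 2 * (f z - g z)^2)" by (intro set_integrable_mult_right f(2))
 show "integ (%z. (f z)^2)"
 proof (rule integ_dominated[OF _ set_integral_add(1)[OF f2 g2]], use m in simp, intro AE_I2 impI)
  fix z
  have "0 <= (f z - 2 * g z)^2" by simp
  thus "\<bar>(f z)^2\<bar> <= 2 * (f z - g z)^2 + 2 * (g z)^2" by (simp add: power2_eq_square algebra_simps)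
 qed
qed

lemmas u_integ = L2_add_continuous[OF velocity_difference_integ(1,3) cont_coeff(2)]

lemmas Du_integ = L2_add_continuous[OF velocity_difference_integ(2,4) cont_coeff(3)]

lemma integ_bu: "integ (\<lambda>z. b z * u z $ i)" by (rule integ_product[OF b_measurable integ_b2 u_integ])

lemma integ_Du: "integ (\<lambda>z. Du z $ i $ j)" using integ_product[OF Du_integ, of "\<lambda>z. 1"] integ_const[of 1] by simp

lemma integ_DuDu: "integ (\<lambda>z. Du z $ i $ j * Du z $ k $ l)" by (rule integ_product[OF Du_integ Du_integ])

lemma integ_kinetic: "integ (\<lambda>z. rho z * ((u z $ 1 - uB (snd z) $ 1)^2 + (u z $ 2 - uB (snd z) $ 2)^2))"
proof -
 have e: "(%(t, x). rho (t, x) * (norm (u (t, x) - uB x))^2) = (%z. rho z * ((u z $ 1 - uB (snd z) $ 1)^2 + (u z $ 2 - uB (snd z) $ 2)^2))"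
  by (simp add: fun_eq_iff norm_plane_square)
 note k = Linf_Lp_integ[OF kinetic, unfolded e]
 show ?thesis by (rule integ_dominated[OF k]) simp_all
qed

text \<open>Only \<open>rho |u - uB|^2\<close> is bounded by hypothesis; \<open>uB\<close> is bounded and \<open>rho\<close>
 integrable.\<close>

lemma integ_rhouu: "integ (\<lambda>z. rho z * (u z $ i * u z $ j))"
proof -
 define k where "k z = rho z * ((u z $ 1 - uB (snd z) $ 1)^2 + (u z $ 2 - uB (snd z) $ 2)^2)" for z
 define l where "l z = rho z * ((uB (snd z) $ 1)^2 + (uB (snd z) $ 2)^2)" for z
 have kl: "integ (%z. 2 * k z + 2 * l z)" unfolding k_def l_def
  by (intro set_integral_add(1) set_integrable_mult_right integ_kinetic integ_mult integ_rho continuous_on_add continuous_on_power cont_coeff)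
 show ?thesis
 proof (rule integ_dominated[OF _ kl])
  show "(%z. rho z * (u z $ i * u z $ j)) \<in> borel_measurable (lebesgue_on S)" using rho_measurable u_integ(1) by simp
  show "AE z in lebesgue. z \<in> S --> \<bar>rho z * (u z $ i * u z $ j)\<bar> <= 2 * k z + 2 * l z" using rho_nonneg
  proof eventually_elim
   case (elim z)
   show ?case
   proof
    assume "z \<in> S"
    hence r: "0 <= rho z" using elim by blast
    have a: "x^2 <= 2 * (x - y)^2 + 2 * y^2" for x y :: real
    proof -
     have "0 <= (x - 2 * y)^2" by simp
     thus ?thesis by (simp add: power2_eq_square algebra_simps)
    qed
    have "\<bar>u z $ i * u z $ j\<bar> <= (norm (u z))^2" unfolding abs_mult power2_eq_square by (intro mult_mono component_le_norm_cart) simp_all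
    also have "... = (u z $ 1)^2 + (u z $ 2)^2" by (rule norm_plane_square)
    also have "... <= (2 * (u z $ 1 - uB (snd z) $ 1)^2 + 2 * (uB (snd z) $ 1)^2) + (2 * (u z $ 2 - uB (snd z) $ 2)^2 + 2 * (uB (snd z) $ 2)^2)"
     by (intro add_mono a)
    finally have "\<bar>rho z * (u z $ i * u z $ j)\<bar> <= rho z * ((2 * (u z $ 1 - uB (snd z) $ 1)^2 + 2 * (uB (snd z) $ 1)^2) + (2 * (u z $ 2 - uB (snd z) $ 2)^2 + 2 * (uB (snd z) $ 2)^2))"
     using mult_left_mono[OF _ r] by (simp add: abs_mult r)
    thus "\<bar>rho z * (u z $ i * u z $ j)\<bar> <= 2 * k z + 2 * l z" unfolding k_def l_def by (simp add: algebra_simps)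
   qed
  qed
 qed
qed

lemma integ_rhou: "integ (\<lambda>z. rho z * u z $ i)"
proof (rule integ_dominated[OF _ set_integral_add(1)[OF integ_rho integ_rhouu[of i i]]])
 show "(%z. rho z * u z $ i) \<in> borel_measurable (lebesgue_on S)" using rho_measurable u_integ(1) by simp
 show "AE z in lebesgue. z \<in> S --> \<bar>rho z * u z $ i\<bar> <= rho z + rho z * (u z $ i * u z $ i)" using rho_nonneg
 proof eventually_elim
  case (elim z)
  show ?case
  proof
   assume "z \<in> S"
   hence r: "0 <= rho z" using elim by blast
   have "0 <= (\<bar>u z $ i\<bar> - 1)^2" by simp
   hence "2 * \<bar>u z $ i\<bar> <= 1 + u z $ i * u z $ i" by (simp add: power2_diff flip: power2_eq_square)
   hence "\<bar>u z $ i\<bar> <= 1 + u z $ i * u z $ i" by linarith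
   hence "rho z * \<bar>u z $ i\<bar> <= rho z * (1 + u z $ i * u z $ i)" using r by (rule mult_left_mono)
   thus "\<bar>rho z * u z $ i\<bar> <= rho z + rho z * (u z $ i * u z $ i)" using r by (simp add: abs_mult algebra_simps)
  qed
 qed
qed

text \<open>The space-time integrands of the energy inequality and of the four balance laws that are combined with it.\<close>

definition energy_rate :: "spacetime => real" where
 "energy_rate z = - (rho z powr \<gamma> + (b z)^2 / 2) * trace (jB (snd z)) - rho z * ((jB (snd z) *v u z) \<bullet> (u z - uB (snd z)))
   + stress mu lam (Du z) \<bullet> jB (snd z)"

definition dissipation :: "spacetime => real" where
 "dissipation z = stress mu lam (Du z) \<bullet> Du z"

definition flux_tensor :: "spacetime => real ^ 2 ^ 2" where
 "flux_tensor z = rho z *\<^sub>R tensor (u z) (u z) + (rho z powr \<gamma> + (b z)^2 / 2) *\<^sub>R mat 1 - stress mu lam (Du z)"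

definition momentum_rate :: "spacetime => real" where
 "momentum_rate z = (\<Sum>i\<in>UNIV. rho z * u z $ i * DU z (1, 0) $ i + (\<Sum>j\<in>UNIV. flux_tensor z $ i $ j * (gradU z $ i $ j - jB (snd z) $ i $ j)))"

definition transport_rate :: "(spacetime => real) => (spacetime => spacetime => real) => spacetime => real" where
 "transport_rate f Dg z = f z * Dg z (1, 0) + f z * (u z $ 1 * Dg z (0, axis 1 1) + u z $ 2 * Dg z (0, axis 2 1))"

definition pressure_rate :: "spacetime => real" where
 "pressure_rate z = Dpressure z (1, 0) + (\<Sum>j\<in>UNIV. pressure z * gradU z $ j $ j + Dpressure z (0, axis j 1) * U z $ j)"

definition w :: "spacetime => plane" where "w z = u z - U z"

definition Dw :: "spacetime => real ^ 2 ^ 2" where "Dw z = Du z - gradU z"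

definition rel_energy :: "spacetime => real" where
 "rel_energy z = rho z * (norm (w z))^2 / 2 + rel_potential \<gamma> (rho z) (r z) + (b z - B z)^2 / 2"

text \<open>What is left of the rate once the viscous terms are split off. Every summand is at least quadratic in the
 differences between the two solutions.\<close>

definition remainder :: "spacetime => real" where
 "remainder z = - trace (gradU z) * ((\<gamma> - 1) * rel_potential \<gamma> (rho z) (r z) + (b z - B z)^2 / 2)
   - rho z * (w z \<bullet> (gradU z *v w z)) + (1 - rho z / r z) * (w z \<bullet> K z)
   + (rho z / r z * B z - b z) * (w z $ 1 * DB z (0, axis 1 1) + w z $ 2 * DB z (0, axis 2 1))"

text \<open>The power of the viscous stress of the strong solution on \<open>w\<close>; it integrates to zero over the
 domain.\<close>

definition work :: "spacetime => real" where
 "work z = w z \<bullet> K z + stress mu lam (gradU z) \<bullet> Dw z"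

lemma transport_rate_eq:
 assumes "C1_closure S g Dg" "z \<in> S"
 shows "f z * ddt g z + f z * (u z \<bullet> space_grad g z) = transport_rate f Dg z" using ddt_eq[OF C1D(2)[OF assms]] ddx_eq[OF C1D(2)[OF assms]]
 by (simp add: transport_rate_def space_grad_def inner_vec_def sum_2)

text \<open>The inviscid part is the polynomial identity above, with \<open>\<kappa> = rho / r\<close>; the stress terms
 combine by bilinearity.\<close>

lemma relative_energy_rate_identity:
 assumes z: "z \<in> S"
 shows "energy_rate z - dissipation z - momentum_rate z + transport_rate rho Dphi z - transport_rate b DB z + pressure_rate z
  = remainder z - stress mu lam (Dw z) \<bullet> Dw z - work z"
proof -
 have rp: "0 < r z" using r_pos S_subset_closure z by blast
 have q1: "r z powr (\<gamma> - 1) = r z * r z powr (\<gamma> - 2)" using powr_add[of "r z" 1 "\<gamma> - 2"] rp by (simp add: powr_one)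
 have q0: "r z powr \<gamma> = r z * r z * r z powr (\<gamma> - 2)" using powr_add[of "r z" 1 "\<gamma> - 1"] rp q1 by (simp add: powr_one)
 have D0: "DuB x 0 = 0" for x by (rule linear_0[OF linear_DuB])
 define V where "V = jB (snd z)"
 define G where "G = gradU z"
 have jV: "DuB (snd z) (axis j 1) $ i = V $ i $ j" for i j unfolding V_def jB_nth ..
 have DG: "DU z (0, axis j 1) $ i = G $ i $ j" for i j unfolding G_def gradU_def by simp
 define p q where "p = rho z powr \<gamma>" and "q = r z powr (\<gamma> - 2)"
 have \<rho>: "rho z = rho z / r z * r z" using rp by simp
 note id = relative_energy_transport_identity[OF \<rho> strong_continuity(1)[OF z, folded G_def] strong_continuity(2)[OF z, folded G_def]
   strong_momentum[OF z, of 1, unfolded q1, folded G_def q_def] strong_momentum[OF z, of 2, unfolded q1, folded G_def q_def],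
   of p "b z" "V $ 1 $ 1" "V $ 2 $ 2" "u z $ 1" "V $ 1 $ 2" "u z $ 2" "uB (snd z) $ 1" "V $ 2 $ 1" "uB (snd z) $ 2"]
 have e1: "energy_rate z = (- (p + (b z)^2 / 2) * (V $ 1 $ 1 + V $ 2 $ 2) - rho z * ((V $ 1 $ 1 * u z $ 1 + V $ 1 $ 2 * u z $ 2) * (u z $ 1 - uB (snd z) $ 1)
   + (V $ 2 $ 1 * u z $ 1 + V $ 2 $ 2 * u z $ 2) * (u z $ 2 - uB (snd z) $ 2))) + stress mu lam (Du z) \<bullet> V"
  unfolding energy_rate_def V_def p_def trace_def matrix_vector_mult_def inner_vec_def[of "\<chi> i. f i" for f] by (simp add: sum_2)
 have e2: "momentum_rate z = (rho z * u z $ 1 * DU z (1, 0) $ 1 + rho z * u z $ 2 * DU z (1, 0) $ 2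
   + (rho z * u z $ 1 * u z $ 1 + (p + (b z)^2 / 2)) * (G $ 1 $ 1 - V $ 1 $ 1) + rho z * u z $ 1 * u z $ 2 * (G $ 1 $ 2 - V $ 1 $ 2)
    + rho z * u z $ 2 * u z $ 1 * (G $ 2 $ 1 - V $ 2 $ 1) + (rho z * u z $ 2 * u z $ 2 + (p + (b z)^2 / 2)) * (G $ 2 $ 2 - V $ 2 $ 2))
   - stress mu lam (Du z) \<bullet> (G - V)" unfolding momentum_rate_def flux_tensor_def V_def[symmetric] G_def[symmetric] p_def[symmetric]
  by (simp add: sum_2 inner_vec_def tensor_def mat_def algebra_simps diff_divide_distrib)
 have e3: "transport_rate rho Dphi z = rho z * (U z $ 1 * DU z (1, 0) $ 1 + U z $ 2 * DU z (1, 0) $ 2 - \<gamma> * q * Dr z (1, 0))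
    + rho z * (u z $ 1 * (U z $ 1 * G $ 1 $ 1 + U z $ 2 * G $ 2 $ 1 - uB (snd z) $ 1 * V $ 1 $ 1 - uB (snd z) $ 2 * V $ 2 $ 1 - \<gamma> * q * Dr z (0, axis 1 1))
    + u z $ 2 * (U z $ 1 * G $ 1 $ 2 + U z $ 2 * G $ 2 $ 2 - uB (snd z) $ 1 * V $ 1 $ 2 - uB (snd z) $ 2 * V $ 2 $ 2 - \<gamma> * q * Dr z (0, axis 2 1)))"
  unfolding transport_rate_def Dphi_def DG snd_conv jV D0 q_def by simp
 have e5: "pressure_rate z = \<gamma> * (r z * q) * Dr z (1, 0) + B z * DB z (1, 0) + ((r z * r z * q + (B z)^2 / 2) * (G $ 1 $ 1 + G $ 2 $ 2)
    + (\<gamma> * (r z * q) * Dr z (0, axis 1 1) + B z * DB z (0, axis 1 1)) * U z $ 1 + (\<gamma> * (r z * q) * Dr z (0, axis 2 1) + B z * DB z (0, axis 2 1)) * U z $ 2)"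
  unfolding pressure_rate_def pressure_def Dpressure_def q0 q1 G_def[symmetric] q_def[symmetric] by (simp add: sum_2 power2_eq_square algebra_simps)
 have st: "stress mu lam (Du z) \<bullet> V - dissipation z + stress mu lam (Du z) \<bullet> (G - V)
  = - (stress mu lam (Dw z) \<bullet> Dw z) - stress mu lam G \<bullet> Dw z" unfolding dissipation_def Dw_def G_def[symmetric] by (rule stress_relative_identity)
 have g1: "(\<gamma> - 1) * rel_potential \<gamma> (rho z) (r z) = p - \<gamma> * (r z * q) * rho z + (\<gamma> - 1) * (r z * r z * q)"
  using \<gamma> unfolding rel_potential_def q0 q1 p_def q_def by simp
 have rem: "remainder z - work z = - (G $ 1 $ 1 + G $ 2 $ 2) * (p - \<gamma> * (r z * q) * rho z + (\<gamma> - 1) * (r z * r z * q) + (b z - B z)^2 / 2)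
   - rho z * ((u z $ 1 - U z $ 1) * (G $ 1 $ 1 * (u z $ 1 - U z $ 1) + G $ 1 $ 2 * (u z $ 2 - U z $ 2))
     + (u z $ 2 - U z $ 2) * (G $ 2 $ 1 * (u z $ 1 - U z $ 1) + G $ 2 $ 2 * (u z $ 2 - U z $ 2)))
   + (1 - rho z / r z) * ((u z $ 1 - U z $ 1) * K z $ 1 + (u z $ 2 - U z $ 2) * K z $ 2)
   + (rho z / r z * B z - b z) * ((u z $ 1 - U z $ 1) * DB z (0, axis 1 1) + (u z $ 2 - U z $ 2) * DB z (0, axis 2 1))
   - ((u z $ 1 - U z $ 1) * K z $ 1 + (u z $ 2 - U z $ 2) * K z $ 2) - stress mu lam G \<bullet> Dw z"
  unfolding remainder_def work_def g1 G_def[symmetric] trace_def w_def matrix_vector_mult_def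
   inner_vec_def[of "x - y" for x y :: plane] by (simp add: sum_2)
 have e4: "transport_rate b DB z = b z * DB z (1, 0) + b z * (u z $ 1 * DB z (0, axis 1 1) + u z $ 2 * DB z (0, axis 2 1))" by (rule transport_rate_def)
 show ?thesis using id st rem unfolding e1 e2 e3 e4 e5 by linarith
qed

lemma flux_tensor_nth: "flux_tensor z $ i $ j = rho z * (u z $ i * u z $ j) + (if i = j then rho z powr \<gamma> + (b z)^2 / 2 else 0)
  - (mu * (Du z $ i $ j + Du z $ j $ i) + (if i = j then lam * (Du z $ 1 $ 1 + Du z $ 2 $ 2) else 0))" by (simp add: flux_tensor_def tensor_def mat_def stress_nth)

lemmas integ_add = set_integral_add(1) and integ_diff = set_integral_diff(1)

lemma integ_cmult: "integ f ==> integ (\<lambda>z. c * f z)" by (rule set_integrable_mult_right) simp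

lemma integ_if: "(P ==> integ f) ==> integ (\<lambda>z. if P then f z else 0)" using integ_const[of 0] by (cases P) simp_all

lemma integ_flux_tensor: "integ (\<lambda>z. flux_tensor z $ i $ j)" unfolding flux_tensor_nth
 by (intro integ_add integ_diff integ_if integ_cmult integ_rhouu integ_rho_powr integ_Du integ_b2 set_integrable_divide)

lemma integ_stress_product:
 assumes "!!i j k l. integ (\<lambda>z. f z $ i $ j * g z $ k $ l)"
 shows "integ (\<lambda>z. stress mu lam (f z) \<bullet> g z)"
proof -
 have "integ (%z. (2 * mu) * (f z $ 1 $ 1 * g z $ 1 $ 1) + (2 * mu) * (f z $ 2 $ 2 * g z $ 2 $ 2)
   + mu * (f z $ 1 $ 2 * g z $ 1 $ 2 + f z $ 1 $ 2 * g z $ 2 $ 1 + f z $ 2 $ 1 * g z $ 1 $ 2 + f z $ 2 $ 1 * g z $ 2 $ 1)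
   + lam * (f z $ 1 $ 1 * g z $ 1 $ 1 + f z $ 1 $ 1 * g z $ 2 $ 2 + f z $ 2 $ 2 * g z $ 1 $ 1 + f z $ 2 $ 2 * g z $ 2 $ 2))" by (intro integ_add integ_cmult assms)
 thus ?thesis unfolding stress_inner by (simp add: algebra_simps)
qed

lemma integ_energy_rate: "integ energy_rate"
proof -
 have "integ (%z. ((-1) * (rho z powr \<gamma> + (1/2) * (b z)^2) * (jB (snd z) $ 1 $ 1 + jB (snd z) $ 2 $ 2)
   - ((rho z * (u z $ 1 * u z $ 1)) * jB (snd z) $ 1 $ 1 + (rho z * (u z $ 2 * u z $ 1)) * jB (snd z) $ 1 $ 2
   + (rho z * (u z $ 1 * u z $ 2)) * jB (snd z) $ 2 $ 1 + (rho z * (u z $ 2 * u z $ 2)) * jB (snd z) $ 2 $ 2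
   - (rho z * u z $ 1) * (jB (snd z) $ 1 $ 1 * uB (snd z) $ 1 + jB (snd z) $ 2 $ 1 * uB (snd z) $ 2)
   - (rho z * u z $ 2) * (jB (snd z) $ 1 $ 2 * uB (snd z) $ 1 + jB (snd z) $ 2 $ 2 * uB (snd z) $ 2)))
   + stress mu lam (Du z) \<bullet> jB (snd z))"
  by (intro integ_add integ_diff integ_mult integ_cmult integ_rho_powr integ_b2 integ_rhouu integ_rhou integ_stress_product
    integ_Du continuous_on_add continuous_on_mult cont_coeff)
 moreover have "energy_rate = (%z. ((-1) * (rho z powr \<gamma> + (1/2) * (b z)^2) * (jB (snd z) $ 1 $ 1 + jB (snd z) $ 2 $ 2)
   - ((rho z * (u z $ 1 * u z $ 1)) * jB (snd z) $ 1 $ 1 + (rho z * (u z $ 2 * u z $ 1)) * jB (snd z) $ 1 $ 2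
   + (rho z * (u z $ 1 * u z $ 2)) * jB (snd z) $ 2 $ 1 + (rho z * (u z $ 2 * u z $ 2)) * jB (snd z) $ 2 $ 2
   - (rho z * u z $ 1) * (jB (snd z) $ 1 $ 1 * uB (snd z) $ 1 + jB (snd z) $ 2 $ 1 * uB (snd z) $ 2)
   - (rho z * u z $ 2) * (jB (snd z) $ 1 $ 2 * uB (snd z) $ 1 + jB (snd z) $ 2 $ 2 * uB (snd z) $ 2)))
   + stress mu lam (Du z) \<bullet> jB (snd z))" unfolding energy_rate_def[abs_def] trace_def matrix_vector_mult_def inner_vec_def[of "\<chi> i. f i" for f]
  by (simp add: sum_2 fun_eq_iff algebra_simps)
 ultimately show ?thesis by simp
qed

lemma integ_dissipation: "integ dissipation" unfolding dissipation_def[abs_def] by (rule integ_stress_product[OF integ_DuDu])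

lemma integ_momentum_rate: "integ momentum_rate" unfolding momentum_rate_def[abs_def] sum_2
 by (intro integ_add integ_mult integ_rhou integ_flux_tensor continuous_on_diff cont_coeff)

lemma integ_transport_rate:
 assumes f: "integ f" "!!i. integ (\<lambda>z. f z * u z $ i)"
  and g: "cont (\<lambda>z. Dg z (1, 0))" "!!j. cont (\<lambda>z. Dg z (0, axis j 1))"
 shows "integ (transport_rate f Dg)"
proof -
 have "integ (%z. f z * Dg z (1, 0) + ((f z * u z $ 1) * Dg z (0, axis 1 1) + (f z * u z $ 2) * Dg z (0, axis 2 1)))" by (intro integ_add integ_mult f g)
 thus ?thesis unfolding transport_rate_def[abs_def] by (simp add: algebra_simps)
qed

lemma integ_pressure_rate: "integ pressure_rate" unfolding pressure_rate_def[abs_def] sum_2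
 by (intro integ_continuous continuous_on_add continuous_on_mult cont_coeff)

lemma w_integ:
 "(\<lambda>z. w z $ i) \<in> borel_measurable (lebesgue_on S)" "integ (\<lambda>z. (w z $ i)^2)"
 "(\<lambda>z. Dw z $ i $ j) \<in> borel_measurable (lebesgue_on S)" "integ (\<lambda>z. (Dw z $ i $ j)^2)"
proof -
 have 1: "(%z. w z $ i - - U z $ i) \<in> borel_measurable (lebesgue_on S)" "integ (%z. (w z $ i - - U z $ i)^2)"
  using u_integ[of i] by (simp_all add: w_def)
 have 2: "(%z. Dw z $ i $ j - - gradU z $ i $ j) \<in> borel_measurable (lebesgue_on S)" "integ (%z. (Dw z $ i $ j - - gradU z $ i $ j)^2)"
  using Du_integ[of i j] by (simp_all add: Dw_def)
 show "(%z. w z $ i) \<in> borel_measurable (lebesgue_on S)" "integ (%z. (w z $ i)^2)"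
  using L2_add_continuous[OF 1 continuous_on_minus[OF cont_coeff(1)]] by blast+
 show "(%z. Dw z $ i $ j) \<in> borel_measurable (lebesgue_on S)" "integ (%z. (Dw z $ i $ j)^2)"
  using L2_add_continuous[OF 2 continuous_on_minus[OF cont_coeff(4)]] by blast+
qed

lemma integ_w: "integ (\<lambda>z. w z $ i)" "integ (\<lambda>z. Dw z $ i $ j)"
 using integ_product[OF w_integ(1,2), of "\<lambda>z. 1"] integ_product[OF w_integ(3,4), of "\<lambda>z. 1"] integ_const[of 1] by simp_all

lemma integ_norm_w: "integ (\<lambda>z. (norm (w z))^2)" unfolding norm_plane_square by (intro integ_add w_integ)

lemma integ_relative_dissipation: "integ (\<lambda>z. stress mu lam (Dw z) \<bullet> Dw z)" by (rule integ_stress_product[OF integ_product[OF w_integ(3,4) w_integ(3,4)]])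

lemma integ_work: "integ work" unfolding work_def[abs_def] inner_vec_def[of "w z" for z] sum_2 inner_real_def
 unfolding inner_vec_def sum_2 inner_real_def mult.commute[of "stress mu lam D $ i $ j" for D i j] by (intro integ_add integ_mult integ_w cont_coeff)

lemma r_powr_continuous: "cont (\<lambda>z. r z powr a)" using C1D(1)[OF r_powr_C1[of 1 a]] by simp

lemma integ_rel_energy: "integ rel_energy"
proof -
 have "integ (%z. (1/2) * ((rho z * (u z $ 1 * u z $ 1)) + (rho z * (u z $ 2 * u z $ 2)) - (rho z * u z $ 1) * (2 * U z $ 1) - (rho z * u z $ 2) * (2 * U z $ 2)
   + rho z * (U z $ 1 * U z $ 1 + U z $ 2 * U z $ 2))
  + (1 / (\<gamma> - 1)) * (rho z powr \<gamma> - rho z * (\<gamma> * r z powr (\<gamma> - 1)) + (\<gamma> - 1) * r z powr \<gamma>) + (1/2) * ((b z)^2 - b z * (2 * B z) + B z * B z))"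
  by (intro integ_add integ_diff integ_mult integ_cmult integ_rho_powr integ_b2 integ_rhouu integ_rhou integ_rho integ_b integ_continuous
    continuous_on_add continuous_on_mult cont_coeff r_powr_continuous continuous_on_const)
 moreover have "rel_energy = (%z. (1/2) * ((rho z * (u z $ 1 * u z $ 1)) + (rho z * (u z $ 2 * u z $ 2)) - (rho z * u z $ 1) * (2 * U z $ 1) - (rho z * u z $ 2) * (2 * U z $ 2)
   + rho z * (U z $ 1 * U z $ 1 + U z $ 2 * U z $ 2))
  + (1 / (\<gamma> - 1)) * (rho z powr \<gamma> - rho z * (\<gamma> * r z powr (\<gamma> - 1)) + (\<gamma> - 1) * r z powr \<gamma>) + (1/2) * ((b z)^2 - b z * (2 * B z) + B z * B z))"
  unfolding rel_energy_def[abs_def] norm_plane_square w_def rel_potential_def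
  by (simp add: fun_eq_iff power2_eq_square algebra_simps diff_divide_distrib add_divide_distrib)
 ultimately show ?thesis by simp
qed

definition total_rate :: "spacetime => real" where
 "total_rate z = energy_rate z - dissipation z - momentum_rate z + transport_rate rho Dphi z - transport_rate b DB z + pressure_rate z"

lemma integ_total_rate: "integ total_rate" unfolding total_rate_def[abs_def]
 by (intro integ_add integ_diff integ_energy_rate integ_dissipation integ_momentum_rate integ_pressure_rate
   integ_transport_rate integ_rho integ_rhou integ_b integ_bu cont_coeff)

end

lemma set_integral_mono_AE_lebesgue:
 fixes f g :: "'a::euclidean_space => real"
 assumes "set_integrable lebesgue A f" "set_integrable lebesgue A g" "AE x in lebesgue. x \<in> A --> f x <= g x"
 shows "(LINT x:A|lebesgue. f x) <= (LINT x:A|lebesgue. g x)" unfolding set_lebesgue_integral_def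
proof (rule integral_mono_AE)
 show "AE x in lebesgue. indicator A x *\<^sub>R f x <= indicator A x *\<^sub>R g x" using assms(3) by eventually_elim (auto simp: indicator_def)
qed (use assms in \<open>simp_all add: set_integrable_def\<close>)

context weak_strong_pair begin

lemma continuous_bounded:
 assumes g: "cont (g :: spacetime => real)"
 obtains C where "0 <= C" "!!z. z \<in> S ==> \<bar>g z\<bar> <= C"
proof -
 have "compact (closure S)" using bounded_S by simp
 hence "bounded (g ` closure S)" by (intro compact_imp_bounded compact_continuous_image g)
 then obtain C where C: "!!z. z \<in> closure S ==> \<bar>g z\<bar> <= C" by (auto simp: bounded_real)
 show thesis
 proof (rule that[of "\<bar>C\<bar>"])
  show "\<bar>g z\<bar> <= \<bar>C\<bar>" if "z \<in> S" for z using C[OF subsetD[OF S_subset_closure that]] by linarith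
 qed simp
qed

section \<open>The rate of the relative energy\<close>

text \<open>The coefficients are bounded by one constant \<open>M\<close>. The terms \<open>(1 - rho / r) w \<cdot>
 K\<close> and \<open>(rho / r - 1) B w \<cdot> \<nabla>B\<close> are linear in \<open>w\<close> without a factor
 \<open>rho\<close> that could be paired with it; for them the relative pressure is used, at the price of
 \<open>\<delta> |w|^2\<close>. Young's inequality handles the part \<open>(B - b) w \<cdot> \<nabla>B\<close>.\<close>

lemma remainder_bound:
 assumes \<delta>: "0 < \<delta>"
 shows "\<exists>C\<ge>0. \<forall>z\<in>S. 0 <= rho z --> remainder z <= C * rel_energy z + \<delta> * (norm (w z))^2"
proof -
 \<comment> \<open>one continuous function that dominates every coefficient\<close>
 define g where "g z = (\<bar>gradU z $ 1 $ 1\<bar> + \<bar>gradU z $ 1 $ 2\<bar> + \<bar>gradU z $ 2 $ 1\<bar> + \<bar>gradU z $ 2 $ 2\<bar>) + (\<bar>K z $ 1\<bar> + \<bar>K z $ 2\<bar>) + \<bar>B z\<bar>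
   + (\<bar>DB z (0, axis 1 1)\<bar> + \<bar>DB z (0, axis 2 1)\<bar>)" for z
 have "cont g" unfolding g_def by (intro continuous_on_add continuous_on_rabs cont_coeff)
 then obtain M where M0: "0 <= M" and M: "!!z. z \<in> S ==> \<bar>g z\<bar> <= M" using continuous_bounded by blast
 \<comment> \<open>the factor of \<open>|s / r - 1| |w|\<close>: at most \<open>M\<close> from \<open>K\<close> and \<open>M * M\<close> from \<open>B \<nabla>B\<close>\<close>
 define L where "L = M + M * M"
 have "0 <= L" using M0 by (simp add: L_def)
 then obtain C' where C': "0 <= C'" and rel: "!!s r w. 0 <= s ==> c1 <= r ==> 0 <= w ==>
   \<bar>s / r - 1\<bar> * L * w <= C' * (rel_potential \<gamma> s r + s * w^2) + \<delta> / 2 * w^2"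
  using relative_velocity_term_bound[OF \<gamma> c1, of "\<delta> / 2" L] \<delta> by auto
 define C where "C = M * \<gamma> + M + 2 * M + 2 * C' + M * M / \<delta>"
 have C0: "0 <= C" using M0 C' \<gamma> \<delta> unfolding C_def by (intro add_nonneg_nonneg) simp_all
 have "remainder z <= C * rel_energy z + \<delta> * (norm (w z))^2" if z: "z \<in> S" and \<rho>: "0 <= rho z" for z
 proof -
  define H where "H = rel_potential \<gamma> (rho z) (r z)"
  define W where "W = norm (w z)"
  define \<beta> where "\<beta> = \<bar>b z - B z\<bar>"
  define k where "k = rho z / r z"
  have z': "z \<in> {0..T} \<times> closure Om" using subsetD[OF S_subset_closure z] unfolding closure_S .
  have H: "0 <= H" unfolding H_def using r_ge[OF z'] c1 by (intro rel_potential_nonneg(1)[OF \<gamma> _ \<rho>]) linarith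
  have W: "0 <= W" and \<beta>: "0 <= \<beta>" by (simp_all add: W_def \<beta>_def)
  have "a <= M & b <= M & c <= M & d <= M" if "0 <= a" "0 <= b" "0 <= c" "0 <= d" "a + b + c + d <= M" for a b c d
   using that by linarith
  moreover have "g z <= M" using M[OF z] by linarith
  ultimately have g: "\<bar>gradU z $ 1 $ 1\<bar> + \<bar>gradU z $ 1 $ 2\<bar> + \<bar>gradU z $ 2 $ 1\<bar> + \<bar>gradU z $ 2 $ 2\<bar> <= M"
    "\<bar>K z $ 1\<bar> + \<bar>K z $ 2\<bar> <= M" "\<bar>B z\<bar> <= M" "\<bar>DB z (0, axis 1 1)\<bar> + \<bar>DB z (0, axis 2 1)\<bar> <= M"
   unfolding g_def by (metis (no_types, lifting) abs_ge_zero add_nonneg_nonneg)+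
  have wi: "\<bar>w z $ i\<bar> <= W" for i unfolding W_def by (rule component_le_norm_cart)
  have 1: "- trace (gradU z) * ((\<gamma> - 1) * H + (b z - B z)^2 / 2) <= M * ((\<gamma> - 1) * H + \<beta>^2 / 2)"
  proof -
   have "- trace (gradU z) <= M" using g(1) unfolding trace_def sum_2 by linarith
   moreover have "0 <= (\<gamma> - 1) * H + (b z - B z)^2 / 2" using H \<gamma> by (intro add_nonneg_nonneg) simp_all
   ultimately show ?thesis using mult_right_mono[of "- trace (gradU z)" M] by (simp add: \<beta>_def)
  qed
  have prod: "- (x * y * c) <= \<bar>c\<bar> * (W * W)" if "\<bar>x\<bar> <= W" "\<bar>y\<bar> <= W" for x y c
  proof -
   have "\<bar>x\<bar> * \<bar>y\<bar> <= W * W" by (intro mult_mono that W) simp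
   hence "\<bar>c\<bar> * (\<bar>x\<bar> * \<bar>y\<bar>) <= \<bar>c\<bar> * (W * W)" by (rule mult_left_mono) simp
   moreover have "- (x * y * c) <= \<bar>x * y * c\<bar>" by (rule abs_ge_minus_self)
   ultimately show ?thesis by (simp add: abs_mult mult.commute mult.left_commute)
  qed
  have add4: "- (p1 + p2 + p3 + p4) <= q1 + q2 + q3 + q4" if "- p1 <= q1" "- p2 <= q2" "- p3 <= q3" "- p4 <= q4" for p1 p2 p3 p4 q1 q2 q3 q4 :: real
   using that by linarith
  have "w z \<bullet> (gradU z *v w z) = w z $ 1 * w z $ 1 * gradU z $ 1 $ 1 + w z $ 1 * w z $ 2 * gradU z $ 1 $ 2
    + w z $ 2 * w z $ 1 * gradU z $ 2 $ 1 + w z $ 2 * w z $ 2 * gradU z $ 2 $ 2" by (simp add: inner_vec_def matrix_vector_mult_def sum_2 algebra_simps)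
  hence "- (w z \<bullet> (gradU z *v w z)) <= \<bar>gradU z $ 1 $ 1\<bar> * (W * W) + \<bar>gradU z $ 1 $ 2\<bar> * (W * W)
    + \<bar>gradU z $ 2 $ 1\<bar> * (W * W) + \<bar>gradU z $ 2 $ 2\<bar> * (W * W)"
   using add4[OF prod[OF wi[of 1] wi[of 1], of "gradU z $ 1 $ 1"] prod[OF wi[of 1] wi[of 2], of "gradU z $ 1 $ 2"]
    prod[OF wi[of 2] wi[of 1], of "gradU z $ 2 $ 1"] prod[OF wi[of 2] wi[of 2], of "gradU z $ 2 $ 2"]] by simp
  also have "... = (\<bar>gradU z $ 1 $ 1\<bar> + \<bar>gradU z $ 1 $ 2\<bar> + \<bar>gradU z $ 2 $ 1\<bar> + \<bar>gradU z $ 2 $ 2\<bar>) * (W * W)" by (simp add: distrib_right)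
  also have "... <= M * (W * W)" using W by (intro mult_right_mono g) simp
  finally have "rho z * - (w z \<bullet> (gradU z *v w z)) <= rho z * (M * (W * W))" by (rule mult_left_mono[OF _ \<rho>])
  hence 2: "- rho z * (w z \<bullet> (gradU z *v w z)) <= M * (rho z * W^2)" by (simp add: power2_eq_square mult.left_commute)
  have lin: "\<bar>w z $ 1 * a + w z $ 2 * c\<bar> <= (\<bar>a\<bar> + \<bar>c\<bar>) * W" for a c
  proof -
   have "\<bar>w z $ 1\<bar> * \<bar>a\<bar> <= W * \<bar>a\<bar>" "\<bar>w z $ 2\<bar> * \<bar>c\<bar> <= W * \<bar>c\<bar>" by (intro mult_right_mono wi abs_ge_zero)+
   moreover have "\<bar>w z $ 1 * a + w z $ 2 * c\<bar> <= \<bar>w z $ 1\<bar> * \<bar>a\<bar> + \<bar>w z $ 2\<bar> * \<bar>c\<bar>"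
    unfolding abs_mult[symmetric] by (rule abs_triangle_ineq)
   moreover have "(\<bar>a\<bar> + \<bar>c\<bar>) * W = W * \<bar>a\<bar> + W * \<bar>c\<bar>" by (simp add: algebra_simps)
   ultimately show ?thesis by linarith
  qed
  have bound: "a * c <= \<bar>a\<bar> * d" if "\<bar>c\<bar> <= d" for a c d :: real
  proof -
   have "a * c <= \<bar>a\<bar> * \<bar>c\<bar>" unfolding abs_mult[symmetric] by simp
   thus ?thesis using mult_left_mono[OF that abs_ge_zero[of a]] by linarith
  qed
  have wK: "\<bar>w z \<bullet> K z\<bar> <= M * W"
  proof -
   have "\<bar>w z \<bullet> K z\<bar> <= (\<bar>K z $ 1\<bar> + \<bar>K z $ 2\<bar>) * W" using lin[of "K z $ 1" "K z $ 2"] by (simp add: inner_vec_def sum_2)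
   also have "... <= M * W" by (intro mult_right_mono W g)
   finally show ?thesis .
  qed
  define d where "d = w z $ 1 * DB z (0, axis 1 1) + w z $ 2 * DB z (0, axis 2 1)"
  have d: "\<bar>d\<bar> <= M * W"
  proof -
   have "\<bar>d\<bar> <= (\<bar>DB z (0, axis 1 1)\<bar> + \<bar>DB z (0, axis 2 1)\<bar>) * W" unfolding d_def by (rule lin)
   also have "... <= M * W" by (intro mult_right_mono W g)
   finally show ?thesis .
  qed
  have Bd: "\<bar>B z * d\<bar> <= M * (M * W)"
  proof -
   show ?thesis unfolding abs_mult by (rule mult_mono[OF g(3) d M0 abs_ge_zero])
  qed
  have 3: "(1 - k) * (w z \<bullet> K z) <= \<bar>k - 1\<bar> * (M * W)" using bound[OF wK, of "1 - k"] by (simp add: abs_minus_commute)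
  have 4: "(k * B z - b z) * d <= \<bar>k - 1\<bar> * (M * (M * W)) + \<beta> * (M * W)"
  proof -
   have "(k * B z - b z) * d = (k - 1) * (B z * d) + (B z - b z) * d" by (simp add: algebra_simps)
   moreover have "(k - 1) * (B z * d) <= \<bar>k - 1\<bar> * (M * (M * W))" by (rule bound[OF Bd])
   moreover have "(B z - b z) * d <= \<beta> * (M * W)" using bound[OF d, of "B z - b z"] by (simp add: \<beta>_def abs_minus_commute)
   ultimately show ?thesis by linarith
  qed
  have 5: "\<beta> * (M * W) <= M * M / \<delta> * (\<beta>^2 / 2) + \<delta> / 2 * W^2"
  proof -
   have "0 <= (M * \<beta> - \<delta> * W)^2 / (2 * \<delta>)" using \<delta> by simp
   also have "... = M * M / \<delta> * (\<beta>^2 / 2) + \<delta> / 2 * W^2 - \<beta> * (M * W)"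
    using \<delta> by (simp add: power2_eq_square field_simps)
   finally show ?thesis by linarith
  qed
  have 6: "\<bar>k - 1\<bar> * (M * W) + \<bar>k - 1\<bar> * (M * (M * W)) <= C' * (H + rho z * W^2) + \<delta> / 2 * W^2"
   using rel[OF \<rho> r_ge[OF z'] W] unfolding L_def k_def H_def by (simp add: algebra_simps)
  define P where "P = rho z * W^2"
  have P: "0 <= P" using \<rho> by (simp add: P_def)
  define Q where "Q = \<beta>^2 / 2"
  have Q: "0 <= Q" by (simp add: Q_def)
  have e: "rel_energy z = P / 2 + H + Q" by (simp add: rel_energy_def P_def H_def Q_def \<beta>_def W_def)
  have "remainder z <= M * ((\<gamma> - 1) * H + Q) + M * P + C' * (H + P) + M * M / \<delta> * Q + \<delta> * W^2"
   unfolding remainder_def using 1 2 3 4 5 6 unfolding H_def[symmetric] k_def[symmetric] d_def[symmetric] P_def[symmetric] Q_def[symmetric] by linarith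
  also have "... <= C * (P / 2 + H + Q) + \<delta> * W^2"
  proof -
   have n: "0 <= M * \<gamma>" "0 <= M * M / \<delta>" using M0 \<gamma> \<delta> by simp_all
   have "M * ((\<gamma> - 1) * H + Q) + M * P + C' * (H + P) + M * M / \<delta> * Q
     = (M * \<gamma> + C' - M) * H + (M + M * M / \<delta>) * Q + (2 * M + 2 * C') * (P / 2)" by (simp add: algebra_simps)
   also have "... <= C * H + C * Q + C * (P / 2)"
   proof -
    have "M * \<gamma> + C' - M <= C" "M + M * M / \<delta> <= C" "2 * M + 2 * C' <= C" using n M0 C' unfolding C_def by linarith+
    moreover have "0 <= P / 2" using P by simp
    ultimately show ?thesis using mult_right_mono[OF _ H] mult_right_mono[OF _ Q] mult_right_mono[of _ _ "P / 2"] by (meson add_mono)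
   qed
   finally show ?thesis by (simp add: algebra_simps)
  qed
  finally show ?thesis unfolding e W_def .
 qed
 thus ?thesis using C0 by blast
qed

lemma slice_gradient:
 fixes f :: "spacetime => real"
 assumes f: "C1_closure S f Df" and z: "(t, x) \<in> S"
 shows "((\<lambda>x. f (t, x)) has_derivative (\<lambda>v. (\<chi> j. Df (t, x) (0, axis j 1)) \<bullet> v)) (at x)"
proof -
 have d: "(f has_derivative Df (t, x)) (at (t, x))" by (rule C1D(2)[OF f z])
 have "Df (t, x) (0, v) = (\<chi> j. Df (t, x) (0, axis j 1)) \<bullet> v" for v
 proof -
  have "(0, v) = v $ 1 *\<^sub>R (0, axis 1 1) + v $ 2 *\<^sub>R ((0, axis 2 1) :: spacetime)" by (simp add: prod_eq_iff vec_eq_iff axis_def forall_2)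
  hence "Df (t, x) (0, v) = Df (t, x) (v $ 1 *\<^sub>R (0, axis 1 1) + v $ 2 *\<^sub>R (0, axis 2 1))" by simp
  also have "... = v $ 1 * Df (t, x) (0, axis 1 1) + v $ 2 * Df (t, x) (0, axis 2 1)"
   using has_derivative_linear[OF d] by (simp only: linear_add linear_scale real_scaleR_def)
  finally show ?thesis by (simp add: inner_vec_def sum_2)
 qed
 hence "(%v. Df (t, x) (0, v)) = (%v. (\<chi> j. Df (t, x) (0, axis j 1)) \<bullet> v)" by (rule ext)
 with slice_has_derivative[OF d] show ?thesis by (rule has_derivative_eq_rhs)
qed

lemma slice_cont_Omega:
 fixes F :: "spacetime => real"
 assumes "cont F" "t \<in> {0..T}"
 shows "continuous_on Om (\<lambda>x. F (t, x))" by (rule continuous_on_subset[OF slice_cont[OF assms] closure_subset])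

lemma strong_boundary_slice_H01:
 assumes t: "t \<in> {0<..<T}"
 shows "H01 Om (\<lambda>x. U (t, x) $ i - uB x $ i) (\<lambda>x. gradU (t, x) $ i - jB x $ i)"
proof -
 define f where "f z = U z $ i - uB (snd z) $ i" for z
 define Df where "Df z h = DU z h $ i - DuB (snd z) (snd h) $ i" for z h
 have f: "C1_closure S f Df" unfolding f_def[abs_def] Df_def[abs_def] by (intro C1_closure_diff C1_closure_nth U_C1 uB_snd_C1)
 have t': "t \<in> {0..T}" using t by simp
 have Dfj: "Df (t, x) (0, axis j 1) = (gradU (t, x) $ i - jB x $ i) $ j" for x j by (simp add: Df_def gradU_def jB_nth)
 have cDf: "cont (%z. gradU z $ i $ j - jB (snd z) $ i $ j)" for j by (intro continuous_on_diff cont_coeff)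
 define h where "h z = \<bar>gradU z $ i $ 1 - jB (snd z) $ i $ 1\<bar> + \<bar>gradU z $ i $ 2 - jB (snd z) $ i $ 2\<bar>" for z
 have "cont h" unfolding h_def by (intro continuous_on_add continuous_on_rabs cDf)
 then obtain C where C: "!!z. z \<in> S ==> \<bar>h z\<bar> <= C" using continuous_bounded by blast
 have "H01 Om (%x. f (t, x)) (%x. gradU (t, x) $ i - jB x $ i)"
 proof (rule H01_if_vanishing_on_frontier[OF op bd])
  show "continuous_on (closure Om) (%x. f (t, x))" by (rule slice_cont[OF C1D(1)[OF f] t'])
  show "f (t, x) = 0" if "x \<in> frontier Om" for x using U_boundary[OF t' that] by (simp add: f_def)
  show "((%x. f (t, x)) has_derivative (%v. (gradU (t, x) $ i - jB x $ i) \<bullet> v)) (at x)" if "x \<in> Om" for x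
  proof -
   have "(\<chi> j. Df (t, x) (0, axis j 1)) = gradU (t, x) $ i - jB x $ i" unfolding vec_eq_iff vec_lambda_beta Dfj by simp
   thus ?thesis using slice_gradient[OF f, of t x] t that by (metis mem_Times_iff fst_conv snd_conv)
  qed
  have "continuous_on Om (%x. \<chi> j. gradU (t, x) $ i $ j - jB (snd (t, x)) $ i $ j)" by (intro continuous_on_vec_lambda slice_cont_Omega[OF cDf t'])
  moreover have "(\<chi> j. gradU (t, x) $ i $ j - jB (snd (t, x)) $ i $ j) = gradU (t, x) $ i - jB x $ i" for x by (simp add: vec_eq_iff)
  ultimately show "continuous_on Om (%x. gradU (t, x) $ i - jB x $ i)" by simp
  show "\<bar>(gradU (t, x) $ i - jB x $ i) $ j\<bar> <= C" if "x \<in> Om" for x j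
  proof -
   have "\<bar>h (t, x)\<bar> <= C" using C[of "(t, x)"] t that by simp
   thus ?thesis using exhaust_2[of j] by (auto simp: h_def)
  qed
 qed
 thus ?thesis by (simp add: f_def)
qed

text \<open>\<open>u - uB\<close> is in the space by hypothesis, and \<open>U - uB\<close> because it is smooth and vanishes
 on the boundary.\<close>

lemma relative_velocity_H01:
 "AE t in lebesgue. t \<in> {0<..<T} --> H01_vec Om (\<lambda>x. w (t, x)) (\<lambda>x. Dw (t, x))"
proof -
 have "AE t in lebesgue. t \<in> {0<..<T} --> W12_zero Om (%x. u (t, x) - uB x) (%x. Du (t, x) - jB x)"
  using velocity unfolding L2_W12_zero_def by simp
 thus ?thesis
 proof eventually_elim
  case (elim t)
  show ?case
  proof
   assume t: "t \<in> {0<..<T}"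
   have v: "H01_vec Om (%x. u (t, x) - uB x) (%x. Du (t, x) - jB x)" using elim t by (intro W12_zero_H01_vec[OF op bd]) simp
   show "H01_vec Om (%x. w (t, x)) (%x. Dw (t, x))" unfolding H01_vec_def
   proof
    fix i
    have "H01 Om (%x. (u (t, x) - uB x) $ i) (%x. (Du (t, x) - jB x) $ i)" using v unfolding H01_vec_def by blast
    from H01_diff[OF op bd this strong_boundary_slice_H01[OF t, of i]]
    show "H01 Om (%x. w (t, x) $ i) (%x. Dw (t, x) $ i)" by (simp add: w_def Dw_def)
   qed
  qed
 qed
qed

text \<open>Integration by parts, with no boundary term since \<open>w\<close> vanishes on the boundary.\<close>

lemma work_integral_zero:
 "AE t in lebesgue. t \<in> {0<..<T} --> (LINT x:Om|lebesgue. work (t, x)) = 0"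
proof -
 define k where "k i j z = Dstress z (0, axis j 1) $ i $ j" for i j z
 define s where "s i j z = stress mu lam (gradU z) $ i $ j" for i j z
 have ck: "cont (k i j)" for i j unfolding k_def by (rule C1D(3)[OF stress_C1 st_basis(2)])
 have cs: "cont (s i j)" for i j unfolding s_def by (rule cont_coeff)
 have i1: "integ (%z. w z $ i * k i j z)" and i2: "integ (%z. Dw z $ i $ j * s i j z)" for i j by (intro integ_mult integ_w ck cs)+
 have f1: "AE t in lebesgue. \<forall>i j. t \<in> {0<..<T} --> set_integrable lebesgue Om (%x. w (t, x) $ i * k i j (t, x))"
  unfolding AE_all_countable by (intro allI set_lebesgue_Fubini(1)[OF i1])
 have f2: "AE t in lebesgue. \<forall>i j. t \<in> {0<..<T} --> set_integrable lebesgue Om (%x. Dw (t, x) $ i $ j * s i j (t, x))"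
  unfolding AE_all_countable by (intro allI set_lebesgue_Fubini(1)[OF i2])
 show ?thesis using f1 f2 relative_velocity_H01
 proof eventually_elim
  case (elim t)
  show ?case
  proof
   assume t: "t \<in> {0<..<T}"
   hence t': "t \<in> {0..T}" by simp
   have s1: "set_integrable lebesgue Om (%x. w (t, x) $ i * k i j (t, x))" for i j using elim(1) t by blast
   have s2: "set_integrable lebesgue Om (%x. Dw (t, x) $ i $ j * s i j (t, x))" for i j using elim(2) t by blast
   have h: "H01 Om (%x. w (t, x) $ i) (%x. Dw (t, x) $ i)" for i using elim(3) t unfolding H01_vec_def by blast
   have on: "(LINT x:Om|lebesgue. f x) = (LINT x|lebesgue_on Om. f x)" for f :: "plane => real"
    unfolding set_lebesgue_integral_def by (rule integral_restrict_space[symmetric]) (use Omega_sets in simp)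
   have parts: "(LINT x:Om|lebesgue. w (t, x) $ i * k i j (t, x)) + (LINT x:Om|lebesgue. Dw (t, x) $ i $ j * s i j (t, x)) = 0" for i j
   proof -
    define g where "g x = (\<chi> l. Dstress (t, x) (0, axis l 1) $ i $ j)" for x
    define G where "G z = \<bar>s i j z\<bar> + \<bar>k i j z\<bar>" for z
    have "cont G" unfolding G_def by (intro continuous_on_add continuous_on_rabs ck cs)
    then obtain C where C: "!!z. z \<in> S ==> \<bar>G z\<bar> <= C" using continuous_bounded by blast
    have C': "\<bar>s i j (t, x)\<bar> + \<bar>k i j (t, x)\<bar> <= C" if "x \<in> Om" for x using C[of "(t, x)"] t that by (simp add: G_def)
    have gj: "g x $ j = k i j (t, x)" for x by (simp add: g_def k_def)
    have "(LINT x|lebesgue_on Om. w (t, x) $ i * g x $ j) = - (LINT x|lebesgue_on Om. Dw (t, x) $ i $ j * s i j (t, x))"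
    proof (rule H01_parts[OF op bd h, where C = C])
     show "((%x. s i j (t, x)) has_derivative (%v. g x \<bullet> v)) (at x)" if "x \<in> Om" for x
      unfolding s_def g_def by (rule slice_gradient[OF stress_C1]) (use t that in simp)
     show "continuous_on Om g" unfolding g_def by (intro continuous_on_vec_lambda slice_cont_Omega[OF _ t'] C1D(3)[OF stress_C1 st_basis(2)])
     show "\<bar>s i j (t, x)\<bar> <= C" if "x \<in> Om" for x using C'[OF that] by linarith
     show "\<bar>g x $ j\<bar> <= C" if "x \<in> Om" for x unfolding gj using C'[OF that] by linarith
    qed
    thus ?thesis unfolding gj on by linarith
   qed
   have "(LINT x:Om|lebesgue. work (t, x)) = (LINT x:Om|lebesgue.
     (w (t, x) $ 1 * k 1 1 (t, x) + Dw (t, x) $ 1 $ 1 * s 1 1 (t, x)) + (w (t, x) $ 1 * k 1 2 (t, x) + Dw (t, x) $ 1 $ 2 * s 1 2 (t, x))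
     + ((w (t, x) $ 2 * k 2 1 (t, x) + Dw (t, x) $ 2 $ 1 * s 2 1 (t, x)) + (w (t, x) $ 2 * k 2 2 (t, x) + Dw (t, x) $ 2 $ 2 * s 2 2 (t, x))))"
    by (rule set_lebesgue_integral_cong[OF Omega_sets])
      (simp add: work_def K_def k_def s_def inner_vec_def sum_2 algebra_simps)
   also have "... = 0"
   proof -
    define Z where "Z f \<longleftrightarrow> set_integrable lebesgue Om f & (LINT x:Om|lebesgue. f x) = 0" for f :: "plane => real"
    have add: "Z (%x. f x + g x)" if "Z f" "Z g" for f g using set_integral_add[of lebesgue Om f g] that by (simp add: Z_def)
    have "Z (%x. w (t, x) $ i * k i j (t, x) + Dw (t, x) $ i $ j * s i j (t, x))" for i j
     unfolding Z_def using set_integral_add[OF s1 s2, of i j i j] parts[of i j] by simp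
    hence "Z (%x. (w (t, x) $ 1 * k 1 1 (t, x) + Dw (t, x) $ 1 $ 1 * s 1 1 (t, x)) + (w (t, x) $ 1 * k 1 2 (t, x) + Dw (t, x) $ 1 $ 2 * s 1 2 (t, x))
     + ((w (t, x) $ 2 * k 2 1 (t, x) + Dw (t, x) $ 2 $ 1 * s 2 1 (t, x)) + (w (t, x) $ 2 * k 2 2 (t, x) + Dw (t, x) $ 2 $ 2 * s 2 2 (t, x))))"
     by (intro add[OF add add])
    thus ?thesis unfolding Z_def by (rule conjunct2)
   qed
   finally show "(LINT x:Om|lebesgue. work (t, x)) = 0" .
  qed
 qed
qed

lemma total_rate_integral_bound:
 "\<exists>C\<ge>0. AE t in lebesgue. t \<in> {0<..<T} -->
   (LINT x:Om|lebesgue. total_rate (t, x)) <= C * (LINT x:Om|lebesgue. rel_energy (t, x))"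
proof -
 obtain c where c: "0 < c" and dis: "!!v G. H01_vec Om v G ==>
  c * (LINT x|lebesgue_on Om. (norm (v x))^2) <= (LINT x|lebesgue_on Om. stress mu lam (G x) \<bullet> G x)"
  using viscous_dissipation_controls_velocity[OF op bd mu] by blast
 obtain C where C: "0 <= C" and rem: "!!z. z \<in> S ==> 0 <= rho z ==> remainder z <= C * rel_energy z + c * (norm (w z))^2"
  using remainder_bound[OF c] by blast
 have "AE t in lebesgue. t \<in> {0<..<T} -->
   (LINT x:Om|lebesgue. total_rate (t, x)) <= C * (LINT x:Om|lebesgue. rel_energy (t, x))"
  using AE_lebesgue_pair[OF rho_nonneg] relative_velocity_H01 work_integral_zero set_lebesgue_Fubini(1)[OF integ_total_rate]
   set_lebesgue_Fubini(1)[OF integ_rel_energy] set_lebesgue_Fubini(1)[OF integ_norm_w]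
   set_lebesgue_Fubini(1)[OF integ_relative_dissipation] set_lebesgue_Fubini(1)[OF integ_work]
 proof eventually_elim
  case (elim t)
  show ?case
  proof
   assume t: "t \<in> {0<..<T}"
   let ?e = "%x. rel_energy (t, x)" and ?n = "%x. (norm (w (t, x)))^2" and ?d = "%x. stress mu lam (Dw (t, x)) \<bullet> Dw (t, x)"
    and ?W = "%x. work (t, x)"
   have i: "set_integrable lebesgue Om (%x. total_rate (t, x))" "set_integrable lebesgue Om ?e" "set_integrable lebesgue Om ?n"
    "set_integrable lebesgue Om ?d" "set_integrable lebesgue Om ?W" using elim(4-8) t by blast+
   have on: "(LINT x:Om|lebesgue. f x) = (LINT x|lebesgue_on Om. f x)" for f :: "plane => real"
    unfolding set_lebesgue_integral_def by (rule integral_restrict_space[symmetric]) (use Omega_sets in simp)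
   have ie: "set_integrable lebesgue Om (%x. C * ?e x)" and "in": "set_integrable lebesgue Om (%x. c * ?n x)"
    by (intro set_integrable_mult_right i)+
   have "(LINT x:Om|lebesgue. total_rate (t, x)) <= (LINT x:Om|lebesgue. C * ?e x + c * ?n x - ?d x - ?W x)"
   proof (rule set_integral_mono_AE_lebesgue[OF i(1)])
    show "set_integrable lebesgue Om (%x. C * ?e x + c * ?n x - ?d x - ?W x)" by (intro set_integral_diff(1) set_integral_add(1) ie "in" i)
    show "AE x in lebesgue. x \<in> Om --> total_rate (t, x) <= C * ?e x + c * ?n x - ?d x - ?W x" using elim(1)
    proof eventually_elim
     case (elim x)
     show ?case
     proof
      assume "x \<in> Om"
      hence z: "(t, x) \<in> S" using t by simp
      hence "0 <= rho (t, x)" using elim by blast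
      from rem[OF z this] show "total_rate (t, x) <= C * ?e x + c * ?n x - ?d x - ?W x" unfolding total_rate_def relative_energy_rate_identity[OF z] by linarith
     qed
    qed
   qed
   also have "... = C * (LINT x:Om|lebesgue. ?e x) + c * (LINT x:Om|lebesgue. ?n x) - (LINT x:Om|lebesgue. ?d x) - (LINT x:Om|lebesgue. ?W x)"
    unfolding set_integral_diff(2)[OF set_integral_diff(1)[OF set_integral_add(1)[OF ie "in"] i(4)] i(5)]
     set_integral_diff(2)[OF set_integral_add(1)[OF ie "in"] i(4)] set_integral_add(2)[OF ie "in"] set_integral_mult_right by (rule refl)
   also have "... <= C * (LINT x:Om|lebesgue. ?e x)" using dis[of "%x. w (t, x)" "%x. Dw (t, x)"] elim(2,3) t unfolding on by simp
   finally show "(LINT x:Om|lebesgue. total_rate (t, x)) <= C * (LINT x:Om|lebesgue. ?e x)" .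
  qed
 qed
 thus ?thesis using C by blast
qed

section \<open>The relative energy inequality\<close>

text \<open>Stated for arbitrary values of the weak density, velocity and magnetic field, so that it also applies on the
 boundary and to the strong solution itself, where the right-hand side is zero.\<close>

lemma energy_decomposition:
 "s * (norm (v - uB (snd z)))^2 / 2 + s powr \<gamma> / (\<gamma> - 1) + a^2 / 2 - s * (v \<bullet> (U z - uB (snd z))) + s * phi z - a * B z + pressure z
  = s * (norm (v - U z))^2 / 2 + rel_potential \<gamma> s (r z) + (a - B z)^2 / 2"
proof -
 define k where "k = 1 / (\<gamma> - 1)"
 have 1: "\<gamma> / (\<gamma> - 1) = 1 + k" using \<gamma> by (simp add: k_def field_simps)
 have 2: "x / (\<gamma> - 1) = k * x" for x by (simp add: k_def)
 have 3: "(\<gamma> - 1) * x / (\<gamma> - 1) = x" for x using \<gamma> by simp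
 have 4: "rel_potential \<gamma> s (r z) = k * s powr \<gamma> - (1 + k) * (r z powr (\<gamma> - 1) * s) + r z powr \<gamma>"
 proof -
  have "\<gamma> * y * s / (\<gamma> - 1) = \<gamma> / (\<gamma> - 1) * (y * s)" for y by simp
  hence "\<gamma> * y * s / (\<gamma> - 1) = (1 + k) * (y * s)" for y unfolding 1 .
  thus ?thesis unfolding rel_potential_def add_divide_distrib diff_divide_distrib 3 by (simp add: k_def)
 qed
 show ?thesis unfolding 4 phi_def pressure_def unfolding 1 unfolding 2 norm_plane_square inner_vec_def sum_2
  by (simp add: power2_eq_square algebra_simps diff_divide_distrib add_divide_distrib)
qed

text \<open>The sign of the boundary values of the density is not known. For negative \<open>s\<close> the only odd term has
 the good sign.\<close>

lemma rel_potential_ge_0: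
 assumes "0 < c"
 shows "0 <= rel_potential \<gamma> s c"
proof -
 have "0 <= rel_potential \<gamma> \<bar>s\<bar> c" by (rule rel_potential_nonneg(1)[OF \<gamma> assms]) simp
 also have "... <= rel_potential \<gamma> s c"
 proof -
  have "\<gamma> * c powr (\<gamma> - 1) * s <= \<gamma> * c powr (\<gamma> - 1) * \<bar>s\<bar>" using \<gamma> by (intro mult_left_mono) simp_all
  thus ?thesis unfolding rel_potential_def abs_powr using \<gamma> by (intro divide_right_mono) simp_all
 qed
 finally show ?thesis .
qed

lemma rel_potential_self: "0 < c ==> rel_potential \<gamma> c c = 0"
 using \<gamma> powr_add[of c 1 "\<gamma> - 1"] by (simp add: rel_potential_def powr_one algebra_simps)

lemma boundary_cylinder_sets: "{0<..<T} \<times> frontier Om \<in> sets BM" by (rule emeasure_cylinder_finite(1)) (simp add: frontier_def)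

lemma boundary_measurable_iff:
 "set_borel_measurable BM ({0<..<T} \<times> frontier Om) f \<longleftrightarrow> f \<in> borel_measurable (restrict_space BM ({0<..<T} \<times> frontier Om))"
 for f :: "spacetime => real" unfolding set_borel_measurable_def using boundary_cylinder_sets by (subst borel_measurable_restrict_space_iff) auto

lemma integrable_boundary_dominated:
 assumes \<Gamma>: "\<Gamma> \<in> sets borel" "\<Gamma> <= frontier Om" and \<tau>: "\<tau> <= T"
  and f: "set_borel_measurable BM ({0<..<T} \<times> frontier Om) f"
  and le: "!!z. z \<in> {0..T} \<times> closure Om ==> \<bar>f z\<bar> <= C * (1 + rho z powr \<gamma> + (b z)^2)"
 shows "set_integrable BM ({0<..<\<tau>} \<times> \<Gamma>) (\<lambda>(t, x). f (t, x) * flux x)"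
proof (rule integrable_boundary_product[OF \<Gamma> \<tau> f])
 let ?F = "{0<..<T} \<times> frontier Om"
 have Fs: "frontier Om \<in> sets borel" by (simp add: frontier_def)
 have "set_integrable BM ?F (%(t, x). 1 * flux x)" using integrable_boundary_continuous[of T "%z. 1" T "frontier Om"] Fs by simp
 hence 1: "set_integrable BM ?F (%z. \<bar>(%(t, x). 1 * flux x) z\<bar>)" by (rule set_integrable_abs)
 have 2: "set_integrable BM ?F (%(t, x). \<bar>rho (t, x)\<bar> powr \<gamma> * \<bar>uB x \<bullet> outer_normal Om x\<bar>)"
  and 3: "set_integrable BM ?F (%(t, x). \<bar>b (t, x)\<bar> powr 2 * \<bar>uB x \<bullet> outer_normal Om x\<bar>)"
  using rho_Lp(2) b_Lp(2) unfolding boundary_Lp_def by blast+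
 show "set_integrable BM ?F (%z. C * (\<bar>(%(t, x). 1 * flux x) z\<bar> + (%(t, x). \<bar>rho (t, x)\<bar> powr \<gamma> * \<bar>uB x \<bullet> outer_normal Om x\<bar>) z
   + (%(t, x). \<bar>b (t, x)\<bar> powr 2 * \<bar>uB x \<bullet> outer_normal Om x\<bar>) z))"
  by (intro set_integrable_mult_right set_integral_add(1) 1 2 3)
 fix t x assume "t \<in> {0<..<T}" "x \<in> frontier Om"
 hence "(t, x) \<in> {0..T} \<times> closure Om" by (auto simp: frontier_def)
 hence "\<bar>f (t, x)\<bar> * \<bar>flux x\<bar> <= (C * (1 + rho (t, x) powr \<gamma> + (b (t, x))^2)) * \<bar>flux x\<bar>"
  by (intro mult_right_mono le) simp_all
 also have "... = C * (\<bar>flux x\<bar> + \<bar>rho (t, x)\<bar> powr \<gamma> * \<bar>flux x\<bar> + \<bar>b (t, x)\<bar> powr 2 * \<bar>flux x\<bar>)"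
  by (simp add: abs_powr[of "rho (t, x)"] algebra_simps)
 also have "... <= \<bar>...\<bar>" by (rule abs_ge_self)
 finally show "\<bar>f (t, x) * flux x\<bar> <= \<bar>C * (\<bar>case (t, x) of (t, x) => 1 * flux x\<bar> + (case (t, x) of (t, x) => \<bar>rho (t, x)\<bar> powr \<gamma> * \<bar>uB x \<bullet> outer_normal Om x\<bar>)
   + (case (t, x) of (t, x) => \<bar>b (t, x)\<bar> powr 2 * \<bar>uB x \<bullet> outer_normal Om x\<bar>))\<bar>"
  by (simp add: abs_mult normal_flux_def)
qed

lemma boundary_integral_combination:
 assumes "set_integrable BM ({0<..<\<tau>} \<times> \<Gamma>) (\<lambda>(t, x). f (t, x) * flux x)" "set_integrable BM ({0<..<\<tau>} \<times> \<Gamma>) (\<lambda>(t, x). g (t, x) * flux x)"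
  "set_integrable BM ({0<..<\<tau>} \<times> \<Gamma>) (\<lambda>(t, x). h (t, x) * flux x)" "set_integrable BM ({0<..<\<tau>} \<times> \<Gamma>) (\<lambda>(t, x). k (t, x) * flux x)"
 shows "boundary_integral \<tau> Om \<Gamma> (\<lambda>(t, x). f (t, x) * flux x) + boundary_integral \<tau> Om \<Gamma> (\<lambda>(t, x). g (t, x) * flux x)
  - boundary_integral \<tau> Om \<Gamma> (\<lambda>(t, x). h (t, x) * flux x) + boundary_integral \<tau> Om \<Gamma> (\<lambda>(t, x). k (t, x) * flux x)
  = (LINT z:{0<..<\<tau>} \<times> \<Gamma>|BM. (f z + g z - h z + k z) * flux (snd z))"
proof -
 have e: "(%(t, x). F (t, x) * flux x) = (%z. F z * flux (snd z))" for F :: "spacetime => real" by auto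
 note i = assms[unfolded e]
 show ?thesis unfolding boundary_integral_def e distrib_right left_diff_distrib
  set_integral_add(2)[OF set_integral_diff(1)[OF set_integral_add(1)[OF i(1,2)] i(3)] i(4)]
  set_integral_diff(2)[OF set_integral_add(1)[OF i(1,2)] i(3)] set_integral_add(2)[OF i(1,2)] by (rule refl)
qed

text \<open>On the boundary the velocities agree, and the outflow terms add up to the flux of the relative energy of the
 densities.\<close>

lemma outflow_terms_nonneg:
 assumes \<tau>: "\<tau> \<in> {0<..<T}"
 shows "0 <= boundary_integral \<tau> Om (outflow Om uB) (\<lambda>(t, x). (rho (t, x) powr \<gamma> / (\<gamma> - 1) + (b (t, x))^2 / 2) * flux x)
  + boundary_integral \<tau> Om (outflow Om uB) (\<lambda>(t, x). (rho (t, x) * phi (t, x)) * flux x)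
  - boundary_integral \<tau> Om (outflow Om uB) (\<lambda>(t, x). (b (t, x) * B (t, x)) * flux x)
  + boundary_integral \<tau> Om (outflow Om uB) (\<lambda>(t, x). pressure (t, x) * flux x)"
proof -
 let ?F = "{0<..<T} \<times> frontier Om" and ?Q = "{0<..<\<tau>} \<times> outflow Om uB"
 let ?R = "restrict_space BM ?F"
 have \<tau>T: "\<tau> <= T" using \<tau> by simp
 have mr: "rho \<in> borel_measurable ?R" and mb: "b \<in> borel_measurable ?R" using rho_Lp(2) b_Lp(2) unfolding boundary_Lp_def boundary_measurable_iff by blast+
 have mc: "f \<in> borel_measurable ?R" if "cont f" for f :: "spacetime => real"
  using continuous_boundary_measurable[of T f] that unfolding boundary_measurable_iff closure_S .
 note mphi = mc[OF cont_coeff(9)] and mB = mc[OF cont_coeff(6)] and mP = mc[OF cont_coeff(12)]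
 have cl: "closure S = {0..T} \<times> closure Om" by (rule closure_S)
 have bnd: "\<exists>C\<ge>0. \<forall>z\<in>{0..T} \<times> closure Om. \<bar>g z\<bar> <= C" if g: "cont g" for g :: "spacetime => real"
 proof -
  have "compact (closure S)" using bounded_S by simp
  hence "bounded (g ` closure S)" by (intro compact_imp_bounded compact_continuous_image g)
  then obtain C where C: "!!z. z \<in> closure S ==> \<bar>g z\<bar> <= C" by (auto simp: bounded_real)
  have "\<bar>g z\<bar> <= \<bar>C\<bar>" if "z \<in> {0..T} \<times> closure Om" for z using C[of z] that unfolding cl by linarith
  thus ?thesis by (intro exI[of _ "\<bar>C\<bar>"]) simp
 qed
 obtain Cp where Cp: "0 <= Cp" "!!z. z \<in> {0..T} \<times> closure Om ==> \<bar>phi z\<bar> <= Cp" using bnd[OF cont_coeff(9)] by blast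
 obtain CB where CB: "0 <= CB" "!!z. z \<in> {0..T} \<times> closure Om ==> \<bar>B z\<bar> <= CB" using bnd[OF cont_coeff(6)] by blast
 note dom = integrable_boundary_dominated[OF outflow_sets in_out_frontier(2) \<tau>T, unfolded boundary_measurable_iff]
 have i1: "set_integrable BM ?Q (%(t, x). (%z. rho z powr \<gamma> / (\<gamma> - 1) + (b z)^2 / 2) (t, x) * flux x)"
 proof (rule dom[where C = "1 / (\<gamma> - 1) + 1"])
  show "(%z. rho z powr \<gamma> / (\<gamma> - 1) + (b z)^2 / 2) \<in> borel_measurable ?R" using mr mb by simp
  fix z
  define k where "k = 1 / (\<gamma> - 1)"
  have k: "0 <= k" using \<gamma> by (simp add: k_def)
  have p: "0 <= k * rho z powr \<gamma>" "0 <= k * (b z)^2" "0 <= rho z powr \<gamma>" "0 <= (b z)^2" using k by simp_all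
  have "rho z powr \<gamma> / (\<gamma> - 1) = k * rho z powr \<gamma>" by (simp add: k_def)
  thus "\<bar>rho z powr \<gamma> / (\<gamma> - 1) + (b z)^2 / 2\<bar> <= (1 / (\<gamma> - 1) + 1) * (1 + rho z powr \<gamma> + (b z)^2)"
   unfolding k_def[symmetric] using p k by (simp add: algebra_simps)
 qed
 have i2: "set_integrable BM ?Q (%(t, x). (%z. rho z * phi z) (t, x) * flux x)"
 proof (rule dom[where C = Cp])
  show "(%z. rho z * phi z) \<in> borel_measurable ?R" using mr mphi by simp
  fix z assume "z \<in> {0..T} \<times> closure Om"
  hence "\<bar>rho z\<bar> * \<bar>phi z\<bar> <= (1 + rho z powr \<gamma> + (b z)^2) * Cp"
   using abs_le_powr[of "rho z"] by (intro mult_mono Cp) (simp_all add: add_increasing2)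
  thus "\<bar>rho z * phi z\<bar> <= Cp * (1 + rho z powr \<gamma> + (b z)^2)" by (simp add: abs_mult mult.commute)
 qed
 have i3: "set_integrable BM ?Q (%(t, x). (%z. b z * B z) (t, x) * flux x)"
 proof (rule dom[where C = CB])
  show "(%z. b z * B z) \<in> borel_measurable ?R" using mb mB by simp
  fix z assume z: "z \<in> {0..T} \<times> closure Om"
  have "0 <= (\<bar>b z\<bar> - 1)^2" by simp
  hence "\<bar>b z\<bar> <= 1 + (b z)^2" by (simp add: power2_diff)
  hence "\<bar>b z\<bar> <= 1 + rho z powr \<gamma> + (b z)^2" using powr_ge_zero[of "rho z" \<gamma>] by linarith
  hence "\<bar>b z\<bar> * \<bar>B z\<bar> <= (1 + rho z powr \<gamma> + (b z)^2) * CB" using z by (intro mult_mono CB) (simp_all add: add_nonneg_nonneg)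
  thus "\<bar>b z * B z\<bar> <= CB * (1 + rho z powr \<gamma> + (b z)^2)" by (simp add: abs_mult mult.commute)
 qed
 have i4: "set_integrable BM ?Q (%(t, x). pressure (t, x) * flux x)" by (rule integrable_boundary_continuous[OF _ \<tau>T outflow_sets in_out_frontier(2)])
    (use cont_coeff(12) closure_S in simp)
 have "0 <= indicat_real ?Q z *\<^sub>R ((rho z powr \<gamma> / (\<gamma> - 1) + (b z)^2 / 2 + rho z * phi z - b z * B z + pressure z) * flux (snd z))" for z
 proof (cases "z \<in> ?Q")
  case True
  then obtain t x where z: "z = (t, x)" and t: "t \<in> {0..T}" and x: "x \<in> frontier Om" "0 < flux x" using \<tau> by (auto simp: outflow_def normal_flux_def)
  have "z \<in> closure S" unfolding cl z using t x(1) by (simp add: frontier_def)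
  hence rp: "0 < r z" by (rule r_pos)
  have "uB (snd z) = U z" using U_boundary[OF t x(1)] by (simp add: z)
  hence "rho z powr \<gamma> / (\<gamma> - 1) + (b z)^2 / 2 + rho z * phi z - b z * B z + pressure z
    = rel_potential \<gamma> (rho z) (r z) + (b z - B z)^2 / 2" using energy_decomposition[of "rho z" "U z" z "b z"] by simp
  also have "... >= 0" using rel_potential_ge_0[OF rp] by simp
  finally show ?thesis using True x(2) by (simp add: z)
 qed simp
 thus ?thesis unfolding boundary_integral_combination[OF i1 i2 i3 i4] set_lebesgue_integral_def by (intro integral_nonneg_AE AE_I2)
qed

lemma inflow_terms_cancel:
 assumes \<tau>: "\<tau> \<in> {0<..<T}"
 shows "boundary_integral \<tau> Om (inflow Om uB) (\<lambda>(t, x). (rhoB x powr \<gamma> / (\<gamma> - 1) + (bB x)^2 / 2) * flux x)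
  + boundary_integral \<tau> Om (inflow Om uB) (\<lambda>(t, x). (rhoB x * phi (t, x)) * flux x)
  - boundary_integral \<tau> Om (inflow Om uB) (\<lambda>(t, x). (bB x * B (t, x)) * flux x)
  + boundary_integral \<tau> Om (inflow Om uB) (\<lambda>(t, x). pressure (t, x) * flux x) = 0"
proof -
 let ?Q = "{0<..<\<tau>} \<times> inflow Om uB"
 have \<tau>T: "\<tau> <= T" using \<tau> by simp
 have int: "set_integrable BM ?Q (%(t, x). F (t, x) * flux x)" if F: "cont F" for F
  by (rule integrable_boundary_continuous[OF F[unfolded closure_S] \<tau>T inflow_sets in_out_frontier(1)])
 have Qs: "?Q \<in> sets BM" by (rule emeasure_cylinder_finite(1)[OF inflow_sets])
 have Q: "t \<in> {0..T}" "x \<in> frontier Om" "x \<in> inflow Om uB" "(t, x) \<in> closure S" if "(t, x) \<in> ?Q" for t x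
  using that \<tau> in_out_frontier(1) unfolding closure_S by (auto simp: frontier_def)
 have c1: "cont (%z. r z powr \<gamma> / (\<gamma> - 1) + (B z)^2 / 2)"
  using \<gamma> by (intro continuous_on_add continuous_on_divide r_powr_continuous continuous_on_power cont_coeff continuous_on_const) auto
 have c2: "cont (%z. r z * phi z)" and c3: "cont (%z. B z * B z)" by (intro continuous_on_mult cont_coeff)+
 note i1 = int[OF c1] and i2 = int[OF c2] and i3 = int[OF c3] and i4 = int[OF cont_coeff(12)]
 have cong: "boundary_integral \<tau> Om (inflow Om uB) (%(t, x). f t x * flux x) = boundary_integral \<tau> Om (inflow Om uB) (%(t, x). g (t, x) * flux x)"
  if "!!t x. (t, x) \<in> ?Q ==> f t x = g (t, x)" for f g
  unfolding boundary_integral_def by (rule set_lebesgue_integral_cong[OF Qs]) (use that in auto)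
 have eqs: "rhoB x = r (t, x)" "bB x = B (t, x)" if "(t, x) \<in> ?Q" for t x using rB_inflow[OF Q(1,3)[OF that]] by simp_all
 have c: "boundary_integral \<tau> Om (inflow Om uB) (%(t, x). (rhoB x powr \<gamma> / (\<gamma> - 1) + (bB x)^2 / 2) * flux x)
   = boundary_integral \<tau> Om (inflow Om uB) (%(t, x). (%z. r z powr \<gamma> / (\<gamma> - 1) + (B z)^2 / 2) (t, x) * flux x)"
  "boundary_integral \<tau> Om (inflow Om uB) (%(t, x). (rhoB x * phi (t, x)) * flux x)
   = boundary_integral \<tau> Om (inflow Om uB) (%(t, x). (%z. r z * phi z) (t, x) * flux x)"
  "boundary_integral \<tau> Om (inflow Om uB) (%(t, x). (bB x * B (t, x)) * flux x)
   = boundary_integral \<tau> Om (inflow Om uB) (%(t, x). (%z. B z * B z) (t, x) * flux x)" by (rule cong, simp only: eqs)+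
 have "(LINT z:?Q|BM. (r z powr \<gamma> / (\<gamma> - 1) + (B z)^2 / 2 + r z * phi z - B z * B z + pressure z) * flux (snd z)) = (LINT z:?Q|BM. 0)"
 proof (rule set_lebesgue_integral_cong[OF Qs], intro allI impI)
  fix z assume "z \<in> ?Q"
  then obtain t x where z: "z = (t, x)" and tx: "(t, x) \<in> ?Q" by blast
  have rp: "0 < r z" unfolding z by (rule r_pos[OF Q(4)[OF tx]])
  have "uB (snd z) = U z" using U_boundary[OF Q(1,2)[OF tx]] by (simp add: z)
  hence "r z powr \<gamma> / (\<gamma> - 1) + (B z)^2 / 2 + r z * phi z - B z * B z + pressure z = rel_potential \<gamma> (r z) (r z)"
   using energy_decomposition[of "r z" "U z" z "B z"] by simp
  also have "... = 0" by (rule rel_potential_self[OF rp])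
  finally show "(r z powr \<gamma> / (\<gamma> - 1) + (B z)^2 / 2 + r z * phi z - B z * B z + pressure z) * flux (snd z) = 0" by simp
 qed
 thus ?thesis unfolding c boundary_integral_combination[OF i1 i2 i3 i4] by simp
qed

lemma set_integrable_slice:
 fixes F :: "spacetime => real"
 assumes F: "cont F" and t: "t \<in> {0..T}"
 shows "set_integrable lebesgue Om (\<lambda>x. F (t, x))"
proof -
 have "compact (closure Om)" using bd by simp
 hence "bounded ((%x. F (t, x)) ` closure Om)" by (intro compact_imp_bounded compact_continuous_image slice_cont[OF F t])
 then obtain C where C: "!!x. x \<in> closure Om ==> \<bar>F (t, x)\<bar> <= C" by (auto simp: bounded_real)
 show ?thesis by (rule set_integrable_cont_bounded(2)[OF op bd slice_cont_Omega[OF F t] C[OF subsetD[OF closure_subset]]])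
qed

lemma set_integral_alternating_sum:
 fixes f1 f2 f3 f4 f5 :: "'a => real"
 assumes "set_integrable M A f1" "set_integrable M A f2" "set_integrable M A f3" "set_integrable M A f4" "set_integrable M A f5"
 shows "(LINT x:A|M. f1 x - f2 x + f3 x - f4 x + f5 x) = (LINT x:A|M. f1 x) - (LINT x:A|M. f2 x) + (LINT x:A|M. f3 x) - (LINT x:A|M. f4 x) + (LINT x:A|M. f5 x)"
 using assms by (simp add: set_integral_add set_integral_diff)

lemma bulk_cong:
 assumes "\<tau> \<in> {0<..<T}" "!!z. z \<in> S ==> f z = g z"
 shows "bulk_integral \<tau> Om f = bulk_integral \<tau> Om g" unfolding bulk_integral_def
proof (rule set_lebesgue_integral_cong)
 show "cyl \<tau> Om \<in> sets lebesgue" using open_cylinder[OF op, of \<tau>] by simp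
 show "\<forall>z. z \<in> cyl \<tau> Om --> f z = g z" using assms by auto
qed

lemma integ_restrict: "integ f ==> \<tau> \<in> {0<..<T} ==> set_integrable lebesgue (cyl \<tau> Om) f"
 by (rule set_integrable_subset) (use open_cylinder[OF op, of \<tau>] in auto)

definition energy_density :: "spacetime => real" where
 "energy_density z = rho z * (norm (u z - uB (snd z)))^2 / 2 + rho z powr \<gamma> / (\<gamma> - 1) + (b z)^2 / 2"

definition momentum_density :: "spacetime => real" where
 "momentum_density z = rho z * (u z \<bullet> (U z - uB (snd z)))"

lemma integ_energy_density: "integ energy_density" unfolding energy_density_def[abs_def] norm_plane_square vector_minus_component
 by (intro integ_add set_integrable_divide integ_kinetic integ_rho_powr integ_b2)

lemma integ_momentum_density: "integ momentum_density"
proof -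
 have "integ (%z. (rho z * u z $ 1) * (U z $ 1 - uB (snd z) $ 1) + (rho z * u z $ 2) * (U z $ 2 - uB (snd z) $ 2))"
  by (intro integ_add integ_mult integ_rhou continuous_on_diff cont_coeff)
 thus ?thesis unfolding momentum_density_def[abs_def] by (simp add: inner_vec_def sum_2 algebra_simps)
qed

lemma weak_transport_tested:
 assumes \<tau>: "\<tau> \<in> {0<..<T}" and f: "weak_transport Om T uB u fB f0 f" and g: "C1_closure S g Dg"
 shows "(LINT x:Om|lebesgue. f (\<tau>, x) * g (\<tau>, x)) = (LINT x:Om|lebesgue. f0 x * g (0, x)) + bulk_integral \<tau> Om (transport_rate f Dg)
  - boundary_integral \<tau> Om (inflow Om uB) (\<lambda>(t, x). (fB x * g (t, x)) * flux x)
  - boundary_integral \<tau> Om (outflow Om uB) (\<lambda>(t, x). (f (t, x) * g (t, x)) * flux x)"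
proof -
 have \<tau>': "\<tau> \<in> {0..T}" using \<tau> by simp
 have 1: "(%(t, x). fB x * (uB x \<bullet> outer_normal Om x) * g (t, x)) = (%(t, x). (fB x * g (t, x)) * flux x)"
  "(%(t, x). f (t, x) * (uB x \<bullet> outer_normal Om x) * g (t, x)) = (%(t, x). (f (t, x) * g (t, x)) * flux x)"
  by (simp_all add: fun_eq_iff normal_flux_def)
 have 2: "bulk_integral \<tau> Om (%z. f z * ddt g z + f z * (u z \<bullet> space_grad g z)) = bulk_integral \<tau> Om (transport_rate f Dg)"
  by (rule bulk_cong[OF \<tau> transport_rate_eq[OF g]])
 show ?thesis using f[unfolded weak_transport_def, rule_format, OF \<tau>' C1_closure_imp_Ck_closure[OF g]] unfolding 1 2 by linarith
qed

text \<open>The energy inequality minus the momentum equation tested with \<open>U - uB\<close>, plus the continuity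
 equation tested with \<open>phi\<close>, minus the induction equation tested with \<open>B\<close>, plus the
 balance of the strong pressure.\<close>

lemma relative_energy_estimate:
 "AE \<tau> in lebesgue. \<tau> \<in> {0<..<T} -->
   (LINT x:Om|lebesgue. rel_energy (\<tau>, x)) <= bulk_integral \<tau> Om total_rate"
proof -
 define V where "V z = U z - uB (snd z)" for z
 define DV where "DV z h = DU z h - DuB (snd z) (snd h)" for z h
 have V: "C1_closure S V DV" unfolding V_def[abs_def] DV_def[abs_def] by (rule C1_closure_diff[OF U_C1 uB_snd_C1])
 have i_rho_phi: "integ (%z. rho z * phi z)" and i_bB: "integ (%z. b z * B z)" by (intro integ_mult integ_rho integ_b cont_coeff)+
 have Fr: "AE t in lebesgue. \<forall>i. t \<in> {0<..<T} --> set_integrable lebesgue Om (%x. rho (t, x) * u (t, x) $ i)"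
  unfolding AE_all_countable by (intro allI set_lebesgue_Fubini(1)[OF integ_rhou])
 show ?thesis using energy[unfolded energy_inequality_def] AE_lebesgue_pair[OF momentum_AE] Fr
   set_lebesgue_Fubini(1)[OF integ_energy_density] set_lebesgue_Fubini(1)[OF integ_momentum_density]
   set_lebesgue_Fubini(1)[OF i_rho_phi] set_lebesgue_Fubini(1)[OF i_bB]
 proof eventually_elim
  case (elim \<tau>)
  show ?case
  proof
   assume \<tau>: "\<tau> \<in> {0<..<T}"
   hence \<tau>': "\<tau> \<in> {0..T}" by simp
   have t0: "0 \<in> {0..T}" using T by simp
   have m: "AE x in lebesgue. x \<in> Om --> m (\<tau>, x) = rho (\<tau>, x) *\<^sub>R u (\<tau>, x)" using elim(2) \<tau> by simp
   have iru: "set_integrable lebesgue Om (%x. rho (\<tau>, x) * u (\<tau>, x) $ i)" for i using elim(3) \<tau> by blast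
   let ?en = "%x. energy_density (\<tau>, x)" and ?mo = "%x. momentum_density (\<tau>, x)" and ?ph = "%x. rho (\<tau>, x) * phi (\<tau>, x)"
    and ?bB = "%x. b (\<tau>, x) * B (\<tau>, x)" and ?P = "%x. pressure (\<tau>, x)"
   have i: "set_integrable lebesgue Om ?en" "set_integrable lebesgue Om ?mo" "set_integrable lebesgue Om ?ph"
    "set_integrable lebesgue Om ?bB" using elim(4-7) \<tau> by blast+
   have iP: "set_integrable lebesgue Om ?P" by (rule set_integrable_slice[OF cont_coeff(12) \<tau>'])
   have "(%x. rel_energy (\<tau>, x)) = (%x. ?en x - ?mo x + ?ph x - ?bB x + ?P x)"
   proof
    fix x
    show "rel_energy (\<tau>, x) = ?en x - ?mo x + ?ph x - ?bB x + ?P x" unfolding rel_energy_def energy_density_def momentum_density_def w_def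
     by (rule energy_decomposition[symmetric])
   qed
   hence split: "(LINT x:Om|lebesgue. rel_energy (\<tau>, x)) = (LINT x:Om|lebesgue. ?en x) - (LINT x:Om|lebesgue. ?mo x)
     + (LINT x:Om|lebesgue. ?ph x) - (LINT x:Om|lebesgue. ?bB x) + (LINT x:Om|lebesgue. ?P x)"
    by (simp only: set_integral_alternating_sum[OF i iP])
   \<comment> \<open>one relation for each of the five terms of \<open>split\<close>\<close>
   define en0 where "en0 x = r (0, x) * (norm (U (0, x) - uB x))^2 / 2 + r (0, x) powr \<gamma> / (\<gamma> - 1) + (B (0, x))^2 / 2" for x
   define mo0 where "mo0 x = r (0, x) *\<^sub>R U (0, x) \<bullet> V (0, x)" for x
   let ?OUT = "boundary_integral \<tau> Om (outflow Om uB)" and ?IN = "boundary_integral \<tau> Om (inflow Om uB)"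
   have er: "(%(t, x). - (rho (t, x) powr \<gamma> + (b (t, x))^2 / 2) * trace (jacobian uB (at x))
       - rho (t, x) * ((jacobian uB (at x) *v u (t, x)) \<bullet> (u (t, x) - uB x))
       + stress mu lam (Du (t, x)) \<bullet> jacobian uB (at x)) = energy_rate" by (simp add: fun_eq_iff energy_rate_def)
   have EN: "(LINT x:Om|lebesgue. ?en x) + bulk_integral \<tau> Om dissipation
     + ?OUT (%(t, x). (rho (t, x) powr \<gamma> / (\<gamma> - 1) + (b (t, x))^2 / 2) * flux x)
    <= (LINT x:Om|lebesgue. en0 x) - ?IN (%(t, x). (rhoB x powr \<gamma> / (\<gamma> - 1) + (bB x)^2 / 2) * flux x)
     + bulk_integral \<tau> Om energy_rate"
    using elim(1)[rule_format, OF \<tau>] unfolding er energy_density_def dissipation_def[abs_def] en0_def snd_conv normal_flux_def .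
   have MO: "bulk_integral \<tau> Om momentum_rate = (LINT x:Om|lebesgue. ?mo x) - (LINT x:Om|lebesgue. mo0 x)"
   proof -
    have D0: "DuB x 0 = 0" for x by (rule linear_0[OF linear_DuB])
    have "bulk_integral \<tau> Om (%z. \<Sum>i\<in>UNIV. rho z * u z $ i * DV z (1, 0) $ i + (\<Sum>j\<in>UNIV. flux_tensor z $ i $ j * DV z (0, axis j 1) $ i))
     = (LINT x:Om|lebesgue. m (\<tau>, x) \<bullet> V (\<tau>, x)) - (LINT x:Om|lebesgue. r (0, x) *\<^sub>R U (0, x) \<bullet> V (0, x))"
    proof (rule weak_momentum_vanishing_test[OF T \<tau>' op bd momentum V _ flux_tensor_def])
     show "V (t, x) = 0" if "t \<in> {0..T}" "x \<in> frontier Om" for t x using U_boundary[OF that] by (simp add: V_def)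
     show "set_integrable lebesgue (cyl \<tau> Om) (%z. rho z * u z $ i)" for i by (rule integ_restrict[OF integ_rhou \<tau>])
     show "set_integrable lebesgue (cyl \<tau> Om) (%z. flux_tensor z $ i $ j)" for i j by (rule integ_restrict[OF integ_flux_tensor \<tau>])
     show "set_integrable lebesgue Om (%x. m (\<tau>, x) $ i)" for i
     proof -
      have "AE x in lebesgue. x \<in> Om --> m (\<tau>, x) $ i = rho (\<tau>, x) * u (\<tau>, x) $ i" using m by eventually_elim simp
      from lebesgue_set_integral_AE_cong(1)[OF this] iru show ?thesis by blast
     qed
     show "set_integrable lebesgue Om (%x. r (0, x) * U (0, x) $ i)" for i
      by (rule set_integrable_slice[of "%z. r z * U z $ i" 0]) (intro continuous_on_mult cont_coeff t0)+
    qed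
    moreover have "(%z. \<Sum>i\<in>UNIV. rho z * u z $ i * DV z (1, 0) $ i + (\<Sum>j\<in>UNIV. flux_tensor z $ i $ j * DV z (0, axis j 1) $ i)) = momentum_rate"
     by (simp add: fun_eq_iff momentum_rate_def DV_def D0 gradU_def jB_nth)
    moreover have "(LINT x:Om|lebesgue. m (\<tau>, x) \<bullet> V (\<tau>, x)) = (LINT x:Om|lebesgue. ?mo x)"
    proof (rule lebesgue_set_integral_AE_cong(2))
     show "AE x in lebesgue. x \<in> Om --> m (\<tau>, x) \<bullet> V (\<tau>, x) = ?mo x"
      using m by eventually_elim (simp add: momentum_density_def V_def)
    qed
    ultimately show ?thesis by (simp add: mo0_def)
   qed
   note RH = weak_transport_tested[OF \<tau> continuity_rho phi_C1]
   note BB = weak_transport_tested[OF \<tau> continuity_b B_C1]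
   have PP: "bulk_integral \<tau> Om pressure_rate = (LINT x:Om|lebesgue. ?P x) - (LINT x:Om|lebesgue. pressure (0, x))
     + ?IN (%(t, x). pressure (t, x) * flux x) + ?OUT (%(t, x). pressure (t, x) * flux x)"
   proof -
    have "(%z. Dpressure z (1, 0) + (\<Sum>j\<in>UNIV. pressure z * DU z (0, axis j 1) $ j + Dpressure z (0, axis j 1) * U z $ j)) = pressure_rate"
     by (simp add: fun_eq_iff pressure_rate_def gradU_def)
    thus ?thesis using transported_quantity_balance[OF T \<tau>' pressure_C1 U_C1 U_boundary] by simp
   qed
   have initial: "(LINT x:Om|lebesgue. en0 x) - (LINT x:Om|lebesgue. mo0 x) + (LINT x:Om|lebesgue. r (0, x) * phi (0, x))
     - (LINT x:Om|lebesgue. B (0, x) * B (0, x)) + (LINT x:Om|lebesgue. pressure (0, x)) = 0"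
   proof -
    have j1: "set_integrable lebesgue Om en0" unfolding en0_def[abs_def] norm_plane_square
     using set_integrable_slice[of "%z. r z * ((U z $ 1 - uB (snd z) $ 1)^2 + (U z $ 2 - uB (snd z) $ 2)^2) / 2 + r z powr \<gamma> / (\<gamma> - 1) + (B z)^2 / 2" 0]
      \<gamma> t0
     by (simp add: continuous_on_add continuous_on_divide continuous_on_mult continuous_on_power continuous_on_diff cont_coeff r_powr_continuous)
    have j2: "set_integrable lebesgue Om mo0" unfolding mo0_def[abs_def] V_def inner_vec_def sum_2
     using set_integrable_slice[of "%z. r z * U z $ 1 * (U z $ 1 - uB (snd z) $ 1) + r z * U z $ 2 * (U z $ 2 - uB (snd z) $ 2)" 0] t0
     by (simp add: continuous_on_add continuous_on_mult continuous_on_diff cont_coeff)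
    have j3: "set_integrable lebesgue Om (%x. r (0, x) * phi (0, x))" and j4: "set_integrable lebesgue Om (%x. B (0, x) * B (0, x))"
     using set_integrable_slice[of "%z. r z * phi z" 0] set_integrable_slice[of "%z. B z * B z" 0] t0
     by (simp_all add: continuous_on_mult cont_coeff)
    have j5: "set_integrable lebesgue Om (%x. pressure (0, x))" by (rule set_integrable_slice[OF cont_coeff(12) t0])
    have "(LINT x:Om|lebesgue. en0 x) - (LINT x:Om|lebesgue. mo0 x) + (LINT x:Om|lebesgue. r (0, x) * phi (0, x))
     - (LINT x:Om|lebesgue. B (0, x) * B (0, x)) + (LINT x:Om|lebesgue. pressure (0, x))
     = (LINT x:Om|lebesgue. en0 x - mo0 x + r (0, x) * phi (0, x) - B (0, x) * B (0, x) + pressure (0, x))"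
     by (rule set_integral_alternating_sum[OF j1 j2 j3 j4 j5, symmetric])
    also have "... = (LINT x:Om|lebesgue. 0)"
    proof (rule set_lebesgue_integral_cong[OF Omega_sets], intro allI impI)
     fix x assume "x \<in> Om"
     hence "(0, x) \<in> closure S" unfolding closure_S using t0 closure_subset[of Om] by blast
     hence rp: "0 < r (0, x)" by (rule r_pos)
     have "en0 x - mo0 x + r (0, x) * phi (0, x) - B (0, x) * B (0, x) + pressure (0, x) = rel_potential \<gamma> (r (0, x)) (r (0, x))"
      using energy_decomposition[of "r (0, x)" "U (0, x)" "(0, x)" "B (0, x)"] by (simp add: en0_def mo0_def V_def)
     also have "... = 0" by (rule rel_potential_self[OF rp])
     finally show "en0 x - mo0 x + r (0, x) * phi (0, x) - B (0, x) * B (0, x) + pressure (0, x) = 0" .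
    qed
    finally show ?thesis by simp
   qed
   have total: "bulk_integral \<tau> Om total_rate = bulk_integral \<tau> Om energy_rate - bulk_integral \<tau> Om dissipation - bulk_integral \<tau> Om momentum_rate
     + bulk_integral \<tau> Om (transport_rate rho Dphi) - bulk_integral \<tau> Om (transport_rate b DB) + bulk_integral \<tau> Om pressure_rate"
   proof -
    have k3: "integ (transport_rate rho Dphi)" and k4: "integ (transport_rate b DB)"
     by (intro integ_transport_rate integ_rho integ_rhou integ_b integ_bu cont_coeff)+
    note k = integ_restrict[OF integ_energy_rate \<tau>] integ_restrict[OF integ_dissipation \<tau>] integ_restrict[OF integ_momentum_rate \<tau>]
     integ_restrict[OF k3 \<tau>] integ_restrict[OF k4 \<tau>] integ_restrict[OF integ_pressure_rate \<tau>]
    show ?thesis unfolding bulk_integral_def total_rate_def[abs_def]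
     set_integral_alternating_sum[OF set_integral_diff(1)[OF k(1,2)] k(3-6)] set_integral_diff(2)[OF k(1,2)] by (rule refl)
   qed
   show "(LINT x:Om|lebesgue. rel_energy (\<tau>, x)) <= bulk_integral \<tau> Om total_rate"
    using EN MO RH BB PP initial outflow_terms_nonneg[OF \<tau>] inflow_terms_cancel[OF \<tau>] unfolding split total by linarith
  qed
 qed
qed

lemma rel_energy_nonneg:
 assumes "z \<in> S" "0 <= rho z"
 shows "0 <= rel_energy z"
proof -
 have "0 < r z" using assms(1) r_pos S_subset_closure by blast
 thus ?thesis using rel_potential_ge_0 assms(2) unfolding rel_energy_def by (intro add_nonneg_nonneg) simp_all
qed

lemma rel_energy_integral_zero: "(LINT z:S|lebesgue. rel_energy z) = 0"
proof -
 define E where "E t = (LINT x:Om|lebesgue. rel_energy (t, x))" for t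
 obtain C where C: "0 <= C" and rate: "AE t in lebesgue. t \<in> {0<..<T} --> (LINT x:Om|lebesgue. total_rate (t, x)) <= C * E t"
  using total_rate_integral_bound unfolding E_def by blast
 have Ei: "set_integrable lebesgue {0<..<T} E" unfolding E_def by (rule set_lebesgue_Fubini(2)[OF integ_rel_energy])
 have nonneg: "AE t in lebesgue. t \<in> {0<..<T} --> 0 <= E t" using AE_lebesgue_pair[OF rho_nonneg]
 proof eventually_elim
  case (elim t)
  show ?case
  proof
   assume t: "t \<in> {0<..<T}"
   show "0 <= E t" unfolding E_def set_lebesgue_integral_def
   proof (rule integral_nonneg_AE)
    show "AE x in lebesgue. 0 <= indicat_real Om x *\<^sub>R rel_energy (t, x)" using elim
    proof eventually_elim
     case (elim x)
     show ?case using elim t rel_energy_nonneg[of "(t, x)"] by (cases "x \<in> Om") simp_all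
    qed
   qed
  qed
 qed
 have "AE \<tau> in lebesgue. \<tau> \<in> {0<..<T} --> E \<tau> <= C * (LINT t:{0<..<\<tau>}|lebesgue. E t)" using relative_energy_estimate
 proof eventually_elim
  case (elim \<tau>)
  show ?case
  proof
   assume \<tau>: "\<tau> \<in> {0<..<T}"
   have sub: "{0<..<\<tau>} <= {0<..<T}" using \<tau> by auto
   note iR = integ_restrict[OF integ_total_rate \<tau>]
   have iE: "set_integrable lebesgue {0<..<\<tau>} E" by (rule set_integrable_subset[OF Ei _ sub]) simp
   have "E \<tau> <= bulk_integral \<tau> Om total_rate" using elim \<tau> by (simp add: E_def)
   also have "... = (LINT t:{0<..<\<tau>}|lebesgue. LINT x:Om|lebesgue. total_rate (t, x))"
    unfolding bulk_integral_def by (rule set_lebesgue_Fubini(3)[OF iR, symmetric])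
   also have "... <= (LINT t:{0<..<\<tau>}|lebesgue. C * E t)"
   proof (rule set_integral_mono_AE_lebesgue[OF set_lebesgue_Fubini(2)[OF iR]])
    show "set_integrable lebesgue {0<..<\<tau>} (%t. C * E t)" by (intro set_integrable_mult_right iE)
    show "AE t in lebesgue. t \<in> {0<..<\<tau>} --> (LINT x:Om|lebesgue. total_rate (t, x)) <= C * E t"
     using rate by eventually_elim (use sub in blast)
   qed
   also have "... = C * (LINT t:{0<..<\<tau>}|lebesgue. E t)" by (rule set_integral_mult_right)
   finally show "E \<tau> <= C * (LINT t:{0<..<\<tau>}|lebesgue. E t)" .
  qed
 qed
 from integral_Gronwall_zero[OF C T Ei nonneg this]
 show ?thesis unfolding E_def set_lebesgue_Fubini(3)[OF integ_rel_energy] .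
qed

lemma weak_equals_strong:
 "AE z in lebesgue. z \<in> S --> rho z = r z & u z = U z & b z = B z"
proof -
 have nn: "AE z in lebesgue. 0 <= indicat_real S z *\<^sub>R rel_energy z" using rho_nonneg by eventually_elim (auto simp: indicator_def rel_energy_nonneg)
 have "AE z in lebesgue. indicat_real S z *\<^sub>R rel_energy z = 0" using rel_energy_integral_zero integ_rel_energy nn
  unfolding set_lebesgue_integral_def set_integrable_def by (subst (asm) integral_nonneg_eq_0_iff_AE) auto
 thus ?thesis using rho_nonneg
 proof eventually_elim
  case (elim z)
  show ?case
  proof
   assume z: "z \<in> S"
   have rp: "0 < r z" using z r_pos S_subset_closure by blast
   have rn: "0 <= rho z" using elim(2) z by blast
   define a1 a2 a3 where "a1 = rho z * (norm (w z))^2 / 2" and "a2 = rel_potential \<gamma> (rho z) (r z)" and "a3 = (b z - B z)^2 / 2"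
   have "a1 + a2 + a3 = 0" using elim(1) z by (simp add: rel_energy_def a1_def a2_def a3_def)
   moreover have "0 <= a1" "0 <= a2" "0 <= a3" using rn rel_potential_ge_0[OF rp] by (simp_all add: a1_def a2_def a3_def)
   ultimately have 0: "a1 = 0" "a2 = 0" "a3 = 0" by linarith+
   have r: "rho z = r z" by (rule rel_potential_nonneg(2)[OF \<gamma> rp rn]) (use 0(2) in \<open>simp add: a2_def\<close>)
   have "w z = 0" using 0(1) rp r by (simp add: a1_def)
   moreover have "b z = B z" using 0(3) by (simp add: a3_def)
   ultimately show "rho z = r z & u z = U z & b z = B z" using r by (simp add: w_def)
  qed
 qed
qed

end

section \<open>Weak-strong uniqueness\<close>

lemma Ck_closure_Suc_C1_closure:
 assumes "Ck_closure (Suc k) S f"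
 shows "\<exists>D. C1_closure S f D & (\<forall>e\<in>Basis. Ck_closure k S (\<lambda>z. D z e)) & (\<forall>z. linear (D z))"
proof (rule Ck_closure_Suc_derivative[OF assms])
 fix D assume 1: "C1_closure S f D" and 2: "!!e. e \<in> Basis ==> Ck_closure k S (%z. D z e)" and 3: "!!z. linear (D z)"
 show ?thesis by (intro exI[of _ D] conjI ballI allI 1 2 3)
qed

lemma weak_transport_initial_cong:
 assumes "weak_transport Om T uB u fB f0 f" and ae: "AE x in lebesgue. x \<in> Om --> g0 x = f0 x"
 shows "weak_transport Om T uB u fB g0 f"
proof -
 have "(LINT x:Om|lebesgue. g0 x * \<phi> (0, x)) = (LINT x:Om|lebesgue. f0 x * \<phi> (0, x))" for \<phi> :: "spacetime => real"
  by (rule lebesgue_set_integral_AE_cong(2)) (use ae in eventually_elim, simp)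
 thus ?thesis using assms(1) unfolding weak_transport_def by simp
qed

lemma weak_momentum_initial_cong:
 assumes "weak_momentum Om T \<gamma> mu lam f0 v0 rho u Du b m" and ae: "AE x in lebesgue. x \<in> Om --> g0 x = f0 x & w0 x = v0 x"
 shows "weak_momentum Om T \<gamma> mu lam g0 w0 rho u Du b m"
proof -
 have "(LINT x:Om|lebesgue. g0 x *\<^sub>R w0 x \<bullet> \<phi> (0, x)) = (LINT x:Om|lebesgue. f0 x *\<^sub>R v0 x \<bullet> \<phi> (0, x))" for \<phi> :: "spacetime => plane"
  by (rule lebesgue_set_integral_AE_cong(2)) (use ae in eventually_elim, simp)
 thus ?thesis using assms(1) unfolding weak_momentum_def by simp
qed

lemma energy_inequality_initial_cong:
 assumes "energy_inequality Om T \<gamma> mu lam rhoB uB bB f0 v0 h0 rho u Du b"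
  and ae: "AE x in lebesgue. x \<in> Om --> g0 x = f0 x & w0 x = v0 x & k0 x = h0 x"
 shows "energy_inequality Om T \<gamma> mu lam rhoB uB bB g0 w0 k0 rho u Du b"
proof -
 have "(LINT x:Om|lebesgue. g0 x * (norm (w0 x - uB x))^2 / 2 + g0 x powr \<gamma> / (\<gamma> - 1) + (k0 x)^2 / 2)
  = (LINT x:Om|lebesgue. f0 x * (norm (v0 x - uB x))^2 / 2 + f0 x powr \<gamma> / (\<gamma> - 1) + (h0 x)^2 / 2)"
  by (rule lebesgue_set_integral_AE_cong(2)) (use ae in eventually_elim, simp)
 thus ?thesis using assms(1) unfolding energy_inequality_def by simp
qed

theorem theorem2p2:
  fixes \<Omega> :: "plane set"
    and T \<gamma> mu lam Clow Cup :: real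
    and rhoB bB rho0 b0 :: "plane \<Rightarrow> real"
    and uB u0 :: "plane \<Rightarrow> plane"
    and rho b r B :: "spacetime \<Rightarrow> real"
    and u U :: "spacetime \<Rightarrow> plane"
  assumes domain: "piecewise_regular_lipschitz_domain \<Omega>"
    and parameters: "\<gamma> > 1" "T > 0" "mu > 0" "2 * mu + lam > 0"
    and rhoB: "continuous_on UNIV rhoB" "compactly_supported rhoB" "\<forall>x\<in>closure \<Omega>. rhoB x > 0"
    and bB: "continuous_on UNIV bB" "compactly_supported bB" "\<forall>x\<in>closure \<Omega>. bB x > 0"
    and uB: "Ck_closure 1 UNIV uB" "compactly_supported uB"
    and initial_measurable: "set_borel_measurable lebesgue \<Omega> rho0"
      "set_borel_measurable lebesgue \<Omega> b0" "set_borel_measurable lebesgue \<Omega> u0"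
    and initial_energy: "set_integrable lebesgue \<Omega>
      (\<lambda>x. rho0 x * (norm (u0 x))\<^sup>2 / 2 + rho0 x powr \<gamma> / (\<gamma> - 1) + (b0 x)\<^sup>2 / 2)"
    and constants: "0 < Clow" "Clow < Cup"
    and initial_domination:
      "AE x in lebesgue. x \<in> \<Omega> \<longrightarrow> Clow * rho0 x \<le> b0 x \<and> b0 x \<le> Cup * rho0 x"
    and boundary_domination: "\<forall>x\<in>closure \<Omega>. Clow * rhoB x \<le> bB x \<and> bB x \<le> Cup * rhoB x"
    and weak: "weak_solution \<Omega> T \<gamma> mu lam rhoB uB bB rho0 u0 b0 rho u b"
    and strong: "strong_solution \<Omega> T \<gamma> mu lam rhoB uB bB rho0 u0 b0 r U B"
  shows "AE z in lebesgue. z \<in> {0<..<T} \<times> \<Omega> \<longrightarrow> rho z = r z \<and> u z = U z \<and> b z = B z"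
proof -
 let ?S = "cyl T \<Omega>"
 obtain DuB where duB: "C1_closure UNIV uB DuB & (\<forall>e\<in>Basis. Ck_closure 0 UNIV (%z. DuB z e)) & (\<forall>z. linear (DuB z))"
  using Ck_closure_Suc_C1_closure[OF uB(1)[unfolded One_nat_def]] ..
 hence uB1: "C1_closure UNIV uB DuB" and linuB: "linear (DuB x)" for x by (iprover, simp)
 have sr: "Ck_closure (Suc 0) ?S r" and sB: "Ck_closure (Suc 0) ?S B" and sU: "Ck_closure (Suc (Suc 0)) ?S U"
  using strong unfolding strong_solution_def numeral_2_eq_2 One_nat_def by blast+
 obtain Dr where "C1_closure ?S r Dr & (\<forall>e\<in>Basis. Ck_closure 0 ?S (%z. Dr z e)) & (\<forall>z. linear (Dr z))"
  using Ck_closure_Suc_C1_closure[OF sr] ..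
 hence Dr: "C1_closure ?S r Dr" ..
 obtain DB where "C1_closure ?S B DB & (\<forall>e\<in>Basis. Ck_closure 0 ?S (%z. DB z e)) & (\<forall>z. linear (DB z))"
  using Ck_closure_Suc_C1_closure[OF sB] ..
 hence DB: "C1_closure ?S B DB" ..
 obtain DU where DU': "C1_closure ?S U DU & (\<forall>e\<in>Basis. Ck_closure (Suc 0) ?S (%z. DU z e)) & (\<forall>z. linear (DU z))"
  using Ck_closure_Suc_C1_closure[OF sU] ..
 hence DU: "C1_closure ?S U DU" ..
 have DU1: "Ck_closure (Suc 0) ?S (%z. DU z (0, axis j 1))" for j by (rule bspec[OF conjunct1[OF conjunct2[OF DU']] st_basis(2)])
 have "\<exists>D. C1_closure ?S (%z. DU z (0, axis j 1)) D" for j using Ck_closure_Suc_C1_closure[OF DU1[of j]] by iprover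
 hence "\<forall>j. \<exists>D. C1_closure ?S (%z. DU z (0, axis j 1)) D" by (rule allI)
 from choice[OF this] obtain D2 where D2': "\<forall>j. C1_closure ?S (%z. DU z (0, axis j 1)) (D2 j)" ..
 have D2: "C1_closure ?S (%z. DU z (0, axis j 1)) (D2 j)" for j using D2' by (rule spec)
 obtain c1 c2 where c: "0 < c1" "\<forall>z \<in> {0..T} \<times> closure \<Omega>. c1 <= r z & r z <= c2 & c1 <= B z & B z <= c2"
  using strong unfolding strong_solution_def by blast
 have init: "AE x in lebesgue. x \<in> \<Omega> --> r (0, x) = rho0 x & U (0, x) = u0 x & B (0, x) = b0 x"
  using strong unfolding strong_solution_def by blast
 have init_r: "AE x in lebesgue. x \<in> \<Omega> --> r (0, x) = rho0 x" and init_B: "AE x in lebesgue. x \<in> \<Omega> --> B (0, x) = b0 x"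
  and init_rU: "AE x in lebesgue. x \<in> \<Omega> --> r (0, x) = rho0 x & U (0, x) = u0 x" using init by (eventually_elim, simp)+
 have boundary: "\<forall>t\<in>{0..T}. (\<forall>x\<in>frontier \<Omega>. U (t, x) = uB x) & (\<forall>x\<in>inflow \<Omega> uB. r (t, x) = rhoB x & B (t, x) = bB x)"
  and classical: "solves_system_classically \<Omega> T \<gamma> mu lam r U B" using strong unfolding strong_solution_def by blast+
 obtain Du m where velocity: "L2_W12_zero T \<Omega> (%(t, x). u (t, x) - uB x) (%(t, x). Du (t, x) - jacobian uB (at x))"
  and mAE: "AE z in lebesgue. z \<in> ?S --> m z = rho z *\<^sub>R u z"
  and mom: "weak_momentum \<Omega> T \<gamma> mu lam rho0 u0 rho u Du b m"
  and en: "energy_inequality \<Omega> T \<gamma> mu lam rhoB uB bB rho0 u0 b0 rho u Du b" using weak unfolding weak_solution_def by blast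
 have pos: "AE z in lebesgue. z \<in> ?S --> rho z >= 0 & b z >= 0"
  and Lp: "C_weak T \<gamma> \<Omega> rho" "boundary_Lp T \<gamma> \<Omega> uB rho" "C_weak T 2 \<Omega> b" "boundary_Lp T 2 \<Omega> uB b"
   "Linf_Lp T 1 \<Omega> (%(t, x). rho (t, x) * (norm (u (t, x) - uB x))^2)"
  and tr: "weak_transport \<Omega> T uB u rhoB rho0 rho" "weak_transport \<Omega> T uB u bB b0 b" using weak unfolding weak_solution_def by blast+
 interpret weak_strong_pair \<Omega> uB T \<gamma> mu lam c1 rhoB bB DuB rho b r B u U m Du Dr DB DU D2
 proof
  show "continuous_on UNIV uB" using C1D(1)[OF uB1] by simp
  show "AE z in lebesgue. z \<in> ?S --> 0 <= rho z" using pos by eventually_elim simp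
  show "weak_transport \<Omega> T uB u rhoB (%x. r (0, x)) rho" by (rule weak_transport_initial_cong[OF tr(1) init_r])
  show "weak_transport \<Omega> T uB u bB (%x. B (0, x)) b" by (rule weak_transport_initial_cong[OF tr(2) init_B])
  show "weak_momentum \<Omega> T \<gamma> mu lam (%x. r (0, x)) (%x. U (0, x)) rho u Du b m" by (rule weak_momentum_initial_cong[OF mom init_rU])
  show "energy_inequality \<Omega> T \<gamma> mu lam rhoB uB bB (%x. r (0, x)) (%x. U (0, x)) (%x. B (0, x)) rho u Du b"
   by (rule energy_inequality_initial_cong[OF en init])
  show "Linf_Lp T \<gamma> \<Omega> rho" "Linf_Lp T 2 \<Omega> b" using Lp(1,3) unfolding C_weak_def by blast+
  show "c1 <= r z" if "z \<in> {0..T} \<times> closure \<Omega>" for z using c(2) that by blast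
  show "U (t, x) = uB x" if "t \<in> {0..T}" "x \<in> frontier \<Omega>" for t x using boundary that by blast
  show "r (t, x) = rhoB x & B (t, x) = bB x" if "t \<in> {0..T}" "x \<in> inflow \<Omega> uB" for t x using boundary that by blast
 qed (rule domain parameters uB1 linear_add[OF linuB] linear_scale[OF linuB] Lp(2,4,5) velocity mAE Dr DB DU D2 c(1) classical)+
 show ?thesis by (rule weak_equals_strong)
qed

end
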